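(* Let $C$ be a compact labeled configuration. Then: (1) If no cell of the bounding box is empty, $G_C$ is the trivial group. (2) If exactly one cell of the bounding box is empty, $G_C$ is the cyclic group generated by the cyclic permutation of the non-core tokens taken in clockwise order (around the boundary of the bounding box). (3) If $C$ has exactly $6$ tokens and exactly $2$ cells of the bounding box are empty, $G_C$ is isomorphic to the alternating group $A_5$. (4) In all other cases, $G_C$ is the alternating group on the non-core tokens (the permutations that fix all core tokens and are even on the non-core tokens). Consequently, in this case, if at least two non-core tokens have the same label, then every configuration obtained from $C$ by an arbitrary rearrangement of the labels among the non-core cells (core tokens unchanged) is reachable from $C$ by a sequence of pushes; otherwise (all non-core labels distinct), exactly those rearrangements that are even permutations of the non-core labels are reachable.
   Context: Tokens occupy distinct cells of $\mathbb{Z}^2$ and carry labels (not necessarily distinct); for the group $G_C$ tokens are regarded as distinct objects. The bounding box is the smallest axis-parallel rectangle containing all tokens; configurations are identified up to translation. A push in direction "left": translate so that the lower-left corner of the bounding box is $(0,0)$; for columns $i=1,2,\dots$ in increasing order and every row $j$, if $(i,j)$ is full and $(i-1,j)$ is empty, move the token (with its label) from $(i,j)$ to $(i-1,j)$. Pushes in directions right, up, down are defined symmetrically. A configuration is canonical if applying a push in direction left or a push in direction down leaves the set of occupied cells unchanged (up to translation); it is compact if it can be obtained from a canonical configuration by pushes. $G_C$ is the group of permutations $\pi$ of the occupied cells of $C$ such that some finite sequence of pushes transforms $C$ into a configuration with the same set of occupied cells in which the token originally at $p$ is at $\pi(p)$ for every occupied $p$. Core: let the bounding box have $a$ columns and $b$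 rows, with $a'$ completely full columns and $b'$ completely full rows, and $a''=a-a'$, $b''=b-b'$. If $a'>a''$ and $b'>b''$, the core is the set of cells of the bounding box lying in the central $a'-a''$ columns (excluding the $a''$ leftmost and $a''$ rightmost columns) and in the central $b'-b''$ rows (excluding the $b''$ topmost and $b''$ bottommost rows); otherwise the core is empty. Core tokens are tokens in core cells; the others are non-core tokens. *)

theory Defs
  imports "HOL-Algebra.Sym_Groups" "HOL-Library.Product_Plus"
begin

type_synonym cell = "int \<times> int"

text \<open>A configuration maps a full cell to the label of its token and an empty cell to
  \<^const>\<open>None\<close>; its occupied cells are its domain.\<close>

type_synonym 'l config = "cell \<Rightarrow> 'l option"

definition configuration :: "'l config \<Rightarrow> bool" where
  "configuration C \<longleftrightarrow> finite (dom C) \<and> dom C \<noteq> {}"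

definition translate :: "cell \<Rightarrow> 'l config \<Rightarrow> 'l config" where
  "translate v C = (\<lambda>p. C (p - v))"

definition translation_equiv :: "'l config \<Rightarrow> 'l config \<Rightarrow> bool" where
  "translation_equiv C D \<longleftrightarrow> (\<exists>v. D = translate v C)"


section \<open>Bounding box\<close>

definition xmin :: "cell set \<Rightarrow> int" where "xmin S = Min (fst ` S)"
definition xmax :: "cell set \<Rightarrow> int" where "xmax S = Max (fst ` S)"
definition ymin :: "cell set \<Rightarrow> int" where "ymin S = Min (snd ` S)"
definition ymax :: "cell set \<Rightarrow> int" where "ymax S = Max (snd ` S)"

definition columns :: "cell set \<Rightarrow> int set" where "columns S = {xmin S..xmax S}"
definition rows :: "cell set \<Rightarrow> int set" where "rows S = {ymin S..ymax S}"

definition bounding_box :: "cell set \<Rightarrow> cell set" where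
  "bounding_box S = columns S \<times> rows S"

definition empty_cells :: "'l config \<Rightarrow> cell set" where
  "empty_cells C = bounding_box (dom C) - dom C"


section \<open>Pushes\<close>

definition normalize :: "'l config \<Rightarrow> 'l config" where
  "normalize C = translate (- (xmin (dom C), ymin (dom C))) C"

text \<open>All tokens of column \<open>i\<close> whose left neighbour cell is empty move one step left.\<close>

definition shift_column :: "int \<Rightarrow> 'l config \<Rightarrow> 'l config" where
  "shift_column i C = (\<lambda>(x, y).
     if C (i, y) \<noteq> None \<and> C (i - 1, y) = None
     then (if x = i - 1 then C (i, y) else if x = i then None else C (x, y))
     else C (x, y))"

text \<open>Columns beyond the bounding box contain no tokens, so the iteration stops at its
  last column.\<close>

definition push_left :: "'l config \<Rightarrow> 'l config" where
  "push_left C = (let N = normalize C in fold shift_column [1..xmax (dom N)] N)"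

text \<open>The other three pushes are conjugates of the left push under the symmetries of the grid.
  The result is placed differently in the plane from one direction to another; this is
  immaterial because configurations only matter up to \<^const>\<open>translation_equiv\<close>.\<close>

definition mirror_x :: "'l config \<Rightarrow> 'l config" where
  "mirror_x C = (\<lambda>(x, y). C (- x, y))"

definition swap_axes :: "'l config \<Rightarrow> 'l config" where
  "swap_axes C = (\<lambda>(x, y). C (y, x))"

datatype direction = Leftward | Rightward | Upward | Downward

fun push :: "direction \<Rightarrow> 'l config \<Rightarrow> 'l config" where
  "push Leftward C = push_left C"
| "push Rightward C = mirror_x (push_left (mirror_x C))"
| "push Downward C = swap_axes (push_left (swap_axes C))"
| "push Upward C = swap_axes (mirror_x (push_left (mirror_x (swap_axes C))))"

definition reachable :: "'l config \<Rightarrow> 'l config \<Rightarrow> bool" where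
  "reachable C D \<longleftrightarrow> (\<exists>ds. translation_equiv (fold push ds C) D)"

definition same_cells :: "'l config \<Rightarrow> 'k config \<Rightarrow> bool" where
  "same_cells C D \<longleftrightarrow> (\<exists>v. dom D = (\<lambda>p. p + v) ` dom C)"

definition canonical :: "'l config \<Rightarrow> bool" where
  "canonical C \<longleftrightarrow> configuration C \<and>
     same_cells C (push Leftward C) \<and> same_cells C (push Downward C)"

definition compact_config :: "'l config \<Rightarrow> bool" where
  "compact_config C \<longleftrightarrow> (\<exists>C0. canonical C0 \<and> reachable C0 C)"


section \<open>The group of a configuration\<close>

text \<open>To treat tokens as distinct objects, each token is labeled by its original cell.\<close>

definition distinct_tokens :: "'l config \<Rightarrow> cell config" where
  "distinct_tokens C = (\<lambda>p. if p \<in> dom C then Some p else None)"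

definition push_perms :: "'l config \<Rightarrow> (cell \<Rightarrow> cell) set" where
  "push_perms C = {\<pi>. \<pi> permutes dom C \<and>
     (\<exists>ds v. let D = fold push ds (distinct_tokens C) in
        dom D = (\<lambda>p. p + v) ` dom C \<and> (\<forall>p\<in>dom C. D (\<pi> p + v) = Some p))}"

definition sym_group_on :: "'a set \<Rightarrow> ('a \<Rightarrow> 'a) monoid" where
  "sym_group_on S = \<lparr> carrier = {\<pi>. \<pi> permutes S}, mult = (\<circ>), one = id \<rparr>"

definition push_group :: "'l config \<Rightarrow> (cell \<Rightarrow> cell) monoid" where
  "push_group C = (sym_group_on (dom C)) \<lparr> carrier := push_perms C \<rparr>"


section \<open>Core\<close>

definition full_columns :: "cell set \<Rightarrow> int set" where
  "full_columns S = {x \<in> columns S. \<forall>y\<in>rows S. (x, y) \<in> S}"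

definition full_rows :: "cell set \<Rightarrow> int set" where
  "full_rows S = {y \<in> rows S. \<forall>x\<in>columns S. (x, y) \<in> S}"

definition core :: "cell set \<Rightarrow> cell set" where
  "core S =
     (let a' = card (full_columns S); a'' = card (columns S) - a';
          b' = card (full_rows S); b'' = card (rows S) - b'
      in if a' > a'' \<and> b' > b''
         then {xmin S + int a''..xmax S - int a''} \<times> {ymin S + int b''..ymax S - int b''}
         else {})"

definition noncore_cells :: "'l config \<Rightarrow> cell set" where
  "noncore_cells C = dom C - core (dom C)"

text \<open>The boundary cells of the bounding box in clockwise order, from the lower left corner:
  up the left column, along the top row, down the right column, back along the bottom row.
  This lists every boundary cell exactly once if there are at least two columns and two rows.\<close>

definition clockwise_boundary :: "cell set \<Rightarrow> cell list" where
  "clockwise_boundary S =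
     map (\<lambda>y. (xmin S, y)) [ymin S..ymax S - 1] @
     map (\<lambda>x. (x, ymax S)) [xmin S..xmax S - 1] @
     map (\<lambda>y. (xmax S, y)) (rev [ymin S + 1..ymax S]) @
     map (\<lambda>x. (x, ymin S)) (rev [xmin S + 1..xmax S])"

definition noncore_cycle :: "'l config \<Rightarrow> cell \<Rightarrow> cell" where
  "noncore_cycle C =
     cycle_of_list (filter (\<lambda>p. p \<in> noncore_cells C) (clockwise_boundary (dom C)))"

text \<open>The configuration in which the label at \<open>p\<close> has been moved to \<open>\<pi> p\<close>.\<close>

definition rearrange :: "(cell \<Rightarrow> cell) \<Rightarrow> 'l config \<Rightarrow> 'l config" where
  "rearrange \<pi> C = C \<circ> Hilbert_Choice.inv \<pi>"

end

theory Submission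
  imports Defs
begin

text \<open>A compact shape is a Young diagram whose rows and columns have slid independently of each
  other, all rows of the same length together. The tokens of the core never move, and in suitable
  coordinates each push acts by a permutation whose sign depends only on the shapes before and
  after it; hence a closed walk permutes the tokens evenly. Conversely, pushing right \<open>i + 1\<close>
  times, up, left once, down and then left moves the tokens along the boundary of a rectangle, a
  cycle of odd length. Two such cycles for consecutive \<open>i\<close>, or for a row and a column, overlap in
  one or two arcs; their commutator, or a power of a product, is a three-cycle, and the conjugates
  of one three-cycle generate the alternating group of all non-core tokens. This fails only if
  there is a single cycle, that is, a single empty cell, and for rows of lengths 4 and 2. If only
  one row is incomplete, every push acts through these cycles; for lengths 4 and 2 they are two
  5-cycles that permute the five perfect matchings of a one-factorization of \<open>K\<^sub>6\<close> and generate
  \<open>A\<^sub>5\<close> there.\<close>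

section \<open>Groups of permutations containing three-cycles\<close>

text \<open>A push changes the set of occupied cells, so by itself it has neither a sign nor an
  inverse. Signs become meaningful once a token is named by the ranks of its column and row: this
  identifies every shape with the diagram, and a horizontal push becomes a quotient of two
  permutations, each determined by one shape, so that the signs telescope along a walk. Inverses
  come from finiteness: closed walks at the diagram compose, and a finite set of permutations closed
  under composition is a group. For the converse, a set of maximal size all of whose three-cycles
  lie in the group is a block: a group element maps it into itself or off it. A rotation that fixes
  one point of the block therefore preserves it, and if its cycle meets the block, the block
  contains the whole cycle. From the boundary of the first rectangle the block thus spreads from one
  rectangle to the next. That first boundary is, as a set, symmetric in rows and columns, so one
  seed feeds both families of rotations, whose boundaries cover all non-core cells.\<close>

definition three_cycle :: "'a \<Rightarrow> 'a \<Rightarrow> 'a \<Rightarrow> 'a \<Rightarrow> 'a" where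
  "three_cycle x y z = transpose x y \<circ> transpose y z"

lemma three_cycle_simps:
  assumes "x \<noteq> y" "y \<noteq> z" "x \<noteq> z"
  shows "three_cycle x y z x = y" "three_cycle x y z y = z" "three_cycle x y z z = x"
    "w \<noteq> x \<Longrightarrow> w \<noteq> y \<Longrightarrow> w \<noteq> z \<Longrightarrow> three_cycle x y z w = w"
  using assms by (auto simp: three_cycle_def transpose_def)

lemma three_cycle_rotate:
  assumes "x \<noteq> y" "y \<noteq> z" "x \<noteq> z"
  shows "three_cycle x y z = three_cycle y z x"
  using assms by (auto simp: three_cycle_def transpose_def fun_eq_iff)

lemma bij_three_cycle: "bij (three_cycle x y z)"
  by (simp add: three_cycle_def bij_comp)

lemma inv_three_cycle: "inv' (three_cycle x y z) = three_cycle z y x"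
  by (simp add: three_cycle_def o_inv_distrib transpose_commute)

lemma conj_transpose:
  assumes "bij p"
  shows "p \<circ> transpose x y \<circ> inv' p = transpose (p x) (p y)"
proof
  fix w
  obtain v where v: "w = p v" using assms by (metis bij_pointE)
  show "(p \<circ> transpose x y \<circ> inv' p) w = transpose (p x) (p y) w"
    using assms v by (auto simp: transpose_def bij_is_inj inj_eq)
qed

lemma conj_comp:
  assumes "bij p"
  shows "p \<circ> (f \<circ> g) \<circ> inv' p = (p \<circ> f \<circ> inv' p) \<circ> (p \<circ> g \<circ> inv' p)"
  using assms by (auto simp: fun_eq_iff bij_is_inj)

lemma conj_three_cycle:
  assumes "bij p"
  shows "p \<circ> three_cycle x y z \<circ> inv' p = three_cycle (p x) (p y) (p z)"
  unfolding three_cycle_def by (simp only: conj_comp[OF assms] conj_transpose[OF assms])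

lemma three_cycle_permutes:
  "x \<in> S \<Longrightarrow> y \<in> S \<Longrightarrow> z \<in> S \<Longrightarrow> three_cycle x y z permutes S"
  unfolding three_cycle_def by (intro permutes_compose permutes_swap_id)

lemma evenperm_three_cycle:
  assumes "x \<noteq> y" "y \<noteq> z"
  shows "evenperm (three_cycle x y z)"
  using assms by (simp add: three_cycle_def evenperm_comp permutation_swap_id evenperm_swap)

text \<open>A bare set of functions instead of a structure of HOL-Algebra: its elements are applied
  to points throughout, and the same locale serves permutations of cells and of matchings.\<close>

locale perm_group =
  fixes G :: "('a \<Rightarrow> 'a) set"
  assumes id_mem: "id \<in> G"
    and bij_mem: "p \<in> G \<Longrightarrow> bij p"
    and inv_mem: "p \<in> G \<Longrightarrow> inv' p \<in> G"
    and comp_mem: "p \<in> G \<Longrightarrow> q \<in> G \<Longrightarrow> p \<circ> q \<in> G"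
begin

lemma conj_mem: "p \<in> G \<Longrightarrow> q \<in> G \<Longrightarrow> p \<circ> q \<circ> inv' p \<in> G"
  by (intro comp_mem inv_mem)

lemma funpow_mem: "p \<in> G \<Longrightarrow> p ^^ n \<in> G"
  by (induction n) (auto intro: id_mem comp_mem simp: id_def[symmetric])

definition three_cycles_on :: "'a set \<Rightarrow> bool" where
  "three_cycles_on S \<longleftrightarrow>
     (\<forall>x\<in>S. \<forall>y\<in>S. \<forall>z\<in>S. x \<noteq> y \<longrightarrow> y \<noteq> z \<longrightarrow> x \<noteq> z \<longrightarrow> three_cycle x y z \<in> G)"

lemma three_cycles_onD:
  assumes "three_cycles_on S" "x \<in> S" "y \<in> S" "z \<in> S" "x \<noteq> y" "y \<noteq> z" "x \<noteq> z"
  shows "three_cycle x y z \<in> G"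
  using assms by (auto simp: three_cycles_on_def)

lemma three_cycles_on_subset: "three_cycles_on S \<Longrightarrow> T \<subseteq> S \<Longrightarrow> three_cycles_on T"
  by (auto simp: three_cycles_on_def)

lemma three_cycle_reverse:
  assumes "three_cycle x y z \<in> G"
  shows "three_cycle z y x \<in> G"
  using inv_mem[OF assms] by (simp add: inv_three_cycle)

lemma three_cycles_onI_one:
  assumes "three_cycle x y z \<in> G" "x \<noteq> y" "y \<noteq> z" "x \<noteq> z"
  shows "three_cycles_on {x, y, z}"
proof -
  have 1: "three_cycle y z x \<in> G" "three_cycle z x y \<in> G"
    using assms three_cycle_rotate[of x y z] three_cycle_rotate[of y z x] by auto
  note 2 = three_cycle_reverse[OF assms(1)] three_cycle_reverse[OF 1(1)] three_cycle_reverse[OF 1(2)]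
  show ?thesis unfolding three_cycles_on_def using assms(1) 1 2 by auto
qed

lemma three_cycle_conj_mem:
  assumes "three_cycle x y z \<in> G" "p \<in> G"
  shows "three_cycle (p x) (p y) (p z) \<in> G"
  using conj_mem[OF assms(2,1)] conj_three_cycle[OF bij_mem[OF assms(2)]] by simp

lemma three_cycles_on_image:
  assumes "three_cycles_on S" "p \<in> G"
  shows "three_cycles_on (p ` S)"
  using assms(1) three_cycle_conj_mem[OF _ assms(2)] unfolding three_cycles_on_def by fastforce

text \<open>Conjugation by three-cycles inside \<open>S\<close> carries the pair \<open>p\<close>,
  \<open>q\<close> to any other pair of \<open>S\<close> and leaves \<open>t\<close> alone, so one
  three-cycle through \<open>t\<close> yields all of them.\<close>

lemma three_cycles_on_insert:
  assumes S: "three_cycles_on S" and pq: "p \<in> S" "q \<in> S" "p \<noteq> q" and t: "t \<notin> S"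
    and G: "three_cycle p q t \<in> G"
  shows "three_cycles_on (insert t S)"
proof -
  have rot: "three_cycle y z x \<in> G" if "three_cycle x y z \<in> G" "x \<noteq> y" "y \<noteq> z" "x \<noteq> z" for x y z
    using that three_cycle_rotate by metis
  have sw: "three_cycle v u t \<in> G" if "three_cycle u v t \<in> G" "u \<noteq> v" "u \<in> S" "v \<in> S" for u v
    using rot[OF three_cycle_reverse[OF that(1)]] that t by metis
  have step: "three_cycle v x t \<in> G"
    if "three_cycle u v t \<in> G" "u \<in> S" "v \<in> S" "x \<in> S" "u \<noteq> v" "x \<noteq> u" "x \<noteq> v" for u v x
  proof -
    have ne: "t \<noteq> u" "t \<noteq> v" "t \<noteq> x" using that t by auto
    have "three_cycle u v x \<in> G" using that by (intro three_cycles_onD[OF S]) auto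
    from three_cycle_conj_mem[OF that(1) this] show ?thesis
      using that ne by (simp add: three_cycle_simps)
  qed
  have all: "three_cycle u v t \<in> G" if "u \<in> S" "v \<in> S" "u \<noteq> v" for u v
  proof -
    have "three_cycle q v t \<in> G" if "v \<in> S" "v \<noteq> q" for v
      using step[OF G, of v] sw[OF G] that pq by (cases "v = p") auto
    moreover from this have "three_cycle v u t \<in> G" if "u \<in> S" "v \<in> S" "v \<noteq> q" "u \<noteq> q" "u \<noteq> v" for u v
      using step[of q v u] that pq by auto
    ultimately show ?thesis using that sw pq by (cases "u = q"; cases "v = q") metis+
  qed
  have all2: "three_cycle t u v \<in> G" "three_cycle u t v \<in> G" if "u \<in> S" "v \<in> S" "u \<noteq> v" for u v
    using rot[OF rot[OF all[OF that]]] rot[OF rot[OF rot[OF rot[OF all[of v u]]]]] rot[OF all[of v u]] that t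
    by (metis rot all)+
  show ?thesis
    unfolding three_cycles_on_def using three_cycles_onD[OF S] all all2 by (metis insertE)
qed

text \<open>The commutator of two three-cycles with exactly one common point is a three-cycle.\<close>

lemma three_cycles_on_Un:
  assumes S: "three_cycles_on S" "finite S" "card S \<ge> 3" and T: "three_cycles_on T" "finite T" "card T \<ge> 3"
    and p: "p \<in> S" "p \<in> T"
  shows "three_cycles_on (S \<union> T)"
proof -
  have other: "\<exists>u\<in>A. u \<noteq> x \<and> u \<noteq> y" if A: "finite A" "card A \<ge> 3" for A :: "'a set" and x y
  proof (rule ccontr)
    assume "\<not> ?thesis"
    then have "A \<subseteq> {x, y}" by auto
    then have "card A \<le> card {x, y}" by (intro card_mono) auto
    moreover have "card {x, y} \<le> 2" by (simp add: card_insert_if)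
    ultimately show False using A by simp
  qed
  have "three_cycles_on (S \<union> F)" if "finite F" "F \<subseteq> T" for F
    using that
  proof (induction F)
    case empty then show ?case using S by simp
  next
    case (insert t F)
    let ?U = "S \<union> F"
    have U: "three_cycles_on ?U" using insert by auto
    show ?case
    proof (cases "t \<in> ?U")
      case True then show ?thesis using U by (simp add: insert_absorb)
    next
      case False
      have tp: "t \<noteq> p" "t \<in> T" using False p insert by auto
      obtain t2 where t2: "t2 \<in> T" "t2 \<noteq> p" "t2 \<noteq> t" using other[OF T(2,3)] by metis
      have G2: "three_cycle p t2 t \<in> G" using t2 tp p by (intro three_cycles_onD[OF T(1)]) auto
      \<comment> \<open>If \<open>t2\<close> is already present, the three-cycle on
        \<open>p\<close>, \<open>t2\<close>, \<open>t\<close> has a single new point. Otherwise the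
        commutator with a three-cycle of \<open>S\<close> through \<open>p\<close> replaces
        \<open>t2\<close> by the old point \<open>s\<close>.\<close>
      have "\<exists>q\<in>?U. q \<noteq> p \<and> three_cycle p q t \<in> G"
      proof (cases "t2 \<in> ?U")
        case True then show ?thesis using G2 t2 by auto
      next
        case False2: False
        obtain s where s: "s \<in> S" "s \<noteq> p" using other[OF S(2,3)] by metis
        obtain s2 where s2: "s2 \<in> S" "s2 \<noteq> p" "s2 \<noteq> s" using other[OF S(2,3)] by metis
        have ne: "s \<noteq> t" "s2 \<noteq> t" "s \<noteq> t2" "s2 \<noteq> t2" using s s2 False False2 by auto
        have a: "three_cycle p s s2 \<in> G" using s s2 p by (intro three_cycles_onD[OF S(1)]) auto
        have b: "three_cycle p t t2 \<in> G" using t2 tp p by (intro three_cycles_onD[OF T(1)]) auto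
        have "three_cycle p s s2 \<circ> three_cycle p t t2 \<circ> three_cycle s2 s p \<circ> three_cycle t2 t p \<in> G"
          by (intro comp_mem a b three_cycle_reverse)
        also have "three_cycle p s s2 \<circ> three_cycle p t t2 \<circ> three_cycle s2 s p \<circ> three_cycle t2 t p
          = three_cycle p s t"
          using ne s s2 t2 tp by (auto simp: three_cycle_def transpose_def fun_eq_iff)
        finally show ?thesis using s by auto
      qed
      then obtain q where "q \<in> ?U" "q \<noteq> p" "three_cycle p q t \<in> G" by auto
      then show ?thesis using three_cycles_on_insert[OF U, of p q t] p False by auto
    qed
  qed
  from this[OF T(2)] show ?thesis by simp
qed

text \<open>Induction on the support: a three-cycle that takes \<open>p x\<close> back to
  \<open>x\<close> removes \<open>x\<close> from it. The third point \<open>z\<close> of this cycle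
  exists because otherwise \<open>p\<close> would be a transposition, hence odd.\<close>

lemma even_permutation_mem:
  assumes "finite S" "three_cycles_on S" "p permutes S" "evenperm p"
  shows "p \<in> G"
  using assms
proof (induction S arbitrary: p rule: finite_induct)
  case empty
  then show ?case using id_mem by (simp add: id_def)
next
  case (insert x F)
  show ?case
  proof (cases "p x = x")
    case True
    then have "p permutes F" using permutes_superset[OF insert.prems(2), of F] by blast
    then show ?thesis using insert.IH insert.prems three_cycles_on_subset by blast
  next
    case False
    define y where "y = p x"
    have y: "y \<in> F" "y \<noteq> x" using False insert.prems(2) permutes_in_image[of p "insert x F" x] y_def by auto
    have "\<exists>z\<in>F. z \<noteq> y"
    proof (rule ccontr)
      assume "\<not> ?thesis"
      then have F: "F = {y}" using y(1) by blast
      have py: "p y = x"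
        using insert.prems(2) permutes_in_image[of p "insert x F" y] permutes_inj[of p] y_def y F
        by (metis insertE empty_iff insertI1 insertI2 injD)
      have "p = transpose x y"
      proof
        fix w show "p w = transpose x y w"
          using py y_def insert.prems(2) F by (cases "w \<in> {x,y}") (auto simp: transpose_def permutes_def)
      qed
      then show False using insert.prems(3) y by (simp add: evenperm_swap)
    qed
    then obtain z where z: "z \<in> F" "z \<noteq> y" by blast
    have zx: "z \<noteq> x" using z insert.hyps by auto
    let ?t = "three_cycle y x z"
    have t: "?t \<in> G" using y z zx by (intro three_cycles_onD[OF insert.prems(1)]) auto
    have per: "?t \<circ> p permutes insert x F"
      using insert.prems(2) y z by (intro permutes_compose three_cycle_permutes) auto
    moreover have "(?t \<circ> p) x = x" using y z zx by (simp add: y_def[symmetric] three_cycle_simps)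
    ultimately have "?t \<circ> p permutes F"
      using permutes_superset[OF per, of F] by blast
    moreover have "evenperm (?t \<circ> p)"
    proof -
      have "permutation p" "permutation ?t"
        using insert.prems(2) insert.hyps three_cycle_permutes[of y "insert x F" x z] y z
        unfolding permutation_permutes by blast+
      then show ?thesis using insert.prems(3) y zx z by (simp add: evenperm_comp evenperm_three_cycle)
    qed
    ultimately have "?t \<circ> p \<in> G" using insert.IH insert.prems three_cycles_on_subset by blast
    then have "inv' ?t \<circ> (?t \<circ> p) \<in> G" using comp_mem[OF inv_mem[OF t]] by blast
    moreover have "inv' ?t \<circ> (?t \<circ> p) = p"
      using inv_f_f[OF bij_is_inj[OF bij_three_cycle[of y x z]]] by (simp add: fun_eq_iff)
    ultimately show ?thesis by metis
  qed
qed

text \<open>Conjugation by \<open>p\<close> shows that the three-cycles on the image of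
  \<open>S\<close> lie in \<open>G\<close>. If the image meets \<open>S\<close>, those on the union
  do as well, and maximality of the size forces the image into \<open>S\<close>. The result is a
  block of \<open>G\<close>.\<close>

lemma maximal_three_cycles_on:
  assumes "finite \<Omega>" and \<Omega>: "\<And>p. p \<in> G \<Longrightarrow> p permutes \<Omega>"
    and S0: "three_cycles_on S0" "S0 \<subseteq> \<Omega>" "card S0 \<ge> 3"
  obtains S where "S0 \<subseteq> S" "S \<subseteq> \<Omega>" "three_cycles_on S"
    "\<And>p. p \<in> G \<Longrightarrow> p ` S \<inter> S \<noteq> {} \<Longrightarrow> p ` S \<subseteq> S"
proof -
  let ?A = "{S. S0 \<subseteq> S \<and> S \<subseteq> \<Omega> \<and> three_cycles_on S}"
  have "finite ?A" by (rule finite_subset[of _ "Pow \<Omega>"]) (use assms(1) in auto)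
  moreover have "S0 \<in> ?A" using S0 by auto
  ultimately obtain S where S: "S \<in> ?A" and max: "\<And>T. T \<in> ?A \<Longrightarrow> card T \<le> card S"
    using arg_max_nat_lemma[of "\<lambda>S. S \<in> ?A" S0 card "Suc (Max (card ` ?A))"]
    by (metis (no_types, lifting) Max_ge finite_imageI imageI less_Suc_eq_le)
  have fin: "finite S" using S assms(1) finite_subset by auto
  have c: "card S \<ge> 3"
  proof -
    have "S0 \<subseteq> S" using S by blast
    then show ?thesis using S0(3) card_mono[OF fin, of S0] by linarith
  qed
  have "p ` S \<subseteq> S" if p: "p \<in> G" "p ` S \<inter> S \<noteq> {}" for p
  proof -
    obtain x where x: "x \<in> S" "x \<in> p ` S" using p(2) by auto
    have "card (p ` S) = card S"
      using bij_mem[OF p(1)] by (meson bij_is_inj card_image inj_on_subset subset_UNIV)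
    then have "three_cycles_on (S \<union> p ` S)"
      using S c fin x by (intro three_cycles_on_Un[where p = x] three_cycles_on_image p(1)) auto
    moreover have "p ` S \<subseteq> \<Omega>" using S \<Omega>[OF p(1)] permutes_image by blast
    ultimately have "card (S \<union> p ` S) \<le> card S" using S by (intro max) auto
    then have "S \<union> p ` S = S" using fin by (metis card_seteq finite_UnI finite_imageI sup_ge1)
    then show ?thesis by auto
  qed
  then show thesis using that S by auto
qed

end

text \<open>Integer indices, because arcs are described by sums and differences of lengths and by
  shifts modulo \<open>N\<close>.\<close>

definition is_cycle :: "('a \<Rightarrow> 'a) \<Rightarrow> (int \<Rightarrow> 'a) \<Rightarrow> int \<Rightarrow> bool" where
  "is_cycle f \<phi> N \<longleftrightarrow> 0 < N \<and> inj_on \<phi> {0..<N} \<and>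
     (\<forall>k. 0 \<le> k \<and> k < N \<longrightarrow> f (\<phi> k) = \<phi> (if k = N - 1 then 0 else k + 1)) \<and>
     (\<forall>x. x \<notin> \<phi> ` {0..<N} \<longrightarrow> f x = x)"

lemma is_cycle_step: "is_cycle f \<phi> N \<Longrightarrow> 0 \<le> k \<Longrightarrow> k < N - 1 \<Longrightarrow> f (\<phi> k) = \<phi> (k + 1)"
  by (auto simp: is_cycle_def)

lemma is_cycle_last: "is_cycle f \<phi> N \<Longrightarrow> f (\<phi> (N - 1)) = \<phi> 0"
  by (auto simp: is_cycle_def)

lemma is_cycle_outside: "is_cycle f \<phi> N \<Longrightarrow> x \<notin> \<phi> ` {0..<N} \<Longrightarrow> f x = x"
  by (auto simp: is_cycle_def)

lemma is_cycle_inj: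
  "is_cycle f \<phi> N \<Longrightarrow> 0 \<le> i \<Longrightarrow> i < N \<Longrightarrow> 0 \<le> j \<Longrightarrow> j < N \<Longrightarrow> \<phi> i = \<phi> j \<longleftrightarrow> i = j"
  by (auto simp: is_cycle_def inj_on_def)

lemma is_cycle_funpow:
  assumes "is_cycle f \<phi> N" "0 \<le> k" "k < N"
  shows "(f ^^ n) (\<phi> k) = \<phi> ((k + int n) mod N)"
proof (induction n)
  case 0 then show ?case using assms by simp
next
  case (Suc n)
  have N: "0 < N" using assms by auto
  let ?j = "(k + int n) mod N"
  have j: "0 \<le> ?j" "?j < N" using N by auto
  have eq: "(k + int (Suc n)) mod N = (?j + 1) mod N"
    by (simp add: mod_simps algebra_simps)
  show ?case
  proof (cases "?j = N - 1")
    case True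
    then show ?thesis using Suc is_cycle_last[OF assms(1)] eq by simp
  next
    case False
    then have "?j + 1 < N" using j by simp
    then have "(?j + 1) mod N = ?j + 1" using j by (intro mod_pos_pos_trivial) auto
    then show ?thesis using Suc is_cycle_step[OF assms(1), of ?j] eq j False by simp
  qed
qed

lemma is_cycle_inv:
  assumes "is_cycle f \<phi> N" "bij f" "0 \<le> k" "k < N - 1"
  shows "inv' f (\<phi> (k + 1)) = \<phi> k"
  using is_cycle_step[OF assms(1,3,4)] assms(2) by (metis bij_is_inj inv_f_f)

lemma is_cycle_inv_first:
  assumes "is_cycle f \<phi> N" "bij f"
  shows "inv' f (\<phi> 0) = \<phi> (N - 1)"
  using is_cycle_last[OF assms(1)] assms(2) by (metis bij_is_inj inv_f_f)

lemma inv_fixed: "bij f \<Longrightarrow> f x = x \<Longrightarrow> inv' f x = x"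
  by (metis bij_is_inj inv_f_f)

lemma is_cycle_invariant:
  assumes "is_cycle f \<phi> N" "f ` S \<subseteq> S" "0 \<le> k" "k < N" "\<phi> k \<in> S"
  shows "\<phi> ` {0..<N} \<subseteq> S"
proof
  fix x assume "x \<in> \<phi> ` {0..<N}"
  then obtain j where j: "x = \<phi> j" "0 \<le> j" "j < N" by auto
  have "(f ^^ n) (\<phi> k) \<in> S" for n by (induction n) (use assms in auto)
  then have "\<phi> ((k + int (nat (j - k + N))) mod N) \<in> S"
    using is_cycle_funpow[OF assms(1,3,4)] by metis
  moreover have "(k + int (nat (j - k + N))) mod N = j"
    using j assms by (simp add: mod_pos_pos_trivial)
  ultimately show "x \<in> S" using j by simp
qed

lemma is_cycle_permutes: "is_cycle f \<phi> N \<Longrightarrow> f permutes \<phi> ` {0..<N}"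
proof (rule bij_imp_permutes)
  assume a: "is_cycle f \<phi> N"
  have "f ` (\<phi> ` {0..<N}) = \<phi> ` {0..<N}"
  proof (intro equalityI subsetI)
    fix x assume "x \<in> f ` (\<phi> ` {0..<N})"
    then show "x \<in> \<phi> ` {0..<N}" using a by (auto simp: is_cycle_def)
  next
    fix x assume "x \<in> \<phi> ` {0..<N}"
    then obtain k where k: "x = \<phi> k" "0 \<le> k" "k < N" by auto
    show "x \<in> f ` (\<phi> ` {0..<N})"
    proof (cases "k = 0")
      case True
      then have "x = f (\<phi> (N - 1))" using k is_cycle_last[OF a] by simp
      then show ?thesis using k by auto
    next
      case False
      then have "x = f (\<phi> (k - 1))" using k is_cycle_step[OF a, of "k - 1"] by simp
      then show ?thesis using k False by auto
    qed
  qed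
  then show "bij_betw f (\<phi> ` {0..<N}) (\<phi> ` {0..<N})"
    by (simp add: bij_betw_def eq_card_imp_inj_on)
  show "f x = x" if "x \<notin> \<phi> ` {0..<N}" for x using is_cycle_outside[OF a that] .
qed

section \<open>Three-cycles from two overlapping cycles\<close>

definition comm :: "('a \<Rightarrow> 'a) \<Rightarrow> ('a \<Rightarrow> 'a) \<Rightarrow> 'a \<Rightarrow> 'a" where
  "comm f g = f \<circ> inv' g \<circ> inv' f \<circ> g"

text \<open>\<open>p\<close>, \<open>q\<close>, \<open>t\<close> and \<open>w\<close> are the
  successive images of \<open>x\<close>; premises in terms of \<open>f\<close> and \<open>g\<close>
  alone avoid evaluating inverses.\<close>

lemma comm_eval:
  assumes "bij f" "bij g" "g x = p" "f q = p" "g t = q" "f t = w"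
  shows "comm f g x = w"
  unfolding comm_def o_apply using assms by (metis bij_is_inj inv_f_f)

lemma funpow_fixed: "f x = x \<Longrightarrow> (f ^^ n) x = x"
  by (induction n) auto

text \<open>Moves the starting point, so that the indices of the common arcs of two cycles can be
  matched.\<close>

lemma is_cycle_rotate:
  assumes "is_cycle f \<phi> N" "0 \<le> d" "d < N"
  shows "is_cycle f (\<lambda>k. if k < d then \<phi> (k + N - d) else \<phi> (k - d)) N"
proof -
  let ?\<psi> = "\<lambda>k. if k < d then \<phi> (k + N - d) else \<phi> (k - d)"
  have img: "?\<psi> ` {0..<N} = \<phi> ` {0..<N}"
  proof (intro equalityI subsetI)
    fix x assume "x \<in> ?\<psi> ` {0..<N}"
    then show "x \<in> \<phi> ` {0..<N}" using assms(2,3) by (auto split: if_splits)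
  next
    fix x assume "x \<in> \<phi> ` {0..<N}"
    then obtain k where k: "x = \<phi> k" "0 \<le> k" "k < N" by auto
    show "x \<in> ?\<psi> ` {0..<N}"
    proof (cases "k < N - d")
      case True
      then show ?thesis using k assms(2,3) by (intro image_eqI[of _ _ "k + d"]) auto
    next
      case False
      then show ?thesis using k assms(2,3) by (intro image_eqI[of _ _ "k + d - N"]) auto
    qed
  qed
  have inj: "inj_on ?\<psi> {0..<N}"
    using assms is_cycle_inj[OF assms(1)] by (auto simp: inj_on_def)
  have step: "f (?\<psi> k) = ?\<psi> (if k = N - 1 then 0 else k + 1)" if "0 \<le> k" "k < N" for k
    using that assms(2,3) is_cycle_step[OF assms(1), of "k + N - d"] is_cycle_last[OF assms(1)]
      is_cycle_step[OF assms(1), of "k - d"]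
    by (cases "k = N - 1"; cases "k = d - 1"; cases "k < d") (auto simp: algebra_simps)
  show ?thesis
    unfolding is_cycle_def using assms(2,3) inj step img is_cycle_outside[OF assms(1)] by auto
qed

text \<open>Meant for a \<open>q\<close> whose cycles other than the three-cycle have lengths
  dividing \<open>n\<close>: they disappear in the power, while an exponent that is 1 modulo 3 keeps
  the three-cycle.\<close>

lemma pow_eq_three_cycle:
  assumes abc: "q a = b" "q b = c" "q c = a" "a \<noteq> b" "b \<noteq> c" "a \<noteq> c"
    and other: "\<And>x. x \<notin> {a, b, c} \<Longrightarrow> (q ^^ n) x = x"
    and n: "n mod 3 = 1"
  shows "q ^^ n = three_cycle a b c"
proof -
  have q3: "(q ^^ (3 * k)) x = x" if "x \<in> {a, b, c}" for k x
  proof (induction k)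
    case (Suc k)
    have "(q ^^ (3 * Suc k)) x = (q ^^ (3 * k)) (q (q (q x)))"
      by (simp add: funpow_swap1 numeral_3_eq_3)
    also have "q (q (q x)) = x" using that abc by auto
    finally show ?case using Suc by simp
  qed simp
  have n': "n = Suc (3 * (n div 3))" using n by presburger
  have "(q ^^ n) x = q x" if "x \<in> {a, b, c}" for x
    by (subst n') (simp add: q3[OF that])
  then show ?thesis using abc other by (intro ext) (metis insertCI three_cycle_simps insertE empty_iff)
qed

text \<open>The product of two involutions is computed along the paths that their transpositions form;
  the power removes every cycle but the one of length three.\<close>

lemma path_product_3_2_2:
  assumes "distinct [a, b, c, d, e, u, v]"
  shows "((transpose a b \<circ> transpose d e) \<circ> (transpose b c \<circ> transpose u v)) ^^ 4 = three_cycle c a b"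
proof -
  define q where "q = (transpose a b \<circ> transpose d e) \<circ> (transpose b c \<circ> transpose u v)"
  have q: "q c = a" "q a = b" "q b = c" "q d = e" "q e = d" "q u = v" "q v = u"
    using assms distinct_rev[THEN iffD2, OF assms] by (simp_all add: transpose_def q_def)
  have o: "q x = x" if "x \<notin> {a, b, c, d, e, u, v}" for x
    using that by (simp add: transpose_def q_def)
  have "(q ^^ 4) x = x" if "x \<notin> {c, a, b}" for x
  proof (cases "x \<in> {d, e, u, v}")
    case True
    then show ?thesis by (elim insertE emptyE; simp add: eval_nat_numeral q)
  next
    case False
    then show ?thesis using that by (intro funpow_fixed o) blast
  qed
  then show ?thesis using q assms distinct_rev[THEN iffD2, OF assms] unfolding q_def[symmetric]
    by (intro pow_eq_three_cycle) simp_all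
qed

text \<open>The transposition of \<open>u\<close> and \<open>v\<close> occurs in both factors and
  cancels. What remains is a five-cycle and a three-cycle, and 10 is 0 modulo 5 and 1 modulo
  3.\<close>

lemma path_product_5_3:
  assumes "distinct [P, Q, z, m, w, x1, x2, x3, u, v]"
  shows "((transpose P m \<circ> transpose Q z \<circ> transpose x2 x3 \<circ> transpose u v) \<circ>
    (transpose P w \<circ> transpose Q m \<circ> transpose u v \<circ> transpose x1 x2)) ^^ 10 = three_cycle x1 x3 x2"
proof -
  define q where "q = (transpose P m \<circ> transpose Q z \<circ> transpose x2 x3 \<circ> transpose u v) \<circ>
    (transpose P w \<circ> transpose Q m \<circ> transpose u v \<circ> transpose x1 x2)"
  have q: "q x1 = x3" "q x3 = x2" "q x2 = x1" "q u = u" "q v = v"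
    "q P = w" "q w = m" "q m = z" "q z = Q" "q Q = P"
    using assms distinct_rev[THEN iffD2, OF assms] by (simp_all add: transpose_def q_def)
  have o: "q x = x" if "x \<notin> {P, Q, z, m, w, x1, x2, x3, u, v}" for x
    using that by (simp add: transpose_def q_def)
  have "(q ^^ 10) x = x" if "x \<notin> {x1, x3, x2}" for x
  proof (cases "x \<in> {P, Q, z, m, w, u, v}")
    case True
    then show ?thesis by (elim insertE emptyE; simp add: eval_nat_numeral q)
  next
    case False
    then show ?thesis using that by (intro funpow_fixed o) blast
  qed
  then show ?thesis using q assms distinct_rev[THEN iffD2, OF assms] unfolding q_def[symmetric]
    by (intro pow_eq_three_cycle) simp_all
qed

text \<open>Besides the three-cycle there are one five-cycle and two transpositions, whence the
  exponent 10.\<close>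

lemma path_product_3_5_2_2:
  assumes "distinct [P, Q, m, a0, a1, a2, m1, m2, w, g1, g2, y]"
  shows "((transpose P m \<circ> transpose Q a0 \<circ> transpose a1 a2 \<circ> transpose m1 m2) \<circ>
    (transpose g1 w \<circ> transpose g2 Q \<circ> transpose a0 m2 \<circ> transpose y P)) ^^ 10 = three_cycle y m P"
proof -
  define q where "q = (transpose P m \<circ> transpose Q a0 \<circ> transpose a1 a2 \<circ> transpose m1 m2) \<circ>
    (transpose g1 w \<circ> transpose g2 Q \<circ> transpose a0 m2 \<circ> transpose y P)"
  have q: "q y = m" "q m = P" "q P = y" "q a1 = a2" "q a2 = a1" "q g1 = w" "q w = g1"
    "q g2 = a0" "q a0 = m1" "q m1 = m2" "q m2 = Q" "q Q = g2"
    using assms distinct_rev[THEN iffD2, OF assms] by (simp_all add: transpose_def q_def)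
  have o: "q x = x" if "x \<notin> {P, Q, m, a0, a1, a2, m1, m2, w, g1, g2, y}" for x
    using that by (simp add: transpose_def q_def)
  have "(q ^^ 10) x = x" if "x \<notin> {y, m, P}" for x
  proof (cases "x \<in> {a1, a2, g1, w, g2, a0, m1, m2, Q}")
    case True
    then show ?thesis by (elim insertE emptyE; simp add: eval_nat_numeral q)
  next
    case False
    then show ?thesis using that by (intro funpow_fixed o) blast
  qed
  then show ?thesis using q assms distinct_rev[THEN iffD2, OF assms] unfolding q_def[symmetric]
    by (intro pow_eq_three_cycle) simp_all
qed

text \<open>The degenerate form of the previous product with \<open>g1 = m1\<close> and
  \<open>g2 = a1\<close>: the five-cycle and the two transpositions merge into one cycle of length
  7.\<close>

lemma path_product_3_7:
  assumes "distinct [P, Q, m, a0, a1, a2, m1, m2, w, y]"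
  shows "((transpose P m \<circ> transpose Q a0 \<circ> transpose a1 a2 \<circ> transpose m1 m2) \<circ>
    (transpose m1 w \<circ> transpose a1 Q \<circ> transpose a0 m2 \<circ> transpose y P)) ^^ 7 = three_cycle y m P"
proof -
  define q where "q = (transpose P m \<circ> transpose Q a0 \<circ> transpose a1 a2 \<circ> transpose m1 m2) \<circ>
    (transpose m1 w \<circ> transpose a1 Q \<circ> transpose a0 m2 \<circ> transpose y P)"
  have q: "q y = m" "q m = P" "q P = y" "q a2 = a1" "q a1 = a0" "q a0 = m1" "q m1 = w" "q w = m2"
    "q m2 = Q" "q Q = a2"
    using assms distinct_rev[THEN iffD2, OF assms] by (simp_all add: transpose_def q_def)
  have o: "q x = x" if "x \<notin> {P, Q, m, a0, a1, a2, m1, m2, w, y}" for x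
    using that by (simp add: transpose_def q_def)
  have "(q ^^ 7) x = x" if "x \<notin> {y, m, P}" for x
  proof (cases "x \<in> {a1, a2, a0, m1, m2, w, Q}")
    case True
    then show ?thesis by (elim insertE emptyE; simp add: eval_nat_numeral q)
  next
    case False
    then show ?thesis using that by (intro funpow_fixed o) blast
  qed
  then show ?thesis using q assms distinct_rev[THEN iffD2, OF assms] unfolding q_def[symmetric]
    by (intro pow_eq_three_cycle) simp_all
qed

lemma eq_four_transpositions:
  assumes "distinct [a, b, c, d, e, f, g, h]"
    and "r a = b" "r b = a" "r c = d" "r d = c" "r e = f" "r f = e" "r g = h" "r h = g"
    and "\<And>x. x \<notin> {a, b, c, d, e, f, g, h} \<Longrightarrow> r x = x"
  shows "r = transpose a b \<circ> transpose c d \<circ> transpose e f \<circ> transpose g h"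
proof
  fix x
  define q where "q = transpose a b \<circ> transpose c d \<circ> transpose e f \<circ> transpose g h"
  have q: "q a = b" "q b = a" "q c = d" "q d = c" "q e = f" "q f = e" "q g = h" "q h = g"
    using assms(1) distinct_rev[THEN iffD2, OF assms(1)] by (simp_all add: transpose_def q_def)
  have o: "q x = x" if "x \<notin> {a, b, c, d, e, f, g, h}"
    using that by (simp add: transpose_def q_def)
  have "q x = r x"
  proof (cases "x \<in> {a, b, c, d, e, f, g, h}")
    case True
    then show ?thesis by (elim insertE emptyE; simp only: q assms(2-9))
  next
    case False
    then show ?thesis using o assms(10) by simp
  qed
  then show "r x = (transpose a b \<circ> transpose c d \<circ> transpose e f \<circ> transpose g h) x"
    by (simp add: q_def)
qed

lemma eq_two_transpositions:
  assumes "distinct [a, b, c, d]" "r a = b" "r b = a" "r c = d" "r d = c"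
    and "\<And>x. x \<notin> {a, b, c, d} \<Longrightarrow> r x = x"
  shows "r = transpose a b \<circ> transpose c d"
proof
  fix x
  define q where "q = transpose a b \<circ> transpose c d"
  have q: "q a = b" "q b = a" "q c = d" "q d = c"
    using assms(1) distinct_rev[THEN iffD2, OF assms(1)] by (simp_all add: transpose_def q_def)
  have o: "q x = x" if "x \<notin> {a, b, c, d}"
    using that by (simp add: transpose_def q_def)
  have "q x = r x"
  proof (cases "x \<in> {a, b, c, d}")
    case True
    then show ?thesis by (elim insertE emptyE; simp only: q assms(2-5))
  next
    case False
    then show ?thesis using o assms(6) by simp
  qed
  then show "r x = (transpose a b \<circ> transpose c d) x"
    by (simp add: q_def)
qed

locale two_cycles = perm_group G for G :: "('a \<Rightarrow> 'a) set" +
  fixes f g :: "'a \<Rightarrow> 'a" and \<phi> \<psi> :: "int \<Rightarrow> 'a" and N M :: int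
  assumes f_mem: "f \<in> G" and g_mem: "g \<in> G"
    and f_cycle: "is_cycle f \<phi> N" and g_cycle: "is_cycle g \<psi> M"
begin

lemmas bij_f = bij_mem[OF f_mem]
lemmas bij_g = bij_mem[OF g_mem]
lemmas f_step = is_cycle_step[OF f_cycle]
lemmas g_step = is_cycle_step[OF g_cycle]
lemmas \<phi>_eq = is_cycle_inj[OF f_cycle]
lemmas \<psi>_eq = is_cycle_inj[OF g_cycle]
lemmas commI = comm_eval[OF bij_f bij_g]

lemma f_fix: "(\<And>i. 0 \<le> i \<Longrightarrow> i < N \<Longrightarrow> \<phi> i \<noteq> x) \<Longrightarrow> f x = x"
  using is_cycle_outside[OF f_cycle, of x] by fastforce

lemma g_fix: "(\<And>i. 0 \<le> i \<Longrightarrow> i < M \<Longrightarrow> \<psi> i \<noteq> x) \<Longrightarrow> g x = x"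
  using is_cycle_outside[OF g_cycle, of x] by fastforce

lemma comm_mem: "comm f g \<in> G"
  unfolding comm_def by (intro comp_mem inv_mem f_mem g_mem)

text \<open>The commutator is trivial in the interior of a common arc, of a private arc of
  \<open>f\<close> (\<open>comm_fix2\<close>) and of a private arc of \<open>g\<close>
  (\<open>comm_fix3\<close>); only the junctions of arcs remain to be computed.\<close>

lemma comm_fix1: "g x = f x \<Longrightarrow> f y = x \<Longrightarrow> g y = x \<Longrightarrow> comm f g x = x"
  by (rule commI) auto

lemma comm_fix2: "g x = x \<Longrightarrow> f y = x \<Longrightarrow> g y = y \<Longrightarrow> comm f g x = x"
  by (rule commI) auto

lemma comm_fix3: "f x = x \<Longrightarrow> f (g x) = g x \<Longrightarrow> comm f g x = x"
  by (rule commI) auto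

text \<open>What it takes to spread a three-cycle over the cycle of \<open>f\<close>: the point
  \<open>p\<close>, possibly a fixed point of \<open>f\<close>, makes \<open>f\<close> preserve the
  block around the three-cycle, and the index \<open>i\<close> makes this block meet the
  cycle.\<close>

definition seed :: bool where
  "seed \<longleftrightarrow> (\<exists>x y z. x \<noteq> y \<and> y \<noteq> z \<and> x \<noteq> z \<and> three_cycle x y z \<in> G \<and>
     (\<exists>p\<in>{x, y, z}. f p \<in> {x, y, z}) \<and> (\<exists>i. 0 \<le> i \<and> i < N \<and> \<phi> i \<in> {x, y, z}))"

lemma seedI:
  assumes "x \<noteq> y" "y \<noteq> z" "x \<noteq> z" "three_cycle x y z \<in> G"
    "p \<in> {x, y, z}" "f p \<in> {x, y, z}" "0 \<le> i" "i < N" "\<phi> i \<in> {x, y, z}"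
  shows seed
  unfolding seed_def using assms by blast

lemma three_cycles_on_support:
  assumes "finite \<Omega>" "\<And>p. p \<in> G \<Longrightarrow> p permutes \<Omega>" seed
  shows "three_cycles_on (\<phi> ` {0..<N})"
proof -
  obtain x y z p i where xyz: "x \<noteq> y" "y \<noteq> z" "x \<noteq> z" "three_cycle x y z \<in> G"
    and p: "p \<in> {x, y, z}" "f p \<in> {x, y, z}" and i: "0 \<le> i" "i < N" "\<phi> i \<in> {x, y, z}"
    using assms(3) unfolding seed_def by blast
  have tc: "three_cycles_on {x, y, z}" by (rule three_cycles_onI_one) (use xyz in auto)
  have "{x, y, z} \<subseteq> \<Omega>"
  proof -
    have "w \<in> \<Omega>" if "w \<in> {x, y, z}" for w
      using assms(2)[OF xyz(4)] that three_cycle_simps[OF xyz(1-3)] xyz(1-3)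
      by (metis insertE emptyE permutes_not_in)
    then show ?thesis by blast
  qed
  moreover have "card {x, y, z} \<ge> 3" using xyz by simp
  ultimately obtain S where S: "{x, y, z} \<subseteq> S" "S \<subseteq> \<Omega>" "three_cycles_on S"
    and max: "\<And>p. p \<in> G \<Longrightarrow> p ` S \<inter> S \<noteq> {} \<Longrightarrow> p ` S \<subseteq> S"
    using maximal_three_cycles_on[OF assms(1,2) tc] by metis
  have "f ` S \<inter> S \<noteq> {}" using p S(1) by blast
  then have "f ` S \<subseteq> S" by (rule max[OF f_mem])
  then have "\<phi> ` {0..<N} \<subseteq> S"
    using is_cycle_invariant[OF f_cycle _ i(1,2)] i(3) S(1) by blast
  then show ?thesis using S(3) three_cycles_on_subset by blast
qed

end

text \<open>Two cycles of length \<open>2a + 2n + 1\<close> that run in parallel through two common arcs of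
  length \<open>a\<close> and have private arcs of lengths \<open>n\<close>, \<open>n + 1\<close> and \<open>n + 1\<close>, \<open>n\<close> in between.\<close>

locale parallel_cycles = two_cycles +
  fixes a n :: int
  assumes a: "2 \<le> a" and n: "0 \<le> n" and N: "N = 2 * a + 2 * n + 1" and M: "M = N"
    and overlap: "\<And>i j. 0 \<le> i \<Longrightarrow> i < N \<Longrightarrow> 0 \<le> j \<Longrightarrow> j < N \<Longrightarrow>
      \<phi> i = \<psi> j \<longleftrightarrow> i = j \<and> i < a \<or> a + n \<le> i \<and> i < 2 * a + n \<and> j = i + 1"
begin

lemma \<phi>_fixed_g: "a \<le> i \<and> i < a + n \<or> 2 * a + n \<le> i \<and> i < N \<Longrightarrow> g (\<phi> i) = \<phi> i"
  using overlap[of i] a n N M by (intro g_fix) fastforce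

lemma \<psi>_fixed_f: "a \<le> j \<and> j \<le> a + n \<or> 2 * a + n < j \<and> j < N \<Longrightarrow> f (\<psi> j) = \<psi> j"
  using overlap[of _ j] a n N M by (intro f_fix) fastforce

lemma arc1: "0 \<le> i \<Longrightarrow> i < a \<Longrightarrow> \<phi> i = \<psi> i"
  using overlap[of i i] a n N by auto

lemma arc2: "a + n \<le> i \<Longrightarrow> i < 2 * a + n \<Longrightarrow> \<phi> i = \<psi> (i + 1)"
  using overlap[of i "i + 1"] a n N by auto

lemma f_last: "f (\<phi> (2 * a + 2 * n)) = \<phi> 0"
  using is_cycle_last[OF f_cycle] N by simp

lemma g_last: "g (\<psi> (2 * a + 2 * n)) = \<psi> 0"
  using is_cycle_last[OF g_cycle] N M by simp

text \<open>Every junction yields one transposition: on entering a common arc, the last private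
  point of \<open>g\<close> is exchanged with the first common point; on leaving it, the last common
  point with the first private point of \<open>f\<close>. With \<open>1 \<le> n\<close> no private
  arc is empty.\<close>

lemma comm_eq:
  assumes n: "1 \<le> n"
  shows "comm f g = transpose (\<psi> (a + n)) (\<phi> (a + n)) \<circ> transpose (\<psi> (2 * a + 2 * n)) (\<phi> 0) \<circ>
    transpose (\<phi> (a - 1)) (\<phi> a) \<circ> transpose (\<phi> (2 * a + n - 1)) (\<phi> (2 * a + n))" (is "?r = _")
proof (rule eq_four_transpositions)
  show "distinct [\<psi> (a + n), \<phi> (a + n), \<psi> (2 * a + 2 * n), \<phi> 0, \<phi> (a - 1), \<phi> a, \<phi> (2 * a + n - 1), \<phi> (2 * a + n)]"
    using a n N M by (simp add: \<phi>_eq \<psi>_eq overlap overlap[THEN trans[OF eq_commute]])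
  show "?r (\<psi> (a + n)) = \<phi> (a + n)"
    by (rule commI[of _ "\<phi> (a + n)" "\<phi> (a + n - 1)" "\<phi> (a + n - 1)"])
      (use a n N M g_step[of "a + n"] f_step[of "a + n - 1"] arc2[of "a + n"] \<phi>_fixed_g[of "a + n - 1"] in auto)
  show "?r (\<phi> (a + n)) = \<psi> (a + n)"
    by (rule commI[of _ "\<phi> (a + n + 1)" "\<phi> (a + n)" "\<psi> (a + n)"])
      (use a n N M g_step[of "a + n"] g_step[of "a + n + 1"] f_step[of "a + n"] arc2[of "a + n"] arc2[of "a + n + 1"] \<psi>_fixed_f[of "a + n"] in \<open>auto simp: add.commute\<close>)
  show "?r (\<psi> (2 * a + 2 * n)) = \<phi> 0"
    by (rule commI[of _ "\<phi> 0" "\<phi> (2 * a + 2 * n)" "\<phi> (2 * a + 2 * n)"])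
      (use a n N M g_last f_last arc1[of 0] \<phi>_fixed_g[of "2 * a + 2 * n"] in auto)
  show "?r (\<phi> 0) = \<psi> (2 * a + 2 * n)"
    by (rule commI[of _ "\<phi> 1" "\<phi> 0" "\<psi> (2 * a + 2 * n)"])
      (use a n N M g_last f_step[of 0] g_step[of 0] arc1[of 0] arc1[of 1] \<psi>_fixed_f[of "2 * a + 2 * n"] in auto)
  show "?r (\<phi> (a - 1)) = \<phi> a"
    by (rule commI[of _ "\<psi> a" "\<psi> a" "\<phi> (a - 1)"])
      (use a n N M f_step[of "a - 1"] g_step[of "a - 1"] arc1[of "a - 1"] \<psi>_fixed_f[of a] in auto)
  show "?r (\<phi> a) = \<phi> (a - 1)"
    by (rule commI[of _ "\<phi> a" "\<phi> (a - 1)" "\<phi> (a - 2)"])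
      (use a n N M f_step[of "a - 1"] f_step[of "a - 2"] g_step[of "a - 2"] arc1[of "a - 1"] arc1[of "a - 2"] \<phi>_fixed_g[of a] in auto)
  show "?r (\<phi> (2 * a + n - 1)) = \<phi> (2 * a + n)"
    by (rule commI[of _ "\<psi> (2 * a + n + 1)" "\<psi> (2 * a + n + 1)" "\<phi> (2 * a + n - 1)"])
      (use a n N M f_step[of "2 * a + n - 1"] g_step[of "2 * a + n"] arc2[of "2 * a + n - 1"] \<psi>_fixed_f[of "2 * a + n + 1"] in auto)
  show "?r (\<phi> (2 * a + n)) = \<phi> (2 * a + n - 1)"
    by (rule commI[of _ "\<phi> (2 * a + n)" "\<phi> (2 * a + n - 1)" "\<phi> (2 * a + n - 2)"])
      (use a n N M f_step[of "2 * a + n - 1"] f_step[of "2 * a + n - 2"] g_step[of "2 * a + n - 1"]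
        arc2[of "2 * a + n - 1"] arc2[of "2 * a + n - 2"] \<phi>_fixed_g[of "2 * a + n"] in auto)
  fix x assume x: "x \<notin> {\<psi> (a + n), \<phi> (a + n), \<psi> (2 * a + 2 * n), \<phi> 0, \<phi> (a - 1), \<phi> a, \<phi> (2 * a + n - 1), \<phi> (2 * a + n)}"
  consider (1) i where "x = \<phi> i" "0 \<le> i" "i < N" | (2) j where "x = \<psi> j" "0 \<le> j" "j < N" "\<forall>i. 0 \<le> i \<and> i < N \<longrightarrow> \<phi> i \<noteq> x"
    | (3) "\<forall>i. 0 \<le> i \<and> i < N \<longrightarrow> \<phi> i \<noteq> x" "\<forall>j. 0 \<le> j \<and> j < N \<longrightarrow> \<psi> j \<noteq> x"
    by metis
  then show "?r x = x"
  proof cases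
    case 1
    then have "i \<noteq> 0" "i \<noteq> a - 1" "i \<noteq> a" "i \<noteq> a + n" "i \<noteq> 2 * a + n - 1" "i \<noteq> 2 * a + n" using x by auto
    then consider "0 < i" "i < a - 1" | "a < i" "i < a + n" | "a + n < i" "i < 2 * a + n - 1" | "2 * a + n < i"
      using 1 by linarith
    then show ?thesis
    proof cases
      case 1
      then show ?thesis using \<open>x = \<phi> i\<close> a n N M f_step[of i] f_step[of "i - 1"] g_step[of i] g_step[of "i - 1"] arc1[of "i - 1"] arc1[of i] arc1[of "i + 1"]
        by (intro comm_fix1[of _ "\<phi> (i - 1)"]) auto
    next
      case 2
      then show ?thesis using \<open>x = \<phi> i\<close> a n N M f_step[of "i - 1"] \<phi>_fixed_g[of i] \<phi>_fixed_g[of "i - 1"]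
        by (intro comm_fix2[of _ "\<phi> (i - 1)"]) auto
    next
      case 3
      then show ?thesis using \<open>x = \<phi> i\<close> a n N M f_step[of i] f_step[of "i - 1"] g_step[of "i + 1"] g_step[of i] arc2[of "i - 1"] arc2[of i] arc2[of "i + 1"]
        by (intro comm_fix1[of _ "\<phi> (i - 1)"]) (auto simp: algebra_simps)
    next
      case 4
      then show ?thesis using \<open>x = \<phi> i\<close> \<open>i < N\<close> a n N M f_step[of "i - 1"] \<phi>_fixed_g[of i] \<phi>_fixed_g[of "i - 1"]
        by (intro comm_fix2[of _ "\<phi> (i - 1)"]) auto
    qed
  next
    case 2
    have "\<not> j < a" "\<not> (a + n < j \<and> j \<le> 2 * a + n)"
      using 2 arc1[of j] arc2[of "j - 1"] a n N by fastforce+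
    moreover have "j \<noteq> a + n" "j \<noteq> 2 * a + 2 * n" using 2 x by auto
    ultimately have "f (\<psi> j) = \<psi> j" "g (\<psi> j) = \<psi> (j + 1)" "f (\<psi> (j + 1)) = \<psi> (j + 1)"
      using 2 a n N M g_step[of j] \<psi>_fixed_f[of j] \<psi>_fixed_f[of "j + 1"] by auto
    then show ?thesis using 2 by (intro comm_fix3) auto
  next
    case 3
    then have "f x = x" "g x = x" using f_fix[of x] g_fix[of x] M by auto
    then show ?thesis by (intro comm_fix3) auto
  qed
qed

lemma f_pow:
  assumes "j = i + k \<or> j = i + k - N" "0 \<le> i" "i < N" "0 \<le> k" "0 \<le> j" "j < N"
  shows "(f ^^ nat k) (\<phi> i) = \<phi> j"
  using is_cycle_funpow[OF f_cycle assms(2,3), of "nat k"] assms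
  by (metis (no_types, lifting) int_nat_eq minus_mod_self2 mod_pos_pos_trivial)

lemma g_pow:
  assumes "j = i + k \<or> j = i + k - N" "0 \<le> i" "i < N" "0 \<le> k" "0 \<le> j" "j < N"
  shows "(g ^^ nat k) (\<psi> i) = \<psi> j"
  using is_cycle_funpow[OF g_cycle, of i "nat k"] M assms
  by (metis (no_types, lifting) int_nat_eq minus_mod_self2 mod_pos_pos_trivial)

lemmas distinct_simps = \<phi>_eq \<psi>_eq overlap overlap[THEN trans[OF eq_commute]]

lemma seed_wide:
  assumes "3 \<le> a" "1 \<le> n"
  shows seed
proof -
  \<comment> \<open>This power carries the start of the first common arc to the start of the second
    and fixes the private points of \<open>g\<close>, so the conjugate shares several points with
    the commutator, including one whole transposition. The bound \<open>3 \<le> a\<close> keeps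
    \<open>\<phi> (a - 2)\<close> and \<open>\<phi> 0\<close> apart.\<close>
  let ?X = "f ^^ nat (a + n)"
  have X: "?X \<in> G" by (rule funpow_mem[OF f_mem])
  have "?X \<circ> comm f g \<circ> inv' ?X = transpose (\<psi> (a + n)) (\<phi> (2 * a + 2 * n)) \<circ>
      transpose (\<psi> (2 * a + 2 * n)) (\<phi> (a + n)) \<circ>
      transpose (\<phi> (2 * a + n - 1)) (\<phi> (2 * a + n)) \<circ> transpose (\<phi> (a - 2)) (\<phi> (a - 1))"
  proof -
    have "?X (\<psi> (a + n)) = \<psi> (a + n)" "?X (\<psi> (2 * a + 2 * n)) = \<psi> (2 * a + 2 * n)"
      using assms N by (auto intro!: funpow_fixed \<psi>_fixed_f)
    moreover have "?X (\<phi> (a + n)) = \<phi> (2 * a + 2 * n)" "?X (\<phi> 0) = \<phi> (a + n)"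
      "?X (\<phi> (a - 1)) = \<phi> (2 * a + n - 1)" "?X (\<phi> a) = \<phi> (2 * a + n)"
      "?X (\<phi> (2 * a + n - 1)) = \<phi> (a - 2)" "?X (\<phi> (2 * a + n)) = \<phi> (a - 1)"
      using assms N by (intro f_pow; linarith)+
    ultimately show ?thesis
      unfolding comm_eq[OF assms(2)] by (simp only: conj_comp[OF bij_mem[OF X]] conj_transpose[OF bij_mem[OF X]])
  qed
  moreover have "(comm f g \<circ> (?X \<circ> comm f g \<circ> inv' ?X)) ^^ 10 \<in> G"
    by (intro funpow_mem comp_mem[OF comm_mem] conj_mem X comm_mem)
  moreover have "distinct [\<psi> (a + n), \<psi> (2 * a + 2 * n), \<phi> 0, \<phi> (a + n), \<phi> (2 * a + 2 * n),
      \<phi> (a - 2), \<phi> (a - 1), \<phi> a, \<phi> (2 * a + n - 1), \<phi> (2 * a + n)]"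
    using assms N M by (simp add: distinct_simps)
  ultimately have "three_cycle (\<phi> (a - 2)) (\<phi> a) (\<phi> (a - 1)) \<in> G"
    using path_product_5_3 unfolding comm_eq[OF assms(2)] by metis
  then show ?thesis
    using assms N f_step[of "a - 2"]
    by (intro seedI[of "\<phi> (a - 2)" "\<phi> a" "\<phi> (a - 1)" "\<phi> (a - 2)" a]) (auto simp: \<phi>_eq)
qed

lemma seed_two:
  assumes "a = 2" "1 \<le> n"
  shows seed
proof -
  \<comment> \<open>For \<open>a = 2\<close> the points \<open>\<phi> (a - 2)\<close> and
    \<open>\<phi> 0\<close> coincide and the conjugate used for wider arcs fails. Conjugating it
    once more, by a power of \<open>g\<close>, restores a product with a single three-cycle.\<close>
  let ?F = "f ^^ nat (n + 2)" and ?H = "g ^^ nat (n + 1)"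
  let ?X = "?H \<circ> ?F"
  have X: "?X \<in> G" by (intro comp_mem funpow_mem f_mem g_mem)
  have r: "comm f g = transpose (\<psi> (n + 2)) (\<phi> (n + 2)) \<circ> transpose (\<psi> (2 * n + 4)) (\<phi> 0) \<circ>
    transpose (\<phi> 1) (\<phi> 2) \<circ> transpose (\<phi> (n + 3)) (\<phi> (n + 4))"
    using comm_eq[OF assms(2)] assms(1) by (simp add: algebra_simps)
  have N': "N = 2 * n + 5" using N assms by simp
  have rX: "?X \<circ> comm f g \<circ> inv' ?X = transpose (\<psi> (2 * n + 3)) (\<phi> (2 * n + 4)) \<circ>
      transpose (\<psi> n) (\<psi> (2 * n + 4)) \<circ> transpose (\<phi> 0) (\<phi> (n + 4)) \<circ>
      transpose (\<psi> (n + 1)) (\<psi> (n + 2))"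
  proof -
    have F: "?F (\<psi> (n + 2)) = \<psi> (n + 2)" "?F (\<psi> (2 * n + 4)) = \<psi> (2 * n + 4)"
      using assms N' by (auto intro!: funpow_fixed \<psi>_fixed_f)
    have H: "?H (\<phi> (2 * n + 4)) = \<phi> (2 * n + 4)" "?H (\<phi> (n + 4)) = \<phi> (n + 4)"
      using assms N' by (auto intro!: funpow_fixed \<phi>_fixed_g)
    have "?F (\<phi> (n + 2)) = \<phi> (2 * n + 4)" "?F (\<phi> 0) = \<phi> (n + 2)"
      "?F (\<phi> 1) = \<phi> (n + 3)" "?F (\<phi> 2) = \<phi> (n + 4)"
      "?F (\<phi> (n + 3)) = \<phi> 0" "?F (\<phi> (n + 4)) = \<phi> 1"
      using assms N' by (intro f_pow; linarith)+
    moreover have "?H (\<psi> (n + 2)) = \<psi> (2 * n + 3)" "?H (\<psi> (2 * n + 4)) = \<psi> n"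
      "?H (\<psi> (n + 3)) = \<psi> (2 * n + 4)" "?H (\<psi> (n + 4)) = \<psi> 0" "?H (\<psi> 0) = \<psi> (n + 1)"
      "?H (\<psi> 1) = \<psi> (n + 2)"
      using assms N' by (intro g_pow; linarith)+
    moreover have "\<phi> 0 = \<psi> 0" "\<phi> 1 = \<psi> 1" "\<phi> (n + 2) = \<psi> (n + 3)" "\<phi> (n + 3) = \<psi> (n + 4)"
      using assms arc1[of 0] arc1[of 1] arc2[of "n + 2"] arc2[of "n + 3"] by (simp_all add: algebra_simps)
    ultimately have "?X (\<psi> (n + 2)) = \<psi> (2 * n + 3)" "?X (\<phi> (n + 2)) = \<phi> (2 * n + 4)"
      "?X (\<psi> (2 * n + 4)) = \<psi> n" "?X (\<phi> 0) = \<psi> (2 * n + 4)" "?X (\<phi> 1) = \<phi> 0"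
      "?X (\<phi> 2) = \<phi> (n + 4)" "?X (\<phi> (n + 3)) = \<psi> (n + 1)" "?X (\<phi> (n + 4)) = \<psi> (n + 2)"
      using F H by (simp_all only: o_apply)
    then show ?thesis
      unfolding r by (simp only: conj_comp[OF bij_mem[OF X]] conj_transpose[OF bij_mem[OF X]])
  qed
  have "(comm f g \<circ> (?X \<circ> comm f g \<circ> inv' ?X)) ^^ k \<in> G" for k
    by (intro funpow_mem comp_mem[OF comm_mem] conj_mem X comm_mem)
  note mem = this[unfolded rX, unfolded r]
  have "three_cycle (\<psi> (n + 1)) (\<phi> (n + 2)) (\<psi> (n + 2)) \<in> G"
  \<comment> \<open>For \<open>n = 1\<close> the images \<open>\<psi> (2 * n + 3)\<close> and
    \<open>\<psi> n\<close> fall on \<open>\<phi> (n + 3)\<close> and \<open>\<phi> 1\<close>, which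
    is the product with cycle lengths 3 and 7.\<close>
  proof (cases "n = 1")
    case True
    have eq: "\<psi> (2 * n + 3) = \<phi> (n + 3)" "\<psi> n = \<phi> 1"
      using True assms arc1[of 1] arc2[of 4] by auto
    have "distinct [\<psi> (n + 2), \<psi> (2 * n + 4), \<phi> (n + 2), \<phi> 0, \<phi> 1, \<phi> 2, \<phi> (n + 3), \<phi> (n + 4),
       \<phi> (2 * n + 4), \<psi> (n + 1)]"
      using assms N' M True by (simp add: distinct_simps)
    from path_product_3_7[OF this] mem[of 7] show ?thesis unfolding eq by metis
  next
    case False
    then have "distinct [\<psi> (n + 2), \<psi> (2 * n + 4), \<phi> (n + 2), \<phi> 0, \<phi> 1, \<phi> 2, \<phi> (n + 3), \<phi> (n + 4),
       \<phi> (2 * n + 4), \<psi> (2 * n + 3), \<psi> n, \<psi> (n + 1)]"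
      using assms N' M by (simp add: distinct_simps)
    from path_product_3_5_2_2[OF this] mem[of 10] show ?thesis by metis
  qed
  moreover have "f (\<psi> (n + 1)) = \<psi> (n + 1)" using assms N' by (intro \<psi>_fixed_f) auto
  ultimately show ?thesis
    using assms N' M
    by (intro seedI[of "\<psi> (n + 1)" "\<phi> (n + 2)" "\<psi> (n + 2)" "\<psi> (n + 1)" "n + 2"]) (auto simp: distinct_simps)
qed

text \<open>For \<open>n = 0\<close> each cycle has just one private point,
  \<open>\<phi> (2 * a)\<close> and \<open>\<psi> a\<close>. The cycles agree except around these
  points, so already the quotient moves only four points.\<close>

lemma quotient_eq:
  assumes n: "n = 0"
  shows "inv' f \<circ> g = transpose (\<phi> (a - 1)) (\<psi> a) \<circ> transpose (\<phi> (2 * a - 1)) (\<phi> (2 * a))" (is "?s = _")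
proof (rule eq_two_transpositions)
  have ev: "?s x = y" if "f y = g x" for x y
    using that bij_f by (metis bij_is_inj inv_f_f o_apply)
  show "distinct [\<phi> (a - 1), \<psi> a, \<phi> (2 * a - 1), \<phi> (2 * a)]"
    using a n N M by (simp add: distinct_simps)
  show "?s (\<phi> (a - 1)) = \<psi> a"
    by (rule ev) (use a n N M g_step[of "a - 1"] arc1[of "a - 1"] \<psi>_fixed_f[of a] in auto)
  show "?s (\<psi> a) = \<phi> (a - 1)"
    by (rule ev) (use a n N M g_step[of a] f_step[of "a - 1"] arc2[of a] in auto)
  show "?s (\<phi> (2 * a - 1)) = \<phi> (2 * a)"
    by (rule ev) (use a n N M g_last f_last arc2[of "2 * a - 1"] arc1[of 0] in auto)
  show "?s (\<phi> (2 * a)) = \<phi> (2 * a - 1)"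
    by (rule ev) (use a n N M f_step[of "2 * a - 1"] \<phi>_fixed_g[of "2 * a"] in auto)
  fix x assume x: "x \<notin> {\<phi> (a - 1), \<psi> a, \<phi> (2 * a - 1), \<phi> (2 * a)}"
  consider (1) i where "x = \<phi> i" "0 \<le> i" "i < N" | (2) j where "x = \<psi> j" "0 \<le> j" "j < N" "\<forall>i. 0 \<le> i \<and> i < N \<longrightarrow> \<phi> i \<noteq> x"
    | (3) "\<forall>i. 0 \<le> i \<and> i < N \<longrightarrow> \<phi> i \<noteq> x" "\<forall>j. 0 \<le> j \<and> j < N \<longrightarrow> \<psi> j \<noteq> x"
    by metis
  then have "f x = g x"
  proof cases
    case 1
    then have "i \<noteq> a - 1" "i \<noteq> 2 * a - 1" "i \<noteq> 2 * a" using x by auto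
    then consider "i < a - 1" | "a \<le> i" "i < 2 * a - 1" using 1 N n by linarith
    then show ?thesis
      by cases (use 1 a n N M f_step[of i] g_step[of i] arc1[of i] arc1[of "i + 1"] g_step[of "i + 1"] arc2[of i] arc2[of "i + 1"] in auto)
  next
    case 2
    have "\<not> j < a" "\<not> (a < j \<and> j \<le> 2 * a)"
      using 2 arc1[of j] arc2[of "j - 1"] a n N by fastforce+
    then have "j = a" using 2 N n by linarith
    then show ?thesis using x 2 by simp
  next
    case 3
    then show ?thesis using f_fix[of x] g_fix[of x] M by auto
  qed
  then show "?s x = x" by (intro ev) auto
qed

lemma seed_flat:
  assumes "3 \<le> a" "n = 0"
  shows seed
proof -
  \<comment> \<open>Shifting by two steps leaves \<open>\<psi> a\<close> as the only common point of
    the two double transpositions; for this \<open>a\<close> must be at least 3.\<close>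
  let ?s = "inv' f \<circ> g" and ?X = "f ^^ nat 2"
  have X: "?X \<in> G" and s: "?s \<in> G" by (intro comp_mem inv_mem funpow_mem f_mem g_mem)+
  have "?X \<circ> ?s \<circ> inv' ?X = transpose (\<psi> a) (\<phi> (a + 1)) \<circ> transpose (\<phi> 0) (\<phi> 1)"
  proof -
    have "?X (\<psi> a) = \<psi> a" using assms N by (intro funpow_fixed \<psi>_fixed_f) auto
    moreover have "?X (\<phi> (a - 1)) = \<phi> (a + 1)" "?X (\<phi> (2 * a - 1)) = \<phi> 0" "?X (\<phi> (2 * a)) = \<phi> 1"
      using assms N by (intro f_pow; linarith)+
    ultimately show ?thesis
      unfolding quotient_eq[OF assms(2)]
      by (simp only: conj_comp[OF bij_mem[OF X]] conj_transpose[OF bij_mem[OF X]] transpose_commute)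
  qed
  moreover have "(?s \<circ> (?X \<circ> ?s \<circ> inv' ?X)) ^^ 4 \<in> G"
    by (intro funpow_mem comp_mem[OF s] conj_mem X s)
  moreover have "distinct [\<phi> (a - 1), \<psi> a, \<phi> (a + 1), \<phi> (2 * a - 1), \<phi> (2 * a), \<phi> 0, \<phi> 1]"
    using assms N M by (simp add: distinct_simps)
  ultimately have "three_cycle (\<phi> (a + 1)) (\<phi> (a - 1)) (\<psi> a) \<in> G"
    using path_product_3_2_2 unfolding quotient_eq[OF assms(2)] by metis
  moreover have "f (\<psi> a) = \<psi> a" using assms N by (intro \<psi>_fixed_f) auto
  ultimately show ?thesis
    using assms N M
    by (intro seedI[of "\<phi> (a + 1)" "\<phi> (a - 1)" "\<psi> a" "\<psi> a" "a - 1"]) (auto simp: distinct_simps)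
qed

end

text \<open>The arc that follows \<open>\<phi> 0\<close> in the first cycle precedes it, reversed, in the second one.\<close>

locale reversed_arc = two_cycles +
  fixes k v :: int
  assumes k: "3 \<le> k" and v: "2 \<le> v" and N: "N = 2 * k - 1" and M: "M = v + k"
    and overlap: "\<And>i j. 0 \<le> i \<Longrightarrow> i < N \<Longrightarrow> 0 \<le> j \<Longrightarrow> j < M \<Longrightarrow>
      \<phi> i = \<psi> j \<longleftrightarrow> i = 0 \<and> j = 0 \<or> 1 \<le> i \<and> i < k \<and> j = v + k - i"
begin

text \<open>Enumerates the cycle of \<open>f \<circ> g\<close>. On the reversed arc the two
  movements cancel, which leaves \<open>\<psi> 0\<close> to \<open>\<psi> v\<close> followed by the
  private points of \<open>f\<close> from \<open>\<phi> k\<close> on, again \<open>v + k\<close>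
  points.\<close>

definition \<eta> :: "int \<Rightarrow> 'a" where "\<eta> i = (if i \<le> v then \<psi> i else \<phi> (k + i - v - 1))"

lemma arc: "1 \<le> i \<Longrightarrow> i < k \<Longrightarrow> \<phi> i = \<psi> (v + k - i)"
  using overlap[of i "v + k - i"] k v N M by auto

lemma start: "\<phi> 0 = \<psi> 0"
  using overlap[of 0 0] k v N M by auto

lemma \<phi>_fixed_g: "k \<le> i \<Longrightarrow> i < N \<Longrightarrow> g (\<phi> i) = \<phi> i"
  using overlap[of i] k v N M by (intro g_fix) fastforce

lemma \<psi>_fixed_f: "1 \<le> j \<Longrightarrow> j \<le> v \<Longrightarrow> f (\<psi> j) = \<psi> j"
  using overlap[of _ j] k v N M by (intro f_fix) fastforce

lemma f_last: "f (\<phi> (2 * k - 2)) = \<phi> 0"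
  using is_cycle_last[OF f_cycle] N by simp

lemma g_last: "g (\<psi> (v + k - 1)) = \<psi> 0"
  using is_cycle_last[OF g_cycle] M by simp

lemma fg_fixed: "1 \<le> i \<Longrightarrow> i < k \<Longrightarrow> f (g (\<phi> i)) = \<phi> i"
  using k v N M arc[of i] arc[of "i - 1"] start g_last g_step[of "v + k - i"] f_step[of "i - 1"]
  by (cases "i = 1") (auto simp: algebra_simps)

lemma fg_cycle: "is_cycle (f \<circ> g) \<eta> M"
  unfolding is_cycle_def
proof (intro conjI allI impI)
  show "0 < M" using k v M by simp
  show "inj_on \<eta> {0..<M}"
  proof (rule inj_onI)
    fix i j assume ij: "i \<in> {0..<M}" "j \<in> {0..<M}" "\<eta> i = \<eta> j"
    then show "i = j"
      using k v N M by (auto simp: \<eta>_def \<phi>_eq \<psi>_eq overlap overlap[THEN trans[OF eq_commute]] split: if_splits)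
  qed
next
  fix i assume i: "0 \<le> i \<and> i < M"
  consider "i < v" | "i = v" | "v < i" "i < M - 1" | "i = M - 1" "v < i" using i by linarith
  then show "(f \<circ> g) (\<eta> i) = \<eta> (if i = M - 1 then 0 else i + 1)"
  proof cases
    case 1
    then show ?thesis using i k v N M g_step[of i] \<psi>_fixed_f[of "i + 1"] by (auto simp: \<eta>_def)
  next
    case 2
    then show ?thesis using i k v N M g_step[of v] arc[of "k - 1"] f_step[of "k - 1"] by (auto simp: \<eta>_def)
  next
    case 3
    then show ?thesis using i k v N M \<phi>_fixed_g[of "k + i - v - 1"] f_step[of "k + i - v - 1"]
      by (auto simp: \<eta>_def algebra_simps)
  next
    case 4
    then have "\<eta> i = \<phi> (2 * k - 2)" using M by (simp add: \<eta>_def)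
    then show ?thesis using 4 k v N \<phi>_fixed_g[of "2 * k - 2"] f_last start
      by (simp add: \<eta>_def)
  qed
next
  fix x assume x: "x \<notin> \<eta> ` {0..<M}"
  have 1: "x \<noteq> \<psi> j" if "0 \<le> j" "j \<le> v" for j
    using x that k v M by (force simp: \<eta>_def image_iff)
  have 2: "x \<noteq> \<phi> i" if "k \<le> i" "i < N" for i
  proof
    assume "x = \<phi> i"
    then have "x = \<eta> (i - k + v + 1)" using that by (simp add: \<eta>_def)
    then show False using x that k v N M by (auto simp: image_iff)
  qed
  show "(f \<circ> g) x = x"
  proof (cases "\<exists>i. 1 \<le> i \<and> i < k \<and> x = \<phi> i")
    case True
    then show ?thesis using fg_fixed by auto
  next
    case False
    have "\<phi> i \<noteq> x" if "0 \<le> i" "i < N" for i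
      using that False 1[of 0] 2[of i] start v by (cases "i = 0"; cases "i < k") auto
    moreover have "\<psi> j \<noteq> x" if "0 \<le> j" "j < M" for j
      using that False[unfolded not_ex, rule_format, of "v + k - j"] 1[of j] arc[of "v + k - j"] M
      by (cases "j \<le> v") auto
    ultimately show ?thesis using f_fix[of x] g_fix[of x] by simp
  qed
qed

lemma fg_mem: "f \<circ> g \<in> G" by (intro comp_mem f_mem g_mem)

sublocale fg: two_cycles G f "f \<circ> g" \<phi> \<eta> N M
  by unfold_locales (fact f_mem fg_mem f_cycle fg_cycle)+

text \<open>\<open>f\<close> and \<open>f \<circ> g\<close> share the single arc
  \<open>\<phi> k\<close>, ..., \<open>\<phi> (2 * k - 2)\<close>, \<open>\<phi> 0\<close>, now run
  through in the same direction. Its entry and its exit contribute one transposition each.\<close>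

lemma comm_eq:
  "comm f (f \<circ> g) = transpose (\<psi> v) (\<phi> k) \<circ> transpose (\<phi> 0) (\<phi> 1)" (is "?r = _")
proof (rule eq_two_transpositions)
  let ?h = "f \<circ> g"
  have hX: "?h (\<phi> i) = \<phi> i" if "1 \<le> i" "i < k" for i using fg_fixed that by simp
  have hZ: "?h (\<phi> i) = \<phi> (i + 1)" if "k \<le> i" "i < N - 1" for i using \<phi>_fixed_g[of i] f_step[of i] that k N by simp
  have hZl: "?h (\<phi> (2 * k - 2)) = \<phi> 0" using \<phi>_fixed_g[of "2 * k - 2"] f_last k N by simp
  have hV: "?h (\<psi> j) = \<psi> (j + 1)" if "0 \<le> j" "j < v" for j
    using g_step[of j] \<psi>_fixed_f[of "j + 1"] that k M by simp
  have hVl: "?h (\<psi> v) = \<phi> k" using g_step[of v] arc[of "k - 1"] f_step[of "k - 1"] k v M N by simp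
  show "distinct [\<psi> v, \<phi> k, \<phi> 0, \<phi> 1]"
    using k v N M by (simp add: \<phi>_eq \<psi>_eq overlap overlap[THEN trans[OF eq_commute]])
  show "?r (\<psi> v) = \<phi> k"
    by (rule fg.commI[of _ "\<phi> k" "\<phi> (k - 1)" "\<phi> (k - 1)"])
      (use k v N M hVl hX[of "k - 1"] f_step[of "k - 1"] in auto)
  show "?r (\<phi> k) = \<psi> v"
    by (rule fg.commI[of _ "\<phi> (k + 1)" "\<phi> k" "\<psi> v"])
      (use k v N M hVl hZ[of k] f_step[of k] \<psi>_fixed_f[of v] in auto)
  show "?r (\<phi> 0) = \<phi> 1"
    by (rule fg.commI[of _ "\<psi> 1" "\<psi> 1" "\<phi> 0"])
      (use k v N M hV[of 0] start f_step[of 0] \<psi>_fixed_f[of 1] in auto)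
  show "?r (\<phi> 1) = \<phi> 0"
    by (rule fg.commI[of _ "\<phi> 1" "\<phi> 0" "\<phi> (2 * k - 2)"])
      (use k v N M hX[of 1] hZl f_step[of 0] f_last in auto)
  fix x assume x: "x \<notin> {\<psi> v, \<phi> k, \<phi> 0, \<phi> 1}"
  consider (1) i where "x = \<phi> i" "0 \<le> i" "i < N" | (2) j where "x = \<psi> j" "0 \<le> j" "j < M" "\<forall>i. 0 \<le> i \<and> i < N \<longrightarrow> \<phi> i \<noteq> x"
    | (3) "\<forall>i. 0 \<le> i \<and> i < N \<longrightarrow> \<phi> i \<noteq> x" "\<forall>j. 0 \<le> j \<and> j < M \<longrightarrow> \<psi> j \<noteq> x"
    by metis
  then show "?r x = x"
  proof cases
    case 1
    then have "i \<noteq> 0" "i \<noteq> 1" "i \<noteq> k" using x by auto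
    then consider "2 \<le> i" "i < k" | "k < i" "i < N - 1" | "i = 2 * k - 2" "k < i" using 1 k N by linarith
    then show ?thesis
    proof cases
      case 1
      then show ?thesis using \<open>x = \<phi> i\<close> k N f_step[of "i - 1"] hX[of i] hX[of "i - 1"]
        by (intro fg.comm_fix2[of _ "\<phi> (i - 1)"]) auto
    next
      case 2
      then show ?thesis using \<open>x = \<phi> i\<close> k N f_step[of "i - 1"] f_step[of i] hZ[of i] hZ[of "i - 1"]
        by (intro fg.comm_fix1[of _ "\<phi> (i - 1)"]) auto
    next
      case 3
      then show ?thesis using \<open>x = \<phi> i\<close> k N f_step[of "i - 1"] f_last hZl hZ[of "i - 1"]
        by (intro fg.comm_fix1[of _ "\<phi> (i - 1)"]) auto
    qed
  next
    case 2
    have "j \<noteq> 0" using 2 start k N by auto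
    moreover have "\<not> v < j" using 2 arc[of "v + k - j"] k N M by fastforce
    moreover have "j \<noteq> v" using x 2 by auto
    ultimately show ?thesis using 2 hV[of j] \<psi>_fixed_f[of j] \<psi>_fixed_f[of "j + 1"]
      by (intro fg.comm_fix3) auto
  next
    case 3
    then have "f x = x" "(f \<circ> g) x = x" using f_fix[of x] g_fix[of x] by auto
    then show ?thesis by (intro fg.comm_fix3) auto
  qed
qed

lemma seed_reversed: seed
proof -
  let ?F = "f ^^ nat (k - 1)"
  \<comment> \<open>Chosen so that the conjugate has only the point \<open>\<phi> k\<close> in
    common with the commutator, which makes the product a three-cycle times two
    transpositions.\<close>
  let ?X = "(f \<circ> g) \<circ> ?F"
  have X: "?X \<in> G" by (intro comp_mem funpow_mem f_mem g_mem)
  have "?F (\<phi> k) = \<phi> 0" "?F (\<phi> 0) = \<phi> (k - 1)" "?F (\<phi> 1) = \<phi> k"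
    using is_cycle_funpow[OF f_cycle, of _ "nat (k - 1)"] k N by (auto simp: mod_pos_pos_trivial)
  moreover have "?F (\<psi> v) = \<psi> v" using v by (intro funpow_fixed \<psi>_fixed_f) auto
  ultimately have "?X (\<phi> k) = \<psi> 1" "?X (\<phi> 0) = \<phi> (k - 1)" "?X (\<phi> 1) = \<phi> (k + 1)" "?X (\<psi> v) = \<phi> k"
    using start g_step[of 0] \<psi>_fixed_f[of 1] fg_fixed[of "k - 1"] \<phi>_fixed_g[of k] f_step[of k]
      g_step[of v] arc[of "k - 1"] f_step[of "k - 1"] k v M N by auto
  then have "?X \<circ> comm f (f \<circ> g) \<circ> inv' ?X =
      transpose (\<phi> k) (\<psi> 1) \<circ> transpose (\<phi> (k - 1)) (\<phi> (k + 1))"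
    unfolding comm_eq by (simp only: conj_comp[OF bij_mem[OF X]] conj_transpose[OF bij_mem[OF X]])
  moreover have "(comm f (f \<circ> g) \<circ> (?X \<circ> comm f (f \<circ> g) \<circ> inv' ?X)) ^^ 4 \<in> G"
    by (intro funpow_mem comp_mem[OF fg.comm_mem] conj_mem X fg.comm_mem)
  moreover have "distinct [\<psi> v, \<phi> k, \<psi> 1, \<phi> 0, \<phi> 1, \<phi> (k - 1), \<phi> (k + 1)]"
    using k v N M by (simp add: \<phi>_eq \<psi>_eq overlap overlap[THEN trans[OF eq_commute]])
  ultimately have "three_cycle (\<psi> 1) (\<psi> v) (\<phi> k) \<in> G"
    using path_product_3_2_2 unfolding comm_eq by metis
  moreover have "f (\<psi> 1) = \<psi> 1" using v by (intro \<psi>_fixed_f) auto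
  ultimately show ?thesis
    using k v N M
    by (intro seedI[of "\<psi> 1" "\<psi> v" "\<phi> k" "\<psi> 1" k])
      (auto simp: \<phi>_eq \<psi>_eq overlap overlap[THEN trans[OF eq_commute]])
qed

end

text \<open>Two cycles with a common point \<open>\<phi> 0\<close> and one common arc of length \<open>a\<close>.\<close>

locale point_and_arc = two_cycles +
  fixes p a q y :: int
  assumes p: "1 \<le> p" and a: "2 \<le> a" and q: "1 \<le> q" and y: "1 \<le> y"
    and N: "N = 1 + p + a + q" and M: "M = y + a + q"
    and overlap: "\<And>i j. 0 \<le> i \<Longrightarrow> i < N \<Longrightarrow> 0 \<le> j \<Longrightarrow> j < M \<Longrightarrow>
      \<phi> i = \<psi> j \<longleftrightarrow> i = 0 \<and> j = 0 \<or> p < i \<and> i \<le> p + a \<and> j = i - p + y"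
begin

lemma arc: "p < i \<Longrightarrow> i \<le> p + a \<Longrightarrow> \<phi> i = \<psi> (i - p + y)"
  using overlap[of i "i - p + y"] p a q y N M by auto

lemma start: "\<phi> 0 = \<psi> 0"
  using overlap[of 0 0] p a q y N M by auto

lemma \<phi>_fixed_g: "1 \<le> i \<and> i \<le> p \<or> p + a < i \<and> i < N \<Longrightarrow> g (\<phi> i) = \<phi> i"
  using overlap[of i] p a q y N M by (intro g_fix) fastforce

lemma \<psi>_fixed_f: "1 \<le> j \<and> j \<le> y \<or> y + a < j \<and> j < M \<Longrightarrow> f (\<psi> j) = \<psi> j"
  using overlap[of _ j] p a q y N M by (intro f_fix) fastforce

lemma f_last: "f (\<phi> (p + a + q)) = \<phi> 0"
  using is_cycle_last[OF f_cycle] N by (simp add: algebra_simps)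

lemma g_last: "g (\<psi> (y + a + q - 1)) = \<psi> 0"
  using is_cycle_last[OF g_cycle] M by (simp add: algebra_simps)

lemmas distinct_simps = \<phi>_eq \<psi>_eq overlap overlap[THEN trans[OF eq_commute]]

lemma comm_swap: "comm f g (\<psi> y) = \<phi> (p + 1)" "comm f g (\<phi> (p + 1)) = \<psi> y"
proof -
  show "comm f g (\<psi> y) = \<phi> (p + 1)"
    by (rule commI[of _ "\<phi> (p + 1)" "\<phi> p" "\<phi> p"])
      (use p a q y N M g_step[of y] arc[of "p + 1"] f_step[of p] \<phi>_fixed_g[of p] in \<open>auto simp: add.commute\<close>)
  show "comm f g (\<phi> (p + 1)) = \<psi> y"
    by (rule commI[of _ "\<phi> (p + 2)" "\<phi> (p + 1)" "\<psi> y"])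
      (use p a q y N M g_step[of "y + 1"] g_step[of y] arc[of "p + 1"] arc[of "p + 2"] f_step[of "p + 1"] \<psi>_fixed_f[of y]
        in \<open>auto simp: add.commute\<close>)
qed

lemma comm_start: "comm f g (\<phi> 0) = \<phi> 1"
  by (rule commI[of _ "\<psi> 1" "\<psi> 1" "\<phi> 0"])
    (use p a q y N M g_step[of 0] start f_step[of 0] \<psi>_fixed_f[of 1] in auto)

lemma comm_other:
  assumes x: "x \<notin> {\<psi> y, \<phi> (p + 1), \<phi> 0, \<phi> 1, \<phi> (p + a), \<phi> (p + a + 1), \<psi> (y + a + q - 1)}"
  shows "comm f g x = x"
proof -
  consider (1) i where "x = \<phi> i" "0 \<le> i" "i < N" | (2) j where "x = \<psi> j" "0 \<le> j" "j < M" "\<forall>i. 0 \<le> i \<and> i < N \<longrightarrow> \<phi> i \<noteq> x"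
    | (3) "\<forall>i. 0 \<le> i \<and> i < N \<longrightarrow> \<phi> i \<noteq> x" "\<forall>j. 0 \<le> j \<and> j < M \<longrightarrow> \<psi> j \<noteq> x"
    by metis
  then show ?thesis
  proof cases
    case 1
    then have "i \<noteq> 0" "i \<noteq> 1" "i \<noteq> p + 1" "i \<noteq> p + a" "i \<noteq> p + a + 1" using x by auto
    then consider "2 \<le> i" "i \<le> p" | "p + 1 < i" "i < p + a" | "p + a + 1 < i" using 1 by linarith
    then show ?thesis
    proof cases
      case 1
      then show ?thesis using \<open>x = \<phi> i\<close> a q N f_step[of "i - 1"] \<phi>_fixed_g[of i] \<phi>_fixed_g[of "i - 1"]
        by (intro comm_fix2[of _ "\<phi> (i - 1)"]) auto
    next
      case 2
      then show ?thesis using \<open>x = \<phi> i\<close> p a q y N M f_step[of i] f_step[of "i - 1"] g_step[of "i - p + y"] g_step[of "i - 1 - p + y"]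
          arc[of "i - 1"] arc[of i] arc[of "i + 1"]
        by (intro comm_fix1[of _ "\<phi> (i - 1)"]) (auto simp: algebra_simps)
    next
      case 3
      then show ?thesis using \<open>x = \<phi> i\<close> \<open>i < N\<close> p a N f_step[of "i - 1"] \<phi>_fixed_g[of i] \<phi>_fixed_g[of "i - 1"]
        by (intro comm_fix2[of _ "\<phi> (i - 1)"]) auto
    qed
  next
    case 2
    have "\<not> (y < j \<and> j \<le> y + a)" "j \<noteq> 0"
      using 2 arc[of "j + p - y"] start p a q N by fastforce+
    moreover have "j \<noteq> y" "j \<noteq> y + a + q - 1" using 2 x by auto
    ultimately have "f (\<psi> j) = \<psi> j" "g (\<psi> j) = \<psi> (j + 1)" "f (\<psi> (j + 1)) = \<psi> (j + 1)"
      using 2 a N M g_step[of j] \<psi>_fixed_f[of j] \<psi>_fixed_f[of "j + 1"] by auto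
    then show ?thesis using 2 by (intro comm_fix3) auto
  next
    case 3
    then have "f x = x" "g x = x" using f_fix[of x] g_fix[of x] by auto
    then show ?thesis by (intro comm_fix3) auto
  qed
qed

text \<open>The isolated common point contributes a three-cycle to the commutator and each end of
  the common arc a transposition; the fourth power keeps the three-cycle only.\<close>

lemma seed_long:
  assumes "2 \<le> q"
  shows seed
proof -
  let ?r = "comm f g"
  have 1: "?r (\<phi> (p + a)) = \<phi> (p + a + 1)"
    by (rule commI[of _ "\<psi> (y + a + 1)" "\<psi> (y + a + 1)" "\<phi> (p + a)"])
      (use p a y assms N M g_step[of "y + a"] arc[of "p + a"] f_step[of "p + a"] \<psi>_fixed_f[of "y + a + 1"] in \<open>auto simp: add.commute\<close>)
  have 2: "?r (\<phi> (p + a + 1)) = \<phi> (p + a)"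
    by (rule commI[of _ "\<phi> (p + a + 1)" "\<phi> (p + a)" "\<phi> (p + a - 1)"])
      (use p a y assms N M g_step[of "y + a - 1"] arc[of "p + a"] arc[of "p + a - 1"] f_step[of "p + a - 1"] f_step[of "p + a"]
        \<phi>_fixed_g[of "p + a + 1"] in \<open>auto simp: algebra_simps\<close>)
  have 3: "?r (\<psi> (y + a + q - 1)) = \<phi> 0"
    by (rule commI[of _ "\<phi> 0" "\<phi> (p + a + q)" "\<phi> (p + a + q)"])
      (use p a y assms N M g_last start f_last \<phi>_fixed_g[of "p + a + q"] in auto)
  have 4: "?r (\<phi> 1) = \<psi> (y + a + q - 1)"
    by (rule commI[of _ "\<phi> 1" "\<phi> 0" "\<psi> (y + a + q - 1)"])
      (use p a y assms N M g_last start f_step[of 0] \<phi>_fixed_g[of 1] \<psi>_fixed_f[of "y + a + q - 1"] in auto)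
  have ne: "\<phi> 0 \<noteq> \<phi> 1" "\<phi> 0 \<noteq> \<psi> (y + a + q - 1)" "\<phi> 1 \<noteq> \<psi> (y + a + q - 1)"
    using p a y assms N M by (simp_all add: distinct_simps)
  have "?r ^^ 4 = three_cycle (\<phi> 0) (\<phi> 1) (\<psi> (y + a + q - 1))"
  proof (rule pow_eq_three_cycle)
    fix x assume x: "x \<notin> {\<phi> 0, \<phi> 1, \<psi> (y + a + q - 1)}"
    have "?r (?r x) = x"
    proof (cases "x \<in> {\<psi> y, \<phi> (p + 1), \<phi> (p + a), \<phi> (p + a + 1)}")
      case True
      then show ?thesis using 1 2 comm_swap by auto
    next
      case False
      then have "?r x = x" using x by (intro comm_other) auto
      then show ?thesis by simp
    qed
    then show "(?r ^^ 4) x = x" by (simp add: eval_nat_numeral)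
  qed (use 3 4 comm_start ne in auto)
  then have "three_cycle (\<phi> 0) (\<phi> 1) (\<psi> (y + a + q - 1)) \<in> G"
    using funpow_mem[OF comm_mem, of 4] by simp
  then show ?thesis
    using p a y assms N M ne f_step[of 0]
    by (intro seedI[of "\<phi> 0" "\<phi> 1" "\<psi> (y + a + q - 1)" "\<phi> 0" 0]) auto
qed

text \<open>For \<open>q = 1\<close> the cycle of \<open>g\<close> passes from the common arc
  directly to the isolated point, and their contributions merge into a four-cycle. Its square is a
  double transposition; \<open>g \<circ> inv' f\<close> replaces \<open>\<phi> 1\<close> by
  \<open>\<psi> 1\<close> in one pair and preserves the other pair, so the product of both is a
  three-cycle.\<close>

lemma seed_short:
  assumes "q = 1"
  shows seed
proof -
  let ?r = "comm f g" and ?b = "\<phi> (p + a)" and ?x = "\<phi> (p + a + 1)" and ?X = "g \<circ> inv' f"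
  have 1: "?r ?b = \<phi> 0"
    by (rule commI[of _ "\<phi> 0" ?x ?x])
      (use p a y assms N M g_last arc[of "p + a"] f_last start \<phi>_fixed_g[of "p + a + 1"] in \<open>auto simp: add.commute\<close>)
  have 2: "?r ?x = ?b"
    by (rule commI[of _ ?x ?b "\<phi> (p + a - 1)"])
      (use p a y assms N M g_step[of "y + a - 1"] arc[of "p + a"] arc[of "p + a - 1"] f_step[of "p + a - 1"] f_step[of "p + a"]
        \<phi>_fixed_g[of "p + a + 1"] in \<open>auto simp: algebra_simps\<close>)
  have 4: "?r (\<phi> 1) = ?x"
    by (rule commI[of _ "\<phi> 1" "\<phi> 0" ?b])
      (use p a y assms N M g_last start arc[of "p + a"] f_step[of 0] f_step[of "p + a"] \<phi>_fixed_g[of 1] in \<open>auto simp: add.commute\<close>)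
  have d: "distinct [?b, \<phi> 1, \<phi> 0, ?x]"
    using p a y assms N M by (simp add: distinct_simps)
  have d5: "distinct [?b, \<phi> 1, \<phi> 0, ?x, \<psi> 1]"
    using p a y assms N M by (simp add: distinct_simps)
  have t: "?r \<circ> ?r = transpose ?b (\<phi> 1) \<circ> transpose (\<phi> 0) ?x"
  proof (rule eq_two_transpositions[OF d])
    fix x assume x: "x \<notin> {?b, \<phi> 1, \<phi> 0, ?x}"
    show "(?r \<circ> ?r) x = x"
    proof (cases "x \<in> {\<psi> y, \<phi> (p + 1)}")
      case True
      then show ?thesis using comm_swap by auto
    next
      case False
      have "\<psi> (y + a + q - 1) = ?b" using assms arc[of "p + a"] a by (simp add: algebra_simps)
      then have "?r x = x" using x False by (intro comm_other) auto
      then show ?thesis by simp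
    qed
  qed (use 1 2 4 comm_start in auto)
  have tm: "?r \<circ> ?r \<in> G" by (intro comp_mem comm_mem)
  have X: "?X \<in> G" by (intro comp_mem inv_mem f_mem g_mem)
  have fi: "inv' f (\<phi> (i + 1)) = \<phi> i" if "0 \<le> i" "i < N - 1" for i
    using is_cycle_inv[OF f_cycle bij_f that] .
  have "inv' f ?b = \<phi> (p + a - 1)" "inv' f (\<phi> 1) = \<phi> 0" "inv' f (\<phi> 0) = ?x" "inv' f ?x = ?b"
    using fi[of "p + a - 1"] fi[of 0] fi[of "p + a"] is_cycle_inv_first[OF f_cycle bij_f] p a N assms
    by (auto simp: add.commute)
  then have "?X ?b = ?b" "?X (\<phi> 1) = \<psi> 1" "?X (\<phi> 0) = ?x" "?X ?x = \<phi> 0"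
    using p a y assms N M g_step[of "y + a - 1"] g_step[of 0] g_last start
      arc[of "p + a"] arc[of "p + a - 1"] \<phi>_fixed_g[of "p + a + 1"] by (auto simp: algebra_simps)
  then have tX: "?X \<circ> (?r \<circ> ?r) \<circ> inv' ?X = transpose ?b (\<psi> 1) \<circ> transpose ?x (\<phi> 0)"
    unfolding t by (simp only: conj_comp[OF bij_mem[OF X]] conj_transpose[OF bij_mem[OF X]])
  have "(?r \<circ> ?r) \<circ> (?X \<circ> (?r \<circ> ?r) \<circ> inv' ?X) = three_cycle ?b (\<psi> 1) (\<phi> 1)" (is "?Q = _")
  proof -
    have Q: "?Q = (transpose ?b (\<phi> 1) \<circ> transpose (\<phi> 0) ?x) \<circ> (transpose ?b (\<psi> 1) \<circ> transpose ?x (\<phi> 0))"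
      by (subst tX, subst t, rule refl)
    have "?Q ?b = \<psi> 1" "?Q (\<psi> 1) = \<phi> 1" "?Q (\<phi> 1) = ?b" "?Q (\<phi> 0) = \<phi> 0" "?Q ?x = ?x"
      using d5 distinct_rev[THEN iffD2, OF d5] unfolding Q by (simp_all add: transpose_def)
    moreover have "?Q w = w" if "w \<notin> {?b, \<phi> 1, \<phi> 0, ?x, \<psi> 1}" for w
      using that unfolding Q by (simp add: transpose_def)
    ultimately have "?Q ^^ 1 = three_cycle ?b (\<psi> 1) (\<phi> 1)"
      using d5 by (intro pow_eq_three_cycle) (force, force, force, force, force, force, force, simp)
    then show ?thesis by simp
  qed
  then have "three_cycle ?b (\<psi> 1) (\<phi> 1) \<in> G"
    using comp_mem[OF tm conj_mem[OF X tm]] by simp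
  moreover have "f (\<psi> 1) = \<psi> 1" using y by (intro \<psi>_fixed_f) auto
  ultimately show ?thesis
    using p a N q d5 by (intro seedI[of ?b "\<psi> 1" "\<phi> 1" "\<psi> 1" 1]) auto
qed

end

text \<open>The gap \<open>a = 2\<close>, \<open>n = 0\<close> of the parallel case: two such
  five-cycles alone are those of the exceptional diagram. A third cycle brings in the point
  \<open>\<chi> 2\<close>, fixed by \<open>f\<close>. Conjugated by the inverse of \<open>f\<close>,
  the quotient of the last two cycles meets that of the first two in one point.\<close>

lemma (in perm_group) seed_three_cycles:
  assumes 1: "parallel_cycles G f g \<phi> \<psi> 5 5 2 0" and 2: "parallel_cycles G g h \<psi> \<chi> 5 5 2 0"
    and out: "\<chi> 2 \<notin> \<phi> ` {0..<5}"
  shows "two_cycles.seed G f \<phi> 5"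
proof -
  interpret A: parallel_cycles G f g \<phi> \<psi> 5 5 2 0 by fact
  interpret B: parallel_cycles G g h \<psi> \<chi> 5 5 2 0 by fact
  let ?s = "inv' f \<circ> g" and ?s' = "inv' g \<circ> h" and ?X = "inv' f"
  have X: "?X \<in> G" and s: "?s \<in> G" "?s' \<in> G"
    by (intro comp_mem inv_mem A.f_mem B.f_mem B.g_mem)+
  have \<phi>\<psi>: "\<psi> 1 = \<phi> 1" "\<psi> 3 = \<phi> 2" "\<psi> 4 = \<phi> 3"
    using A.arc1[of 1] A.arc2[of 2] A.arc2[of 3] by auto
  have "f (\<chi> 2) = \<chi> 2" using out by (intro is_cycle_outside[OF A.f_cycle])
  then have im: "?X (\<chi> 2) = \<chi> 2" by (rule inv_fixed[OF A.bij_f])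
  have im2: "?X (\<phi> 1) = \<phi> 0" "?X (\<phi> 2) = \<phi> 1" "?X (\<phi> 3) = \<phi> 2"
    using is_cycle_inv[OF A.f_cycle A.bij_f, of 0] is_cycle_inv[OF A.f_cycle A.bij_f, of 1]
      is_cycle_inv[OF A.f_cycle A.bij_f, of 2] by auto
  have sq: "?s = transpose (\<psi> 2) (\<phi> 1) \<circ> transpose (\<phi> 3) (\<phi> 4)"
    using A.quotient_eq by (simp add: transpose_commute)
  have "?s' = transpose (\<psi> 1) (\<chi> 2) \<circ> transpose (\<psi> 3) (\<psi> 4)"
    using B.quotient_eq by simp
  then have "?X \<circ> ?s' \<circ> inv' ?X = transpose (\<phi> 0) (\<chi> 2) \<circ> transpose (\<phi> 1) (\<phi> 2)"
    unfolding \<phi>\<psi> by (simp only: conj_comp[OF bij_mem[OF X]] conj_transpose[OF bij_mem[OF X]] im im2)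
  also have "\<dots> = transpose (\<phi> 1) (\<phi> 2) \<circ> transpose (\<phi> 0) (\<chi> 2)"
  proof -
    have "\<phi> i \<noteq> \<chi> 2" if "0 \<le> i" "i < 5" for i
      using out that by (metis atLeastLessThan_iff image_eqI)
    then have d: "distinct [\<phi> 0, \<phi> 1, \<phi> 2, \<chi> 2]"
      using A.\<phi>_eq by simp
    show ?thesis
      using d distinct_rev[THEN iffD2, OF d] by (auto simp: fun_eq_iff transpose_def)
  qed
  finally have "(?s \<circ> (transpose (\<phi> 1) (\<phi> 2) \<circ> transpose (\<phi> 0) (\<chi> 2))) ^^ 4 \<in> G"
    using funpow_mem[OF comp_mem[OF s(1) conj_mem[OF X s(2)]], of 4] by simp
  moreover have "distinct [\<psi> 2, \<phi> 1, \<phi> 2, \<phi> 3, \<phi> 4, \<phi> 0, \<chi> 2]"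
  proof -
    have "\<psi> 2 \<noteq> \<chi> 2" using B.overlap[of 2 2] by simp
    moreover have "\<chi> 2 \<noteq> \<phi> i" if "0 \<le> i" "i < 5" for i
      using out that by (metis atLeastLessThan_iff image_eqI)
    ultimately show ?thesis using A.\<phi>_eq A.overlap A.overlap[THEN trans[OF eq_commute]]
      by (simp add: eq_commute[of "\<phi> _" "\<chi> 2"])
  qed
  ultimately have "three_cycle (\<phi> 2) (\<psi> 2) (\<phi> 1) \<in> G"
    using path_product_3_2_2 unfolding sq by metis
  then show ?thesis
    using A.f_step[of 1] by (intro A.seedI[of "\<phi> 2" "\<psi> 2" "\<phi> 1" "\<phi> 1" 1]) (auto simp: A.distinct_simps)
qed

section \<open>The movement of the tokens under a push\<close>

text \<open>Tokens are tracked in the coordinates of the bounding box \<open>{0..<a} \<times> {0..<b}\<close>; a token moves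
  left iff there is an empty cell to its left.\<close>

definition box :: "int \<Rightarrow> int \<Rightarrow> cell set" where
  "box a b = {0..<a} \<times> {0..<b}"

text \<open>Expresses that \<open>box a b\<close> is the bounding box of \<open>S\<close>.\<close>

definition spanned :: "int \<Rightarrow> int \<Rightarrow> cell set \<Rightarrow> bool" where
  "spanned a b S \<longleftrightarrow> S \<subseteq> box a b \<and> (\<exists>y. (0, y) \<in> S) \<and> (\<exists>y. (a - 1, y) \<in> S) \<and>
     (\<exists>x. (x, 0) \<in> S) \<and> (\<exists>x. (x, b - 1) \<in> S)"

definition move_left :: "cell set \<Rightarrow> cell \<Rightarrow> cell" where
  "move_left S = (\<lambda>(x, y). if \<exists>x'. 0 \<le> x' \<and> x' < x \<and> (x', y) \<notin> S then (x - 1, y) else (x, y))"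

definition flip :: "int \<Rightarrow> cell \<Rightarrow> cell" where
  "flip a = (\<lambda>(x, y). (a - 1 - x, y))"

definition move_right :: "int \<Rightarrow> cell set \<Rightarrow> cell \<Rightarrow> cell" where
  "move_right a S = flip a \<circ> move_left (flip a ` S) \<circ> flip a"

fun move :: "int \<Rightarrow> int \<Rightarrow> direction \<Rightarrow> cell set \<Rightarrow> cell \<Rightarrow> cell" where
  "move a b Leftward S = move_left S"
| "move a b Rightward S = move_right a S"
| "move a b Downward S = prod.swap \<circ> move_left (prod.swap ` S) \<circ> prod.swap"
| "move a b Upward S = prod.swap \<circ> move_right b (prod.swap ` S) \<circ> prod.swap"

lemma flip_flip [simp]: "flip a (flip a p) = p"
  by (auto simp: flip_def split: prod.splits)

lemma mem_flip_image: "p \<in> flip a ` S \<longleftrightarrow> flip a p \<in> S"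
  by (metis flip_flip imageE imageI)

lemma flip_pair: "flip a (x, y) = (a - 1 - x, y)"
  by (simp add: flip_def)

lemma mem_flip_pair: "(x, y) \<in> flip a ` S \<longleftrightarrow> (a - 1 - x, y) \<in> S"
  by (simp add: mem_flip_image flip_pair)

lemma mem_swap_pair: "(x, y) \<in> prod.swap ` S \<longleftrightarrow> (y, x) \<in> S"
  by (simp add: image_iff) force

lemma mem_swap_image: "p \<in> prod.swap ` S \<longleftrightarrow> prod.swap p \<in> S"
  by (metis imageE imageI swap_swap)

lemma move_right_eq:
  "move_right a S (x, y) = (if \<exists>x'. x < x' \<and> x' < a \<and> (x', y) \<notin> S then (x + 1, y) else (x, y))"
proof -
  have "(\<exists>x'. 0 \<le> x' \<and> x' < a - 1 - x \<and> (x', y) \<notin> flip a ` S) \<longleftrightarrow>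
    (\<exists>x'. x < x' \<and> x' < a \<and> (x', y) \<notin> S)" (is "?L \<longleftrightarrow> ?R")
  proof
    assume ?L
    then obtain x' where "0 \<le> x'" "x' < a - 1 - x" "(a - 1 - x', y) \<notin> S"
      by (auto simp: mem_flip_pair)
    then show ?R by (intro exI[of _ "a - 1 - x'"]) auto
  next
    assume ?R
    then obtain x' where "x < x'" "x' < a" "(x', y) \<notin> S" by auto
    then show ?L by (intro exI[of _ "a - 1 - x'"]) (auto simp: mem_flip_pair)
  qed
  then show ?thesis by (auto simp: move_right_def move_left_def flip_pair)
qed

lemma spanned_flip: "spanned a b S \<Longrightarrow> spanned a b (flip a ` S)"
proof -
  assume S: "spanned a b S"
  then obtain y1 y2 x1 x2 where c: "(0, y1) \<in> S" "(a - 1, y2) \<in> S" "(x1, 0) \<in> S" "(x2, b - 1) \<in> S"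
    by (auto simp: spanned_def)
  then have "(a - 1, y1) \<in> flip a ` S" "(0, y2) \<in> flip a ` S" "(a - 1 - x1, 0) \<in> flip a ` S"
    "(a - 1 - x2, b - 1) \<in> flip a ` S"
    by (simp_all add: mem_flip_pair)
  moreover have "flip a ` S \<subseteq> box a b"
    using S by (auto simp: spanned_def box_def flip_def)
  ultimately show ?thesis unfolding spanned_def by blast
qed

lemma spanned_swap: "spanned a b S \<Longrightarrow> spanned b a (prod.swap ` S)"
  unfolding spanned_def mem_swap_image by (auto simp: box_def)

text \<open>Separates the position \<open>v\<close> in the plane, which pushes change in a
  direction-dependent way, from the shape \<open>S\<close> in box coordinates. Only the values of
  \<open>L\<close> on \<open>S\<close> matter.\<close>

definition occupies :: "'l config \<Rightarrow> cell \<Rightarrow> cell set \<Rightarrow> (cell \<Rightarrow> 'l option) \<Rightarrow> bool" where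
  "occupies D v S L \<longleftrightarrow> dom D = (\<lambda>p. p + v) ` S \<and> (\<forall>p\<in>S. D (p + v) = L p)"

lemma mem_translate_image: "p \<in> (\<lambda>p. p + v) ` S \<longleftrightarrow> p - v \<in> S" for p v :: cell
  by (auto intro: image_eqI[of _ _ "p - v"])

lemma occupies_bounds:
  assumes "dom D = (\<lambda>p. p + v) ` S" "spanned a b S"
  shows "xmin (dom D) = fst v" "ymin (dom D) = snd v" "xmax (dom D) = fst v + a - 1" "ymax (dom D) = snd v + b - 1"
proof -
  have S: "S \<subseteq> {0..<a} \<times> {0..<b}" using assms by (auto simp: spanned_def box_def)
  then have "finite S" by (rule finite_subset) auto
  then have fin: "finite (dom D)" using assms(1) by simp
  obtain y1 y2 x1 x2 where c: "(0, y1) \<in> S" "(a - 1, y2) \<in> S" "(x1, 0) \<in> S" "(x2, b - 1) \<in> S"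
    using assms by (auto simp: spanned_def)
  have im: "fst ` dom D = (\<lambda>p. fst p + fst v) ` S" "snd ` dom D = (\<lambda>p. snd p + snd v) ` S"
    using assms(1) by (auto simp: image_image)
  show "xmin (dom D) = fst v" unfolding xmin_def im
    by (rule Min_eqI) (use S c(1) \<open>finite S\<close> in \<open>auto simp: image_iff intro!: bexI[of _ "(0, y1)"]\<close>)
  show "xmax (dom D) = fst v + a - 1" unfolding xmax_def im
    by (rule Max_eqI) (use S c(2) \<open>finite S\<close> in \<open>auto simp: image_iff intro!: bexI[of _ "(a - 1, y2)"]\<close>)
  show "ymin (dom D) = snd v" unfolding ymin_def im
    by (rule Min_eqI) (use S c(3) \<open>finite S\<close> in \<open>auto simp: image_iff intro!: bexI[of _ "(x1, 0)"]\<close>)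
  show "ymax (dom D) = snd v + b - 1" unfolding ymax_def im
    by (rule Max_eqI) (use S c(4) \<open>finite S\<close> in \<open>auto simp: image_iff intro!: bexI[of _ "(x2, b - 1)"]\<close>)
qed

text \<open>The invariant of the sweep after \<open>k\<close> columns. A token moves iff its row
  originally has an empty cell to its left: behind the first such cell every token that moves, and
  every further empty cell, leaves room for the next one.\<close>

lemma sweep_columns:
  fixes N :: "'l config"
  defines "H \<equiv> \<lambda>x y. \<exists>x'. 0 \<le> x' \<and> x' < x \<and> N (x', y) = None"
  shows "fold shift_column [1..int k] N (x, y) =
    (if x < 0 then N (x, y)
     else if x < int k then (if H (x + 1) y then N (x + 1, y) else N (x, y))
     else if x = int k then (if H (int k) y then None else N (int k, y))
     else N (x, y))"
proof (induction k arbitrary: x y)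
  case 0
  have "\<not> H 0 y" by (auto simp: H_def)
  then show ?case by auto
next
  case (Suc k)
  let ?C = "fold shift_column [1..int k] N"
  have "[1..int (Suc k)] = [1..int k] @ [int k + 1]"
    by (subst upto_rec2) auto
  then have eq: "fold shift_column [1..int (Suc k)] N = shift_column (int k + 1) ?C" by simp
  have H1: "H (int k + 1) y \<longleftrightarrow> H (int k) y \<or> N (int k, y) = None"
    unfolding H_def by (metis zless_add1_eq of_nat_0_le_iff)
  show ?case unfolding eq using H1
    by (auto simp: shift_column_def Suc.IH add.commute)
qed

lemma push_left_occupies:
  assumes D: "occupies D v S L" and S: "spanned a b S"
  shows "\<exists>L'. occupies (push_left D) 0 (move_left S ` S) L' \<and> (\<forall>p\<in>S. L' (move_left S p) = L p)"
proof -
  define N where "N = (\<lambda>p. D (p + v))"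
  have dD: "dom D = (\<lambda>p. p + v) ` S" using D by (simp add: occupies_def)
  note bounds = occupies_bounds[OF dD S]
  have nz: "normalize D = N"
    unfolding normalize_def translate_def N_def bounds by (simp add: prod_eq_iff)
  have NS: "N p \<noteq> None \<longleftrightarrow> p \<in> S" for p
  proof -
    have "N p \<noteq> None \<longleftrightarrow> p + v \<in> dom D" by (simp add: N_def domIff)
    then show ?thesis unfolding dD mem_translate_image by simp
  qed
  then have dN: "dom N = (\<lambda>p. p + 0) ` S" by (auto simp: domIff)
  have Sb: "S \<subseteq> {0..<a} \<times> {0..<b}" using S by (auto simp: spanned_def box_def)
  then have a: "0 < a" using S by (auto simp: spanned_def)
  have xm: "xmax (dom N) = int (nat (a - 1))" using occupies_bounds(3)[OF dN S] a by (simp add: zero_prod_def)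
  define E where "E = push_left D"
  have E: "E = fold shift_column [1..int (nat (a - 1))] N"
    unfolding E_def push_left_def Let_def nz xm ..
  note Ev = sweep_columns[of "nat (a - 1)" N, folded E]
  have hole: "(\<exists>x'. 0 \<le> x' \<and> x' < x \<and> N (x', y) = None) \<longleftrightarrow> (\<exists>x'. 0 \<le> x' \<and> x' < x \<and> (x', y) \<notin> S)" for x y
    using NS by (metis option.exhaust)
  have 1: "E (move_left S p) = N p" if p: "p \<in> S" for p
  proof -
    obtain x y where xy: "p = (x, y)" by (cases p)
    have b: "0 \<le> x" "x < a" using p xy Sb by auto
    show ?thesis
    proof (cases "\<exists>x'. 0 \<le> x' \<and> x' < x \<and> (x', y) \<notin> S")
      case True
      then have "1 \<le> x" by auto
      then show ?thesis using True b by (auto simp: xy move_left_def Ev hole)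
    next
      case False
      then have f: "\<not> (\<exists>x'. 0 \<le> x' \<and> x' < x + 1 \<and> (x', y) \<notin> S)"
        using p xy by (metis zless_add1_eq)
      have "E (x, y) = N (x, y)"
      proof (cases "x < a - 1")
        case True
        then show ?thesis unfolding Ev hole if_not_P[OF f] using b by simp
      next
        case no: False
        then have "int (nat (a - 1)) = x" using b by simp
        then show ?thesis unfolding Ev hole using False b by auto
      qed
      then show ?thesis using False unfolding xy move_left_def by auto
    qed
  qed
  have 2: "dom E = move_left S ` S"
  proof (intro equalityI subsetI)
    fix p assume "p \<in> dom E"
    then obtain x y where xy: "p = (x, y)" and ne: "E (x, y) \<noteq> None" by (cases p) auto
    have out: "N (x, y) = None" if "x < 0 \<or> a \<le> x" for x using NS[of "(x, y)"] that Sb by fastforce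
    consider "0 \<le> x" "x < a - 1" | "x = a - 1" using ne out[of x] a by (auto simp: Ev split: if_splits)
    then show "p \<in> move_left S ` S"
    proof cases
      case 1
      show ?thesis
      proof (cases "\<exists>x'. 0 \<le> x' \<and> x' < x + 1 \<and> (x', y) \<notin> S")
        case True
        then have "N (x + 1, y) \<noteq> None" using ne 1 unfolding Ev hole if_P[OF True] by simp
        then have "(x + 1, y) \<in> S" using NS by blast
        then show ?thesis using True by (intro image_eqI[of _ _ "(x + 1, y)"]) (auto simp: xy move_left_def)
      next
        case False
        then have "N (x, y) \<noteq> None" using ne 1 unfolding Ev hole if_not_P[OF False] by simp
        then have "(x, y) \<in> S" using NS by blast
        moreover have "\<not> (\<exists>x'. 0 \<le> x' \<and> x' < x \<and> (x', y) \<notin> S)" using False by force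
        ultimately show ?thesis by (intro image_eqI[of _ _ "(x, y)"]) (auto simp: xy move_left_def)
      qed
    next
      case 2
      then have h: "\<not> (\<exists>x'. 0 \<le> x' \<and> x' < x \<and> (x', y) \<notin> S)" "N (x, y) \<noteq> None"
        using ne a unfolding Ev hole by (auto split: if_splits)
      then have "(x, y) \<in> S" using NS by blast
      then show ?thesis using h(1) by (intro image_eqI[of _ _ "(x, y)"]) (auto simp: xy move_left_def)
    qed
  next
    fix p assume "p \<in> move_left S ` S"
    then obtain q where "q \<in> S" "p = move_left S q" by auto
    then show "p \<in> dom E" using 1 NS by (simp add: domIff)
  qed
  have "occupies E 0 (move_left S ` S) E" using 2 by (auto simp: occupies_def)
  moreover have "\<forall>p\<in>S. E (move_left S p) = L p" using 1 D by (simp add: N_def occupies_def)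
  ultimately show ?thesis unfolding E_def by blast
qed

lemma occupies_mirror_x:
  "occupies D v S L \<Longrightarrow> occupies (mirror_x D) (1 - a - fst v, snd v) (flip a ` S) (L \<circ> flip a)"
proof -
  assume D: "occupies D v S L"
  have "dom (mirror_x D) = (\<lambda>p. p + (1 - a - fst v, snd v)) ` flip a ` S"
  proof (rule Set.set_eqI)
    fix p :: cell
    obtain x y where p: "p = (x, y)" by (cases p)
    have "p \<in> dom (mirror_x D) \<longleftrightarrow> (- x, y) \<in> dom D" by (simp add: p mirror_x_def domIff)
    also have "\<dots> \<longleftrightarrow> (- x - fst v, y - snd v) \<in> S"
      using D by (cases v) (simp add: occupies_def mem_translate_image)
    finally show "p \<in> dom (mirror_x D) \<longleftrightarrow> p \<in> (\<lambda>p. p + (1 - a - fst v, snd v)) ` flip a ` S"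
      unfolding mem_translate_image by (simp add: p mem_flip_pair algebra_simps)
  qed
  moreover have "mirror_x D (flip a p + (1 - a - fst v, snd v)) = L p" if "p \<in> S" for p
    using D that by (cases v; cases p) (auto simp: occupies_def mirror_x_def flip_def dest: bspec[of _ _ p])
  ultimately show ?thesis by (auto simp: occupies_def)
qed

lemma occupies_swap_axes:
  "occupies D v S L \<Longrightarrow> occupies (swap_axes D) (prod.swap v) (prod.swap ` S) (L \<circ> prod.swap)"
proof -
  assume D: "occupies D v S L"
  have "dom (swap_axes D) = (\<lambda>p. p + prod.swap v) ` prod.swap ` S"
  proof (rule Set.set_eqI)
    fix p :: cell
    obtain x y where p: "p = (x, y)" by (cases p)
    have "p \<in> dom (swap_axes D) \<longleftrightarrow> (y, x) \<in> dom D" by (simp add: p swap_axes_def domIff)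
    also have "\<dots> \<longleftrightarrow> (y - fst v, x - snd v) \<in> S"
      using D by (cases v) (simp add: occupies_def mem_translate_image)
    finally show "p \<in> dom (swap_axes D) \<longleftrightarrow> p \<in> (\<lambda>p. p + prod.swap v) ` prod.swap ` S"
      unfolding mem_translate_image by (cases v) (simp add: p mem_swap_pair)
  qed
  moreover have "swap_axes D (prod.swap p + prod.swap v) = L p" if "p \<in> S" for p
    using D that by (cases v; cases p) (auto simp: occupies_def swap_axes_def dest: bspec[of _ _ p])
  ultimately show ?thesis by (auto simp: occupies_def)
qed

lemma push_right_occupies:
  assumes D: "occupies D v S L" and S: "spanned a b S"
  shows "\<exists>v' L'. occupies (mirror_x (push_left (mirror_x D))) v' (move_right a S ` S) L' \<and>
    (\<forall>p\<in>S. L' (move_right a S p) = L p)"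
proof -
  obtain L' where L': "occupies (push_left (mirror_x D)) 0 (move_left (flip a ` S) ` (flip a ` S)) L'"
    and eq: "\<forall>p\<in>flip a ` S. L' (move_left (flip a ` S) p) = (L \<circ> flip a) p"
    using push_left_occupies[OF occupies_mirror_x[OF D] spanned_flip[OF S]] by blast
  have im: "flip a ` (move_left (flip a ` S) ` (flip a ` S)) = move_right a S ` S"
    by (simp add: move_right_def image_comp o_assoc)
  have "\<forall>p\<in>S. (L' \<circ> flip a) (move_right a S p) = L p"
    using eq by (simp add: move_right_def)
  then show ?thesis using occupies_mirror_x[OF L', of a] unfolding im by blast
qed

lemma push_occupies:
  assumes D: "occupies D v S L" and S: "spanned a b S"
  shows "\<exists>v' L'. occupies (push d D) v' (move a b d S ` S) L' \<and> (\<forall>p\<in>S. L' (move a b d S p) = L p)"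
proof (cases d)
  case Leftward
  then show ?thesis using push_left_occupies[OF assms] unfolding Leftward push.simps move.simps by blast
next
  case Rightward
  then show ?thesis using push_right_occupies[OF assms] unfolding Rightward push.simps move.simps by blast
next
  case Upward
  let ?S = "prod.swap ` S"
  obtain v' L' where L': "occupies (mirror_x (push_left (mirror_x (swap_axes D)))) v' (move_right b ?S ` ?S) L'"
    and eq: "\<forall>p\<in>?S. L' (move_right b ?S p) = (L \<circ> prod.swap) p"
    using push_right_occupies[OF occupies_swap_axes[OF D] spanned_swap[OF S]] by blast
  have im: "prod.swap ` (move_right b ?S ` ?S) = move a b d S ` S"
    using Upward by (simp add: image_comp o_assoc)
  have "\<forall>p\<in>S. (L' \<circ> prod.swap) (move a b d S p) = L p"
    using eq Upward by simp
  then show ?thesis using occupies_swap_axes[OF L'] unfolding im unfolding Upward push.simps by blast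
next
  case Downward
  let ?S = "prod.swap ` S"
  obtain L' where L': "occupies (push_left (swap_axes D)) 0 (move_left ?S ` ?S) L'"
    and eq: "\<forall>p\<in>?S. L' (move_left ?S p) = (L \<circ> prod.swap) p"
    using push_left_occupies[OF occupies_swap_axes[OF D] spanned_swap[OF S]] by blast
  have im: "prod.swap ` (move_left ?S ` ?S) = move a b d S ` S"
    using Downward by (simp add: image_comp o_assoc)
  have "\<forall>p\<in>S. (L' \<circ> prod.swap) (move a b d S p) = L p"
    using eq Downward by simp
  then show ?thesis using occupies_swap_axes[OF L'] unfolding im unfolding Downward push.simps by blast
qed

section \<open>Walks of pushes and the closed walks among them\<close>

fun track :: "int \<Rightarrow> int \<Rightarrow> direction list \<Rightarrow> cell set \<Rightarrow> cell \<Rightarrow> cell" where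
  "track a b [] S p = p"
| "track a b (d # ds) S p = track a b ds (move a b d S ` S) (move a b d S p)"

definition shape :: "int \<Rightarrow> int \<Rightarrow> direction list \<Rightarrow> cell set \<Rightarrow> cell set" where
  "shape a b ds S = track a b ds S ` S"

lemma shape_Nil [simp]: "shape a b [] S = S"
  by (simp add: shape_def)

lemma shape_Cons [simp]: "shape a b (d # ds) S = shape a b ds (move a b d S ` S)"
  by (simp add: shape_def image_image)

lemma track_append: "track a b (ds @ es) S p = track a b es (shape a b ds S) (track a b ds S p)"
  by (induction ds arbitrary: S p) auto

lemma shape_append: "shape a b (ds @ es) S = shape a b es (shape a b ds S)"
  by (simp add: shape_def track_append image_image)

text \<open>\<open>F\<close> is any class of shapes that span the box and that moves preserve; it
  keeps the box coordinates valid along the whole walk.\<close>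

lemma fold_push_occupies:
  assumes D: "occupies D v S L" and F: "F S"
    and step: "\<And>S d. F S \<Longrightarrow> spanned a b S \<and> F (move a b d S ` S)"
  shows "\<exists>v' L'. occupies (fold push ds D) v' (shape a b ds S) L' \<and> (\<forall>p\<in>S. L' (track a b ds S p) = L p)"
  using D F
proof (induction ds arbitrary: D v S L)
  case Nil
  then show ?case by (intro exI[of _ v] exI[of _ L]) simp
next
  case (Cons d ds)
  obtain v' L' where 1: "occupies (push d D) v' (move a b d S ` S) L'" "\<forall>p\<in>S. L' (move a b d S p) = L p"
    using push_occupies[OF Cons.prems(1)] step[OF Cons.prems(2)] by blast
  obtain v2 L2 where 2: "occupies (fold push ds (push d D)) v2 (shape a b ds (move a b d S ` S)) L2"
    "\<forall>p\<in>move a b d S ` S. L2 (track a b ds (move a b d S ` S) p) = L' p"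
    using Cons.IH[OF 1(1)] step[OF Cons.prems(2)] by blast
  show ?case using 1(2) 2 by (intro exI[of _ v2] exI[of _ L2]) auto
qed

text \<open>The counterpart of \<open>push_perms\<close> in box coordinates: the effect of the walks
  that return to the shape \<open>S\<close>.\<close>

definition loops :: "int \<Rightarrow> int \<Rightarrow> cell set \<Rightarrow> (cell \<Rightarrow> cell) set" where
  "loops a b S = {\<pi>. \<pi> permutes S \<and> (\<exists>ds. shape a b ds S = S \<and> (\<forall>p\<in>S. track a b ds S p = \<pi> p))}"

lemma loops_comp:
  assumes "p \<in> loops a b S" "q \<in> loops a b S"
  shows "p \<circ> q \<in> loops a b S"
proof -
  obtain ds es where p: "p permutes S" "shape a b ds S = S" "\<forall>x\<in>S. track a b ds S x = p x"
    and q: "q permutes S" "shape a b es S = S" "\<forall>x\<in>S. track a b es S x = q x"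
    using assms by (auto simp: loops_def)
  have "shape a b (es @ ds) S = S" using p q by (simp add: shape_append)
  moreover have "\<forall>x\<in>S. track a b (es @ ds) S x = (p \<circ> q) x"
    using p q by (auto simp: track_append permutes_in_image)
  ultimately show ?thesis using p q permutes_compose unfolding loops_def by blast
qed

text \<open>Pushes are not undone by the opposite push. In a finite set of permutations closed under
  composition, however, multiplication by \<open>p\<close> is injective, hence onto, and reaches
  \<open>id\<close>.\<close>

lemma loops_group:
  assumes S: "finite S"
  shows "perm_group (loops a b S)"
proof
  show 1: "id \<in> loops a b S"
    by (auto simp: loops_def permutes_id intro!: exI[of _ "[]"])
  show "bij p" if "p \<in> loops a b S" for p using that permutes_bij by (auto simp: loops_def)
  show comp: "p \<circ> q \<in> loops a b S" if "p \<in> loops a b S" "q \<in> loops a b S" for p q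
    using that by (rule loops_comp)
  show "inv' p \<in> loops a b S" if p: "p \<in> loops a b S" for p
  proof -
    have per: "p permutes S" using p by (simp add: loops_def)
    have fin: "finite (loops a b S)"
      by (rule finite_subset[OF _ finite_permutations[OF S]]) (auto simp: loops_def)
    have "inj_on (\<lambda>q. p \<circ> q) (loops a b S)"
    proof (rule inj_onI, rule ext)
      fix q q' x assume "p \<circ> q = p \<circ> q'"
      then have "p (q x) = p (q' x)" by (metis o_apply)
      then show "q x = q' x" using permutes_inj[OF per] by (simp add: inj_eq)
    qed
    then have "(\<lambda>q. p \<circ> q) ` loops a b S = loops a b S"
      using comp[OF p] fin by (intro endo_inj_surj) auto
    then obtain q where q: "q \<in> loops a b S" "p \<circ> q = id" using 1 by (metis imageE)
    have "inv' p x = q x" for x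
      using inv_f_f[OF permutes_inj[OF per], of "q x"] fun_cong[OF q(2), of x] by simp
    then have "inv' p = q" by blast
    then show ?thesis using q by simp
  qed
qed

fun transposed :: "direction \<Rightarrow> direction" where
  "transposed Leftward = Downward"
| "transposed Rightward = Upward"
| "transposed Downward = Leftward"
| "transposed Upward = Rightward"

lemma move_transposed:
  "move a b (transposed d) S = prod.swap \<circ> move b a d (prod.swap ` S) \<circ> prod.swap"
  by (cases d) (auto simp: image_image fun_eq_iff)

lemma track_transposed:
  "track a b (map transposed ds) S p = prod.swap (track b a ds (prod.swap ` S) (prod.swap p))"
proof (induction ds arbitrary: S p)
  case (Cons d ds)
  have "prod.swap ` (move a b (transposed d) S ` S) = move b a d (prod.swap ` S) ` (prod.swap ` S)"
    by (simp add: move_transposed image_image)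
  then show ?case using Cons.IH by (simp add: move_transposed)
qed simp

lemma loops_transposed:
  assumes "\<pi> \<in> loops b a (prod.swap ` S)"
  shows "prod.swap \<circ> \<pi> \<circ> prod.swap \<in> loops a b S"
proof -
  obtain ds where p: "\<pi> permutes prod.swap ` S" and sh: "shape b a ds (prod.swap ` S) = prod.swap ` S"
    and tr: "\<forall>x\<in>prod.swap ` S. track b a ds (prod.swap ` S) x = \<pi> x"
    using assms by (auto simp: loops_def)
  have tr': "\<forall>x\<in>S. track a b (map transposed ds) S x = (prod.swap \<circ> \<pi> \<circ> prod.swap) x"
    using tr by (simp add: track_transposed)
  have "(prod.swap \<circ> \<pi> \<circ> prod.swap) permutes S"
  proof (rule bij_imp_permutes)
    show "bij_betw (prod.swap \<circ> \<pi> \<circ> prod.swap) S S"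
    proof (intro bij_betw_trans)
      show "bij_betw prod.swap S (prod.swap ` S)" by (auto simp: bij_betw_def)
      show "bij_betw \<pi> (prod.swap ` S) (prod.swap ` S)" by (rule permutes_imp_bij[OF p])
      show "bij_betw prod.swap (prod.swap ` S) S" by (auto simp: bij_betw_def image_image)
    qed
    show "(prod.swap \<circ> \<pi> \<circ> prod.swap) x = x" if "x \<notin> S" for x
      using that permutes_not_in[OF p, of "prod.swap x"] by (auto simp: mem_swap_image)
  qed
  moreover from this have "shape a b (map transposed ds) S = S"
    using tr' unfolding shape_def by (metis (no_types, lifting) image_cong permutes_image)
  ultimately show ?thesis using tr' by (auto simp: loops_def)
qed

section \<open>Compact shapes\<close>

text \<open>The rows of a compact shape are nested intervals, a row of \<open>l\<close> cells occupying the columns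
  \<open>s l, \<dots>, s l + l - 1\<close>; a horizontal push moves all these intervals one step unless they
  touch the border. Columns behave in the same way, independently of the rows.\<close>

definition offsets :: "int \<Rightarrow> (int \<Rightarrow> int) \<Rightarrow> bool" where
  "offsets n s \<longleftrightarrow> (\<forall>l. 1 \<le> l \<and> l \<le> n \<longrightarrow> 0 \<le> s l \<and> s l + l \<le> n) \<and>
     (\<forall>l. 1 \<le> l \<and> l < n \<longrightarrow> s (l + 1) \<le> s l \<and> s l \<le> s (l + 1) + 1) \<and>
     (\<forall>l. l < 1 \<or> n < l \<longrightarrow> s l = 0)"

definition shift_right :: "int \<Rightarrow> (int \<Rightarrow> int) \<Rightarrow> int \<Rightarrow> int" where
  "shift_right n s = (\<lambda>l. if 1 \<le> l \<and> l \<le> n then min (s l + 1) (n - l) else 0)"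

definition shift_left :: "(int \<Rightarrow> int) \<Rightarrow> int \<Rightarrow> int" where
  "shift_left s = (\<lambda>l. max (s l - 1) 0)"

definition right_offsets :: "int \<Rightarrow> int \<Rightarrow> int \<Rightarrow> int" where
  "right_offsets n i = (\<lambda>l. if 1 \<le> l \<and> l \<le> n then min i (n - l) else 0)"

text \<open>The intervals of lengths 1 to \<open>n\<close> grow by one point at a time, to the left
  or to the right. The rank counts those that miss \<open>x\<close>, so \<open>x\<close> joins with
  length one more than its rank: column \<open>x\<close> of a shape is the column of that index in
  the Young diagram.\<close>

definition rank :: "int \<Rightarrow> (int \<Rightarrow> int) \<Rightarrow> int \<Rightarrow> int" where
  "rank n s x = int (card {l \<in> {1..n}. \<not> (s l \<le> x \<and> x < s l + l)})"

lemma offsets_bounds: "offsets n s \<Longrightarrow> 1 \<le> l \<Longrightarrow> l \<le> n \<Longrightarrow> 0 \<le> s l \<and> s l + l \<le> n"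
  by (auto simp: offsets_def)

lemma offsets_zero: "offsets n (\<lambda>_. 0)"
  by (auto simp: offsets_def)

lemma offsets_shift_right: "offsets n s \<Longrightarrow> offsets n (shift_right n s)"
  unfolding offsets_def shift_right_def by (auto simp: min_def; smt (verit))

lemma offsets_shift_left: "offsets n s \<Longrightarrow> offsets n (shift_left s)"
  unfolding offsets_def shift_left_def by (auto simp: max_def; smt (verit))

lemma offsets_right_offsets: "0 \<le> i \<Longrightarrow> offsets n (right_offsets n i)"
  unfolding offsets_def right_offsets_def by auto

lemma right_offsets_0: "right_offsets n 0 = (\<lambda>_. 0)"
  by (auto simp: right_offsets_def)

lemma funpow_shift_right: "(shift_right n ^^ k) (\<lambda>_. 0) = right_offsets n (int k)"
  by (induction k) (auto simp: right_offsets_def shift_right_def fun_eq_iff)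

lemma funpow_shift_left: "(\<And>l. 0 \<le> s l) \<Longrightarrow> (shift_left ^^ k) s = (\<lambda>l. max (s l - int k) 0)"
  by (induction k) (auto simp: shift_left_def fun_eq_iff)

lemma offsets_nonneg: "offsets n s \<Longrightarrow> 0 \<le> s l"
  unfolding offsets_def by (metis linorder_not_less order_refl)

lemma shift_left_to_zero:
  assumes "offsets n s"
  shows "(shift_left ^^ nat n) s = (\<lambda>_. 0)"
proof -
  have "s l \<le> n \<or> n < 0" "n < 0 \<longrightarrow> s l = 0" for l
    using assms unfolding offsets_def by (smt (verit))+
  then show ?thesis by (subst funpow_shift_left[OF offsets_nonneg[OF assms]]) (auto simp: fun_eq_iff)
qed

lemma offsets_nested:
  assumes s: "offsets n s" and l: "1 \<le> l" "l \<le> m" "m \<le> n" and x: "s l \<le> x" "x < s l + l"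
  shows "s m \<le> x \<and> x < s m + m"
  using l(2,3)
proof (induction m rule: int_ge_induct)
  case base
  then show ?case using x by simp
next
  case (step m)
  have "s (m + 1) \<le> s m" "s m \<le> s (m + 1) + 1" using s step.hyps step.prems l unfolding offsets_def by auto
  moreover have "s m \<le> x \<and> x < s m + m" using step.prems by (intro step.IH) simp
  ultimately show ?case by linarith
qed

lemma rank_less_iff:
  assumes s: "offsets n s" and l: "1 \<le> l" "l \<le> n"
  shows "rank n s x < l \<longleftrightarrow> s l \<le> x \<and> x < s l + l"
proof -
  let ?A = "{m \<in> {1..n}. \<not> (s m \<le> x \<and> x < s m + m)}"
  have fin: "finite ?A" by (rule finite_subset[of _ "{1..n}"]) auto
  show ?thesis
  proof (cases "s l \<le> x \<and> x < s l + l")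
    case True
    have "?A \<subseteq> {1..l - 1}"
    proof
      fix m assume m: "m \<in> ?A"
      show "m \<in> {1..l - 1}"
      proof (rule ccontr)
        assume "m \<notin> {1..l - 1}"
        then have "l \<le> m" "m \<le> n" using m by auto
        then show False using offsets_nested[OF s l(1), of m x] True m by auto
      qed
    qed
    then have "card ?A \<le> card {1..l - 1}" by (intro card_mono) auto
    moreover have "card {1..l - 1} = nat (l - 1)" by simp
    ultimately have "int (card ?A) < l" using l by linarith
    then show ?thesis using True unfolding rank_def by blast
  next
    case False
    have "{1..l} \<subseteq> ?A"
    proof
      fix m assume m: "m \<in> {1..l}"
      then have "\<not> (s m \<le> x \<and> x < s m + m)"
        using offsets_nested[OF s, of m l x] False l by auto
      then show "m \<in> ?A" using m l by auto
    qed
    then have "card {1..l} \<le> card ?A" by (intro card_mono fin)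
    moreover have "card {1..l} = nat l" by simp
    ultimately have "\<not> int (card ?A) < l" using l by linarith
    then show ?thesis using False unfolding rank_def by blast
  qed
qed

lemma rank_nonneg: "0 \<le> rank n s x"
  by (simp add: rank_def)

lemma offsets_full: "offsets n s \<Longrightarrow> 1 \<le> n \<Longrightarrow> s n = 0"
  using offsets_bounds[of n s n] by auto

lemma rank_less:
  assumes "offsets n s" "0 \<le> x" "x < n"
  shows "rank n s x < n"
  using rank_less_iff[OF assms(1), of n x] offsets_full[OF assms(1)] assms by auto

lemma rank_zero: "0 \<le> x \<Longrightarrow> x < n \<Longrightarrow> rank n (\<lambda>_. 0) x = x"
proof -
  assume x: "0 \<le> x" "x < n"
  have "rank n (\<lambda>_. 0) x < x + 1" using rank_less_iff[OF offsets_zero, of "x + 1" n x] x by simp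
  moreover have "\<not> rank n (\<lambda>_. 0) x < x"
    using rank_less_iff[OF offsets_zero, of x n x] rank_nonneg[of n "\<lambda>_. 0" x] x by (cases "x = 0") auto
  ultimately show ?thesis by simp
qed

text \<open>The interval of length \<open>i + 1\<close> has exactly one point outside the interval
  of length \<open>i\<close>, and this is the only point of rank \<open>i\<close>.\<close>

lemma rank_inj:
  assumes s: "offsets n s" and "0 \<le> x" "x < n" "0 \<le> x'" "x' < n" and eq: "rank n s x = rank n s x'"
  shows "x = x'"
proof -
  let ?i = "rank n s x"
  have i: "0 \<le> ?i" "?i < n" using rank_nonneg rank_less assms by auto
  have *: "s l \<le> x \<and> x < s l + l \<longleftrightarrow> s l \<le> x' \<and> x' < s l + l" if "1 \<le> l" "l \<le> n" for l
    using rank_less_iff[OF s that] eq by metis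
  have in1: "s (?i + 1) \<le> x \<and> x < s (?i + 1) + (?i + 1)"
    using rank_less_iff[OF s, of "?i + 1" x] i by simp
  have in2: "s (?i + 1) \<le> x' \<and> x' < s (?i + 1) + (?i + 1)"
    using *[of "?i + 1"] in1 i by simp
  show ?thesis
  proof (cases "?i = 0")
    case True
    then show ?thesis using in1 in2 by simp
  next
    case False
    then have "\<not> (s ?i \<le> x \<and> x < s ?i + ?i)" "\<not> (s ?i \<le> x' \<and> x' < s ?i + ?i)"
      using rank_less_iff[OF s, of ?i x] rank_less_iff[OF s, of ?i x'] i eq by auto
    moreover have "s (?i + 1) \<le> s ?i" "s ?i \<le> s (?i + 1) + 1"
      using s i False unfolding offsets_def by auto
    ultimately show ?thesis using in1 in2 by linarith
  qed
qed

lemma rank_bij: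
  assumes s: "offsets n s"
  shows "bij_betw (rank n s) {0..<n} {0..<n}"
proof -
  have inj: "inj_on (rank n s) {0..<n}"
    using rank_inj[OF s] by (auto intro!: inj_onI)
  moreover have "rank n s ` {0..<n} \<subseteq> {0..<n}"
    using rank_nonneg rank_less[OF s] by auto
  ultimately show ?thesis
    by (simp add: bij_betw_def endo_inj_surj)
qed

lemma rank_surj:
  assumes "offsets n s" "0 \<le> i" "i < n"
  obtains x where "0 \<le> x" "x < n" "rank n s x = i"
  using rank_bij[OF assms(1)] assms unfolding bij_betw_def by (metis atLeastLessThan_iff imageE)

text \<open>Row lengths and column lengths are both parameters, so that the locale is invariant
  under exchanging the axes. \<open>dual\<close> makes them conjugate partitions and forces them to
  be decreasing.\<close>

locale young =
  fixes a b :: int and r c :: "int \<Rightarrow> int"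
  assumes a_pos: "0 < a" and b_pos: "0 < b"
    and r_bounds: "0 \<le> y \<Longrightarrow> y < b \<Longrightarrow> 1 \<le> r y \<and> r y \<le> a"
    and c_bounds: "0 \<le> x \<Longrightarrow> x < a \<Longrightarrow> 1 \<le> c x \<and> c x \<le> b"
    and dual: "0 \<le> x \<Longrightarrow> x < a \<Longrightarrow> 0 \<le> y \<Longrightarrow> y < b \<Longrightarrow> x < r y \<longleftrightarrow> y < c x"
begin

text \<open>The diagram with its columns and rows permuted by the ranks, which treats both axes
  alike. By \<open>mem_cells\<close> the line \<open>y\<close> is then an interval whose start
  depends only on its length.\<close>

definition cells :: "(int \<Rightarrow> int) \<Rightarrow> (int \<Rightarrow> int) \<Rightarrow> cell set" where
  "cells s t = {(x, y). 0 \<le> x \<and> x < a \<and> 0 \<le> y \<and> y < b \<and> rank a s x < r (rank b t y)}"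

text \<open>A token keeps its position within its row while the start of the row passes from its
  offset in \<open>s\<close> to that in \<open>s'\<close>.\<close>

definition hshift :: "(int \<Rightarrow> int) \<Rightarrow> (int \<Rightarrow> int) \<Rightarrow> (int \<Rightarrow> int) \<Rightarrow> cell \<Rightarrow> cell" where
  "hshift t s s' = (\<lambda>(x, y). (x + s' (r (rank b t y)) - s (r (rank b t y)), y))"

definition diagram :: "cell set" where
  "diagram = {(x, y). 0 \<le> x \<and> x < a \<and> 0 \<le> y \<and> y < b \<and> x < r y}"

end

lemma young_transpose: "young a b r c \<Longrightarrow> young b a c r"
  unfolding young_def by metis

text \<open>Results on rows and horizontal pushes thereby become results on columns and vertical
  pushes, with prefix \<open>T\<close>. Contexts are closed and reopened below so that new facts are
  inherited by \<open>T\<close>.\<close>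

sublocale young \<subseteq> T: young b a c r
  by (rule young_transpose) unfold_locales

context young
begin

lemma r_antimono: "0 \<le> y \<Longrightarrow> y \<le> y' \<Longrightarrow> y' < b \<Longrightarrow> r y' \<le> r y"
proof (rule ccontr)
  assume y: "0 \<le> y" "y \<le> y'" "y' < b" and "\<not> r y' \<le> r y"
  then have lt: "r y < r y'" by simp
  moreover have "0 \<le> r y" "r y < a" using r_bounds[of y] r_bounds[of y'] y lt by auto
  ultimately have "y' < c (r y)" using dual[of "r y" y'] y by simp
  then have "r y < r y" using dual[of "r y" y] y \<open>0 \<le> r y\<close> \<open>r y < a\<close> by simp
  then show False by simp
qed

lemma r_0: "r 0 = a"
  using dual[of "a - 1" 0] c_bounds[of "a - 1"] r_bounds[of 0] a_pos b_pos by simp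

lemma r_rank_bounds:
  assumes "offsets b t" "0 \<le> y" "y < b"
  shows "1 \<le> r (rank b t y)" "r (rank b t y) \<le> a"
  using r_bounds[of "rank b t y"] rank_nonneg[of b t y] rank_less[OF assms] by auto

lemma mem_cells:
  assumes "offsets a s" "offsets b t"
  shows "(x, y) \<in> cells s t \<longleftrightarrow> 0 \<le> y \<and> y < b \<and>
    s (r (rank b t y)) \<le> x \<and> x < s (r (rank b t y)) + r (rank b t y)"
proof (cases "0 \<le> y \<and> y < b")
  case True
  note l = r_rank_bounds[OF assms(2), of y]
  show ?thesis
    using rank_less_iff[OF assms(1) l, of x] offsets_bounds[OF assms(1) l] True
    by (auto simp: cells_def)
qed (auto simp: cells_def)

lemma cells_transpose:
  assumes "offsets a s" "offsets b t"
  shows "prod.swap ` cells s t = T.cells t s"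
proof -
  have "(x, y) \<in> cells s t \<longleftrightarrow> (y, x) \<in> T.cells t s" for x y
    using dual[of "rank a s x" "rank b t y"] rank_nonneg[of a s x] rank_nonneg[of b t y]
      rank_less[OF assms(1), of x] rank_less[OF assms(2), of y]
    by (auto simp: cells_def T.cells_def)
  then show ?thesis by (auto simp: mem_swap_pair)
qed

lemma diagram_transpose: "prod.swap ` diagram = T.diagram"
  using dual by (auto simp: mem_swap_pair diagram_def T.diagram_def)

lemma cells_zero: "cells (\<lambda>_. 0) (\<lambda>_. 0) = diagram"
  by (auto simp: cells_def diagram_def rank_zero)

lemma finite_cells: "finite (cells s t)"
  by (rule finite_subset[of _ "{0..<a} \<times> {0..<b}"]) (auto simp: cells_def)

lemma finite_diagram: "finite diagram"
  using finite_cells cells_zero by metis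

lemma hshift_image:
  assumes s: "offsets a s" "offsets a s'" and t: "offsets b t"
  shows "hshift t s s' ` cells s t = cells s' t"
proof (intro equalityI subsetI)
  fix p assume "p \<in> hshift t s s' ` cells s t"
  then show "p \<in> cells s' t"
    by (auto simp: hshift_def mem_cells[OF s(1) t] mem_cells[OF s(2) t])
next
  fix p assume p: "p \<in> cells s' t"
  obtain x y where xy: "p = (x, y)" by (cases p)
  let ?l = "r (rank b t y)"
  have "(x + s ?l - s' ?l, y) \<in> cells s t"
    using p by (auto simp: xy mem_cells[OF s(1) t] mem_cells[OF s(2) t])
  moreover have "hshift t s s' (x + s ?l - s' ?l, y) = p" by (simp add: xy hshift_def)
  ultimately show "p \<in> hshift t s s' ` cells s t" by (metis imageI)
qed

lemma hshift_hshift: "hshift t s' s'' (hshift t s s' p) = hshift t s s'' p"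
  by (auto simp: hshift_def split: prod.splits)

lemma hshift_id [simp]: "hshift t s s p = p"
  by (auto simp: hshift_def split: prod.splits)

text \<open>A line is a single interval, so there is an empty cell to the right of a token iff the
  interval ends before the border, a condition on its length and offset that all its tokens
  share.\<close>

lemma move_right_cells:
  assumes s: "offsets a s" and t: "offsets b t" and p: "p \<in> cells s t"
  shows "move_right a (cells s t) p = hshift t s (shift_right a s) p"
proof -
  obtain x y where xy: "p = (x, y)" by (cases p)
  let ?l = "r (rank b t y)"
  have y: "0 \<le> y" "y < b" and x: "s ?l \<le> x" "x < s ?l + ?l"
    using p mem_cells[OF s t] by (auto simp: xy)
  note l = r_rank_bounds[OF t y]
  have "(\<exists>x'. x < x' \<and> x' < a \<and> (x', y) \<notin> cells s t) \<longleftrightarrow> s ?l + ?l < a"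
  proof
    assume "\<exists>x'. x < x' \<and> x' < a \<and> (x', y) \<notin> cells s t"
    then obtain x' where "x < x'" "x' < a" "(x', y) \<notin> cells s t" by blast
    then show "s ?l + ?l < a" using mem_cells[OF s t] x y by auto
  next
    assume "s ?l + ?l < a"
    then show "\<exists>x'. x < x' \<and> x' < a \<and> (x', y) \<notin> cells s t"
      using mem_cells[OF s t] x by (intro exI[of _ "s ?l + ?l"]) auto
  qed
  then show ?thesis
    using l offsets_bounds[OF s l] unfolding xy move_right_eq
    by (auto simp: hshift_def shift_right_def)
qed

lemma move_left_cells:
  assumes s: "offsets a s" and t: "offsets b t" and p: "p \<in> cells s t"
  shows "move_left (cells s t) p = hshift t s (shift_left s) p"
proof -
  obtain x y where xy: "p = (x, y)" by (cases p)
  let ?l = "r (rank b t y)"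
  have y: "0 \<le> y" "y < b" and x: "s ?l \<le> x" "x < s ?l + ?l"
    using p mem_cells[OF s t] by (auto simp: xy)
  note l = r_rank_bounds[OF t y]
  have "(\<exists>x'. 0 \<le> x' \<and> x' < x \<and> (x', y) \<notin> cells s t) \<longleftrightarrow> 0 < s ?l"
  proof
    assume "\<exists>x'. 0 \<le> x' \<and> x' < x \<and> (x', y) \<notin> cells s t"
    then obtain x' where "0 \<le> x'" "x' < x" "(x', y) \<notin> cells s t" by blast
    then show "0 < s ?l" using mem_cells[OF s t] x y by auto
  next
    assume "0 < s ?l"
    then show "\<exists>x'. 0 \<le> x' \<and> x' < x \<and> (x', y) \<notin> cells s t"
      using mem_cells[OF s t] x by (intro exI[of _ "s ?l - 1"]) auto
  qed
  then show ?thesis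
    using offsets_bounds[OF s l] unfolding xy move_left_def
    by (auto simp: hshift_def shift_left_def)
qed

section \<open>Movements realized by walks\<close>

definition realizes :: "(int \<Rightarrow> int) \<Rightarrow> (int \<Rightarrow> int) \<Rightarrow> (cell \<Rightarrow> cell) \<Rightarrow> (int \<Rightarrow> int) \<Rightarrow> (int \<Rightarrow> int) \<Rightarrow> bool" where
  "realizes s t F s' t' \<longleftrightarrow> (\<exists>ds. shape a b ds (cells s t) = cells s' t' \<and>
     (\<forall>p\<in>cells s t. track a b ds (cells s t) p = F p))"

lemma realizes_id: "realizes s t id s t"
  by (auto simp: realizes_def intro!: exI[of _ "[]"])

lemma realizes_image: "realizes s t F s' t' \<Longrightarrow> F ` cells s t = cells s' t'"
  unfolding realizes_def shape_def by (metis (no_types, lifting) image_cong)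

lemma realizes_trans:
  assumes "realizes s t F s' t'" "realizes s' t' G s'' t''"
  shows "realizes s t (G \<circ> F) s'' t''"
proof -
  obtain ds es where 1: "shape a b ds (cells s t) = cells s' t'" "\<forall>p\<in>cells s t. track a b ds (cells s t) p = F p"
    and 2: "shape a b es (cells s' t') = cells s'' t''" "\<forall>p\<in>cells s' t'. track a b es (cells s' t') p = G p"
    using assms unfolding realizes_def by blast
  have "F p \<in> cells s' t'" if "p \<in> cells s t" for p using realizes_image[OF assms(1)] that by auto
  then show ?thesis unfolding realizes_def
    using 1 2 by (intro exI[of _ "ds @ es"]) (auto simp: shape_append track_append)
qed

lemma realizes_cong:
  assumes "realizes s t F s' t'" "\<And>p. p \<in> cells s t \<Longrightarrow> F p = G p"
  shows "realizes s t G s' t'"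
  using assms unfolding realizes_def by metis

lemma realizes_move:
  assumes "\<And>p. p \<in> cells s t \<Longrightarrow> move a b d (cells s t) p = F p" "F ` cells s t = cells s' t'"
  shows "realizes s t F s' t'"
proof -
  have "move a b d (cells s t) ` cells s t = cells s' t'"
    using assms by (metis (no_types, lifting) image_cong)
  then show ?thesis unfolding realizes_def
    using assms(1) by (intro exI[of _ "[d]"]) simp
qed

lemma realizes_right:
  assumes "offsets a s" "offsets b t"
  shows "realizes s t (hshift t s (shift_right a s)) (shift_right a s) t"
  by (rule realizes_move[where d = Rightward])
    (simp_all add: move_right_cells assms hshift_image offsets_shift_right)

lemma realizes_left:
  assumes "offsets a s" "offsets b t"
  shows "realizes s t (hshift t s (shift_left s)) (shift_left s) t"
  by (rule realizes_move[where d = Leftward])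
    (simp_all add: move_left_cells assms hshift_image offsets_shift_left)

lemma offsets_funpow:
  assumes "offsets n s"
  shows "offsets n ((shift_right n ^^ k) s)" "offsets n ((shift_left ^^ k) s)"
  by (induction k) (use assms offsets_shift_right offsets_shift_left in auto)

lemma realizes_right_funpow:
  assumes "offsets a s" "offsets b t"
  shows "realizes s t (hshift t s ((shift_right a ^^ k) s)) ((shift_right a ^^ k) s) t"
proof (induction k)
  case 0
  then show ?case using realizes_cong[OF realizes_id] by simp
next
  case (Suc k)
  show ?case
    by (rule realizes_cong, rule realizes_trans[OF Suc])
      (use realizes_right[OF offsets_funpow(1)[OF assms(1)] assms(2)] in \<open>auto simp: hshift_hshift\<close>)
qed

lemma realizes_left_funpow:
  assumes "offsets a s" "offsets b t"
  shows "realizes s t (hshift t s ((shift_left ^^ k) s)) ((shift_left ^^ k) s) t"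
proof (induction k)
  case 0
  then show ?case using realizes_cong[OF realizes_id] by simp
next
  case (Suc k)
  show ?case
    by (rule realizes_cong, rule realizes_trans[OF Suc])
      (use realizes_left[OF offsets_funpow(2)[OF assms(1)] assms(2)] in \<open>auto simp: hshift_hshift\<close>)
qed

lemma realizes_to_zero:
  assumes "offsets a s" "offsets b t"
  shows "realizes s t (hshift t s (\<lambda>_. 0)) (\<lambda>_. 0) t"
  using realizes_left_funpow[OF assms, of "nat a"] shift_left_to_zero[OF assms(1)] by simp

lemma realizes_to_right_offsets:
  assumes "offsets a s" "offsets b t" "0 \<le> i"
  shows "realizes s t (hshift t s (right_offsets a i)) (right_offsets a i) t"
proof (rule realizes_cong, rule realizes_trans[OF realizes_to_zero[OF assms(1,2)]])
  show "realizes (\<lambda>_. 0) t (hshift t (\<lambda>_. 0) (right_offsets a i)) (right_offsets a i) t"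
    using realizes_right_funpow[OF offsets_zero assms(2), of "nat i"] assms(3)
    by (simp add: funpow_shift_right)
qed (simp add: hshift_hshift)

end

context young
begin

lemma realizes_transpose:
  assumes "T.realizes t s F t' s'" "offsets a s" "offsets b t" "offsets a s'" "offsets b t'"
  shows "realizes s t (prod.swap \<circ> F \<circ> prod.swap) s' t'"
proof -
  obtain ds where sh: "shape b a ds (T.cells t s) = T.cells t' s'"
    and tr: "\<forall>p\<in>T.cells t s. track b a ds (T.cells t s) p = F p"
    using assms(1) unfolding T.realizes_def by blast
  have sw: "prod.swap ` T.cells t s = cells s t" "prod.swap ` T.cells t' s' = cells s' t'"
    using assms(2-) by (simp_all add: cells_transpose[symmetric] image_image)
  have sw': "prod.swap ` cells s t = T.cells t s" using assms by (simp add: cells_transpose)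
  have tr': "\<forall>p\<in>cells s t. track a b (map transposed ds) (cells s t) p = (prod.swap \<circ> F \<circ> prod.swap) p"
  proof
    fix p assume "p \<in> cells s t"
    then have "prod.swap p \<in> T.cells t s" unfolding sw'[symmetric] by (rule imageI)
    then show "track a b (map transposed ds) (cells s t) p = (prod.swap \<circ> F \<circ> prod.swap) p"
      using tr sw' by (simp add: track_transposed)
  qed
  moreover have "shape a b (map transposed ds) (cells s t) = cells s' t'"
  proof -
    have "shape a b (map transposed ds) (cells s t) = prod.swap ` (track b a ds (T.cells t s) ` (prod.swap ` cells s t))"
    proof -
      have "(\<lambda>p. prod.swap (G (prod.swap p))) ` cells s t = prod.swap ` G ` prod.swap ` cells s t" for G
        by (simp add: image_image)
      then show ?thesis unfolding shape_def track_transposed sw' .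
    qed
    also have "\<dots> = cells s' t'" using sh sw(2) unfolding sw' shape_def by simp
    finally show ?thesis .
  qed
  ultimately show ?thesis unfolding realizes_def by blast
qed

definition vshift :: "(int \<Rightarrow> int) \<Rightarrow> (int \<Rightarrow> int) \<Rightarrow> (int \<Rightarrow> int) \<Rightarrow> cell \<Rightarrow> cell" where
  "vshift s t t' = prod.swap \<circ> T.hshift s t t' \<circ> prod.swap"

lemma vshift_eq:
  "vshift s t t' (x, y) = (x, y + t' (c (rank a s x)) - t (c (rank a s x)))"
  by (simp add: vshift_def T.hshift_def)

lemma vshift_vshift: "vshift s t' t'' (vshift s t t' p) = vshift s t t'' p"
  by (simp add: vshift_def T.hshift_hshift)

lemma vshift_id [simp]: "vshift s t t p = p"
  by (simp add: vshift_def)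

lemma vshift_image:
  assumes "offsets a s" "offsets b t" "offsets b t'"
  shows "vshift s t t' ` cells s t = cells s t'"
proof -
  have "vshift s t t' ` cells s t = prod.swap ` (T.hshift s t t' ` (prod.swap ` cells s t))"
    by (simp add: vshift_def image_comp o_assoc)
  also have "\<dots> = prod.swap ` T.cells t' s"
    using assms by (simp add: cells_transpose T.hshift_image)
  also have "\<dots> = cells s t'"
    using assms by (simp add: cells_transpose[symmetric] image_image)
  finally show ?thesis .
qed

lemma realizes_vertical_to_right_offsets:
  assumes "offsets a s" "offsets b t" "0 \<le> i"
  shows "realizes s t (vshift s t (right_offsets b i)) s (right_offsets b i)"
  unfolding vshift_def using assms
  by (intro realizes_transpose T.realizes_to_right_offsets offsets_right_offsets)

lemma move_up_cells:
  assumes s: "offsets a s" and t: "offsets b t" and p: "p \<in> cells s t"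
  shows "move a b Upward (cells s t) p = vshift s t (shift_right b t) p"
proof -
  have sw: "prod.swap ` cells s t = T.cells t s" by (rule cells_transpose[OF s t])
  then have "prod.swap p \<in> T.cells t s" using p by blast
  then show ?thesis using T.move_right_cells[OF t s] by (simp add: sw vshift_def)
qed

lemma move_down_cells:
  assumes s: "offsets a s" and t: "offsets b t" and p: "p \<in> cells s t"
  shows "move a b Downward (cells s t) p = vshift s t (shift_left t) p"
proof -
  have sw: "prod.swap ` cells s t = T.cells t s" by (rule cells_transpose[OF s t])
  then have "prod.swap p \<in> T.cells t s" using p by blast
  then show ?thesis using T.move_left_cells[OF t s] by (simp add: sw vshift_def)
qed

lemma moves_state:
  assumes s: "offsets a s" and t: "offsets b t"
  obtains s' t' F where "offsets a s'" "offsets b t'" "\<And>p. p \<in> cells s t \<Longrightarrow> move a b d (cells s t) p = F p"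
    "F ` cells s t = cells s' t'" "t' = t \<and> F = hshift t s s' \<or> s' = s \<and> F = vshift s t t'"
proof (cases d)
  case Leftward
  show thesis by (rule that[of "shift_left s" t "hshift t s (shift_left s)"])
    (use Leftward in \<open>simp_all add: s t offsets_shift_left move_left_cells hshift_image\<close>)
next
  case Rightward
  show thesis by (rule that[of "shift_right a s" t "hshift t s (shift_right a s)"])
    (use Rightward in \<open>simp_all add: s t offsets_shift_right move_right_cells hshift_image\<close>)
next
  case Upward
  show thesis by (rule that[of s "shift_right b t" "vshift s t (shift_right b t)"])
    (simp_all only: Upward move_up_cells s t offsets_shift_right vshift_image simp_thms)
next
  case Downward
  show thesis by (rule that[of s "shift_left t" "vshift s t (shift_left t)"])
    (simp_all only: Downward move_down_cells s t offsets_shift_left vshift_image simp_thms)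
qed

lemma full_row:
  assumes "offsets a s" "offsets b t"
  obtains y where "0 \<le> y" "y < b" "\<And>x. 0 \<le> x \<Longrightarrow> x < a \<Longrightarrow> (x, y) \<in> cells s t"
proof -
  obtain y where "0 \<le> y" "y < b" "rank b t y = 0" using rank_surj[OF assms(2), of 0] b_pos by auto
  then show thesis using rank_less[OF assms(1)] by (intro that[of y]) (auto simp: cells_def r_0)
qed

end

context young
begin

lemma spanned_cells:
  assumes s: "offsets a s" and t: "offsets b t"
  shows "spanned a b (cells s t)"
proof -
  obtain y where y: "0 \<le> y" "y < b" "\<And>x. 0 \<le> x \<Longrightarrow> x < a \<Longrightarrow> (x, y) \<in> cells s t"
    using full_row[OF assms] by blast
  obtain x where x: "0 \<le> x" "x < a" "\<And>y. 0 \<le> y \<Longrightarrow> y < b \<Longrightarrow> (y, x) \<in> T.cells t s"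
    using T.full_row[OF t s] by blast
  have "(x, y) \<in> cells s t" if "0 \<le> y" "y < b" for y
    using x(3)[OF that] cells_transpose[OF s t] mem_swap_pair by metis
  then have "(x, 0) \<in> cells s t" "(x, b - 1) \<in> cells s t" using b_pos by auto
  moreover have "(0, y) \<in> cells s t" "(a - 1, y) \<in> cells s t" using y(3) a_pos by auto
  moreover have "cells s t \<subseteq> box a b" by (auto simp: box_def cells_def)
  ultimately show ?thesis unfolding spanned_def by blast
qed

definition compact_shape :: "cell set \<Rightarrow> bool" where
  "compact_shape S \<longleftrightarrow> (\<exists>s t. offsets a s \<and> offsets b t \<and> S = cells s t)"

lemma compact_shape_step: "compact_shape S \<Longrightarrow> spanned a b S \<and> compact_shape (move a b d S ` S)"
proof -
  assume "compact_shape S"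
  then obtain s t where st: "offsets a s" "offsets b t" "S = cells s t" by (auto simp: compact_shape_def)
  obtain s' t' F where "offsets a s'" "offsets b t'" "\<And>p. p \<in> cells s t \<Longrightarrow> move a b d (cells s t) p = F p"
    "F ` cells s t = cells s' t'" using moves_state[OF st(1,2)] by metis
  moreover from this have "move a b d S ` S = cells s' t'" unfolding st by (metis (no_types, lifting) image_cong)
  ultimately show ?thesis using st spanned_cells by (auto simp: compact_shape_def)
qed

end

section \<open>The group of a compact shape\<close>

lemma loopsI:
  assumes "finite S" "shape a b ds S = S"
  shows "(\<lambda>p. if p \<in> S then track a b ds S p else p) \<in> loops a b S" (is "?\<pi> \<in> _")
proof -
  have "?\<pi> ` S = track a b ds S ` S" by auto
  then have im: "?\<pi> ` S = S" using assms(2) by (simp add: shape_def)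
  then have "inj_on ?\<pi> S" using eq_card_imp_inj_on[OF assms(1), of ?\<pi>] by simp
  then have "?\<pi> permutes S" using im by (intro bij_imp_permutes) (auto simp: bij_betw_def)
  then show ?thesis using assms(2) by (auto simp: loops_def)
qed

text \<open>The walk \<open>es\<close> back need not undo the walk \<open>ds\<close>. Their
  composite \<open>\<eta>\<close> is a loop at \<open>L\<close>, and dividing by it turns the round
  trip through \<open>S\<close> into a genuine conjugation.\<close>

lemma loops_conj:
  assumes fin: "finite L" and ds: "shape a b ds L = S" and es: "shape a b es S = L"
  shows "bij_betw (track a b ds L) L S"
    and "loops a b S = map_permutation L (track a b ds L) ` loops a b L"
proof -
  let ?\<tau> = "track a b ds L" and ?\<beta> = "track a b es S"
  have im: "?\<tau> ` L = S" "?\<beta> ` S = L" using ds es by (simp_all add: shape_def)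
  then have finS: "finite S" using fin by blast
  have "card S = card L" using card_image_le[OF fin, of ?\<tau>] card_image_le[OF finS, of ?\<beta>] im by simp
  then have inj: "inj_on ?\<tau> L" using im eq_card_imp_inj_on[OF fin, of ?\<tau>] by simp
  then show bij: "bij_betw ?\<tau> L S" using im by (simp add: bij_betw_def)
  interpret perm_group "loops a b L" by (rule loops_group[OF fin])
  define \<eta> where "\<eta> = (\<lambda>p. if p \<in> L then track a b (ds @ es) L p else p)"
  have \<eta>: "\<eta> \<in> loops a b L" unfolding \<eta>_def
    by (rule loopsI) (simp_all add: fin shape_append ds es)
  have \<eta>_eq: "\<eta> p = ?\<beta> (?\<tau> p)" if "p \<in> L" for p using that by (simp add: \<eta>_def track_append ds)
  have \<tau>_mem: "?\<tau> p \<in> S" if "p \<in> L" for p using that im by auto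
  have \<beta>_mem: "?\<beta> q \<in> L" if "q \<in> S" for q using that im by auto
  have perm: "\<pi> permutes L" if "\<pi> \<in> loops a b L" for \<pi> using that by (simp add: loops_def)
  show "loops a b S = map_permutation L ?\<tau> ` loops a b L"
  proof (intro equalityI subsetI)
    fix \<rho> assume \<rho>: "\<rho> \<in> loops a b S"
    then obtain ws where r: "\<rho> permutes S" "shape a b ws S = S" "\<forall>p\<in>S. track a b ws S p = \<rho> p"
      by (auto simp: loops_def)
    define l where "l = (\<lambda>p. if p \<in> L then track a b (ds @ ws @ es) L p else p)"
    have l: "l \<in> loops a b L" unfolding l_def
      by (rule loopsI) (simp_all add: fin shape_append ds es r)
    have l_eq: "l p = ?\<beta> (\<rho> (?\<tau> p))" if "p \<in> L" for p
      using that r \<tau>_mem by (simp add: l_def track_append ds)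
    let ?\<pi> = "inv' \<eta> \<circ> l"
    have \<pi>: "?\<pi> \<in> loops a b L" by (intro comp_mem inv_mem \<eta> l)
    have "map_permutation L ?\<tau> ?\<pi> = \<rho>"
    proof
      fix q
      show "map_permutation L ?\<tau> ?\<pi> q = \<rho> q"
      proof (cases "q \<in> S")
        case True
        then obtain p where p: "p \<in> L" "q = ?\<tau> p" using im(1) by blast
        have "\<rho> q \<in> S" using True r(1) by (simp add: permutes_in_image)
        then obtain p' where p': "p' \<in> L" "\<rho> q = ?\<tau> p'" using im(1) by blast
        have "l p = \<eta> p'" using l_eq[OF p(1)] \<eta>_eq[OF p'(1)] p p' by simp
        then have "?\<pi> p = p'" using bij_mem[OF \<eta>] by (simp add: bij_is_inj inv_f_f)
        then show ?thesis using p p' map_permutation_apply[OF inj p(1), of ?\<pi>] by simp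
      next
        case False
        then show ?thesis using map_permutation_permutes[OF bij perm[OF \<pi>]] r(1)
          by (simp add: permutes_not_in)
      qed
    qed
    then show "\<rho> \<in> map_permutation L ?\<tau> ` loops a b L" using \<pi> by blast
  next
    fix \<rho> assume "\<rho> \<in> map_permutation L ?\<tau> ` loops a b L"
    then obtain \<pi> where \<pi>: "\<pi> \<in> loops a b L" "\<rho> = map_permutation L ?\<tau> \<pi>" by auto
    let ?\<pi>' = "\<pi> \<circ> inv' \<eta>"
    have "?\<pi>' \<in> loops a b L" by (intro comp_mem inv_mem \<eta> \<pi>)
    then obtain ws where w: "shape a b ws L = L" "\<forall>p\<in>L. track a b ws L p = ?\<pi>' p"
      by (auto simp: loops_def)
    have per: "\<rho> permutes S" unfolding \<pi>(2) by (rule map_permutation_permutes[OF bij perm[OF \<pi>(1)]])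
    have "track a b (es @ ws @ ds) S q = \<rho> q" if q: "q \<in> S" for q
    proof -
      obtain p where p: "p \<in> L" "q = ?\<tau> p" using q im(1) by blast
      have "track a b (es @ ws @ ds) S q = ?\<tau> (?\<pi>' (?\<beta> (?\<tau> p)))"
        using w \<beta>_mem[OF q] p by (simp add: track_append es)
      also have "\<dots> = ?\<tau> (\<pi> p)"
        unfolding \<eta>_eq[OF p(1), symmetric] using bij_mem[OF \<eta>] by (simp add: bij_is_inj inv_f_f)
      also have "\<dots> = \<rho> q" using p \<pi> map_permutation_apply[OF inj p(1), of \<pi>] by simp
      finally show ?thesis .
    qed
    moreover have "shape a b (es @ ws @ ds) S = S" by (simp add: shape_append es ds w)
    ultimately show "\<rho> \<in> loops a b S" using per by (auto simp: loops_def)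
  qed
qed

section \<open>Parity of the movements between shapes\<close>

context young
begin

definition full_col_count :: int where "full_col_count = r (b - 1)"
definition full_row_count :: int where "full_row_count = c (a - 1)"

text \<open>Empty unless both factors are nonempty, in accordance with the definition of the core.\<close>

definition core_cells :: "cell set" where
  "core_cells = {a - full_col_count..<full_col_count} \<times> {b - full_row_count..<full_row_count}"

text \<open>Relates two names of a token in row \<open>j\<close> under the offsets \<open>s\<close>:
  its position \<open>i\<close> within the row and the rank of its column.\<close>

definition row_perm :: "(int \<Rightarrow> int) \<Rightarrow> cell \<Rightarrow> cell" where
  "row_perm s = (\<lambda>(i, j). if (i, j) \<in> diagram then (rank a s (i + s (r j)), j) else (i, j))"

end

context young
begin

definition col_perm :: "(int \<Rightarrow> int) \<Rightarrow> cell \<Rightarrow> cell" where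
  "col_perm t = map_permutation T.diagram prod.swap (T.row_perm t)"

definition ranks :: "(int \<Rightarrow> int) \<Rightarrow> (int \<Rightarrow> int) \<Rightarrow> cell \<Rightarrow> cell" where
  "ranks s t = (\<lambda>(x, y). (rank a s x, rank b t y))"

lemma full_col_count_bounds: "1 \<le> full_col_count" "full_col_count \<le> a"
  using r_bounds[of "b - 1"] b_pos by (auto simp: full_col_count_def)

lemma T_full: "T.full_col_count = full_row_count" "T.full_row_count = full_col_count"
  by (auto simp: full_row_count_def full_col_count_def T.full_row_count_def T.full_col_count_def)

lemma row_perm_permutes:
  assumes s: "offsets a s"
  shows "row_perm s permutes diagram"
proof (rule bij_imp_permutes)
  have im: "row_perm s ` diagram \<subseteq> diagram"
  proof
    fix p assume "p \<in> row_perm s ` diagram"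
    then obtain i j where ij: "(i, j) \<in> diagram" "p = (rank a s (i + s (r j)), j)"
      by (auto simp: row_perm_def)
    then have j: "0 \<le> i" "i < r j" "0 \<le> j" "j < b" by (auto simp: diagram_def)
    have "rank a s (i + s (r j)) < r j"
      using rank_less_iff[OF s, of "r j" "i + s (r j)"] r_bounds[OF j(3,4)] j by auto
    then show "p \<in> diagram" using ij j rank_nonneg r_bounds[OF j(3,4)] by (auto simp: diagram_def)
  qed
  have "inj_on (row_perm s) diagram"
  proof (rule inj_onI)
    fix p q assume pq: "p \<in> diagram" "q \<in> diagram" "row_perm s p = row_perm s q"
    obtain i j i' j' where e: "p = (i, j)" "q = (i', j')" by (cases p; cases q)
    have j: "j' = j" and rk: "rank a s (i + s (r j)) = rank a s (i' + s (r j))"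
      using pq by (auto simp: e row_perm_def)
    have "0 \<le> i" "i < r j" "0 \<le> i'" "i' < r j" "0 \<le> j" "j < b" using pq by (auto simp: e j diagram_def)
    then have "i + s (r j) = i' + s (r j)"
      using rank_inj[OF s _ _ _ _ rk] offsets_bounds[OF s, of "r j"] r_bounds[of j] by auto
    then show "p = q" by (simp add: e j)
  qed
  then show "bij_betw (row_perm s) diagram diagram"
    using im finite_diagram by (simp add: bij_betw_def endo_inj_surj)
  show "row_perm s p = p" if "p \<notin> diagram" for p using that by (cases p) (auto simp: row_perm_def)
qed

text \<open>In the coordinates given by the ranks, the parity of a token movement between two shapes is
  a function of the shapes alone.\<close>

definition parity_preserving ::
    "(int \<Rightarrow> int) \<Rightarrow> (int \<Rightarrow> int) \<Rightarrow> (cell \<Rightarrow> cell) \<Rightarrow> (int \<Rightarrow> int) \<Rightarrow> (int \<Rightarrow> int) \<Rightarrow> bool" where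
  "parity_preserving s t F s' t' \<longleftrightarrow> F ` cells s t = cells s' t' \<and> (\<exists>\<sigma>. \<sigma> permutes diagram \<and>
     sign \<sigma> = sign (row_perm s) * sign (row_perm s') * sign (col_perm t) * sign (col_perm t') \<and>
     (\<forall>p\<in>cells s t. ranks s' t' (F p) = \<sigma> (ranks s t p)))"

lemma ranks_mem: "p \<in> cells s t \<Longrightarrow> offsets a s \<Longrightarrow> offsets b t \<Longrightarrow> ranks s t p \<in> diagram"
  using rank_less rank_nonneg by (auto simp: cells_def ranks_def diagram_def)

lemma parity_preserving_trans:
  assumes F: "parity_preserving s t F s' t'" and G: "parity_preserving s' t' G s'' t''"
  shows "parity_preserving s t (G \<circ> F) s'' t''"
proof -
  obtain \<sigma> \<sigma>' where 1: "F ` cells s t = cells s' t'" "\<sigma> permutes diagram"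
      "sign \<sigma> = sign (row_perm s) * sign (row_perm s') * sign (col_perm t) * sign (col_perm t')"
      "\<forall>p\<in>cells s t. ranks s' t' (F p) = \<sigma> (ranks s t p)"
    and 2: "G ` cells s' t' = cells s'' t''" "\<sigma>' permutes diagram"
      "sign \<sigma>' = sign (row_perm s') * sign (row_perm s'') * sign (col_perm t') * sign (col_perm t'')"
      "\<forall>p\<in>cells s' t'. ranks s'' t'' (G p) = \<sigma>' (ranks s' t' p)"
    using F G unfolding parity_preserving_def by blast
  have "permutation \<sigma>" "permutation \<sigma>'"
    using 1(2) 2(2) finite_diagram by (auto simp: permutation_permutes)
  then have "sign (\<sigma>' \<circ> \<sigma>) = sign (row_perm s) * sign (row_perm s'') * sign (col_perm t) * sign (col_perm t'')"
    unfolding sign_compose[OF \<open>permutation \<sigma>'\<close> \<open>permutation \<sigma>\<close>] 1(3) 2(3)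
    by (simp add: sign_def)
  moreover have "(G \<circ> F) ` cells s t = cells s'' t''" using 1(1) 2(1) by (metis image_comp)
  moreover have "ranks s'' t'' ((G \<circ> F) p) = (\<sigma>' \<circ> \<sigma>) (ranks s t p)" if "p \<in> cells s t" for p
  proof -
    have "F p \<in> cells s' t'" using that 1(1) by blast
    then show ?thesis using that 1(4) 2(4) by simp
  qed
  ultimately show ?thesis
    unfolding parity_preserving_def using permutes_compose[OF 1(2) 2(2)] by blast
qed

lemma parity_preserving_cong:
  assumes "parity_preserving s t F s' t'" "\<And>p. p \<in> cells s t \<Longrightarrow> F p = G p"
  shows "parity_preserving s t G s' t'"
proof -
  have "G ` cells s t = F ` cells s t" using assms(2) by (metis (no_types, lifting) image_cong)
  then show ?thesis using assms unfolding parity_preserving_def by metis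
qed

text \<open>Position within the row and row rank are unchanged, so in rank coordinates the movement
  is \<open>row_perm s'\<close> after the inverse of \<open>row_perm s\<close>; the factors for
  \<open>t\<close> enter as a square.\<close>

lemma parity_preserving_hshift:
  assumes s: "offsets a s" and s': "offsets a s'" and t: "offsets b t"
  shows "parity_preserving s t (hshift t s s') s' t"
proof -
  let ?\<sigma> = "row_perm s' \<circ> inv' (row_perm s)"
  note per = row_perm_permutes[OF s] row_perm_permutes[OF s']
  have "permutation (row_perm s)" "permutation (row_perm s')"
    using per finite_diagram by (auto simp: permutation_permutes)
  then have "sign ?\<sigma> = sign (row_perm s) * sign (row_perm s') * sign (col_perm t) * sign (col_perm t)"
    by (simp add: sign_compose permutation_inverse sign_inverse mult.assoc)
  moreover have "?\<sigma> permutes diagram" using per by (intro permutes_compose permutes_inv)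
  moreover have "ranks s' t (hshift t s s' p) = ?\<sigma> (ranks s t p)" if p: "p \<in> cells s t" for p
  proof -
    obtain x y where xy: "p = (x, y)" by (cases p)
    let ?j = "rank b t y"
    let ?l = "r ?j"
    have y: "0 \<le> y" "y < b" and x: "s ?l \<le> x" "x < s ?l + ?l"
      using p mem_cells[OF s t] by (auto simp: xy)
    note l = r_rank_bounds[OF t y]
    have d: "(x - s ?l, ?j) \<in> diagram"
      using x l rank_nonneg[of b t y] rank_less[OF t y] by (auto simp: diagram_def)
    then have "row_perm s (x - s ?l, ?j) = ranks s t p" by (simp add: row_perm_def ranks_def xy)
    then have "inv' (row_perm s) (ranks s t p) = (x - s ?l, ?j)"
      using permutes_inj[OF per(1)] by (metis inv_f_f)
    then show ?thesis using d by (simp add: row_perm_def ranks_def xy hshift_def algebra_simps)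
  qed
  ultimately show ?thesis
    unfolding parity_preserving_def using hshift_image[OF s s' t] by blast
qed

end

context young
begin

lemma swap_bij: "bij_betw prod.swap T.diagram diagram" "bij_betw prod.swap diagram T.diagram"
  using diagram_transpose T.diagram_transpose by (auto simp: bij_betw_def)

lemma sign_col_perm:
  assumes "offsets b t"
  shows "sign (col_perm t) = sign (T.row_perm t)"
  unfolding col_perm_def
  by (rule sign_map_permutation) (use T.row_perm_permutes[OF assms] T.finite_diagram in \<open>auto intro: inj_onI\<close>)

end

context young
begin

lemma parity_preserving_transpose:
  assumes F: "T.parity_preserving t s F t' s'"
    and o: "offsets a s" "offsets b t" "offsets a s'" "offsets b t'"
  shows "parity_preserving s t (prod.swap \<circ> F \<circ> prod.swap) s' t'"
proof -
  obtain \<sigma> where 1: "F ` T.cells t s = T.cells t' s'" "\<sigma> permutes T.diagram"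
      "sign \<sigma> = sign (T.row_perm t) * sign (T.row_perm t') * sign (T.col_perm s) * sign (T.col_perm s')"
      "\<forall>p\<in>T.cells t s. T.ranks t' s' (F p) = \<sigma> (T.ranks t s p)"
    using F unfolding T.parity_preserving_def by blast
  let ?\<sigma> = "map_permutation T.diagram prod.swap \<sigma>"
  have inj: "inj_on prod.swap T.diagram" by (auto intro: inj_onI)
  have "?\<sigma> permutes diagram" by (rule map_permutation_permutes[OF swap_bij(1) 1(2)])
  moreover have "sign ?\<sigma> = sign (row_perm s) * sign (row_perm s') * sign (col_perm t) * sign (col_perm t')"
    using sign_map_permutation[OF inj 1(2) T.finite_diagram] 1(3) sign_col_perm[OF o(2)] sign_col_perm[OF o(4)]
      T.sign_col_perm[OF o(1)] T.sign_col_perm[OF o(3)] by (simp add: mult_ac)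
  moreover have "(prod.swap \<circ> F \<circ> prod.swap) ` cells s t = cells s' t'"
  proof -
    have "(prod.swap \<circ> F \<circ> prod.swap) ` cells s t = prod.swap ` F ` prod.swap ` cells s t"
      by (simp add: image_comp o_assoc)
    also have "\<dots> = prod.swap ` prod.swap ` cells s' t'" using 1(1) o by (simp add: cells_transpose)
    finally show ?thesis by (simp add: image_image)
  qed
  moreover have "ranks s' t' ((prod.swap \<circ> F \<circ> prod.swap) p) = ?\<sigma> (ranks s t p)" if p: "p \<in> cells s t" for p
  proof -
    have q: "prod.swap p \<in> T.cells t s" using p cells_transpose[OF o(1,2)] by blast
    have rk: "ranks s t q = prod.swap (T.ranks t s (prod.swap q))" for s t q
      by (cases q) (simp add: ranks_def T.ranks_def)
    have "?\<sigma> (ranks s t p) = prod.swap (\<sigma> (T.ranks t s (prod.swap p)))"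
      unfolding rk using T.ranks_mem[OF q o(2,1)] by (rule map_permutation_apply[OF inj])
    then show ?thesis using 1(4) q by (simp add: rk)
  qed
  ultimately show ?thesis unfolding parity_preserving_def by blast
qed

lemma parity_preserving_vshift:
  assumes "offsets a s" "offsets b t" "offsets b t'"
  shows "parity_preserving s t (vshift s t t') s t'"
  unfolding vshift_def using assms
  by (intro parity_preserving_transpose T.parity_preserving_hshift)

lemma parity_preserving_track:
  assumes "offsets a s" "offsets b t"
  shows "\<exists>s' t'. offsets a s' \<and> offsets b t' \<and> shape a b ds (cells s t) = cells s' t' \<and>
    parity_preserving s t (track a b ds (cells s t)) s' t'"
  using assms
proof (induction ds arbitrary: s t)
  case Nil
  have "parity_preserving s t (track a b [] (cells s t)) s t"
    using parity_preserving_cong[OF parity_preserving_hshift[OF Nil(1,1,2)]] by simp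
  then show ?case using Nil shape_Nil by blast
next
  case (Cons d ds)
  obtain s' t' F where 1: "offsets a s'" "offsets b t'" "\<And>p. p \<in> cells s t \<Longrightarrow> move a b d (cells s t) p = F p"
    "F ` cells s t = cells s' t'" "t' = t \<and> F = hshift t s s' \<or> s' = s \<and> F = vshift s t t'"
    using moves_state[OF Cons.prems, of d] by metis
  have im: "move a b d (cells s t) ` cells s t = cells s' t'" using 1(3,4) by (metis (no_types, lifting) image_cong)
  have F: "parity_preserving s t F s' t'"
    using 1(1,2,5) Cons.prems parity_preserving_hshift parity_preserving_vshift by auto
  obtain s'' t'' where 2: "offsets a s''" "offsets b t''" "shape a b ds (cells s' t') = cells s'' t''"
    "parity_preserving s' t' (track a b ds (cells s' t')) s'' t''"
    using Cons.IH[OF 1(1,2)] by blast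
  have "parity_preserving s t (track a b (d # ds) (cells s t)) s'' t''"
    by (rule parity_preserving_cong[OF parity_preserving_trans[OF F 2(4)]]) (simp only: track.simps im 1(3) o_apply)
  moreover have "shape a b (d # ds) (cells s t) = cells s'' t''" using 2(3) by (simp only: shape_Cons im)
  ultimately show ?case using 2(1,2) by blast
qed

text \<open>Different offsets may describe the diagram, since only the lengths of existing rows
  count; on those lengths they vanish.\<close>

lemma offset_zero_of_diagram:
  assumes s: "offsets a s" and t: "offsets b t" and eq: "cells s t = diagram" and p: "p \<in> diagram"
  shows "hshift t s (\<lambda>_. 0) p = p"
proof -
  obtain x y where xy: "p = (x, y)" by (cases p)
  have y: "0 \<le> y" "y < b" using p by (auto simp: xy diagram_def)
  note l = r_rank_bounds[OF t y]
  have "(0, y) \<in> diagram" using p a_pos by (auto simp: xy diagram_def)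
  then have "s (r (rank b t y)) \<le> 0" using eq mem_cells[OF s t, of 0 y] by auto
  then have "s (r (rank b t y)) = 0" using offsets_bounds[OF s l] by simp
  then show ?thesis by (simp add: xy hshift_def)
qed

end

context young
begin

text \<open>A closed walk may end with nonzero offsets that still describe the diagram. Resetting
  them to zero, first \<open>s\<close> and then \<open>t\<close>, moves no token, and then the sign
  becomes a product of squares.\<close>

lemma loops_even:
  assumes \<pi>: "\<pi> \<in> loops a b diagram"
  shows "evenperm \<pi>"
proof -
  let ?z = "\<lambda>_::int. 0::int"
  obtain ds where ds: "\<pi> permutes diagram" "shape a b ds diagram = diagram"
    "\<forall>p\<in>diagram. track a b ds diagram p = \<pi> p"
    using \<pi> by (auto simp: loops_def)
  obtain s t where st: "offsets a s" "offsets b t" "shape a b ds (cells ?z ?z) = cells s t"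
    "parity_preserving ?z ?z (track a b ds (cells ?z ?z)) s t"
    using parity_preserving_track[OF offsets_zero offsets_zero] by blast
  have eq: "cells s t = diagram" using st(3) ds(2) by (simp add: cells_zero)
  have eq0: "cells ?z t = diagram"
  proof -
    have "cells ?z t = hshift t s ?z ` diagram" using hshift_image[OF st(1) offsets_zero st(2)] eq by simp
    also have "\<dots> = diagram" using offset_zero_of_diagram[OF st(1,2) eq] by force
    finally show ?thesis .
  qed
  have h: "parity_preserving s t id ?z t"
    using parity_preserving_cong[OF parity_preserving_hshift[OF st(1) offsets_zero st(2)], of id]
      offset_zero_of_diagram[OF st(1,2) eq] eq by simp
  have "vshift ?z t ?z p = p" if "p \<in> diagram" for p
  proof -
    have "T.cells t ?z = T.diagram" using cells_transpose[OF offsets_zero st(2)] eq0 diagram_transpose by simp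
    moreover have "prod.swap p \<in> T.diagram" using that diagram_transpose by blast
    ultimately show ?thesis using T.offset_zero_of_diagram[OF st(2) offsets_zero] by (simp add: vshift_def)
  qed
  then have v: "parity_preserving ?z t id ?z ?z"
    using parity_preserving_cong[OF parity_preserving_vshift[OF offsets_zero st(2) offsets_zero], of id] eq0
    by simp
  have "parity_preserving ?z ?z (id \<circ> (id \<circ> track a b ds (cells ?z ?z))) ?z ?z"
    by (rule parity_preserving_trans[OF parity_preserving_trans[OF st(4) h] v])
  then obtain \<sigma> where \<sigma>: "\<sigma> permutes diagram"
    "sign \<sigma> = sign (row_perm ?z) * sign (row_perm ?z) * sign (col_perm ?z) * sign (col_perm ?z)"
    "\<forall>p\<in>diagram. ranks ?z ?z (track a b ds diagram p) = \<sigma> (ranks ?z ?z p)"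
    unfolding parity_preserving_def cells_zero by auto
  have rk: "ranks ?z ?z p = p" if "p \<in> diagram" for p
    using that by (auto simp: ranks_def diagram_def rank_zero)
  have "\<sigma> = \<pi>"
  proof
    fix p show "\<sigma> p = \<pi> p"
    proof (cases "p \<in> diagram")
      case True
      moreover from this have "\<pi> p \<in> diagram" using ds(1) by (simp add: permutes_in_image)
      ultimately show ?thesis using \<sigma>(3) ds(3) rk by metis
    next
      case False
      then show ?thesis using \<sigma>(1) ds(1) by (simp add: permutes_not_in)
    qed
  qed
  then show ?thesis using \<sigma>(2) by (simp add: mult.assoc sign_def split: if_splits)
qed

text \<open>At whatever offset, the interval of length \<open>full_row_count\<close> contains the
  line of a core cell. This line therefore always carries a full row, and full rows do not
  move.\<close>

lemma hshift_core:
  assumes s: "offsets a s" and s': "offsets a s'" and t: "offsets b t" and p: "p \<in> core_cells"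
  shows "hshift t s s' p = p"
proof -
  obtain x y where xy: "p = (x, y)" by (cases p)
  have fr: "1 \<le> full_row_count" "full_row_count \<le> b" using T.full_col_count_bounds by (simp_all add: T_full)
  have y: "b - full_row_count \<le> y" "y < full_row_count" using p by (auto simp: xy core_cells_def)
  have "rank b t y < full_row_count"
    using rank_less_iff[OF t fr, of y] offsets_bounds[OF t fr] y by linarith
  then have "a - 1 < r (rank b t y)"
    using dual[of "a - 1" "rank b t y"] a_pos rank_nonneg[of b t y] fr by (auto simp: full_row_count_def)
  moreover have "r (rank b t y) \<le> a"
    using r_bounds[of "rank b t y"] rank_nonneg[of b t y] \<open>rank b t y < full_row_count\<close> fr by auto
  ultimately have "r (rank b t y) = a" by simp
  then show ?thesis using offsets_full[OF s] offsets_full[OF s'] a_pos by (simp add: xy hshift_def)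
qed

lemma core_cells_transpose: "prod.swap ` core_cells = T.core_cells"
  by (auto simp: core_cells_def T.core_cells_def T_full mem_swap_pair)

end

context young
begin

lemma vshift_core:
  assumes "offsets a s" "offsets b t" "offsets b t'" "p \<in> core_cells"
  shows "vshift s t t' p = p"
proof -
  have "prod.swap p \<in> T.core_cells" using assms(4) core_cells_transpose by blast
  then show ?thesis using T.hshift_core[OF assms(2,3,1)] by (simp add: vshift_def)
qed

lemma core_subset_cells:
  assumes s: "offsets a s" and t: "offsets b t"
  shows "core_cells \<subseteq> cells s t"
proof
  fix p assume p: "p \<in> core_cells"
  obtain x y where xy: "p = (x, y)" by (cases p)
  have fr: "1 \<le> full_row_count" "full_row_count \<le> b" using T.full_col_count_bounds by (simp_all add: T_full)
  have "p \<in> diagram" using p full_col_count_bounds fr dual[of x y] r_antimono[of y "b - 1"]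
    by (auto simp: xy core_cells_def diagram_def full_col_count_def)
  then have "hshift (\<lambda>_. 0) (\<lambda>_. 0) s p \<in> cells s (\<lambda>_. 0)"
    using hshift_image[OF offsets_zero s offsets_zero] cells_zero by blast
  then have "p \<in> cells s (\<lambda>_. 0)" using hshift_core[OF offsets_zero s offsets_zero p] by simp
  then have "vshift s (\<lambda>_. 0) t p \<in> cells s t" using vshift_image[OF s offsets_zero t] by blast
  then show "p \<in> cells s t" using vshift_core[OF s offsets_zero t p] by simp
qed

lemma track_core:
  assumes "offsets a s" "offsets b t" "p \<in> core_cells"
  shows "track a b ds (cells s t) p = p"
  using assms(1,2)
proof (induction ds arbitrary: s t)
  case (Cons d ds)
  obtain s' t' F where 1: "offsets a s'" "offsets b t'" "\<And>p. p \<in> cells s t \<Longrightarrow> move a b d (cells s t) p = F p"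
    "F ` cells s t = cells s' t'" "t' = t \<and> F = hshift t s s' \<or> s' = s \<and> F = vshift s t t'"
    using moves_state[OF Cons.prems, of d] by metis
  have im: "move a b d (cells s t) ` cells s t = cells s' t'" using 1(3,4) by (metis (no_types, lifting) image_cong)
  have "F p = p" using 1 Cons.prems assms(3) hshift_core vshift_core by metis
  moreover have "p \<in> cells s t" using core_subset_cells[OF Cons.prems] assms(3) by blast
  ultimately have "move a b d (cells s t) p = p" using 1(3) by metis
  then show ?case using Cons.IH[OF 1(1,2)] by (simp add: im)
qed simp

lemma loops_noncore:
  assumes \<pi>: "\<pi> \<in> loops a b diagram"
  shows "\<pi> permutes (diagram - core_cells)"
proof (rule permutes_superset)
  show per: "\<pi> permutes diagram" using \<pi> by (simp add: loops_def)
  fix p assume "p \<in> diagram - (diagram - core_cells)"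
  then have p: "p \<in> core_cells" "p \<in> diagram" by auto
  obtain ds where "\<forall>p\<in>diagram. track a b ds diagram p = \<pi> p" using \<pi> by (auto simp: loops_def)
  then show "\<pi> p = p" using track_core[OF offsets_zero offsets_zero p(1), of ds] p by (simp add: cells_zero)
qed

lemma return_to_diagram:
  assumes "offsets a s" "offsets b t"
  shows "\<exists>es. shape a b es (cells s t) = diagram"
  using realizes_trans[OF realizes_to_zero[OF assms] realizes_vertical_to_right_offsets[OF offsets_zero assms(2), of 0]]
  by (auto simp: realizes_def right_offsets_0 cells_zero)

end

section \<open>Rotations of rectangles\<close>

text \<open>The boundary of \<open>{i..i + w} \<times> {0..h}\<close> without its upper right corner, clockwise from the
  upper left corner.\<close>

definition rect_path :: "int \<Rightarrow> int \<Rightarrow> int \<Rightarrow> int \<Rightarrow> cell" where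
  "rect_path i w h k = (if k < w then (i + k, h) else if k < w + h then (i + w, h - 1 - (k - w))
     else if k < 2 * w + h then (i + w - 1 - (k - w - h), 0) else (i, k - (2 * w + h) + 1))"

definition rect_rotation :: "int \<Rightarrow> int \<Rightarrow> int \<Rightarrow> cell \<Rightarrow> cell" where
  "rect_rotation i w h = (\<lambda>(x, y).
     if x = i \<and> 0 \<le> y \<and> y < h then (x, y + 1)
     else if y = h \<and> i \<le> x \<and> x < i + w - 1 then (x + 1, y)
     else if y = h \<and> x = i + w - 1 then (x + 1, y - 1)
     else if x = i + w \<and> 1 \<le> y \<and> y < h then (x, y - 1)
     else if y = 0 \<and> i < x \<and> x \<le> i + w then (x - 1, y)
     else (x, y))"

lemma rect_rotation_path:
  assumes "1 \<le> w" "1 \<le> h" "0 \<le> k" "k < 2 * w + 2 * h - 1"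
  shows "rect_rotation i w h (rect_path i w h k) = rect_path i w h (if k = 2 * w + 2 * h - 2 then 0 else k + 1)"
  using assms by (auto simp: rect_rotation_def rect_path_def)

lemma rect_path_inj:
  assumes "1 \<le> w" "1 \<le> h"
  shows "inj_on (rect_path i w h) {0..<2 * w + 2 * h - 1}"
  using assms by (auto simp: inj_on_def rect_path_def split: if_splits)

lemma rect_path_onto:
  assumes "1 \<le> w" "1 \<le> h" "rect_rotation i w h (x, y) \<noteq> (x, y)"
  shows "(x, y) \<in> rect_path i w h ` {0..<2 * w + 2 * h - 1}"
proof -
  consider "x = i" "1 \<le> y" "y < h" | "y = h" "i \<le> x" "x < i + w" | "x = i + w" "0 \<le> y" "y < h"
    | "y = 0" "i \<le> x" "x < i + w"
    using assms by (fastforce simp: rect_rotation_def split: if_splits)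
  then show ?thesis
  proof cases
    case 1
    then show ?thesis using assms by (intro image_eqI[of _ _ "2 * w + h + y - 1"]) (auto simp: rect_path_def)
  next
    case 2
    then show ?thesis using assms by (intro image_eqI[of _ _ "x - i"]) (auto simp: rect_path_def)
  next
    case 3
    then show ?thesis using assms by (intro image_eqI[of _ _ "w + h - 1 - y"]) (auto simp: rect_path_def)
  next
    case 4
    then show ?thesis using assms by (intro image_eqI[of _ _ "2 * w + h - 1 - (x - i)"]) (auto simp: rect_path_def)
  qed
qed

section \<open>The round of pushes that rotates a rectangle\<close>

context young
begin

text \<open>After \<open>i\<close> pushes to the right, for \<open>i\<close> below
  \<open>a - full_col_count\<close>, exactly the rows below this height touch the right
  border.\<close>

definition height :: "int \<Rightarrow> int" where "height i = c (a - 1 - i)"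

definition push_out :: "int \<Rightarrow> cell \<Rightarrow> cell" where
  "push_out i = (\<lambda>(x, y). (x + min i (a - r y), y))"

definition pull_back :: "int \<Rightarrow> cell \<Rightarrow> cell" where
  "pull_back i = (\<lambda>(x, y). (x - min i (a - r y), y))"

text \<open>The rectangle is visible only after \<open>i\<close> pushes to the right; its boundary
  tokens are named here by their places in the diagram.\<close>

definition token_path :: "int \<Rightarrow> int \<Rightarrow> cell" where
  "token_path i k = pull_back i (rect_path i full_col_count (height i) k)"

lemma height_bounds:
  assumes "0 \<le> i" "i < a - full_col_count"
  shows "1 \<le> height i" "height i < b"
proof -
  have x: "0 \<le> a - 1 - i" "a - 1 - i < a" using assms full_col_count_bounds by auto
  show "1 \<le> height i" using c_bounds[OF x] by (simp add: height_def)
  have "\<not> b - 1 < c (a - 1 - i)"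
    using dual[OF x, of "b - 1"] b_pos assms by (auto simp: full_col_count_def)
  then show "height i < b" by (simp add: height_def)
qed

lemma less_height_iff:
  assumes "0 \<le> i" "i < a - full_col_count" "0 \<le> y" "y < b"
  shows "y < height i \<longleftrightarrow> a - r y \<le> i"
  using dual[of "a - 1 - i" y] assms full_col_count_bounds by (auto simp: height_def)

lemma full_col_count_le: "0 \<le> y \<Longrightarrow> y < b \<Longrightarrow> full_col_count \<le> r y"
  using r_antimono[of y "b - 1"] by (simp add: full_col_count_def)

lemma right_offsets_apply: "1 \<le> l \<Longrightarrow> l \<le> n \<Longrightarrow> right_offsets n i l = min i (n - l)"
  by (simp add: right_offsets_def)

text \<open>A column has room above iff it is not full, and the full columns are those in the
  interval of length \<open>full_col_count\<close>.\<close>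

lemma vshift_unit:
  assumes s: "offsets a s" and x: "0 \<le> x" "x < a"
  shows "vshift s (right_offsets b 0) (right_offsets b 1) (x, y) =
      (x, if s full_col_count \<le> x \<and> x < s full_col_count + full_col_count then y else y + 1)"
    and "vshift s (right_offsets b 1) (right_offsets b 0) (x, y) =
      (x, if s full_col_count \<le> x \<and> x < s full_col_count + full_col_count then y else y - 1)"
proof -
  let ?k = "rank a s x"
  have k: "0 \<le> ?k" "?k < a" using rank_nonneg rank_less[OF s x] by auto
  have "c ?k = b \<longleftrightarrow> ?k < full_col_count"
    using dual[OF k, of "b - 1"] b_pos c_bounds[OF k] by (auto simp: full_col_count_def)
  also have "\<dots> \<longleftrightarrow> s full_col_count \<le> x \<and> x < s full_col_count + full_col_count"
    by (rule rank_less_iff[OF s full_col_count_bounds])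
  finally show "vshift s (right_offsets b 0) (right_offsets b 1) (x, y) =
      (x, if s full_col_count \<le> x \<and> x < s full_col_count + full_col_count then y else y + 1)"
    "vshift s (right_offsets b 1) (right_offsets b 0) (x, y) =
      (x, if s full_col_count \<le> x \<and> x < s full_col_count + full_col_count then y else y - 1)"
    using c_bounds[OF k] by (auto simp: vshift_eq right_offsets_apply)
qed

lemma rank_unit:
  assumes "0 \<le> y" "y < b"
  shows "rank b (right_offsets b 1) y = (if y = 0 then b - 1 else y - 1)"
proof -
  have o: "offsets b (right_offsets b 1)" by (rule offsets_right_offsets) simp
  have less: "rank b (right_offsets b 1) y < l \<longleftrightarrow> l = b \<or> 1 \<le> y \<and> y \<le> l" if "1 \<le> l" "l \<le> b" for l
    using rank_less_iff[OF o that, of y] that assms by (auto simp: right_offsets_apply)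
  have bounds: "0 \<le> rank b (right_offsets b 1) y" "rank b (right_offsets b 1) y < b"
    using rank_nonneg rank_less[OF o assms] by auto
  show ?thesis
  proof (cases "y = 0")
    case True
    then show ?thesis using less[of "b - 1"] bounds by (cases "b = 1") auto
  next
    case False
    then show ?thesis using less[of y] less[of "y - 1"] bounds assms by (cases "y = 1") auto
  qed
qed

definition corner_move :: "int \<Rightarrow> cell \<Rightarrow> cell" where
  "corner_move i = hshift (right_offsets b 0) (right_offsets a i) (right_offsets a 0) \<circ>
     (vshift (right_offsets a i) (right_offsets b 1) (right_offsets b 0) \<circ>
     (hshift (right_offsets b 1) (right_offsets a (i + 1)) (right_offsets a i) \<circ>
     (vshift (right_offsets a (i + 1)) (right_offsets b 0) (right_offsets b 1) \<circ>
     hshift (right_offsets b 0) (right_offsets a 0) (right_offsets a (i + 1)))))"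

text \<open>Each leg is realized by a detour through offset zero, which is harmless because such a
  movement depends only on the offsets at its ends.\<close>

lemma realizes_corner_move:
  assumes "0 \<le> i"
  shows "realizes (right_offsets a 0) (right_offsets b 0) (corner_move i) (right_offsets a 0) (right_offsets b 0)"
  unfolding corner_move_def
  by (intro realizes_trans[OF realizes_trans[OF realizes_trans[OF realizes_trans[
      OF realizes_to_right_offsets realizes_vertical_to_right_offsets] realizes_to_right_offsets]
      realizes_vertical_to_right_offsets] realizes_to_right_offsets] offsets_right_offsets)
    (use assms in auto)

text \<open>Seen in the state after \<open>i\<close> pushes to the right, the walk is a single round
  right, up, left, down. A token whose steps cancel returns to its cell; those whose steps do not
  cancel lie on the boundary of the rectangle.\<close>

lemma corner_move_eq:
  assumes i: "0 \<le> i" "i < a - full_col_count" and p: "p \<in> diagram"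
  shows "corner_move i p = pull_back i (rect_rotation i full_col_count (height i) (push_out i p))"
proof -
  let ?w = full_col_count and ?h = "height i"
  obtain x0 y where p0: "p = (x0, y)" by (cases p)
  have y: "0 \<le> y" "y < b" and x0: "0 \<le> x0" "x0 < r y" using p by (auto simp: p0 diagram_def)
  have hb: "1 \<le> ?h" "?h < b" using height_bounds[OF i] by auto
  have w: "1 \<le> ?w" "?w \<le> a" using full_col_count_bounds .
  define x where "x = x0 + min i (a - r y)"
  have rb: "1 \<le> r z" "r z \<le> a" "?w \<le> r z" if "0 \<le> z" "z < b" for z
    using r_bounds[of z] full_col_count_le[of z] that by auto
  have oa: "offsets a (right_offsets a j)" if "0 \<le> j" for j using that by (rule offsets_right_offsets)
  have rk0: "rank b (right_offsets b 0) z = z" if "0 \<le> z" "z < b" for z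
    using that by (simp add: right_offsets_0 rank_zero)
  have lt: "z < ?h \<longleftrightarrow> a - r z \<le> i" if "0 \<le> z" "z < b" for z using less_height_iff[OF i that] .
  have o_i: "right_offsets a i ?w = i" "right_offsets a (i + 1) ?w = i + 1"
    using i w by (auto simp: right_offsets_apply)
  \<comment> \<open>The extra step of row \<open>z\<close> in the push number \<open>i + 1\<close>:
    only the rows from \<open>height i\<close> upward still have room.\<close>
  define d where "d z = (if z < ?h then 0 else 1 :: int)" for z
  have dd: "min (i + 1) (a - r z) = min i (a - r z) + d z" if "0 \<le> z" "z < b" for z
    using lt[OF that] by (auto simp: d_def)
  have xr: "if y < ?h then a - r y \<le> x \<and> x < a else i \<le> x \<and> x < i + r y"
    using lt[OF y] x0 rb[OF y] by (auto simp: x_def)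
  have x1: "0 \<le> x + d y" "x + d y < a"
    using xr rb[OF y] i lt[OF y] by (auto simp: d_def split: if_splits)
  have A: "hshift (right_offsets b 0) (right_offsets a 0) (right_offsets a (i + 1)) p = (x + d y, y)"
    using rb[OF y] dd[OF y] i by (simp add: p0 hshift_def rk0[OF y] right_offsets_apply x_def)
  define y1 where "y1 = (if i + 1 \<le> x + d y \<and> x + d y < i + 1 + ?w then y else y + 1)"
  have B: "vshift (right_offsets a (i + 1)) (right_offsets b 0) (right_offsets b 1) (x + d y, y) = (x + d y, y1)"
    using vshift_unit(1)[OF oa x1, of "i + 1" y] i by (simp add: o_i y1_def)
  have rlast: "r (b - 1) = ?w" by (simp add: full_col_count_def)
  \<comment> \<open>The top row covers exactly the full columns at this moment, so the push up does
    not lift it out of the box.\<close>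
  have y1b: "0 \<le> y1" "y1 < b"
  proof -
    show "0 \<le> y1" using y by (simp add: y1_def)
    show "y1 < b"
    proof (cases "y = b - 1")
      case True
      then show ?thesis using xr hb rlast by (auto simp: y1_def d_def split: if_splits)
    qed (use y in \<open>auto simp: y1_def\<close>)
  qed
  define e where "e = (if y1 = 0 then 1 else d (y1 - 1))"
  have C: "hshift (right_offsets b 1) (right_offsets a (i + 1)) (right_offsets a i) (x + d y, y1) = (x + d y - e, y1)"
  proof (cases "y1 = 0")
    case True
    then show ?thesis using rank_unit[OF y1b] rlast w i by (simp add: hshift_def e_def o_i)
  next
    case False
    then have z: "0 \<le> y1 - 1" "y1 - 1 < b" using y1b by auto
    show ?thesis using rank_unit[OF y1b] False rb[OF z] dd[OF z]
      by (simp add: hshift_def e_def right_offsets_apply)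
  qed
  define x2 where "x2 = x + d y - e"
  have x2: "0 \<le> x2" "x2 < a"
    using xr rb[OF y] i x1 hb y by (auto simp: x2_def e_def d_def y1_def split: if_splits)
  have D: "vshift (right_offsets a i) (right_offsets b 1) (right_offsets b 0) (x2, y1) =
      (x2, if i \<le> x2 \<and> x2 < i + ?w then y1 else y1 - 1)"
    using vshift_unit(2)[OF oa x2, of i y1] i by (simp add: o_i)
  have rot: "rect_rotation i ?w ?h (x, y) = (x2, if i \<le> x2 \<and> x2 < i + ?w then y1 else y1 - 1)"
    using xr y hb w i by (auto simp: rect_rotation_def x2_def e_def d_def y1_def split: if_splits)
  have yb: "0 \<le> snd (rect_rotation i ?w ?h (x, y))" "snd (rect_rotation i ?w ?h (x, y)) < b"
    using y hb by (auto simp: rect_rotation_def)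
  have E: "hshift (right_offsets b 0) (right_offsets a i) (right_offsets a 0) q = pull_back i q"
    if "0 \<le> snd q" "snd q < b" for q
    using that rb[of "snd q"] i by (cases q) (simp add: hshift_def pull_back_def rk0 right_offsets_apply)
  show ?thesis
    unfolding corner_move_def o_apply A B C x2_def[symmetric] D rot[symmetric] E[OF yb]
    by (simp add: push_out_def p0 x_def)
qed

lemma pull_push: "pull_back i (push_out i p) = p" "push_out i (pull_back i p) = p"
  by (auto simp: pull_back_def push_out_def split: prod.splits)

lemma token_path_mem:
  assumes i: "0 \<le> i" "i < a - full_col_count" and k: "0 \<le> k" "k < 2 * full_col_count + 2 * height i - 1"
  shows "token_path i k \<in> diagram"
proof -
  let ?w = full_col_count and ?h = "height i"
  have hb: "1 \<le> ?h" "?h < b" using height_bounds[OF i] by auto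
  have w: "1 \<le> ?w" using full_col_count_bounds by simp
  obtain x y where xy: "rect_path i ?w ?h k = (x, y)" by fastforce
  have y: "0 \<le> y" "y \<le> ?h" "i \<le> x" "x \<le> i + ?w" "y = ?h \<longrightarrow> x < i + ?w"
    using xy k w hb by (auto simp: rect_path_def split: if_splits)
  have rb: "1 \<le> r y" "r y \<le> a" "?w \<le> r y" using r_bounds[of y] full_col_count_le[of y] y hb by auto
  have lt: "y < ?h \<longleftrightarrow> a - r y \<le> i" using less_height_iff[OF i, of y] y hb by auto
  show ?thesis using y rb lt i hb
    by (auto simp: token_path_def xy pull_back_def diagram_def)
qed

lemma corner_cycle:
  assumes i: "0 \<le> i" "i < a - full_col_count"
  obtains M where "M \<in> loops a b diagram" "\<And>p. p \<in> diagram \<Longrightarrow> M p = corner_move i p"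
    "is_cycle M (token_path i) (2 * full_col_count + 2 * height i - 1)"
proof -
  let ?w = full_col_count and ?h = "height i"
  let ?N = "2 * ?w + 2 * ?h - 1"
  have hb: "1 \<le> ?h" using height_bounds[OF i] by auto
  have w: "1 \<le> ?w" using full_col_count_bounds by simp
  have c0: "cells (right_offsets a 0) (right_offsets b 0) = diagram"
    by (simp add: right_offsets_0 cells_zero)
  obtain ds where ds: "shape a b ds diagram = diagram" "\<forall>p\<in>diagram. track a b ds diagram p = corner_move i p"
    using realizes_corner_move[OF i(1)] unfolding realizes_def c0 by blast
  define M where "M = (\<lambda>p. if p \<in> diagram then track a b ds diagram p else p)"
  have M: "M \<in> loops a b diagram" unfolding M_def by (rule loopsI[OF finite_diagram ds(1)])
  have Mp: "M p = corner_move i p" if "p \<in> diagram" for p using that ds(2) by (simp add: M_def)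
  have "is_cycle M (token_path i) ?N"
    unfolding is_cycle_def
  proof (intro conjI allI impI)
    show "0 < ?N" using w hb by simp
    show "inj_on (token_path i) {0..<?N}"
      using rect_path_inj[OF w hb, of i] pull_push(2) unfolding inj_on_def token_path_def by metis
  next
    fix k assume k: "0 \<le> k \<and> k < ?N"
    then have "M (token_path i k) = pull_back i (rect_rotation i ?w ?h (push_out i (token_path i k)))"
      using token_path_mem[OF i] corner_move_eq[OF i] Mp by simp
    also have "\<dots> = token_path i (if k = ?N - 1 then 0 else k + 1)"
      unfolding token_path_def pull_push(2) using rect_rotation_path[OF w hb, of k i] k by simp
    finally show "M (token_path i k) = token_path i (if k = ?N - 1 then 0 else k + 1)" .
  next
    fix p assume p: "p \<notin> token_path i ` {0..<?N}"
    show "M p = p"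
    proof (cases "p \<in> diagram")
      case True
      have "push_out i p \<notin> rect_path i ?w ?h ` {0..<?N}"
      proof
        assume "push_out i p \<in> rect_path i ?w ?h ` {0..<?N}"
        then obtain k where "k \<in> {0..<?N}" "push_out i p = rect_path i ?w ?h k" by blast
        then have "p = token_path i k" using pull_push(1)[of i p] by (simp add: token_path_def)
        then show False using p \<open>k \<in> {0..<?N}\<close> by blast
      qed
      then have "rect_rotation i ?w ?h (push_out i p) = push_out i p"
        using rect_path_onto[OF w hb] by (metis surj_pair)
      then show ?thesis using corner_move_eq[OF i True] Mp[OF True] pull_push by simp
    qed (simp add: M_def)
  qed
  then show thesis using that M Mp by blast
qed

end

section \<open>Generation of the alternating group\<close>

sublocale young \<subseteq> G: perm_group "loops a b diagram"
  by (rule loops_group[OF finite_diagram])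

context young
begin

definition rotation_support :: "int \<Rightarrow> cell set" where
  "rotation_support i = token_path i ` {0..<2 * full_col_count + 2 * height i - 1}"

lemma height_0: "height 0 = full_row_count"
  by (simp add: height_def full_row_count_def)

lemma height_mono:
  assumes "0 \<le> i" "i \<le> j" "j < a - full_col_count"
  shows "height i \<le> height j"
proof (rule ccontr)
  assume "\<not> height i \<le> height j"
  then have "a - r (height j) \<le> i"
    using less_height_iff[of i "height j"] height_bounds[of j] assms by simp
  then show False using less_height_iff[of j "height j"] height_bounds[of j] assms by simp
qed

lemma r_eq_a_iff: "0 \<le> y \<Longrightarrow> y < b \<Longrightarrow> r y = a \<longleftrightarrow> y < full_row_count"
  using dual[of "a - 1" y] a_pos r_bounds[of y] by (auto simp: full_row_count_def)

lemma token_path_0: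
  assumes w: "full_col_count < a" and k: "0 \<le> k" "k < 2 * full_col_count + 2 * full_row_count - 1"
  shows "token_path 0 k = rect_path 0 full_col_count full_row_count k"
proof -
  obtain x y where xy: "rect_path 0 full_col_count full_row_count k = (x, y)" by fastforce
  have hb: "1 \<le> full_row_count" "full_row_count < b" using height_bounds[of 0] w by (auto simp: height_0)
  have "0 \<le> y" "y < b" using xy k hb full_col_count_bounds by (auto simp: rect_path_def split: if_splits)
  then show ?thesis
    using r_bounds[of y] by (simp add: token_path_def height_0 xy pull_back_def)
qed

lemma token_path_1:
  assumes w: "2 \<le> a - full_col_count" and k: "0 \<le> k" "k < 2 * full_col_count + 2 * height 1 - 1"
  shows "token_path 1 k =
    (if k < full_col_count then (k, height 1)
     else if k < full_col_count + height 1 then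
       (if height 1 - 1 - (k - full_col_count) < full_row_count then 1 + full_col_count else full_col_count,
        height 1 - 1 - (k - full_col_count))
     else if k < 2 * full_col_count + height 1 then (full_col_count - (k - full_col_count - height 1), 0)
     else (if k - (2 * full_col_count + height 1) + 1 < full_row_count then 1 else 0,
        k - (2 * full_col_count + height 1) + 1))"
proof -
  have hb: "1 \<le> full_row_count" "full_row_count \<le> height 1" "height 1 < b"
    using height_bounds[of 0] height_bounds[of 1] height_mono[of 0 1] w by (auto simp: height_0)
  have "pull_back 1 (x, y) = (if y < full_row_count then x else x - 1, y)" if "0 \<le> y" "y < b" for x y
    using r_eq_a_iff[OF that] r_bounds[OF that] by (auto simp: pull_back_def)
  then show ?thesis
    using k hb full_col_count_bounds unfolding token_path_def rect_path_def by auto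
qed

text \<open>Row 0 is full and never moves, so the bottom side of the rectangle needs no pulling
  back. Consecutive rectangles are linked through it.\<close>

lemma rotation_support_row_0:
  assumes i: "0 \<le> i" "i < a - full_col_count" and x: "i \<le> x" "x \<le> i + full_col_count"
  shows "(x, 0) \<in> rotation_support i"
proof -
  have hb: "1 \<le> height i" "height i < b" using height_bounds[OF i] by auto
  have w: "1 \<le> full_col_count" using full_col_count_bounds by simp
  have pb: "pull_back i (x, 0) = (x, 0)" using i r_0 by (simp add: pull_back_def)
  show ?thesis
  proof (cases "x = i + full_col_count")
    case True
    have "token_path i (full_col_count + height i - 1) = (x, 0)"
      using pb hb w True by (simp add: token_path_def rect_path_def)
    then show ?thesis unfolding rotation_support_def using hb w
      by (intro image_eqI[of _ _ "full_col_count + height i - 1"]) auto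
  next
    case False
    have "token_path i (2 * full_col_count + height i - 1 - (x - i)) = (x, 0)"
      using pb hb w x False by (simp add: token_path_def rect_path_def)
    then show ?thesis unfolding rotation_support_def using hb w x False
      by (intro image_eqI[of _ _ "2 * full_col_count + height i - 1 - (x - i)"]) auto
  qed
qed

lemma origin_notin_rotation_support:
  assumes i: "0 < i" "i < a - full_col_count"
  shows "(0, 0) \<notin> rotation_support i"
proof
  assume "(0, 0) \<in> rotation_support i"
  then obtain k where k: "0 \<le> k" "k < 2 * full_col_count + 2 * height i - 1" "token_path i k = (0, 0)"
    by (auto simp: rotation_support_def)
  obtain x y where xy: "rect_path i full_col_count (height i) k = (x, y)" by fastforce
  have "i \<le> x" using xy k full_col_count_bounds by (auto simp: rect_path_def split: if_splits)
  then show False using k(3) i r_0 by (auto simp: token_path_def xy pull_back_def)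
qed

text \<open>The index is chosen so that pushing out carries the cell to column
  \<open>i + full_col_count\<close>, the right side of rectangle \<open>i\<close>.\<close>

lemma rotation_support_right:
  assumes p: "(x, y) \<in> diagram" and x: "full_col_count \<le> x"
  shows "\<exists>i. 0 \<le> i \<and> i < a - full_col_count \<and> (x, y) \<in> rotation_support i"
proof -
  let ?i = "x - full_col_count + (a - r y)"
  have y: "0 \<le> y" "y < b" "x < r y" using p by (auto simp: diagram_def)
  have rb: "r y \<le> a" using r_bounds[of y] y by auto
  have i: "0 \<le> ?i" "?i < a - full_col_count" using x y rb by auto
  have h: "y < height ?i" "height ?i < b" "1 \<le> height ?i"
    using less_height_iff[OF i y(1,2)] x height_bounds[OF i] by auto
  have w: "1 \<le> full_col_count" using full_col_count_bounds by simp
  have "token_path ?i (full_col_count + height ?i - 1 - y) = (x, y)"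
    using h w y x by (simp add: token_path_def rect_path_def pull_back_def)
  then have "(x, y) \<in> rotation_support ?i" unfolding rotation_support_def using h w y
    by (intro image_eqI[of _ _ "full_col_count + height ?i - 1 - y"]) auto
  then show ?thesis using i by blast
qed

lemma rotation_support_left:
  assumes x: "0 \<le> x" "x < a - full_col_count" and y: "0 \<le> y" "y < full_row_count"
  shows "(x, y) \<in> rotation_support x"
proof (cases "y = 0")
  case True
  then show ?thesis using rotation_support_row_0[OF x] full_col_count_bounds by simp
next
  case False
  have w: "1 \<le> full_col_count" using full_col_count_bounds by simp
  have h: "full_row_count \<le> height x" "height x < b" using height_mono[of 0 x] height_bounds[OF x] x by (auto simp: height_0)
  then have "r y = a" using r_eq_a_iff[of y] y by simp
  then have "token_path x (2 * full_col_count + height x + y - 1) = (x, y)"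
    using h w y x False by (simp add: token_path_def rect_path_def pull_back_def)
  then show ?thesis unfolding rotation_support_def using h w y False
    by (intro image_eqI[of _ _ "2 * full_col_count + height x + y - 1"]) auto
qed

lemma rotation_support_0:
  assumes w: "full_col_count < a"
  shows "rotation_support 0 = {(x, y). 0 \<le> x \<and> x \<le> full_col_count \<and> 0 \<le> y \<and> y \<le> full_row_count \<and>
     (x = 0 \<or> x = full_col_count \<or> y = 0 \<or> y = full_row_count) \<and> (x, y) \<noteq> (full_col_count, full_row_count)}"
    (is "_ = ?B")
proof -
  let ?w = full_col_count and ?h = full_row_count
  have hb: "1 \<le> ?h" using height_bounds[of 0] w by (auto simp: height_0)
  have wb: "1 \<le> ?w" using full_col_count_bounds by simp
  have "rotation_support 0 = rect_path 0 ?w ?h ` {0..<2 * ?w + 2 * ?h - 1}"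
    unfolding rotation_support_def height_0 by (intro image_cong) (auto simp: token_path_0[OF w])
  also have "\<dots> = ?B"
  proof (intro equalityI subsetI)
    fix p assume "p \<in> rect_path 0 ?w ?h ` {0..<2 * ?w + 2 * ?h - 1}"
    then show "p \<in> ?B" using hb wb by (auto simp: rect_path_def split: if_splits)
  next
    fix p assume p: "p \<in> ?B"
    obtain x y where xy: "p = (x, y)" by (cases p)
    have "rect_rotation 0 ?w ?h (x, y) \<noteq> (x, y)"
      using p hb wb by (auto simp: xy rect_rotation_def)
    then show "p \<in> rect_path 0 ?w ?h ` {0..<2 * ?w + 2 * ?h - 1}"
      unfolding xy by (rule rect_path_onto[OF wb hb])
  qed
  finally show ?thesis .
qed

lemma ex_corner_cycle:
  assumes "0 \<le> i" "i < a - full_col_count"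
  shows "\<exists>M. M \<in> loops a b diagram \<and> is_cycle M (token_path i) (2 * full_col_count + 2 * height i - 1)"
  using corner_cycle[OF assms] by metis

text \<open>A rectangle with both sides 1 has a rotation of length 3, which is itself a
  three-cycle.\<close>

lemma seed_one_one:
  assumes w: "full_col_count = 1" "full_row_count = 1" "full_col_count < a"
  shows "G.three_cycles_on (rotation_support 0)"
proof -
  obtain M where M: "M \<in> loops a b diagram" "is_cycle M (token_path 0) 3"
    using ex_corner_cycle[of 0] w by (auto simp: height_0)
  note st = is_cycle_step[OF M(2), of 0] is_cycle_step[OF M(2), of 1] is_cycle_last[OF M(2)]
  have d: "token_path 0 0 \<noteq> token_path 0 1" "token_path 0 1 \<noteq> token_path 0 2" "token_path 0 0 \<noteq> token_path 0 2"
    using is_cycle_inj[OF M(2)] by simp_all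
  have s: "{0..<3::int} = {0, 1, 2}" by auto
  have "M ^^ 1 = three_cycle (token_path 0 0) (token_path 0 1) (token_path 0 2)"
    by (rule pow_eq_three_cycle) (use st d is_cycle_outside[OF M(2)] s in auto)
  then have "three_cycle (token_path 0 0) (token_path 0 1) (token_path 0 2) \<in> loops a b diagram"
    using M(1) by simp
  then have "G.three_cycles_on {token_path 0 0, token_path 0 1, token_path 0 2}"
    using d by (rule G.three_cycles_onI_one)
  then show ?thesis using w s by (simp add: rotation_support_def height_0)
qed

text \<open>Apart from rotations of length 3, the rotations 0 and 1 overlap in one of three ways,
  according to the width and to whether their rectangles have equal heights. The excluded pair
  consists of two five-cycles.\<close>

lemma seed_rotations:
  assumes w: "2 \<le> a - full_col_count"
    and ex: "\<not> (full_col_count = 2 \<and> full_row_count = 1 \<and> height 1 = 1)"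
  shows "G.three_cycles_on (rotation_support 0)"
proof -
  let ?w = full_col_count and ?h = full_row_count
  have hb: "1 \<le> ?h" "?h \<le> height 1" using height_bounds[of 0] height_mono[of 0 1] w by (auto simp: height_0)
  have wb: "1 \<le> ?w" using full_col_count_bounds by simp
  define N where "N = 2 * ?w + 2 * ?h - 1"
  define N1 where "N1 = 2 * ?w + 2 * height 1 - 1"
  \<comment> \<open>The second path is entered on its left side, directly above the full rows, so
    that both enumerations start at \<open>(0, full_row_count)\<close>.\<close>
  define d where "d = height 1 - ?h"
  define \<phi> where "\<phi> = token_path 0"
  define \<psi> where "\<psi> = (\<lambda>k. if k < d then token_path 1 (k + N1 - d) else token_path 1 (k - d))"
  obtain f where f: "f \<in> loops a b diagram" "is_cycle f \<phi> N"
    using ex_corner_cycle[of 0] w by (auto simp: height_0 N_def \<phi>_def)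
  obtain g where g: "g \<in> loops a b diagram" "is_cycle g (token_path 1) N1"
    using ex_corner_cycle[of 1] w by (auto simp: N1_def)
  have g': "is_cycle g \<psi> N1"
    unfolding \<psi>_def using hb wb by (intro is_cycle_rotate[OF g(2)]) (auto simp: d_def N1_def)
  interpret two_cycles "loops a b diagram" f g \<phi> \<psi> N N1
    by unfold_locales (fact f g(1) g')+
  have \<phi>: "\<phi> k = rect_path 0 ?w ?h k" if "0 \<le> k" "k < N" for k
    using token_path_0[OF _ that[unfolded N_def]] w by (simp add: \<phi>_def)
  have \<psi>: "\<psi> k = (if k < d then (0, ?h + k)
      else if k - d < ?w then (k - d, height 1)
      else if k - d < ?w + height 1 then
       (if height 1 - 1 - (k - d - ?w) < ?h then 1 + ?w else ?w, height 1 - 1 - (k - d - ?w))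
      else if k - d < 2 * ?w + height 1 then (?w - (k - d - ?w - height 1), 0)
      else (1, k - d - (2 * ?w + height 1) + 1))" if "0 \<le> k" "k < N1" for k
    using that hb wb unfolding \<psi>_def by (auto simp: token_path_1[OF w] N1_def d_def)
  have seed
  proof (cases "?w = 1")
    case True
    show ?thesis
    proof (cases "?h = 1")
      case h1: True
      have "G.three_cycles_on (rotation_support 0)" using seed_one_one True h1 w by simp
      moreover have "rotation_support 0 = \<phi> ` {0..<3}" using True h1 by (simp add: rotation_support_def \<phi>_def height_0)
      moreover have N3: "N = 3" using True h1 by (simp add: N_def)
      have ne: "\<phi> 0 \<noteq> \<phi> 1" "\<phi> 1 \<noteq> \<phi> 2" "\<phi> 0 \<noteq> \<phi> 2" using \<phi>_eq N3 by auto
      ultimately have "three_cycle (\<phi> 0) (\<phi> 1) (\<phi> 2) \<in> loops a b diagram"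
        by (intro G.three_cycles_onD) auto
      then show ?thesis using ne N3 f_step[of 0] by (intro seedI[of "\<phi> 0" "\<phi> 1" "\<phi> 2" "\<phi> 0" 0]) auto
    next
      case False
      \<comment> \<open>With width 1 the right side of the first rectangle lies on the left side of
        the second and is run through in the opposite direction.\<close>
      have "reversed_arc (loops a b diagram) f g \<phi> \<psi> N N1 (?h + 1) (2 * height 1 - ?h)"
      proof unfold_locales
        show "3 \<le> ?h + 1" "2 \<le> 2 * height 1 - ?h" "N = 2 * (?h + 1) - 1" "N1 = 2 * height 1 - ?h + (?h + 1)"
          using hb False True by (auto simp: N_def N1_def)
        fix i j assume ij: "0 \<le> i" "i < N" "0 \<le> j" "j < N1"
        show "\<phi> i = \<psi> j \<longleftrightarrow> i = 0 \<and> j = 0 \<or> 1 \<le> i \<and> i < ?h + 1 \<and> j = 2 * height 1 - ?h + (?h + 1) - i"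
          unfolding \<phi>[OF ij(1,2)] \<psi>[OF ij(3,4)] rect_path_def using ij True hb False
          by (auto simp: N_def N1_def d_def)
      qed
      then show ?thesis by (rule reversed_arc.seed_reversed)
    qed
  next
    case False
    then have w2: "2 \<le> ?w" using wb by simp
    show ?thesis
    proof (cases "height 1 = ?h")
      case True
      \<comment> \<open>With equal heights both the top sides and the bottom sides overlap; they are
        the two common arcs.\<close>
      have par: "parallel_cycles (loops a b diagram) f g \<phi> \<psi> N N1 ?w (?h - 1)"
      proof unfold_locales
        show "2 \<le> ?w" "0 \<le> ?h - 1" "N = 2 * ?w + 2 * (?h - 1) + 1" "N1 = N"
          using hb w2 True by (auto simp: N_def N1_def)
        fix i j assume ij: "0 \<le> i" "i < N" "0 \<le> j" "j < N"
        then have j: "j < N1" using True by (simp add: N_def N1_def)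
        show "\<phi> i = \<psi> j \<longleftrightarrow> i = j \<and> i < ?w \<or> ?w + (?h - 1) \<le> i \<and> i < 2 * ?w + (?h - 1) \<and> j = i + 1"
          unfolding \<phi>[OF ij(1,2)] \<psi>[OF ij(3) j] rect_path_def using ij True hb w2
          by (auto simp: N_def N1_def d_def)
      qed
      show ?thesis
      proof (cases "?h = 1")
        case h1: True
        then have "3 \<le> ?w" using ex True w2 by auto
        then show ?thesis using parallel_cycles.seed_flat[OF par] h1 by simp
      next
        case False
        then show ?thesis using parallel_cycles.seed_wide[OF par] parallel_cycles.seed_two[OF par] hb w2
          by (cases "?w = 2") auto
      qed
    next
      case False
      then have lt: "?h < height 1" using hb by simp
      \<comment> \<open>With different heights only the cell \<open>(0, full_row_count)\<close> and
        the bottom sides are common.\<close>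
      have pa: "point_and_arc (loops a b diagram) f g \<phi> \<psi> N N1 (?w + ?h - 2) ?w ?h (?w + 2 * height 1 - ?h - 1)"
      proof unfold_locales
        show "1 \<le> ?w + ?h - 2" "2 \<le> ?w" "1 \<le> ?h" "1 \<le> ?w + 2 * height 1 - ?h - 1"
          "N = 1 + (?w + ?h - 2) + ?w + ?h" "N1 = ?w + 2 * height 1 - ?h - 1 + ?w + ?h"
          using hb w2 lt by (auto simp: N_def N1_def)
        fix i j assume ij: "0 \<le> i" "i < N" "0 \<le> j" "j < N1"
        show "\<phi> i = \<psi> j \<longleftrightarrow> i = 0 \<and> j = 0 \<or>
            ?w + ?h - 2 < i \<and> i \<le> ?w + ?h - 2 + ?w \<and> j = i - (?w + ?h - 2) + (?w + 2 * height 1 - ?h - 1)"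
          unfolding \<phi>[OF ij(1,2)] \<psi>[OF ij(3,4)] rect_path_def using ij hb w2 lt
          by (auto simp: N_def N1_def d_def)
      qed
      then show ?thesis
        using point_and_arc.seed_long[OF pa] point_and_arc.seed_short[OF pa] hb by (cases "?h = 1") auto
    qed
  qed
  then have "G.three_cycles_on (\<phi> ` {0..<N})"
    by (intro three_cycles_on_support[OF finite_diagram]) (auto simp: loops_def)
  then show ?thesis by (simp add: rotation_support_def \<phi>_def N_def height_0)
qed

text \<open>The rotations are five-cycles, the pair excluded before; \<open>5 \<le> a\<close>
  provides a third one that reaches a cell outside the first.\<close>

lemma seed_two_rows:
  assumes "b = 2" "full_col_count = 2" "5 \<le> a"
  shows "G.three_cycles_on (rotation_support 0)"
proof -
  have h: "height i = 1" if "0 \<le> i" "i < a - 2" for i using height_bounds[of i] that assms by simp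
  have r1: "r 1 = 2" using assms(1,2) unfolding full_col_count_def by simp
  have fr: "full_row_count = 1" using h[of 0] assms by (simp add: height_0)
  obtain f where f: "f \<in> loops a b diagram" "is_cycle f (token_path 0) 5"
    using ex_corner_cycle[of 0] assms h[of 0] by auto
  obtain g where g: "g \<in> loops a b diagram" "is_cycle g (token_path 1) 5"
    using ex_corner_cycle[of 1] assms h[of 1] by auto
  obtain k where k: "k \<in> loops a b diagram" "is_cycle k (token_path 2) 5"
    using ex_corner_cycle[of 2] assms h[of 2] by auto
  have tp: "token_path i j = (if j < 2 then (j, 1) else (i + 4 - j, 0))"
    if "0 \<le> i" "i \<le> 2" "0 \<le> j" "j < 5" for i j
    using that assms(2,3) h[of i] by (cases "j = 2") (auto simp: token_path_def rect_path_def pull_back_def r1 r_0)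
  have "parallel_cycles (loops a b diagram) f g (token_path 0) (token_path 1) 5 5 2 0"
    by unfold_locales (use f g in \<open>auto simp: tp\<close>)
  moreover have "parallel_cycles (loops a b diagram) g k (token_path 1) (token_path 2) 5 5 2 0"
    by unfold_locales (use k g in \<open>auto simp: tp\<close>)
  moreover have "token_path 2 2 \<notin> token_path 0 ` {0..<5}" by (auto simp: tp)
  ultimately have s: "two_cycles.seed (loops a b diagram) f (token_path 0) 5"
    by (rule G.seed_three_cycles)
  interpret two_cycles "loops a b diagram" f g "token_path 0" "token_path 1" 5 5
    by unfold_locales (fact f g)+
  have "G.three_cycles_on (token_path 0 ` {0..<5})"
    using s by (intro three_cycles_on_support[OF finite_diagram]) (auto simp: loops_def)
  then show ?thesis using assms(2) fr by (simp add: rotation_support_def height_0)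
qed

end

context young
begin

lemma three_cycles_on_transpose:
  assumes T: "T.G.three_cycles_on S"
  shows "G.three_cycles_on (prod.swap ` S)"
  unfolding G.three_cycles_on_def
proof (intro ballI impI)
  fix x y z assume xyz: "x \<in> prod.swap ` S" "y \<in> prod.swap ` S" "z \<in> prod.swap ` S" "x \<noteq> y" "y \<noteq> z" "x \<noteq> z"
  then have "three_cycle (prod.swap x) (prod.swap y) (prod.swap z) \<in> loops b a T.diagram"
    by (intro T.G.three_cycles_onD[OF T]) (auto simp: mem_swap_image dest: arg_cong[where f = prod.swap])
  then have "prod.swap \<circ> three_cycle (prod.swap x) (prod.swap y) (prod.swap z) \<circ> prod.swap \<in> loops a b diagram"
    unfolding diagram_transpose[symmetric] by (rule loops_transposed)
  moreover have "prod.swap \<circ> three_cycle (prod.swap x) (prod.swap y) (prod.swap z) \<circ> prod.swap = three_cycle x y z"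
    using conj_three_cycle[of prod.swap "prod.swap x" "prod.swap y" "prod.swap z"]
    by (simp add: bij_swap inv_unique_comp[of prod.swap prod.swap])
  ultimately show "three_cycle x y z \<in> loops a b diagram" by simp
qed

text \<open>As a set, the boundary of the first rectangle prefers neither axis; this lets one seed
  start both families of rotations.\<close>

lemma rotation_support_0_transpose:
  assumes "full_col_count < a" "full_row_count < b"
  shows "prod.swap ` T.rotation_support 0 = rotation_support 0"
  using assms by (auto simp: rotation_support_0 T.rotation_support_0 T_full mem_swap_image)

text \<open>Rotation \<open>i + 1\<close> fixes the origin, a point of the block \<open>S\<close>,
  and hence preserves \<open>S\<close>. Its cycle meets the previous support in the cell
  \<open>(i + 1, 0)\<close>, so \<open>S\<close> contains it entirely.\<close>

lemma rotation_support_subset: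
  assumes max: "\<And>p. p \<in> loops a b diagram \<Longrightarrow> p ` S \<inter> S \<noteq> {} \<Longrightarrow> p ` S \<subseteq> S"
    and 0: "rotation_support 0 \<subseteq> S" and i: "0 \<le> i" "i < a - full_col_count"
  shows "rotation_support i \<subseteq> S"
  using i
proof (induction i rule: int_ge_induct)
  case base
  then show ?case using 0 by simp
next
  case (step i)
  obtain M where M: "M \<in> loops a b diagram" "is_cycle M (token_path (i + 1)) (2 * full_col_count + 2 * height (i + 1) - 1)"
    using ex_corner_cycle[of "i + 1"] step by auto
  have "(0, 0) \<in> S" using rotation_support_row_0[of 0 0] 0 full_col_count_bounds step by auto
  moreover have "M (0, 0) = (0, 0)"
    using is_cycle_outside[OF M(2)] origin_notin_rotation_support[of "i + 1"] step
    by (simp add: rotation_support_def)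
  ultimately have "M ` S \<inter> S \<noteq> {}" by (metis disjoint_iff imageI)
  then have inv: "M ` S \<subseteq> S" by (rule max[OF M(1)])
  have "(i + 1, 0) \<in> rotation_support i" "(i + 1, 0) \<in> rotation_support (i + 1)"
    using rotation_support_row_0[of i "i + 1"] rotation_support_row_0[of "i + 1" "i + 1"] full_col_count_bounds step by auto
  moreover have "rotation_support i \<subseteq> S" using step by simp
  ultimately show ?case
    using is_cycle_invariant[OF M(2) inv] unfolding rotation_support_def by force
qed

end

context young
begin

text \<open>The block grown from the seed contains the supports of all rotations, horizontal and
  transposed. These cover the non-core cells: right sides those beyond the full columns, left sides
  those of full rows near the left border, and the transposed rotations the rest.\<close>

lemma loops_alternating_of_seed:
  assumes w: "full_col_count < a" "full_row_count < b"
    and tc: "G.three_cycles_on (rotation_support 0)"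
  shows "loops a b diagram = {\<pi>. \<pi> permutes (diagram - core_cells) \<and> evenperm \<pi>}"
proof (intro equalityI subsetI)
  fix \<pi> assume "\<pi> \<in> loops a b diagram"
  then show "\<pi> \<in> {\<pi>. \<pi> permutes (diagram - core_cells) \<and> evenperm \<pi>}"
    using loops_even loops_noncore by auto
next
  fix \<pi> assume \<pi>: "\<pi> \<in> {\<pi>. \<pi> permutes (diagram - core_cells) \<and> evenperm \<pi>}"
  have per: "p permutes diagram" if "p \<in> loops a b diagram" for p using that by (simp add: loops_def)
  obtain M where M: "is_cycle M (token_path 0) (2 * full_col_count + 2 * full_row_count - 1)"
    using ex_corner_cycle[of 0] w by (auto simp: height_0)
  have hb: "1 \<le> full_row_count" "1 \<le> full_col_count" using full_col_count_bounds T.full_col_count_bounds by (auto simp: T_full)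
  have "card (rotation_support 0) = nat (2 * full_col_count + 2 * full_row_count - 1)"
    using M unfolding rotation_support_def is_cycle_def by (simp add: card_image height_0)
  then have c: "3 \<le> card (rotation_support 0)" using hb by simp
  have sub: "rotation_support 0 \<subseteq> diagram"
    using token_path_mem[of 0] w by (auto simp: rotation_support_def)
  obtain S where S: "rotation_support 0 \<subseteq> S" "G.three_cycles_on S"
    and max: "\<And>p. p \<in> loops a b diagram \<Longrightarrow> p ` S \<inter> S \<noteq> {} \<Longrightarrow> p ` S \<subseteq> S"
    using G.maximal_three_cycles_on[OF finite_diagram per tc sub c] by metis
  have 1: "rotation_support i \<subseteq> S" if "0 \<le> i" "i < a - full_col_count" for i
    using rotation_support_subset[OF max S(1) that] .
  have "p ` (prod.swap ` S) \<subseteq> prod.swap ` S"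
    if p: "p \<in> loops b a T.diagram" "p ` (prod.swap ` S) \<inter> prod.swap ` S \<noteq> {}" for p
  proof -
    let ?p = "prod.swap \<circ> p \<circ> prod.swap"
    have m: "?p \<in> loops a b diagram" using p(1) unfolding diagram_transpose[symmetric] by (rule loops_transposed)
    have im: "?p ` S = prod.swap ` (p ` (prod.swap ` S))" by (simp add: image_comp o_assoc)
    obtain q where q: "q \<in> p ` (prod.swap ` S)" "q \<in> prod.swap ` S" using p(2) by blast
    have "prod.swap q \<in> ?p ` S" unfolding im by (rule imageI[OF q(1)])
    moreover have "prod.swap q \<in> S" using q(2) unfolding mem_swap_image .
    ultimately have "?p ` S \<subseteq> S" using max[OF m] by blast
    then have "prod.swap ` ?p ` S \<subseteq> prod.swap ` S" by (rule image_mono)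
    then show ?thesis unfolding im by (simp add: image_image)
  qed
  moreover have "T.rotation_support 0 \<subseteq> prod.swap ` S"
    using S(1) rotation_support_0_transpose[OF w] by (metis T.rotation_support_0_transpose T_full image_mono w)
  ultimately have 2: "T.rotation_support j \<subseteq> prod.swap ` S" if "0 \<le> j" "j < b - full_row_count" for j
    using T.rotation_support_subset[of "prod.swap ` S" j] that by (simp add: T_full)
  have "diagram - core_cells \<subseteq> S"
  proof
    fix p assume p: "p \<in> diagram - core_cells"
    obtain x y where xy: "p = (x, y)" by (cases p)
    have yx: "(y, x) \<in> T.diagram" using p diagram_transpose by (auto simp: xy mem_swap_pair)
    have xy0: "0 \<le> x" "0 \<le> y" using p by (auto simp: xy diagram_def)
    consider "full_col_count \<le> x" | "full_row_count \<le> y" | "x < full_col_count" "y < full_row_count" "x < a - full_col_count"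
      | "x < full_col_count" "y < full_row_count" "y < b - full_row_count"
      using p by (force simp: xy core_cells_def)
    then show "p \<in> S"
    proof cases
      case 1
      then show ?thesis using rotation_support_right[of x y] p \<open>\<And>i. 0 \<le> i \<Longrightarrow> i < a - full_col_count \<Longrightarrow> rotation_support i \<subseteq> S\<close>
        by (auto simp: xy)
    next
      case 2
      then obtain j where "0 \<le> j" "j < b - full_row_count" "(y, x) \<in> T.rotation_support j"
        using T.rotation_support_right[OF yx] by (auto simp: T_full)
      then have "(y, x) \<in> prod.swap ` S" using \<open>\<And>j. 0 \<le> j \<Longrightarrow> j < b - full_row_count \<Longrightarrow> T.rotation_support j \<subseteq> prod.swap ` S\<close> by blast
      then show ?thesis by (simp add: xy mem_swap_pair)
    next
      case 3
      then show ?thesis using rotation_support_left[of x y] 1[of x] xy0 by (auto simp: xy)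
    next
      case 4
      then have "(y, x) \<in> T.rotation_support y" using T.rotation_support_left[of y x] xy0 by (simp add: T_full)
      then have "(y, x) \<in> prod.swap ` S" using 2[of y] 4 xy0 by blast
      then show ?thesis by (simp add: xy mem_swap_pair)
    qed
  qed
  then have "G.three_cycles_on (diagram - core_cells)" using S(2) G.three_cycles_on_subset by blast
  then show "\<pi> \<in> loops a b diagram"
    using G.even_permutation_mem[of "diagram - core_cells" \<pi>] \<pi> finite_diagram by auto
qed

end

context young
begin

text \<open>The excluded diagrams are the one with rows of lengths 4 and 2 and its transpose.\<close>

lemma loops_alternating:
  assumes ge: "2 \<le> a - full_col_count \<or> 2 \<le> b - full_row_count"
    and lt: "full_col_count < a" "full_row_count < b"
    and ex: "\<not> (a = 4 \<and> b = 2 \<and> full_col_count = 2)" "\<not> (b = 4 \<and> a = 2 \<and> full_row_count = 2)"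
  shows "loops a b diagram = {\<pi>. \<pi> permutes (diagram - core_cells) \<and> evenperm \<pi>}"
proof (rule loops_alternating_of_seed[OF lt])
  have fc: "1 \<le> full_col_count" "1 \<le> full_row_count" using full_col_count_bounds T.full_col_count_bounds by (auto simp: T_full)
  have T: "G.three_cycles_on (rotation_support 0)" if "T.G.three_cycles_on (T.rotation_support 0)"
    using three_cycles_on_transpose[OF that] rotation_support_0_transpose[OF lt] by simp
  show "G.three_cycles_on (rotation_support 0)"
  proof (cases "2 \<le> a - full_col_count")
    case True
    show ?thesis
    proof (cases "full_col_count = 2 \<and> full_row_count = 1 \<and> height 1 = 1")
      case special: True
      show ?thesis
      proof (cases "b = 2")
        case True
        then show ?thesis using seed_two_rows special ex \<open>2 \<le> a - full_col_count\<close> by auto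
      next
        case False
        \<comment> \<open>After exchanging the axes the width is \<open>full_row_count = 1\<close>,
          so the pair excluded in \<open>seed_rotations\<close> cannot occur.\<close>
        then have "2 \<le> b - T.full_col_count" using special lt by (simp add: T_full)
        then show ?thesis using special by (intro T T.seed_rotations) (auto simp: T_full)
      qed
    qed (use seed_rotations True in blast)
  next
    case False
    then have b2: "2 \<le> b - T.full_col_count" and a1: "a - full_col_count = 1" using ge lt by (auto simp: T_full)
    show ?thesis
    proof (cases "T.full_col_count = 2 \<and> T.full_row_count = 1 \<and> T.height 1 = 1")
      case special: True
      then have fr: "full_col_count = 1" "full_row_count = 2" by (simp_all add: T_full)
      have "4 \<le> b" using b2 special by linarith
      moreover have "a = 2" using a1 fr by simp
      moreover from this have "b \<noteq> 4" using ex fr by simp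
      ultimately have "a = 2" "5 \<le> b" by auto
      then show ?thesis using special by (intro T T.seed_two_rows) auto
    qed (use T T.seed_rotations[OF b2] in blast)
  qed
qed

end

section \<open>Diagrams with a single incomplete row\<close>

context young
begin

text \<open>A reference movement from the diagram to a given shape, rows before columns. Walks are
  compared with it, and their deviation is a permutation of the diagram.\<close>

definition carry :: "(int \<Rightarrow> int) \<Rightarrow> (int \<Rightarrow> int) \<Rightarrow> cell \<Rightarrow> cell" where
  "carry s t = vshift s (right_offsets b 0) t \<circ> hshift (right_offsets b 0) (right_offsets a 0) s"

end

text \<open>Here \<open>carry\<close> depends on two numbers only: \<open>s full_col_count\<close>,
  and \<open>t (b - 1)\<close>, which is 0 or 1 according to whether the short row is at the top or
  at the bottom.\<close>

locale single_row = young +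
  assumes rows: "full_row_count = b - 1" and cols: "full_col_count < a"
begin

lemma b_ge_2: "2 \<le> b"
  using T.full_col_count_bounds rows by (simp add: T_full)

lemma r_single: "0 \<le> y \<Longrightarrow> y < b \<Longrightarrow> r y = (if y < b - 1 then a else full_col_count)"
  using r_eq_a_iff[of y] rows by (auto simp: full_col_count_def) (smt (verit))

lemma c_single: "0 \<le> x \<Longrightarrow> x < a \<Longrightarrow> c x = (if x < full_col_count then b else b - 1)"
proof -
  assume x: "0 \<le> x" "x < a"
  have "b - 2 < c x" using dual[OF x, of "b - 2"] r_single[of "b - 2"] x b_ge_2 by simp
  moreover have "b - 1 < c x \<longleftrightarrow> x < full_col_count"
    using dual[OF x, of "b - 1"] b_ge_2 by (simp add: full_col_count_def)
  ultimately show ?thesis using c_bounds[OF x] by auto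
qed

lemma unit_offset: "offsets b t \<Longrightarrow> t (b - 1) = 0 \<or> t (b - 1) = 1"
  using offsets_bounds[of b t "b - 1"] b_ge_2 by auto

lemma short_row:
  assumes t: "offsets b t" and y: "0 \<le> y" "y < b"
  shows "r (rank b t y) = (if y = (if t (b - 1) = 0 then b - 1 else 0) then full_col_count else a)"
proof -
  have k: "0 \<le> rank b t y" "rank b t y < b" using rank_nonneg rank_less[OF t y] by auto
  have "rank b t y < b - 1 \<longleftrightarrow> t (b - 1) \<le> y \<and> y < t (b - 1) + (b - 1)"
    using b_ge_2 by (intro rank_less_iff[OF t]) auto
  then show ?thesis using r_single[OF k] unit_offset[OF t] y by auto
qed

lemma hshift_single:
  assumes s: "offsets a s" "offsets a s'" and t: "offsets b t" and y: "0 \<le> y" "y < b"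
  shows "hshift t s s' (x, y) = (if y = (if t (b - 1) = 0 then b - 1 else 0)
    then x + s' full_col_count - s full_col_count else x, y)"
  using short_row[OF t y] offsets_full[OF s(1)] offsets_full[OF s(2)] a_pos by (auto simp: hshift_def)

lemma vshift_single:
  assumes s: "offsets a s" and t: "offsets b t" "offsets b t'" and x: "0 \<le> x" "x < a"
  shows "vshift s t t' (x, y) = (x, if s full_col_count \<le> x \<and> x < s full_col_count + full_col_count
    then y else y + t' (b - 1) - t (b - 1))"
proof -
  have k: "0 \<le> rank a s x" "rank a s x < a" using rank_nonneg rank_less[OF s x] by auto
  have "rank a s x < full_col_count \<longleftrightarrow> s full_col_count \<le> x \<and> x < s full_col_count + full_col_count"
    by (rule rank_less_iff[OF s full_col_count_bounds])
  then show ?thesis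
    using c_single[OF k] offsets_full[OF t(1)] offsets_full[OF t(2)] b_pos by (auto simp: vshift_eq)
qed

lemma carry_single:
  assumes s: "offsets a s" and t: "offsets b t" and p: "(x, y) \<in> diagram"
  shows "carry s t (x, y) = (let x' = (if y = b - 1 then x + s full_col_count else x) in
    (x', if s full_col_count \<le> x' \<and> x' < s full_col_count + full_col_count then y else y + t (b - 1)))"
proof -
  have y: "0 \<le> x" "0 \<le> y" "y < b" "x < r y" "x < a" using p by (auto simp: diagram_def)
  define x' where "x' = (if y = b - 1 then x + s full_col_count else x)"
  have o: "offsets n (right_offsets n 0)" for n by (rule offsets_right_offsets) simp
  have z: "right_offsets n 0 l = 0" for n l by (simp add: right_offsets_0)
  have h: "hshift (right_offsets b 0) (right_offsets a 0) s (x, y) = (x', y)"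
    using hshift_single[OF o s o y(2,3)] by (simp add: z x'_def)
  have "0 \<le> x'" "x' < a"
    using y r_single[OF y(2,3)] offsets_bounds[OF s full_col_count_bounds] by (auto simp: x'_def)
  then show ?thesis using vshift_single[OF s o t] by (simp add: carry_def h z x'_def Let_def)
qed

lemma carry_cong:
  assumes "offsets a s" "offsets a s'" "offsets b t" "offsets b t'"
    "s full_col_count = s' full_col_count" "t (b - 1) = t' (b - 1)" "p \<in> diagram"
  shows "carry s t p = carry s' t' p"
  using assms by (cases p) (simp add: carry_single)

lemma carry_image:
  assumes s: "offsets a s" and t: "offsets b t"
  shows "carry s t ` diagram = cells s t"
proof -
  have o: "offsets n (right_offsets n 0)" for n by (rule offsets_right_offsets) simp
  have "carry s t ` diagram = vshift s (right_offsets b 0) t ` hshift (right_offsets b 0) (right_offsets a 0) s ` diagram"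
    by (simp add: carry_def image_comp)
  also have "hshift (right_offsets b 0) (right_offsets a 0) s ` diagram = cells s (right_offsets b 0)"
    using hshift_image[OF o s o] by (simp add: right_offsets_0 cells_zero)
  also have "vshift s (right_offsets b 0) t ` \<dots> = cells s t" by (rule vshift_image[OF s o t])
  finally show ?thesis .
qed

lemma carry_mem: "offsets a s \<Longrightarrow> offsets b t \<Longrightarrow> p \<in> diagram \<Longrightarrow> carry s t p \<in> cells s t"
  using carry_image by blast

lemma carry_corner_move:
  "carry (right_offsets a i) (right_offsets b 1) (corner_move i p) =
   hshift (right_offsets b 1) (right_offsets a (i + 1)) (right_offsets a i)
     (carry (right_offsets a (i + 1)) (right_offsets b 1) p)"
  by (simp add: carry_def corner_move_def hshift_hshift vshift_vshift)

text \<open>With the short row on top the reference movement is purely horizontal and absorbs the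
  push. Only a push that moves the short row at the bottom makes a difference, namely a
  \<open>corner_move\<close> or its inverse.\<close>

lemma carry_hshift:
  assumes s: "offsets a s" and t: "offsets b t"
    and s': "s' = shift_right a s \<or> s' = shift_left s"
    and \<Gamma>: "perm_group \<Gamma>" "\<And>\<gamma>. \<gamma> \<in> \<Gamma> \<Longrightarrow> \<gamma> permutes diagram"
    and M: "\<And>i. 0 \<le> i \<Longrightarrow> i < a - full_col_count \<Longrightarrow> \<exists>\<gamma>\<in>\<Gamma>. \<forall>p\<in>diagram. \<gamma> p = corner_move i p"
  shows "\<exists>\<gamma>\<in>\<Gamma>. \<forall>p\<in>diagram. hshift t s s' (carry s t p) = carry s' t (\<gamma> p)"
proof -
  interpret \<Gamma>: perm_group \<Gamma> by (rule \<Gamma>(1))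
  let ?w = full_col_count
  have os': "offsets a s'" using s' offsets_shift_left[OF s] offsets_shift_right[OF s] by auto
  have wb: "1 \<le> ?w" "?w < a" using full_col_count_bounds cols by auto
  have sb: "0 \<le> s ?w" "s ?w \<le> a - ?w" "0 \<le> s' ?w" "s' ?w \<le> a - ?w"
    using offsets_bounds[OF s, of ?w] offsets_bounds[OF os', of ?w] wb by auto
  have u: "offsets b (right_offsets b 1)" "right_offsets b 1 (b - 1) = 1"
    using b_ge_2 by (auto simp: offsets_right_offsets right_offsets_apply)
  have ob: "0 \<le> snd q" "snd q < b" if "q \<in> cells s'' t''" for q s'' t'' using that by (auto simp: cells_def)
  have ra: "offsets a (right_offsets a i)" "right_offsets a i ?w = i" if "0 \<le> i" "i \<le> a - ?w" for i
    using that wb by (auto simp: offsets_right_offsets right_offsets_apply)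
  have hcong: "hshift t s1 s2 q = hshift t' s1' s2' q"
    if "offsets a s1" "offsets a s2" "offsets b t" "offsets a s1'" "offsets a s2'" "offsets b t'"
      "s1 ?w = s1' ?w" "s2 ?w = s2' ?w" "t (b - 1) = t' (b - 1)" "0 \<le> snd q" "snd q < b" for s1 s2 s1' s2' t t' q
    using that by (cases q) (simp add: hshift_single)
  consider "t (b - 1) = 0" | "s' ?w = s ?w" | "t (b - 1) = 1" "s ?w = s' ?w + 1" | "t (b - 1) = 1" "s' ?w = s ?w + 1"
  proof -
    have "s' ?w = min (s ?w + 1) (a - ?w) \<or> s' ?w = max (s ?w - 1) 0"
      using s' wb by (auto simp: shift_right_def shift_left_def)
    then have "s' ?w = s ?w \<or> s ?w = s' ?w + 1 \<or> s' ?w = s ?w + 1"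
      using sb by linarith
    then show ?thesis using that unit_offset[OF t] by blast
  qed
  then show ?thesis
  proof cases
    case 1
    have o: "offsets n (right_offsets n 0)" for n by (rule offsets_right_offsets) simp
    have "hshift t s s' (carry s t p) = carry s' t p" if p: "p \<in> diagram" for p
    proof -
      obtain x y where xy: "p = (x, y)" by (cases p)
      have y: "0 \<le> y" "y < b" using p by (auto simp: xy diagram_def)
      show ?thesis using hshift_single[OF s os' t y] 1 unfolding xy carry_single[OF s t p[unfolded xy]] carry_single[OF os' t p[unfolded xy]]
        by (cases "y = b - 1") (simp_all add: Let_def)
    qed
    then show ?thesis using \<Gamma>.id_mem by (intro bexI[of _ id]) auto
  next
    case 2
    have "hshift t s s' (carry s t p) = carry s' t p" if p: "p \<in> diagram" for p
    proof -
      have "hshift t s s' (carry s t p) = hshift t s s (carry s t p)"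
        using carry_mem[OF s t p] ob 2 by (intro hcong) (auto simp: s os' t)
      then show ?thesis using carry_cong[OF s os' t t _ refl p] 2 by simp
    qed
    then show ?thesis using \<Gamma>.id_mem by (intro bexI[of _ id]) auto
  next
    case 3
    let ?i = "s' ?w"
    have i: "0 \<le> ?i" "?i < a - ?w" "0 \<le> ?i + 1" "?i + 1 \<le> a - ?w" using sb 3 by auto
    obtain \<gamma> where \<gamma>: "\<gamma> \<in> \<Gamma>" "\<forall>p\<in>diagram. \<gamma> p = corner_move ?i p" using M[OF i(1,2)] by blast
    have "hshift t s s' (carry s t p) = carry s' t (\<gamma> p)" if p: "p \<in> diagram" for p
    proof -
      have \<gamma>p: "\<gamma> p \<in> diagram" using p \<Gamma>(2)[OF \<gamma>(1)] by (simp add: permutes_in_image)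
      have "carry s' t (\<gamma> p) = carry (right_offsets a ?i) (right_offsets b 1) (\<gamma> p)"
        using ra[of ?i] i u 3 by (intro carry_cong \<gamma>p) (auto simp: os' t)
      also have "\<dots> = hshift (right_offsets b 1) (right_offsets a (?i + 1)) (right_offsets a ?i)
          (carry (right_offsets a (?i + 1)) (right_offsets b 1) p)"
        using carry_corner_move \<gamma>(2) p by simp
      also have "carry (right_offsets a (?i + 1)) (right_offsets b 1) p = carry s t p"
        using ra[of "?i + 1"] i u 3 by (intro carry_cong p) (auto simp: s t)
      also have "hshift (right_offsets b 1) (right_offsets a (?i + 1)) (right_offsets a ?i) (carry s t p) =
          hshift t s s' (carry s t p)"
        using ra[of "?i + 1"] ra[of ?i] i u 3 carry_mem[OF s t p] ob by (intro hcong) (auto simp: s os' t)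
      finally show ?thesis by simp
    qed
    then show ?thesis using \<gamma>(1) by blast
  next
    case 4
    let ?i = "s ?w"
    have i: "0 \<le> ?i" "?i < a - ?w" "0 \<le> ?i + 1" "?i + 1 \<le> a - ?w" using sb 4 by auto
    obtain \<gamma> where \<gamma>: "\<gamma> \<in> \<Gamma>" "\<forall>p\<in>diagram. \<gamma> p = corner_move ?i p" using M[OF i(1,2)] by blast
    have "hshift t s s' (carry s t p) = carry s' t (inv' \<gamma> p)" if p: "p \<in> diagram" for p
    proof -
      let ?q = "inv' \<gamma> p"
      have q: "?q \<in> diagram" using p permutes_inv[OF \<Gamma>(2)[OF \<gamma>(1)]] by (simp add: permutes_in_image)
      have "\<gamma> ?q = p" using \<Gamma>.bij_mem[OF \<gamma>(1)] by (simp add: bij_is_surj surj_f_inv_f)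
      then have cm: "corner_move ?i ?q = p" using \<gamma>(2) q by simp
      have "carry s t p = carry (right_offsets a ?i) (right_offsets b 1) p"
        using ra[of ?i] i u 4 by (intro carry_cong p) (auto simp: s t)
      also have "\<dots> = hshift (right_offsets b 1) (right_offsets a (?i + 1)) (right_offsets a ?i)
          (carry (right_offsets a (?i + 1)) (right_offsets b 1) ?q)"
        using carry_corner_move[of ?i ?q] cm by simp
      finally have "hshift (right_offsets b 1) (right_offsets a ?i) (right_offsets a (?i + 1)) (carry s t p) =
          carry (right_offsets a (?i + 1)) (right_offsets b 1) ?q"
        by (simp add: hshift_hshift)
      moreover have "hshift (right_offsets b 1) (right_offsets a ?i) (right_offsets a (?i + 1)) (carry s t p) =
          hshift t s s' (carry s t p)"
        using ra[of "?i + 1"] ra[of ?i] i u 4 carry_mem[OF s t p] ob by (intro hcong) (auto simp: s os' t)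
      moreover have "carry (right_offsets a (?i + 1)) (right_offsets b 1) ?q = carry s' t ?q"
        using ra[of "?i + 1"] i u 4 by (intro carry_cong q) (auto simp: os' t)
      ultimately show ?thesis by simp
    qed
    then show ?thesis using \<Gamma>.inv_mem[OF \<gamma>(1)] by blast
  qed
qed

lemma track_carry:
  assumes s: "offsets a s" and t: "offsets b t"
    and \<Gamma>: "perm_group \<Gamma>" "\<And>\<gamma>. \<gamma> \<in> \<Gamma> \<Longrightarrow> \<gamma> permutes diagram"
    and M: "\<And>i. 0 \<le> i \<Longrightarrow> i < a - full_col_count \<Longrightarrow> \<exists>\<gamma>\<in>\<Gamma>. \<forall>p\<in>diagram. \<gamma> p = corner_move i p"
  shows "\<exists>s' t'. \<exists>\<gamma>\<in>\<Gamma>. offsets a s' \<and> offsets b t' \<and> shape a b ds (cells s t) = cells s' t' \<and>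
    (\<forall>p\<in>diagram. track a b ds (cells s t) (carry s t p) = carry s' t' (\<gamma> p))"
  using s t
proof (induction ds arbitrary: s t)
  case Nil
  interpret \<Gamma>: perm_group \<Gamma> by (rule \<Gamma>(1))
  show ?case using Nil \<Gamma>.id_mem by (intro exI[where x = s] exI[of _ t] bexI[of _ id]) auto
next
  case (Cons d ds)
  interpret \<Gamma>: perm_group \<Gamma> by (rule \<Gamma>(1))
  note o = Cons.prems
  have "\<exists>s' t'. \<exists>\<gamma>\<in>\<Gamma>. offsets a s' \<and> offsets b t' \<and> move a b d (cells s t) ` cells s t = cells s' t' \<and>
    (\<forall>p\<in>diagram. move a b d (cells s t) (carry s t p) = carry s' t' (\<gamma> p))"
  proof -
    have horizontal: ?thesis if F: "offsets a s'" "s' = shift_right a s \<or> s' = shift_left s"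
      "\<And>p. p \<in> cells s t \<Longrightarrow> move a b d (cells s t) p = hshift t s s' p" for s'
    proof -
      have "move a b d (cells s t) ` cells s t = cells s' t"
        using F(3) hshift_image[OF o(1) F(1) o(2)] by (metis (no_types, lifting) image_cong)
      moreover obtain \<gamma> where "\<gamma> \<in> \<Gamma>" "\<forall>p\<in>diagram. hshift t s s' (carry s t p) = carry s' t (\<gamma> p)"
        using carry_hshift[OF o F(2) \<Gamma> M] by blast
      ultimately show ?thesis using F(1,3) o(2) carry_mem[OF o] by metis
    qed
    have vertical: ?thesis if F: "offsets b t'"
      "\<And>p. p \<in> cells s t \<Longrightarrow> move a b d (cells s t) p = vshift s t t' p" for t'
    proof -
      have "move a b d (cells s t) ` cells s t = cells s t'"
        using F(2) vshift_image[OF o(1,2) F(1)] by (metis (no_types, lifting) image_cong)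
      moreover have "vshift s t t' (carry s t p) = carry s t' (id p)" for p
        by (simp add: carry_def vshift_vshift)
      ultimately show ?thesis using F o(1) carry_mem[OF o] \<Gamma>.id_mem by metis
    qed
    show ?thesis
    proof (cases d)
      case Leftward
      then show ?thesis using o
        by (intro horizontal[of "shift_left s"]) (auto simp: offsets_shift_left move_left_cells)
    next
      case Rightward
      then show ?thesis using o
        by (intro horizontal[of "shift_right a s"]) (auto simp: offsets_shift_right move_right_cells)
    next
      case Upward
      then show ?thesis using move_up_cells[OF o]
        by (intro vertical[of "shift_right b t"]) (simp_all only: offsets_shift_right o)
    next
      case Downward
      then show ?thesis using move_down_cells[OF o]
        by (intro vertical[of "shift_left t"]) (simp_all only: offsets_shift_left o)
    qed
  qed
  then obtain s' t' \<gamma> where 1: "\<gamma> \<in> \<Gamma>" "offsets a s'" "offsets b t'"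
    "move a b d (cells s t) ` cells s t = cells s' t'"
    "\<forall>p\<in>diagram. move a b d (cells s t) (carry s t p) = carry s' t' (\<gamma> p)" by blast
  obtain s'' t'' \<gamma>' where 2: "\<gamma>' \<in> \<Gamma>" "offsets a s''" "offsets b t''" "shape a b ds (cells s' t') = cells s'' t''"
    "\<forall>p\<in>diagram. track a b ds (cells s' t') (carry s' t' p) = carry s'' t'' (\<gamma>' p)"
    using Cons.IH[OF 1(2,3)] by blast
  have "\<forall>p\<in>diagram. track a b (d # ds) (cells s t) (carry s t p) = carry s'' t'' ((\<gamma>' \<circ> \<gamma>) p)"
  proof
    fix p assume p: "p \<in> diagram"
    have "\<gamma> p \<in> diagram" using p \<Gamma>(2)[OF 1(1)] by (simp add: permutes_in_image)
    then show "track a b (d # ds) (cells s t) (carry s t p) = carry s'' t'' ((\<gamma>' \<circ> \<gamma>) p)"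
      using 1(5) 2(5) p by (simp only: track.simps 1(4) o_apply)
  qed
  moreover have "shape a b (d # ds) (cells s t) = cells s'' t''" by (simp only: shape_Cons 1(4) 2(4))
  ultimately show ?case using 2(2,3) \<Gamma>.comp_mem[OF 2(1) 1(1)] by blast
qed

text \<open>Arriving at the diagram forces the short row to be on top and left-justified, which
  makes the reference movement trivial.\<close>

lemma carry_zero:
  assumes s: "offsets a s" and t: "offsets b t" and eq: "cells s t = diagram" and p: "p \<in> diagram"
  shows "carry s t p = p"
proof -
  let ?w = full_col_count
  have wb: "1 \<le> ?w" using full_col_count_bounds by simp
  have t0: "t (b - 1) = 0"
  proof (rule ccontr)
    assume "t (b - 1) \<noteq> 0"
    then have "r (rank b t 0) = ?w" using short_row[OF t, of 0] b_ge_2 by simp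
    moreover have "(0, 0) \<in> diagram" "(a - 1, 0) \<in> diagram" using a_pos b_pos r_0 by (auto simp: diagram_def)
    ultimately show False using mem_cells[OF s t, of 0 0] mem_cells[OF s t, of "a - 1" 0] eq cols by auto
  qed
  then have "r (rank b t (b - 1)) = ?w" using short_row[OF t, of "b - 1"] b_ge_2 by simp
  moreover have "(0, b - 1) \<in> diagram" using a_pos b_ge_2 r_single[of "b - 1"] wb by (auto simp: diagram_def)
  ultimately have "s ?w = 0"
    using mem_cells[OF s t, of 0 "b - 1"] eq offsets_bounds[OF s full_col_count_bounds] by auto
  then show ?thesis using carry_single[OF s t] t0 p by (cases p) simp
qed

lemma carry_id: "carry (\<lambda>_. 0) (\<lambda>_. 0) p = p"
  by (simp add: carry_def right_offsets_0)

text \<open>Every walk is an element of \<open>\<Gamma>\<close> followed by the reference movement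
  to its final shape, and for a closed walk the latter is trivial.\<close>

lemma loops_subset:
  assumes \<Gamma>: "perm_group \<Gamma>" "\<And>\<gamma>. \<gamma> \<in> \<Gamma> \<Longrightarrow> \<gamma> permutes diagram"
    and M: "\<And>i. 0 \<le> i \<Longrightarrow> i < a - full_col_count \<Longrightarrow> \<exists>\<gamma>\<in>\<Gamma>. \<forall>p\<in>diagram. \<gamma> p = corner_move i p"
  shows "loops a b diagram \<subseteq> \<Gamma>"
proof
  fix \<pi> assume "\<pi> \<in> loops a b diagram"
  then obtain ds where \<pi>: "\<pi> permutes diagram" "shape a b ds diagram = diagram"
    "\<forall>p\<in>diagram. track a b ds diagram p = \<pi> p" by (auto simp: loops_def)
  obtain s t \<gamma> where 1: "\<gamma> \<in> \<Gamma>" "offsets a s" "offsets b t" "shape a b ds diagram = cells s t"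
    "\<forall>p\<in>diagram. track a b ds diagram p = carry s t (\<gamma> p)"
    using track_carry[OF offsets_zero offsets_zero \<Gamma> M, of ds] by (auto simp: cells_zero carry_id)
  have "\<pi> = \<gamma>"
  proof
    fix p show "\<pi> p = \<gamma> p"
    proof (cases "p \<in> diagram")
      case True
      then have "\<gamma> p \<in> diagram" using \<Gamma>(2)[OF 1(1)] by (simp add: permutes_in_image)
      then show ?thesis using True 1(4,5) \<pi>(2,3) carry_zero[OF 1(2,3)] by metis
    next
      case False
      then show ?thesis using \<pi>(1) \<Gamma>(2)[OF 1(1)] by (simp add: permutes_not_in)
    qed
  qed
  then show "\<pi> \<in> \<Gamma>" using 1(1) by simp
qed

end

lemma is_cycle_funpow_length:
  assumes "is_cycle f \<phi> N"
  shows "f ^^ nat N = id"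
proof
  fix x
  show "(f ^^ nat N) x = id x"
  proof (cases "x \<in> \<phi> ` {0..<N}")
    case True
    then obtain k where k: "x = \<phi> k" "0 \<le> k" "k < N" by auto
    then show ?thesis using is_cycle_funpow[OF assms k(2,3), of "nat N"] by simp
  next
    case False
    then show ?thesis using funpow_fixed[of f x, OF is_cycle_outside[OF assms False]] by simp
  qed
qed

text \<open>Natural exponents yield the inverses because the order divides \<open>N\<close>.\<close>

lemma perm_group_powers:
  assumes "is_cycle f \<phi> N"
  shows "perm_group (range (\<lambda>n. f ^^ n))"
proof
  have N: "0 < N" using assms by (simp add: is_cycle_def)
  have bij: "bij f" using is_cycle_permutes[OF assms] by (rule permutes_bij)
  show "id \<in> range (\<lambda>n. f ^^ n)" by (rule range_eqI[of _ _ 0]) simp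
  show "bij p" if "p \<in> range (\<lambda>n. f ^^ n)" for p using that bij by (auto intro: bij_fn)
  show "p \<circ> q \<in> range (\<lambda>n. f ^^ n)" if "p \<in> range (\<lambda>n. f ^^ n)" "q \<in> range (\<lambda>n. f ^^ n)" for p q
    using that by (auto simp: funpow_add[symmetric])
  show "inv' p \<in> range (\<lambda>n. f ^^ n)" if p: "p \<in> range (\<lambda>n. f ^^ n)" for p
  proof -
    obtain n where n: "p = f ^^ n" using p by auto
    let ?m = "(nat N - 1) * n"
    have e: "n + ?m = nat N * n" "?m + n = nat N * n" using N by (cases "nat N"; simp)+
    have "f ^^ (nat N * n) = id" by (simp add: funpow_mult[symmetric] is_cycle_funpow_length[OF assms])
    then have "p \<circ> f ^^ ?m = id" "f ^^ ?m \<circ> p = id" unfolding n funpow_add[symmetric] e by auto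
    then have "inv' p = f ^^ ?m" by (rule inv_unique_comp)
    then show ?thesis by simp
  qed
qed

lemma (in single_row) loops_cyclic:
  assumes "a - full_col_count = 1"
  shows "\<exists>M. M \<in> loops a b diagram \<and> (\<forall>p\<in>diagram. M p = corner_move 0 p) \<and>
    loops a b diagram = range (\<lambda>n. M ^^ n)"
proof -
  obtain M where M: "M \<in> loops a b diagram" "\<And>p. p \<in> diagram \<Longrightarrow> M p = corner_move 0 p"
    "is_cycle M (token_path 0) (2 * full_col_count + 2 * height 0 - 1)"
    by (rule corner_cycle[of 0]) (use assms in auto)
  have "loops a b diagram \<subseteq> range (\<lambda>n. M ^^ n)"
  proof (rule loops_subset[OF perm_group_powers[OF M(3)]])
    show "\<gamma> permutes diagram" if "\<gamma> \<in> range (\<lambda>n. M ^^ n)" for \<gamma>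
      using that M(1) by (auto simp: loops_def intro: permutes_funpow)
    show "\<exists>\<gamma>\<in>range (\<lambda>n. M ^^ n). \<forall>p\<in>diagram. \<gamma> p = corner_move i p" if "0 \<le> i" "i < a - full_col_count" for i
    proof -
      have "i = 0" using that assms by simp
      then have "\<forall>p\<in>diagram. (M ^^ 1) p = corner_move i p" using M(2) by simp
      then show ?thesis by blast
    qed
  qed
  moreover have "range (\<lambda>n. M ^^ n) \<subseteq> loops a b diagram" using G.funpow_mem[OF M(1)] by blast
  ultimately show ?thesis using M by blast
qed

section \<open>The diagram with rows of lengths four and two\<close>

text \<open>The five perfect matchings of a one-factorization of the complete graph on the six tokens;
  the pushes permute them.\<close>

definition partner :: "nat \<Rightarrow> cell \<Rightarrow> cell" where
  "partner i = (
     if i = 1 then transpose (0, 0) (1, 0) \<circ> transpose (2, 0) (0, 1) \<circ> transpose (3, 0) (1, 1)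
     else if i = 2 then transpose (0, 0) (2, 0) \<circ> transpose (1, 0) (3, 0) \<circ> transpose (0, 1) (1, 1)
     else if i = 3 then transpose (0, 0) (3, 0) \<circ> transpose (1, 0) (0, 1) \<circ> transpose (2, 0) (1, 1)
     else if i = 4 then transpose (0, 0) (0, 1) \<circ> transpose (1, 0) (1, 1) \<circ> transpose (2, 0) (3, 0)
     else transpose (0, 0) (1, 1) \<circ> transpose (1, 0) (2, 0) \<circ> transpose (3, 0) (0, 1))"

definition six_cells :: "cell set" where
  "six_cells = {(0, 0), (1, 0), (2, 0), (3, 0), (0, 1), (1, 1)}"

text \<open>Conjugation by \<open>\<pi>\<close> permutes the involutions \<open>partner i\<close> as
  \<open>\<rho>\<close> does. Indices are confined to 1 to 5 because \<open>partner\<close> sends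
  every other index to the fifth matching.\<close>

definition permutes_matchings :: "(cell \<Rightarrow> cell) \<Rightarrow> (nat \<Rightarrow> nat) \<Rightarrow> bool" where
  "permutes_matchings \<pi> \<rho> \<longleftrightarrow> \<pi> permutes six_cells \<and> \<rho> permutes {1..5} \<and>
     (\<forall>i\<in>{1..5}. \<pi> \<circ> partner i = partner (\<rho> i) \<circ> \<pi>)"

lemma atLeastAtMost_1_5: "{1..5::nat} = {1, 2, 3, 4, 5}"
  by auto

lemma partner_table:
  "partner 1 (0, 0) = (1, 0)" "partner 2 (0, 0) = (2, 0)" "partner 3 (0, 0) = (3, 0)"
  "partner 4 (0, 0) = (0, 1)" "partner 5 (0, 0) = (1, 1)"
  "partner 1 (1, 0) = (0, 0)" "partner 2 (1, 0) = (3, 0)" "partner 3 (1, 0) = (0, 1)"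
  "partner 4 (1, 0) = (1, 1)" "partner 5 (1, 0) = (2, 0)"
  "partner 1 (2, 0) = (0, 1)" "partner 2 (2, 0) = (0, 0)" "partner 3 (2, 0) = (1, 1)"
  "partner 4 (2, 0) = (3, 0)" "partner 5 (2, 0) = (1, 0)"
  "partner 1 (3, 0) = (1, 1)" "partner 2 (3, 0) = (1, 0)" "partner 3 (3, 0) = (0, 0)"
  "partner 4 (3, 0) = (2, 0)" "partner 5 (3, 0) = (0, 1)"
  "partner 1 (0, 1) = (2, 0)" "partner 2 (0, 1) = (1, 1)" "partner 3 (0, 1) = (1, 0)"
  "partner 4 (0, 1) = (0, 0)" "partner 5 (0, 1) = (3, 0)"
  "partner 1 (1, 1) = (3, 0)" "partner 2 (1, 1) = (0, 1)" "partner 3 (1, 1) = (2, 0)"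
  "partner 4 (1, 1) = (1, 0)" "partner 5 (1, 1) = (0, 0)"
  by (simp_all add: partner_def transpose_def)

lemma partner_outside: "p \<notin> six_cells \<Longrightarrow> partner i p = p"
  by (auto simp: six_cells_def partner_def transpose_def)

lemma permutes_matchings_id: "permutes_matchings id id"
  by (simp add: permutes_matchings_def permutes_id)

lemma permutes_matchings_comp:
  assumes "permutes_matchings \<pi> \<rho>" "permutes_matchings \<pi>' \<rho>'"
  shows "permutes_matchings (\<pi>' \<circ> \<pi>) (\<rho>' \<circ> \<rho>)"
proof -
  have "(\<pi>' \<circ> \<pi>) \<circ> partner i = partner ((\<rho>' \<circ> \<rho>) i) \<circ> (\<pi>' \<circ> \<pi>)" if i: "i \<in> {1..5}" for i
  proof -
    have "\<rho> i \<in> {1..5}" using assms(1) i permutes_in_image unfolding permutes_matchings_def by metis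
    then show ?thesis using assms i unfolding permutes_matchings_def by (metis comp_assoc comp_apply)
  qed
  then show ?thesis using assms unfolding permutes_matchings_def by (auto intro: permutes_compose)
qed

lemma permutes_matchings_inv:
  assumes "permutes_matchings \<pi> \<rho>"
  shows "permutes_matchings (inv' \<pi>) (inv' \<rho>)"
proof -
  have \<pi>: "\<pi> permutes six_cells" and \<rho>: "\<rho> permutes {1..5}"
    and eq: "\<And>i. i \<in> {1..5} \<Longrightarrow> \<pi> \<circ> partner i = partner (\<rho> i) \<circ> \<pi>"
    using assms by (auto simp: permutes_matchings_def)
  have "inv' \<pi> \<circ> partner j = partner (inv' \<rho> j) \<circ> inv' \<pi>" if j: "j \<in> {1..5}" for j
  proof
    fix p
    have i: "inv' \<rho> j \<in> {1..5}" using permutes_in_image[OF permutes_inv[OF \<rho>]] j by blast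
    have "\<pi> (partner (inv' \<rho> j) (inv' \<pi> p)) = partner (\<rho> (inv' \<rho> j)) (\<pi> (inv' \<pi> p))"
      using fun_cong[OF eq[OF i], of "inv' \<pi> p"] by simp
    also have "\<dots> = partner j p" using \<pi> \<rho> by (simp add: permutes_inverses)
    finally show "(inv' \<pi> \<circ> partner j) p = (partner (inv' \<rho> j) \<circ> inv' \<pi>) p"
      using permutes_inj[OF \<pi>] by (metis comp_apply inv_f_f)
  qed
  then show ?thesis using permutes_inv[OF \<pi>] permutes_inv[OF \<rho>] by (simp add: permutes_matchings_def)
qed

lemma permutes_matchings_unique:
  assumes "permutes_matchings \<pi> \<rho>" "permutes_matchings \<pi> \<rho>'"
  shows "\<rho> = \<rho>'"
proof
  fix i
  show "\<rho> i = \<rho>' i"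
  proof (cases "i \<in> {1..5}")
    case True
    obtain p where p: "\<pi> p = (0, 0)"
      using assms(1) permutes_surj[of \<pi> six_cells] unfolding permutes_matchings_def by (metis surjD)
    have "partner (\<rho> i) (0, 0) = partner (\<rho>' i) (0, 0)"
      using assms True p unfolding permutes_matchings_def by (metis comp_apply)
    moreover have "\<rho> i \<in> {1..5}" "\<rho>' i \<in> {1..5}"
      using assms True permutes_in_image unfolding permutes_matchings_def by metis+
    ultimately show ?thesis unfolding atLeastAtMost_1_5 by (auto simp: partner_table simp del: One_nat_def)
  next
    case False
    then show ?thesis using assms unfolding permutes_matchings_def by (metis permutes_not_in)
  qed
qed

text \<open>Faithfulness of the action on matchings. The five partners of \<open>(0, 0)\<close> are
  all other cells, so a permutation commuting with the five involutions is determined by the image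
  of \<open>(0, 0)\<close>.\<close>

lemma permutes_matchings_id_imp:
  assumes "permutes_matchings \<pi> id"
  shows "\<pi> = id"
proof -
  have per: "\<pi> permutes six_cells" using assms by (simp add: permutes_matchings_def)
  have comm: "\<pi> (partner i p) = partner i (\<pi> p)" if "i \<in> {1, 2, 3, 4, 5}" for i p
    using assms that unfolding permutes_matchings_def atLeastAtMost_1_5 by (metis comp_apply id_apply)
  have "\<pi> (0, 0) \<in> six_cells" using permutes_in_image[OF per] by (simp add: six_cells_def)
  \<comment> \<open>Each wrong image is refuted by computing the image of one further cell along two
    different matchings.\<close>
  moreover have "\<pi> (0, 0) \<noteq> (1, 0)"
    using comm[of 2 "(0, 0)"] comm[of 5 "(1, 0)"] comm[of 1 "(0, 0)"] by (auto simp: partner_table simp del: One_nat_def)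
  moreover have "\<pi> (0, 0) \<noteq> (2, 0)"
    using comm[of 1 "(0, 0)"] comm[of 5 "(2, 0)"] comm[of 2 "(0, 0)"] by (auto simp: partner_table simp del: One_nat_def)
  moreover have "\<pi> (0, 0) \<noteq> (3, 0)"
    using comm[of 1 "(0, 0)"] comm[of 2 "(3, 0)"] comm[of 3 "(0, 0)"] by (auto simp: partner_table simp del: One_nat_def)
  moreover have "\<pi> (0, 0) \<noteq> (0, 1)"
    using comm[of 1 "(0, 0)"] comm[of 3 "(0, 1)"] comm[of 4 "(0, 0)"] by (auto simp: partner_table simp del: One_nat_def)
  moreover have "\<pi> (0, 0) \<noteq> (1, 1)"
    using comm[of 1 "(0, 0)"] comm[of 4 "(1, 1)"] comm[of 5 "(0, 0)"] by (auto simp: partner_table simp del: One_nat_def)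
  ultimately have 0: "\<pi> (0, 0) = (0, 0)" by (auto simp: six_cells_def)
  have "\<pi> p = p" if "p \<in> six_cells" for p
    using that 0 comm[of 1 "(0, 0)"] comm[of 2 "(0, 0)"] comm[of 3 "(0, 0)"] comm[of 4 "(0, 0)"] comm[of 5 "(0, 0)"]
    by (auto simp: six_cells_def partner_table simp del: One_nat_def)
  then show ?thesis using permutes_not_in[OF per] by (metis eq_id_iff)
qed

lemma perm_group_matchings:
  "perm_group {\<pi>. \<exists>\<rho>. permutes_matchings \<pi> \<rho> \<and> evenperm \<rho>}"
proof
  have perm: "permutation \<rho>" if "permutes_matchings \<pi> \<rho>" for \<pi> \<rho>
    using that unfolding permutes_matchings_def permutation_permutes by blast
  show "id \<in> {\<pi>. \<exists>\<rho>. permutes_matchings \<pi> \<rho> \<and> evenperm \<rho>}"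
    using permutes_matchings_id by auto
  fix p assume p: "p \<in> {\<pi>. \<exists>\<rho>. permutes_matchings \<pi> \<rho> \<and> evenperm \<rho>}"
  then show "bij p" by (auto simp: permutes_matchings_def permutes_bij)
  show "inv' p \<in> {\<pi>. \<exists>\<rho>. permutes_matchings \<pi> \<rho> \<and> evenperm \<rho>}"
    using p permutes_matchings_inv perm evenperm_inv by blast
  fix q assume q: "q \<in> {\<pi>. \<exists>\<rho>. permutes_matchings \<pi> \<rho> \<and> evenperm \<rho>}"
  show "p \<circ> q \<in> {\<pi>. \<exists>\<rho>. permutes_matchings \<pi> \<rho> \<and> evenperm \<rho>}"
  proof -
    obtain \<rho> \<rho>' where \<rho>: "permutes_matchings p \<rho>" "evenperm \<rho>" "permutes_matchings q \<rho>'" "evenperm \<rho>'"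
      using p q by blast
    then have "evenperm (\<rho> \<circ> \<rho>')" using evenperm_comp[OF perm perm] by blast
    then show ?thesis using permutes_matchings_comp[OF \<rho>(3,1)] by blast
  qed
qed

locale four_two = young + assumes dims: "a = 4" "b = 2" "full_col_count = 2"
begin

lemma frc: "full_row_count = 1" and h: "0 \<le> i \<Longrightarrow> i < 2 \<Longrightarrow> height i = 1"
proof -
  show *: "height i = 1" if "0 \<le> i" "i < 2" for i using height_bounds[of i] that dims by simp
  show "full_row_count = 1" using *[of 0] height_0 by simp
qed

sublocale single_row
  by unfold_locales (use frc dims in linarith)+

lemma diagram_eq: "diagram = six_cells"
proof -
  have r: "r y = (if y < 1 then 4 else 2)" if "0 \<le> y" "y < 2" for y
    using r_single[of y] that dims(1,3) by (simp add: dims(2))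
  have "(x, y) \<in> diagram \<longleftrightarrow> (x, y) \<in> six_cells" for x y
  proof -
    have "(x, y) \<in> diagram \<longleftrightarrow> 0 \<le> x \<and> 0 \<le> y \<and> y < b \<and> x < r y"
      using r_bounds[of y] by (auto simp: diagram_def)
    also have "\<dots> \<longleftrightarrow> 0 \<le> x \<and> (y = 0 \<or> y = 1) \<and> x < r y"
      unfolding dims(2) by auto
    also have "\<dots> \<longleftrightarrow> 0 \<le> x \<and> (y = 0 \<and> x < 4 \<or> y = 1 \<and> x < 2)"
      using r[of 0] r[of 1] by auto
    also have "\<dots> \<longleftrightarrow> (x, y) \<in> six_cells"
      by (auto simp: six_cells_def)
    finally show ?thesis .
  qed
  then show ?thesis by auto
qed

text \<open>\<open>\<rho>0\<close> and \<open>\<rho>1\<close> are the actions of the rotations 0 and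
  1 on the matchings; as products of four transpositions they are visibly even.\<close>

definition \<rho>0 :: "nat \<Rightarrow> nat" where "\<rho>0 = transpose 1 4 \<circ> transpose 4 2 \<circ> transpose 2 3 \<circ> transpose 3 5"
definition \<rho>1 :: "nat \<Rightarrow> nat" where "\<rho>1 = transpose 1 4 \<circ> transpose 4 5 \<circ> transpose 5 3 \<circ> transpose 3 2"

lemma \<rho>_table: "\<rho>0 1 = 4" "\<rho>0 4 = 2" "\<rho>0 2 = 3" "\<rho>0 3 = 5" "\<rho>0 5 = 1"
  "\<rho>1 1 = 4" "\<rho>1 4 = 5" "\<rho>1 5 = 3" "\<rho>1 3 = 2" "\<rho>1 2 = 1"
  by (simp_all add: \<rho>0_def \<rho>1_def transpose_def)

lemma \<rho>_permutes: "\<rho>0 permutes {1..5}" "\<rho>1 permutes {1..5}"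
  unfolding \<rho>0_def \<rho>1_def by (intro permutes_compose permutes_swap_id; simp)+

lemma \<rho>_even: "evenperm \<rho>0" "evenperm \<rho>1"
  unfolding \<rho>0_def \<rho>1_def by (simp_all add: evenperm_comp evenperm_swap permutation_compose permutation_swap_id)

lemma generators:
  obtains f g where "f \<in> loops a b diagram" "g \<in> loops a b diagram"
    "\<And>p. p \<in> diagram \<Longrightarrow> f p = corner_move 0 p" "\<And>p. p \<in> diagram \<Longrightarrow> g p = corner_move 1 p"
    "permutes_matchings f \<rho>0" "permutes_matchings g \<rho>1"
proof -
  obtain f where f: "f \<in> loops a b diagram" "\<And>p. p \<in> diagram \<Longrightarrow> f p = corner_move 0 p"
    "is_cycle f (token_path 0) 5"
    by (rule corner_cycle[of 0]) (use dims h[of 0] in auto)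
  obtain g where g: "g \<in> loops a b diagram" "\<And>p. p \<in> diagram \<Longrightarrow> g p = corner_move 1 p"
    "is_cycle g (token_path 1) 5"
    by (rule corner_cycle[of 1]) (use dims h[of 1] in auto)
  have r1: "r 1 = 2" using dims(2,3) unfolding full_col_count_def by simp
  have r0: "r 0 = 4" using r_0 dims(1) by simp
  have tp: "token_path i j = (if j < 2 then (j, 1) else (i + 4 - j, 0))"
    if "0 \<le> i" "i < 2" "0 \<le> j" "j < 5" for i j
  proof -
    have "token_path i j = pull_back i (rect_path i 2 1 j)"
      unfolding token_path_def h[OF that(1,2)] dims(3) ..
    moreover have "a - r 0 = 0" "a - r 1 = 2" using r0 r1 dims(1) by simp_all
    ultimately show ?thesis using that by (cases "j = 2") (auto simp: rect_path_def pull_back_def)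
  qed
  have fv: "f (0, 1) = (1, 1)" "f (1, 1) = (2, 0)" "f (2, 0) = (1, 0)" "f (1, 0) = (0, 0)" "f (0, 0) = (0, 1)"
    using is_cycle_step[OF f(3), of 0] is_cycle_step[OF f(3), of 1] is_cycle_step[OF f(3), of 2]
      is_cycle_step[OF f(3), of 3] is_cycle_last[OF f(3)] by (simp_all add: tp)
  have f3: "f (3, 0) = (3, 0)" by (rule is_cycle_outside[OF f(3)]) (auto simp: tp)
  have gv: "g (0, 1) = (1, 1)" "g (1, 1) = (3, 0)" "g (3, 0) = (2, 0)" "g (2, 0) = (1, 0)" "g (1, 0) = (0, 1)"
    using is_cycle_step[OF g(3), of 0] is_cycle_step[OF g(3), of 1] is_cycle_step[OF g(3), of 2]
      is_cycle_step[OF g(3), of 3] is_cycle_last[OF g(3)] by (simp_all add: tp)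
  have g3: "g (0, 0) = (0, 0)" by (rule is_cycle_outside[OF g(3)]) (auto simp: tp)
  have per: "f permutes six_cells" "g permutes six_cells"
    using f(1) g(1) diagram_eq by (auto simp: loops_def)
  have "f \<circ> partner i = partner (\<rho>0 i) \<circ> f" "g \<circ> partner i = partner (\<rho>1 i) \<circ> g" if i: "i \<in> {1..5}" for i
  proof -
    show "f \<circ> partner i = partner (\<rho>0 i) \<circ> f"
    proof
      fix p show "(f \<circ> partner i) p = (partner (\<rho>0 i) \<circ> f) p"
      proof (cases "p \<in> six_cells")
        case True
        then show ?thesis using i unfolding six_cells_def atLeastAtMost_1_5
          by (elim insertE emptyE; simp only: o_apply fv f3 partner_table \<rho>_table)
      next
        case False
        then show ?thesis using permutes_not_in[OF per(1)] by (simp add: partner_outside)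
      qed
    qed
    show "g \<circ> partner i = partner (\<rho>1 i) \<circ> g"
    proof
      fix p show "(g \<circ> partner i) p = (partner (\<rho>1 i) \<circ> g) p"
      proof (cases "p \<in> six_cells")
        case True
        then show ?thesis using i unfolding six_cells_def atLeastAtMost_1_5
          by (elim insertE emptyE; simp only: o_apply gv g3 partner_table \<rho>_table)
      next
        case False
        then show ?thesis using permutes_not_in[OF per(2)] by (simp add: partner_outside)
      qed
    qed
  qed
  then show thesis using that f g per \<rho>_permutes by (auto simp: permutes_matchings_def)
qed

lemma loops_matchings: "loops a b diagram \<subseteq> {\<pi>. \<exists>\<rho>. permutes_matchings \<pi> \<rho> \<and> evenperm \<rho>}"
proof (rule loops_subset[OF perm_group_matchings])
  obtain f g where fg: "\<And>p. p \<in> diagram \<Longrightarrow> f p = corner_move 0 p" "\<And>p. p \<in> diagram \<Longrightarrow> g p = corner_move 1 p"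
    "permutes_matchings f \<rho>0" "permutes_matchings g \<rho>1" using generators by metis
  show "\<gamma> permutes diagram" if "\<gamma> \<in> {\<pi>. \<exists>\<rho>. permutes_matchings \<pi> \<rho> \<and> evenperm \<rho>}" for \<gamma>
    using that by (auto simp: permutes_matchings_def diagram_eq)
  show "\<exists>\<gamma>\<in>{\<pi>. \<exists>\<rho>. permutes_matchings \<pi> \<rho> \<and> evenperm \<rho>}. \<forall>p\<in>diagram. \<gamma> p = corner_move i p"
    if "0 \<le> i" "i < a - full_col_count" for i
  proof -
    have "i = 0 \<or> i = 1" using that dims by auto
    then show ?thesis using fg \<rho>_even by blast
  qed
qed

lemma even_matchings_realized:
  assumes "\<rho> permutes {1..5}" "evenperm \<rho>"
  shows "\<exists>\<pi>\<in>loops a b diagram. permutes_matchings \<pi> \<rho>"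
proof -
  let ?H = "{\<rho>. \<exists>\<pi>\<in>loops a b diagram. permutes_matchings \<pi> \<rho>}"
  obtain f g where fg: "f \<in> loops a b diagram" "g \<in> loops a b diagram"
    "permutes_matchings f \<rho>0" "permutes_matchings g \<rho>1" using generators by metis
  have per: "p permutes {1..5}" if "p \<in> ?H" for p using that by (auto simp: permutes_matchings_def)
  have "perm_group ?H"
  proof
    show "id \<in> ?H" using G.id_mem permutes_matchings_id by blast
    show "bij p" if "p \<in> ?H" for p using per[OF that] by (rule permutes_bij)
    show "inv' p \<in> ?H" if "p \<in> ?H" for p using that G.inv_mem permutes_matchings_inv by blast
    show "p \<circ> q \<in> ?H" if "p \<in> ?H" "q \<in> ?H" for p q using that G.comp_mem permutes_matchings_comp by blast
  qed
  then interpret H: perm_group ?H .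
  have \<rho>H: "\<rho>0 \<in> ?H" "\<rho>1 \<in> ?H" using fg by auto
  let ?\<phi> = "\<lambda>k::int. if k = 0 then 1 else if k = 1 then 4 else if k = 2 then 2 else if k = 3 then 3 else (5::nat)"
  have five: "{0..<5::int} = {0, 1, 2, 3, 4}" by auto
  have im: "?\<phi> ` {0..<5} = {1..5}" unfolding five atLeastAtMost_1_5 by auto
  have cyc: "is_cycle \<rho>0 ?\<phi> 5"
    unfolding is_cycle_def
  proof (intro conjI allI impI)
    show "inj_on ?\<phi> {0..<5}" unfolding five by (simp add: inj_on_def)
    fix k :: int assume "0 \<le> k \<and> k < 5"
    then have "k \<in> {0, 1, 2, 3, 4}" by auto
    then show "\<rho>0 (?\<phi> k) = ?\<phi> (if k = 5 - 1 then 0 else k + 1)"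
      by (elim insertE emptyE) (simp_all add: \<rho>_table del: One_nat_def)
  next
    fix x assume "x \<notin> ?\<phi> ` {0..<5}"
    then show "\<rho>0 x = x" unfolding im using \<rho>_permutes(1) by (rule permutes_not_in[rotated])
  qed simp
  \<comment> \<open>\<open>seed\<close> concerns the first cycle, so the same five-cycle fills both
    places.\<close>
  interpret two_cycles ?H \<rho>0 \<rho>0 ?\<phi> ?\<phi> 5 5
    by unfold_locales (fact \<rho>H cyc)+
  \<comment> \<open>The product of the two five-cycles is already a three-cycle; the exponent 1 is
    there to fit \<open>pow_eq_three_cycle\<close>.\<close>
  have "(\<rho>1 \<circ> \<rho>0) ^^ 1 = three_cycle 1 5 4"
  proof (rule pow_eq_three_cycle)
    fix x :: nat assume x: "x \<notin> {1, 5, 4}"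
    show "((\<rho>1 \<circ> \<rho>0) ^^ 1) x = x"
    proof (cases "x \<in> {1..5}")
      case True
      then show ?thesis using x unfolding atLeastAtMost_1_5 by (auto simp: \<rho>_table)
    next
      case False
      then show ?thesis using \<rho>_permutes by (simp add: permutes_not_in)
    qed
  qed (simp_all add: \<rho>_table del: One_nat_def)
  then have "three_cycle 1 5 4 \<in> ?H" using H.comp_mem[OF \<rho>H(2,1)] by simp
  then have seed by (intro seedI[of 1 5 4 1 0]) (auto simp: \<rho>_table simp del: One_nat_def)
  then have "H.three_cycles_on {1..5}"
    using three_cycles_on_support[of "{1..5}"] per im by simp
  then have "\<rho> \<in> ?H" using assms by (intro H.even_permutation_mem[of "{1..5}"]) auto
  then show ?thesis by simp
qed

lemma loops_iso: "(sym_group_on diagram)\<lparr>carrier := loops a b diagram\<rparr> \<cong> alt_group 5"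
proof -
  define \<Psi> where "\<Psi> \<pi> = (SOME \<rho>. permutes_matchings \<pi> \<rho>)" for \<pi>
  have \<Psi>: "permutes_matchings \<pi> (\<Psi> \<pi>) \<and> evenperm (\<Psi> \<pi>)" if "\<pi> \<in> loops a b diagram" for \<pi>
  proof -
    obtain \<rho> where \<rho>: "permutes_matchings \<pi> \<rho>" "evenperm \<rho>" using loops_matchings \<open>\<pi> \<in> loops a b diagram\<close> by blast
    from \<rho>(1) have "permutes_matchings \<pi> (\<Psi> \<pi>)" unfolding \<Psi>_def by (rule someI[of "permutes_matchings \<pi>"])
    then have "\<Psi> \<pi> = \<rho>" by (rule permutes_matchings_unique) (rule \<rho>(1))
    then show ?thesis using \<rho> by simp
  qed
  let ?L = "(sym_group_on diagram)\<lparr>carrier := loops a b diagram\<rparr>"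
  have "\<Psi> \<in> hom ?L (alt_group 5)"
  proof (rule homI)
    fix \<pi> assume "\<pi> \<in> carrier ?L"
    then show "\<Psi> \<pi> \<in> carrier (alt_group 5)"
      using \<Psi>[of \<pi>] by (auto simp: permutes_matchings_def alt_group_carrier)
    fix \<pi>' assume "\<pi>' \<in> carrier ?L"
    with \<open>\<pi> \<in> carrier ?L\<close> have p: "\<pi> \<in> loops a b diagram" "\<pi>' \<in> loops a b diagram" by simp_all
    have "permutes_matchings (\<pi> \<circ> \<pi>') (\<Psi> (\<pi> \<circ> \<pi>'))" using \<Psi>[OF G.comp_mem[OF p]] by simp
    moreover have "permutes_matchings (\<pi> \<circ> \<pi>') (\<Psi> \<pi> \<circ> \<Psi> \<pi>')"
      using permutes_matchings_comp \<Psi>[OF p(1)] \<Psi>[OF p(2)] by blast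
    ultimately have "\<Psi> (\<pi> \<circ> \<pi>') = \<Psi> \<pi> \<circ> \<Psi> \<pi>'" by (rule permutes_matchings_unique)
    then show "\<Psi> (\<pi> \<otimes>\<^bsub>?L\<^esub> \<pi>') = \<Psi> \<pi> \<otimes>\<^bsub>alt_group 5\<^esub> \<Psi> \<pi>'"
      by (simp add: sym_group_on_def alt_group_mult)
  qed
  moreover have "inj_on \<Psi> (loops a b diagram)"
  proof (rule inj_onI)
    fix \<pi> \<pi>' assume p: "\<pi> \<in> loops a b diagram" "\<pi>' \<in> loops a b diagram" "\<Psi> \<pi> = \<Psi> \<pi>'"
    then have "permutes_matchings (inv' \<pi>' \<circ> \<pi>) (inv' (\<Psi> \<pi>') \<circ> \<Psi> \<pi>)"
      using permutes_matchings_comp permutes_matchings_inv \<Psi> by blast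
    moreover have "inv' (\<Psi> \<pi>') \<circ> \<Psi> \<pi> = id"
      using \<Psi>[OF p(2)] p(3) permutes_inv_o(2) unfolding permutes_matchings_def by metis
    ultimately have "inv' \<pi>' \<circ> \<pi> = id" using permutes_matchings_id_imp by metis
    then have "inv' \<pi>' (\<pi> x) = x" for x by (metis comp_apply id_apply)
    then show "\<pi> = \<pi>'" using G.bij_mem[OF p(2)] by (metis bij_is_surj ext surj_f_inv_f)
  qed
  moreover have "\<Psi> ` loops a b diagram = carrier (alt_group 5)"
  proof (intro equalityI subsetI)
    fix \<rho> assume "\<rho> \<in> \<Psi> ` loops a b diagram"
    then show "\<rho> \<in> carrier (alt_group 5)"
      using \<Psi> by (auto simp: permutes_matchings_def alt_group_carrier)
  next
    fix \<rho> assume "\<rho> \<in> carrier (alt_group 5)"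
    then obtain \<pi> where \<pi>: "\<pi> \<in> loops a b diagram" "permutes_matchings \<pi> \<rho>"
      using even_matchings_realized unfolding alt_group_carrier by blast
    then have "\<Psi> \<pi> = \<rho>" using \<Psi> permutes_matchings_unique by blast
    then show "\<rho> \<in> \<Psi> ` loops a b diagram" using \<pi>(1) by blast
  qed
  ultimately have "\<Psi> \<in> iso ?L (alt_group 5)" by (intro isoI) (simp_all add: bij_betw_def)
  then show ?thesis unfolding is_iso_def by blast
qed

end

section \<open>Compact configurations\<close>

lemma spanned_pos: "spanned a b S \<Longrightarrow> 0 < a \<and> 0 < b"
  by (auto simp: spanned_def box_def)

lemma spanned_normalized:
  assumes "finite A" "A \<noteq> {}"
  shows "\<exists>a b v S. spanned a b S \<and> A = (\<lambda>p. p + v) ` S"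
proof -
  define S where "S = (\<lambda>p. p - (xmin A, ymin A)) ` A"
  have A: "A = (\<lambda>p. p + (xmin A, ymin A)) ` S" by (simp add: S_def image_image)
  have f: "finite (fst ` A)" "fst ` A \<noteq> {}" "finite (snd ` A)" "snd ` A \<noteq> {}" using assms by auto
  note m = Min_in[OF f(1,2)] Max_in[OF f(1,2)] Min_in[OF f(3,4)] Max_in[OF f(3,4)]
  note le = Min_le[OF f(1)] Max_ge[OF f(1)] Min_le[OF f(3)] Max_ge[OF f(3)]
  have S_mem: "p \<in> S \<longleftrightarrow> p + (xmin A, ymin A) \<in> A" for p
  proof
    assume "p + (xmin A, ymin A) \<in> A"
    then show "p \<in> S" unfolding S_def by (intro image_eqI[of _ _ "p + (xmin A, ymin A)"]) auto
  qed (auto simp: S_def)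
  obtain p1 where p1: "p1 \<in> A" "fst p1 = xmin A" using m(1) by (auto simp: xmin_def)
  obtain p2 where p2: "p2 \<in> A" "fst p2 = xmax A" using m(2) by (auto simp: xmax_def)
  obtain p3 where p3: "p3 \<in> A" "snd p3 = ymin A" using m(3) by (auto simp: ymin_def)
  obtain p4 where p4: "p4 \<in> A" "snd p4 = ymax A" using m(4) by (auto simp: ymax_def)
  note p = p1 p2 p3 p4
  have "spanned (xmax A - xmin A + 1) (ymax A - ymin A + 1) S"
    unfolding spanned_def
  proof (intro conjI subsetI exI)
    fix q assume "q \<in> S"
    then have "q + (xmin A, ymin A) \<in> A" using S_mem by blast
    then have q: "fst q + xmin A \<in> fst ` A" "snd q + ymin A \<in> snd ` A" by (force simp: image_iff)+
    show "q \<in> box (xmax A - xmin A + 1) (ymax A - ymin A + 1)"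
      using le(1,2)[OF q(1)] le(3,4)[OF q(2)]
      by (cases q) (simp add: box_def xmin_def xmax_def ymin_def ymax_def)
  next
    show "(0, snd p1 - ymin A) \<in> S" using p(1,2) by (simp add: S_mem prod_eq_iff flip: p(2))
    show "(xmax A - xmin A + 1 - 1, snd p2 - ymin A) \<in> S" using p(3,4) by (simp add: S_mem flip: p(4))
    show "(fst p3 - xmin A, 0) \<in> S" using p(5,6) by (simp add: S_mem flip: p(6))
    show "(fst p4 - xmin A, ymax A - ymin A + 1 - 1) \<in> S" using p(7,8) by (simp add: S_mem flip: p(8))
  qed
  then show ?thesis using A by blast
qed

text \<open>The translation \<open>u\<close> vanishes because the left and bottom sides of the box
  stay attained. In a row with a hole the rightmost token would then vacate its cell, and no token
  could take its place.\<close>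

lemma left_justified:
  assumes S: "spanned a b S" and fixed: "move_left S ` S = (\<lambda>p. p + u) ` S"
    and xy: "(x, y) \<in> S" and x': "0 \<le> x'" "x' < x"
  shows "(x', y) \<in> S"
proof -
  have pos: "0 \<le> x" "0 \<le> y" if "(x, y) \<in> S" for x y using that S by (auto simp: spanned_def box_def)
  have posp: "0 \<le> fst p" "0 \<le> snd p" if "p \<in> S" for p using pos[of "fst p" "snd p"] that by auto
  have mem: "p + u \<in> move_left S ` S \<longleftrightarrow> p \<in> S" for p unfolding fixed by auto
  have ml: "0 \<le> fst p \<and> (\<exists>x. (x, snd p) \<in> S)" if p: "p \<in> move_left S ` S" for p
  proof -
    obtain x y where "(x, y) \<in> S" "p = move_left S (x, y)" using p by auto
    then show ?thesis using pos by (auto simp: move_left_def)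
  qed
  obtain y1 x1 where c: "(0, y1) \<in> S" "(x1, 0) \<in> S" using S by (auto simp: spanned_def)
  have "move_left S (0, y1) = (0, y1)" by (simp add: move_left_def)
  then have "(0, y1) \<in> move_left S ` S" using c(1) by force
  then have "(0, y1) - u \<in> S" using mem[of "(0, y1) - u"] by simp
  then have "fst u \<le> 0" using posp(1)[of "(0, y1) - u"] by simp
  moreover have "0 \<le> fst u" using ml[of "(0, y1) + u"] mem[of "(0, y1)"] c(1) by simp
  moreover have "0 \<le> snd u" using ml[of "(x1, 0) + u"] mem[of "(x1, 0)"] c(2) pos by auto
  moreover have "snd u \<le> 0"
  proof -
    have "snd (move_left S (x1, 0)) = 0" by (simp add: move_left_def)
    moreover have "move_left S (x1, 0) \<in> move_left S ` S" using c(2) by blast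
    ultimately have "move_left S (x1, 0) - u \<in> S" "snd (move_left S (x1, 0) - u) = - snd u"
      using mem[of "move_left S (x1, 0) - u"] by simp_all
    then show ?thesis using posp(2)[of "move_left S (x1, 0) - u"] by simp
  qed
  ultimately have "u = 0" by (simp add: prod_eq_iff)
  then have eq: "move_left S ` S = S" using fixed by simp
  show ?thesis
  proof (rule ccontr)
    assume hole: "(x', y) \<notin> S"
    have "S \<subseteq> box a b" using S by (simp add: spanned_def)
    then have "{z. (z, y) \<in> S} \<subseteq> {0..<a}" by (auto simp: box_def)
    then have fin: "finite {z. (z, y) \<in> S}" by (rule finite_subset) simp
    define m where "m = Max {z. (z, y) \<in> S}"
    have m: "(m, y) \<in> S" "\<And>z. (z, y) \<in> S \<Longrightarrow> z \<le> m"
      using Max_in[OF fin] Max_ge[OF fin] xy by (auto simp: m_def)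
    obtain z w where z: "(z, w) \<in> S" "move_left S (z, w) = (m, y)" using m(1) eq by (metis imageE surj_pair)
    then have w: "w = y" "z = m \<or> z = m + 1" by (auto simp: move_left_def split: if_splits)
    then have "z = m" using m(2)[of z] z(1) by auto
    moreover have "move_left S (m, y) = (m - 1, y)"
    proof -
      have "\<exists>x'. 0 \<le> x' \<and> x' < m \<and> (x', y) \<notin> S"
        using hole x' m(2)[OF xy] by (intro exI[of _ x']) auto
      then show ?thesis by (simp add: move_left_def)
    qed
    ultimately show False using z w by simp
  qed
qed

lemma initial_segment:
  fixes A :: "int set"
  assumes "finite A" "\<And>x. x \<in> A \<Longrightarrow> 0 \<le> x" "\<And>x x'. x \<in> A \<Longrightarrow> 0 \<le> x' \<Longrightarrow> x' < x \<Longrightarrow> x' \<in> A"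
  shows "A = {0..<int (card A)}"
proof (cases "A = {}")
  case False
  have "A = {0..Max A}"
  proof (intro equalityI subsetI)
    fix x assume "x \<in> {0..Max A}"
    then show "x \<in> A" using assms(3)[OF Max_in[OF assms(1) False], of x] Max_in[OF assms(1) False]
      by (cases "x = Max A") auto
  next
    fix x assume "x \<in> A"
    then show "x \<in> {0..Max A}" using assms(2)[of x] Max_ge[OF assms(1), of x] by simp
  qed
  moreover have "0 \<le> Max A" using assms(2)[OF Max_in[OF assms(1) False]] .
  ultimately have "int (card A) = Max A + 1" using card_atLeastAtMost_int[of 0 "Max A"] by simp
  then have "{0..<int (card A)} = {0..Max A}" by auto
  then show ?thesis using \<open>A = {0..Max A}\<close> by (simp only:)
qed simp

lemma young_of_justified:
  assumes S: "spanned a b S" and left: "\<And>x y x'. (x, y) \<in> S \<Longrightarrow> 0 \<le> x' \<Longrightarrow> x' < x \<Longrightarrow> (x', y) \<in> S"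
    and down: "\<And>x y y'. (x, y) \<in> S \<Longrightarrow> 0 \<le> y' \<Longrightarrow> y' < y \<Longrightarrow> (x, y') \<in> S"
  shows "\<exists>r c. young a b r c \<and> young.diagram a b r = S"
proof -
  define r where "r = (\<lambda>y. int (card {x. (x, y) \<in> S}))"
  define c where "c = (\<lambda>x. int (card {y. (x, y) \<in> S}))"
  have Sb: "0 \<le> x" "x < a" "0 \<le> y" "y < b" if "(x, y) \<in> S" for x y
    using that S by (auto simp: spanned_def box_def)
  have row: "{x. (x, y) \<in> S} = {0..<r y}" for y
    unfolding r_def
  proof (rule initial_segment)
    have "{x. (x, y) \<in> S} \<subseteq> {0..<a}" using Sb by auto
    then show "finite {x. (x, y) \<in> S}" by (rule finite_subset) simp
  qed (use Sb left in blast)+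
  have col: "{y. (x, y) \<in> S} = {0..<c x}" for x
    unfolding c_def
  proof (rule initial_segment)
    have "{y. (x, y) \<in> S} \<subseteq> {0..<b}" using Sb by auto
    then show "finite {y. (x, y) \<in> S}" by (rule finite_subset) simp
  qed (use Sb down in blast)+
  have mem: "(x, y) \<in> S \<longleftrightarrow> 0 \<le> x \<and> x < r y" "(x, y) \<in> S \<longleftrightarrow> 0 \<le> y \<and> y < c x" for x y
    using row[of y] col[of x] by auto
  obtain x1 y1 where top: "(x1, b - 1) \<in> S" and right: "(a - 1, y1) \<in> S" using S by (auto simp: spanned_def)
  have pos: "0 < a" "0 < b" using spanned_pos[OF S] by auto
  have y: "young a b r c"
  proof
    fix y assume y: "0 \<le> y" "y < b"
    have "(x1, y) \<in> S" using down[OF top, of y] top y by (cases "y = b - 1") auto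
    then have "1 \<le> r y" using mem(1)[of x1 y] by auto
    moreover have "r y \<le> a" using mem(1)[of "r y - 1" y] Sb(2)[of "r y - 1" y] \<open>1 \<le> r y\<close> by auto
    ultimately show "1 \<le> r y \<and> r y \<le> a" ..
  next
    fix x assume x: "0 \<le> x" "x < a"
    have "(x, y1) \<in> S" using left[OF right, of x] right x by (cases "x = a - 1") auto
    then have "1 \<le> c x" using mem(2)[of x y1] by auto
    moreover have "c x \<le> b" using mem(2)[of x "c x - 1"] Sb(4)[of x "c x - 1"] \<open>1 \<le> c x\<close> by auto
    ultimately show "1 \<le> c x \<and> c x \<le> b" ..
  next
    fix x y :: int assume "0 \<le> x" "x < a" "0 \<le> y" "y < b"
    then show "x < r y \<longleftrightarrow> y < c x" using mem[of x y] by auto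
  qed (use pos in auto)
  moreover have "young.diagram a b r = S"
    unfolding young.diagram_def[OF y] using mem(1) Sb by auto
  ultimately show ?thesis by blast
qed

lemma canonical_diagram:
  assumes "canonical C"
  shows "\<exists>a b r c v. young a b r c \<and> dom C = (\<lambda>p. p + v) ` young.diagram a b r"
proof -
  obtain a b v S where S: "spanned a b S" and dom: "dom C = (\<lambda>p. p + v) ` S"
    using spanned_normalized[of "dom C"] assms by (auto simp: canonical_def configuration_def)
  have occ: "occupies C v S (\<lambda>p. C (p + v))" using dom by (simp add: occupies_def)
  have fixed: "\<exists>u. move a b d S ` S = (\<lambda>p. p + u) ` S" if same: "same_cells C (push d C)" for d
  proof -
    obtain v' L' where "occupies (push d C) v' (move a b d S ` S) L'" using push_occupies[OF occ S] by blast
    then have d: "dom (push d C) = (\<lambda>p. p + v') ` move a b d S ` S" by (simp add: occupies_def)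
    obtain w where "dom (push d C) = (\<lambda>p. p + w) ` dom C" using same unfolding same_cells_def by blast
    then have "(\<lambda>p. p + v') ` move a b d S ` S = (\<lambda>p. p + (v + w)) ` S"
      unfolding d dom by (simp add: image_image add.assoc)
    then have "(\<lambda>p. p - v') ` (\<lambda>p. p + v') ` move a b d S ` S = (\<lambda>p. p - v') ` (\<lambda>p. p + (v + w)) ` S" by simp
    then have "move a b d S ` S = (\<lambda>p. p + (v + w - v')) ` S" by (simp add: image_image add_diff_eq)
    then show ?thesis by blast
  qed
  have left: "(x', y) \<in> S" if "(x, y) \<in> S" "0 \<le> x'" "x' < x" for x y x'
    using fixed[of Leftward] left_justified[OF S _ that] assms by (auto simp: canonical_def)
  have down: "(x, y') \<in> S" if h: "(x, y) \<in> S" "0 \<le> y'" "y' < y" for x y y'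
  proof -
    obtain u where u: "move a b Downward S ` S = (\<lambda>p. p + u) ` S"
      using fixed[of Downward] assms by (auto simp: canonical_def)
    have "move_left (prod.swap ` S) ` prod.swap ` S = prod.swap ` move a b Downward S ` S"
      by (simp add: image_image)
    also have "\<dots> = (\<lambda>p. p + prod.swap u) ` prod.swap ` S"
      unfolding u by (simp add: image_image prod.swap_def)
    finally have "(y', x) \<in> prod.swap ` S"
      using left_justified[OF spanned_swap[OF S]] h unfolding mem_swap_pair by blast
    then show ?thesis by (simp only: mem_swap_pair)
  qed
  have "\<exists>r c. young a b r c \<and> young.diagram a b r = S"
    by (rule young_of_justified[OF S]) (fact left, fact down)
  then show ?thesis using dom by blast
qed

text \<open>\<open>ds\<close> leads from the diagram to the present shape and thereby fixes an
  identification of their tokens; \<open>v\<close> is the position of the box in the plane.\<close>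

locale compact_young = young +
  fixes s t :: "int \<Rightarrow> int" and ds :: "direction list" and v :: cell and C :: "'l config"
  assumes s: "offsets a s" and t: "offsets b t" and from_diagram: "shape a b ds diagram = cells s t"
    and dom: "dom C = (\<lambda>p. p + v) ` cells s t"

lemma compact_config_cells:
  assumes "compact_config C"
  shows "\<exists>a b r c s t ds v. compact_young a b r c s t ds v C"
proof -
  obtain C0 es w where C0: "canonical C0" and C: "C = translate w (fold push es C0)"
    using assms by (auto simp: compact_config_def reachable_def translation_equiv_def)
  obtain a b r c v where y: "young a b r c" and dom0: "dom C0 = (\<lambda>p. p + v) ` young.diagram a b r"
    using canonical_diagram[OF C0] by blast
  interpret young a b r c by (rule y)
  have occ: "occupies C0 v diagram (\<lambda>p. C0 (p + v))" using dom0 by (simp add: occupies_def)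
  have "compact_shape diagram"
    unfolding compact_shape_def cells_zero[symmetric] using offsets_zero by blast
  then obtain v' L' where "occupies (fold push es C0) v' (shape a b es diagram) L'"
    using fold_push_occupies[OF occ, of compact_shape] compact_shape_step by blast
  then have "dom (fold push es C0) = (\<lambda>p. p + v') ` shape a b es diagram" by (simp add: occupies_def)
  moreover have "dom C = (\<lambda>p. p + w) ` dom (fold push es C0)"
    unfolding C set_eq_iff mem_translate_image by (simp add: translate_def domIff)
  ultimately have d: "dom C = (\<lambda>p. p + (v' + w)) ` shape a b es diagram" by (simp add: image_image add.assoc)
  obtain s t where st: "offsets a s" "offsets b t" "shape a b es diagram = cells s t"
    using parity_preserving_track[OF offsets_zero offsets_zero, of es] by (auto simp: cells_zero)
  then have "compact_young a b r c s t es (v' + w) C" using d by unfold_locales auto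
  then show ?thesis by blast
qed

section \<open>Transfer from box coordinates to labeled configurations\<close>

context compact_young
begin

definition place :: "cell \<Rightarrow> cell" where
  "place p = track a b ds diagram p + v"

lemma to_diagram: "\<exists>es. shape a b es (cells s t) = diagram"
  by (rule return_to_diagram[OF s t])

lemma shift_bij: "bij_betw (\<lambda>p. p + v) (cells s t) (dom C)"
  unfolding dom by (rule bij_betw_imageI) (auto simp: inj_on_def)

lemma track_bij: "bij_betw (track a b ds diagram) diagram (cells s t)"
  using to_diagram loops_conj(1)[OF finite_diagram from_diagram] by blast

lemma place_bij: "bij_betw place diagram (dom C)"
  using bij_betw_trans[OF track_bij shift_bij] by (simp add: place_def[abs_def] o_def)

lemma fold_push_cells:
  assumes "occupies D u (cells s t) L"
  shows "\<exists>v' L'. occupies (fold push es D) v' (shape a b es (cells s t)) L' \<and>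
    (\<forall>p\<in>cells s t. L' (track a b es (cells s t) p) = L p)"
proof (rule fold_push_occupies[OF assms, of compact_shape])
  show "compact_shape (cells s t)" using s t by (auto simp: compact_shape_def)
qed (rule compact_shape_step)

text \<open>Both shapes span the same box, so the lower left corner of the configuration determines
  the translation.\<close>

lemma shape_returns:
  assumes D: "occupies D v' (shape a b es (cells s t)) L'" and dD: "dom D = (\<lambda>p. p + w) ` dom C"
  shows "v' = v + w" "shape a b es (cells s t) = cells s t"
proof -
  obtain s' t' where st': "offsets a s'" "offsets b t'" "shape a b es (cells s t) = cells s' t'"
    using parity_preserving_track[OF s t] by blast
  have d1: "dom D = (\<lambda>p. p + v') ` cells s' t'" using D st' by (simp add: occupies_def)
  have d2: "dom D = (\<lambda>p. p + (v + w)) ` cells s t" using dD by (simp add: dom image_image add.assoc)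
  show v': "v' = v + w"
    using occupies_bounds(1,2)[OF d1 spanned_cells[OF st'(1,2)]] occupies_bounds(1,2)[OF d2 spanned_cells[OF s t]]
    by (simp add: prod_eq_iff)
  have "inj (\<lambda>p. p + v')" by (simp add: inj_on_def)
  then have "cells s' t' = cells s t" using d1 d2 v' by (metis inj_image_eq_iff)
  then show "shape a b es (cells s t) = cells s t" using st' by simp
qed

definition outcome :: "direction list \<Rightarrow> cell \<Rightarrow> cell" where
  "outcome es = map_permutation (cells s t) (\<lambda>p. p + v)
     (\<lambda>p. if p \<in> cells s t then track a b es (cells s t) p else p)"

lemma outcome_permutes:
  assumes "shape a b es (cells s t) = cells s t"
  shows "outcome es permutes dom C"
proof -
  have "(\<lambda>p. if p \<in> cells s t then track a b es (cells s t) p else p) permutes cells s t"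
    using loopsI[OF finite_cells assms] by (simp add: loops_def)
  then show ?thesis unfolding outcome_def by (rule map_permutation_permutes[OF shift_bij])
qed

lemma outcome_apply: "p \<in> cells s t \<Longrightarrow> outcome es (p + v) = track a b es (cells s t) p + v"
  unfolding outcome_def by (subst map_permutation_apply[OF bij_betw_imp_inj_on[OF shift_bij]]) auto

lemma rearrange_outcome:
  assumes sh: "shape a b es (cells s t) = cells s t" and D: "occupies D v (cells s t) (\<lambda>p. D (p + v))"
  shows "\<exists>u. fold push es D = translate u (rearrange (outcome es) D)"
proof -
  obtain v' L' where L': "occupies (fold push es D) v' (cells s t) L'"
    "\<forall>p\<in>cells s t. L' (track a b es (cells s t) p) = D (p + v)"
    using fold_push_cells[OF D, of es] unfolding sh by blast
  have per: "outcome es permutes dom C" by (rule outcome_permutes[OF sh])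
  have "fold push es D = translate (v' - v) (rearrange (outcome es) D)"
  proof
    fix p
    let ?q = "p - (v' - v)"
    have R: "translate (v' - v) (rearrange (outcome es) D) p = D (inv' (outcome es) ?q)"
      by (simp add: translate_def rearrange_def)
    show "fold push es D p = translate (v' - v) (rearrange (outcome es) D) p"
    proof (cases "p - v' \<in> cells s t")
      case True
      then obtain q where q: "q \<in> cells s t" "p - v' = track a b es (cells s t) q"
        using sh unfolding shape_def by (metis imageE)
      have "?q = outcome es (q + v)" using outcome_apply[OF q(1), of es] q(2) by (simp add: algebra_simps)
      then have "inv' (outcome es) ?q = q + v" using permutes_inj[OF per] by (simp add: inv_f_f)
      moreover have "fold push es D p = L' (p - v')"
        using L'(1) True unfolding occupies_def by (metis diff_add_cancel)
      ultimately show ?thesis using L'(2) q R by simp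
    next
      case False
      have "p \<notin> dom (fold push es D)" using L'(1) False by (auto simp: occupies_def)
      moreover have "?q \<notin> dom C" using False unfolding dom mem_translate_image by (simp add: algebra_simps)
      moreover from this have "inv' (outcome es) ?q = ?q" using permutes_inv[OF per] by (simp add: permutes_not_in)
      moreover have "dom D = dom C" using D dom by (simp add: occupies_def)
      ultimately show ?thesis unfolding R by (metis domIff)
    qed
  qed
  then show ?thesis by blast
qed

lemma push_perms_outcome: "push_perms C = outcome ` {es. shape a b es (cells s t) = cells s t}"
proof (intro equalityI subsetI)
  let ?D = "distinct_tokens C"
  have dD: "dom ?D = dom C" by (auto simp: distinct_tokens_def split: if_splits)
  have occ: "occupies ?D v (cells s t) (\<lambda>p. ?D (p + v))" using dom dD by (simp add: occupies_def)
  {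
    fix \<pi> assume "\<pi> \<in> outcome ` {es. shape a b es (cells s t) = cells s t}"
    then obtain es where sh: "shape a b es (cells s t) = cells s t" and \<pi>: "\<pi> = outcome es" by blast
    have per: "\<pi> permutes dom C" using outcome_permutes[OF sh] \<pi> by simp
    obtain u where u: "fold push es ?D = translate u (rearrange \<pi> ?D)"
      using rearrange_outcome[OF sh occ] \<pi> by blast
    have m: "inv' \<pi> p \<in> dom C \<longleftrightarrow> p \<in> dom C" for p using permutes_in_image[OF permutes_inv[OF per]] .
    have "p \<in> dom (fold push es ?D) \<longleftrightarrow> p - u \<in> dom C" for p
    proof -
      have "fold push es ?D p = ?D (inv' \<pi> (p - u))" by (simp only: u translate_def rearrange_def o_apply)
      then have "p \<in> dom (fold push es ?D) \<longleftrightarrow> inv' \<pi> (p - u) \<in> dom ?D" by (simp only: domIff)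
      then show ?thesis unfolding dD m .
    qed
    then have "dom (fold push es ?D) = (\<lambda>p. p + u) ` dom C" unfolding set_eq_iff mem_translate_image by blast
    moreover have "fold push es ?D (\<pi> p + u) = Some p" if "p \<in> dom C" for p
      unfolding u using that permutes_inj[OF per] by (simp add: translate_def rearrange_def distinct_tokens_def inv_f_f)
    ultimately show "\<pi> \<in> push_perms C" unfolding push_perms_def Let_def using per by blast
  next
    fix \<pi> assume "\<pi> \<in> push_perms C"
    then obtain es w where per: "\<pi> permutes dom C" and d: "dom (fold push es ?D) = (\<lambda>p. p + w) ` dom C"
      and tok: "\<forall>p\<in>dom C. fold push es ?D (\<pi> p + w) = Some p"
      unfolding push_perms_def Let_def mem_Collect_eq by (elim conjE exE)
    obtain v' L' where L': "occupies (fold push es ?D) v' (shape a b es (cells s t)) L'"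
      "\<forall>p\<in>cells s t. L' (track a b es (cells s t) p) = ?D (p + v)"
      using fold_push_cells[OF occ] by blast
    note ret = shape_returns[OF L'(1) d]
    have "\<pi> p = outcome es p" for p
    proof (cases "p \<in> dom C")
      case True
      then obtain q where q: "q \<in> cells s t" "p = q + v" using dom by blast
      have "\<pi> p \<in> dom C" using True per by (simp add: permutes_in_image)
      then obtain q' where q': "q' \<in> cells s t" "\<pi> p = track a b es (cells s t) q' + v"
        using dom ret(2) unfolding shape_def by (metis (no_types, lifting) imageE)
      have "track a b es (cells s t) q' \<in> shape a b es (cells s t)" using q'(1) by (simp add: shape_def)
      then have "fold push es ?D (track a b es (cells s t) q' + v') = ?D (q' + v)"
        using L' q'(1) by (simp add: occupies_def)
      moreover have "\<pi> p + w = track a b es (cells s t) q' + v'" using q'(2) ret(1) by (simp add: add.assoc)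
      \<comment> \<open>In \<open>distinct_tokens\<close> a label is the original cell of its token,
        so reading it identifies the token that has arrived.\<close>
      ultimately have "?D (q' + v) = Some p" using tok True by metis
      then have "q' + v = p" by (auto simp: distinct_tokens_def split: if_splits)
      then show ?thesis using outcome_apply[OF q'(1)] q'(2) by simp
    next
      case False
      then show ?thesis using per outcome_permutes[OF ret(2)] by (simp add: permutes_not_in)
    qed
    then show "\<pi> \<in> outcome ` {es. shape a b es (cells s t) = cells s t}" using ret(2) by blast
  }
qed

text \<open>Equal labels make different permutations indistinguishable; hence only some push
  permutation with the same labeled result is asked for.\<close>

lemma reachable_rearrange_iff:
  assumes per: "\<pi> permutes dom C"
  shows "reachable C (rearrange \<pi> C) \<longleftrightarrow> (\<exists>\<sigma>\<in>push_perms C. rearrange \<sigma> C = rearrange \<pi> C)"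
proof
  have occ: "occupies C v (cells s t) (\<lambda>p. C (p + v))" using dom by (simp add: occupies_def)
  have tr: "translate u (translate u' D) = translate (u + u') D" for u u' and D :: "'l config"
    by (simp add: translate_def algebra_simps)
  {
    assume "\<exists>\<sigma>\<in>push_perms C. rearrange \<sigma> C = rearrange \<pi> C"
    then obtain es where sh: "shape a b es (cells s t) = cells s t" and r: "rearrange (outcome es) C = rearrange \<pi> C"
      unfolding push_perms_outcome by blast
    obtain u where "fold push es C = translate u (rearrange \<pi> C)" using rearrange_outcome[OF sh occ] r by auto
    then have "rearrange \<pi> C = translate (- u) (fold push es C)" by (simp add: tr) (simp add: translate_def)
    then show "reachable C (rearrange \<pi> C)" unfolding reachable_def translation_equiv_def by blast
  next
    assume "reachable C (rearrange \<pi> C)"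
    then obtain es u where eq: "rearrange \<pi> C = translate u (fold push es C)"
      unfolding reachable_def translation_equiv_def by blast
    have dR: "dom (rearrange \<sigma> C) = dom C" if "\<sigma> permutes dom C" for \<sigma>
      using permutes_in_image[OF permutes_inv[OF that]] by (auto simp: rearrange_def domIff set_eq_iff)
    have "fold push es C = translate (- u) (rearrange \<pi> C)" unfolding eq tr by (simp add: translate_def)
    then have "p \<in> dom (fold push es C) \<longleftrightarrow> p + u \<in> dom (rearrange \<pi> C)" for p
      by (simp add: translate_def domIff)
    then have d: "dom (fold push es C) = (\<lambda>p. p + (- u)) ` dom C"
      unfolding dR[OF per] set_eq_iff mem_translate_image by simp
    obtain v' L' where L': "occupies (fold push es C) v' (shape a b es (cells s t)) L'"
      using fold_push_cells[OF occ] by blast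
    note ret = shape_returns[OF L' d]
    obtain u' where u': "fold push es C = translate u' (rearrange (outcome es) C)"
      using rearrange_outcome[OF ret(2) occ] by blast
    have eq': "rearrange \<pi> C = translate (u + u') (rearrange (outcome es) C)" unfolding eq u' tr ..
    have "dom C = (\<lambda>p. p + (u + u')) ` dom C"
    proof -
      have "p \<in> dom (rearrange \<pi> C) \<longleftrightarrow> p - (u + u') \<in> dom (rearrange (outcome es) C)" for p
        unfolding eq' by (simp add: translate_def domIff)
      then show ?thesis unfolding dR[OF per] dR[OF outcome_permutes[OF ret(2)]] set_eq_iff mem_translate_image by simp
    qed
    then have d2: "dom C = (\<lambda>p. p + (v + (u + u'))) ` cells s t" unfolding dom by (simp add: image_image add.assoc)
    \<comment> \<open>A finite set of cells that equals its translate has an unchanged bounding box,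
      so the translation is zero.\<close>
    have "v + (u + u') = v"
      using occupies_bounds(1,2)[OF d2 spanned_cells[OF s t]] occupies_bounds(1,2)[OF dom spanned_cells[OF s t]]
      by (simp add: prod_eq_iff)
    then have "u + u' = 0" by simp
    then have "rearrange (outcome es) C = rearrange \<pi> C" unfolding eq' by (simp add: translate_def)
    then show "\<exists>\<sigma>\<in>push_perms C. rearrange \<sigma> C = rearrange \<pi> C" unfolding push_perms_outcome using ret(2) by blast
  }
qed

lemma push_perms_eq: "push_perms C = map_permutation diagram place ` loops a b diagram"
proof -
  have "push_perms C = map_permutation (cells s t) (\<lambda>p. p + v) ` loops a b (cells s t)"
  proof (intro equalityI subsetI)
    fix \<pi> assume "\<pi> \<in> push_perms C"
    then show "\<pi> \<in> map_permutation (cells s t) (\<lambda>p. p + v) ` loops a b (cells s t)"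
      unfolding push_perms_outcome outcome_def using loopsI[OF finite_cells] by blast
  next
    fix \<pi> assume "\<pi> \<in> map_permutation (cells s t) (\<lambda>p. p + v) ` loops a b (cells s t)"
    then obtain \<rho> es where l: "\<pi> = map_permutation (cells s t) (\<lambda>p. p + v) \<rho>" "\<rho> permutes cells s t"
      "shape a b es (cells s t) = cells s t" "\<forall>p\<in>cells s t. track a b es (cells s t) p = \<rho> p"
      by (auto simp: loops_def)
    then have "\<rho> = (\<lambda>p. if p \<in> cells s t then track a b es (cells s t) p else p)"
      by (auto simp: permutes_not_in)
    then show "\<pi> \<in> push_perms C" unfolding push_perms_outcome outcome_def using l(1,3) by blast
  qed
  also obtain es where es: "shape a b es (cells s t) = diagram" using to_diagram by blast
  then have "loops a b (cells s t) = map_permutation diagram (track a b ds diagram) ` loops a b diagram"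
    by (rule loops_conj(2)[OF finite_diagram from_diagram])
  finally show ?thesis
    using map_permutation_compose[OF track_bij bij_betw_imp_inj_on[OF shift_bij]]
    by (simp add: image_image place_def[abs_def] o_def)
qed

end

section \<open>Counting the empty cells of a diagram\<close>

context young
begin

definition holes :: "cell set" where
  "holes = box a b - diagram"

lemma mem_holes: "(x, y) \<in> holes \<longleftrightarrow> 0 \<le> x \<and> x < a \<and> 0 \<le> y \<and> y < b \<and> r y \<le> x"
  by (auto simp: holes_def box_def diagram_def)

lemma finite_box: "finite (box a b)"
  by (simp add: box_def)

lemma finite_holes: "finite holes"
  by (simp add: holes_def box_def)

lemma diagram_subset_box: "diagram \<subseteq> box a b"
  by (auto simp: box_def diagram_def)

lemma card_holes: "int (card holes) + int (card diagram) = a * b"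
proof -
  have "card holes + card diagram = card (box a b)"
    unfolding holes_def using card_Diff_subset[OF finite_diagram diagram_subset_box]
      card_mono[OF _ diagram_subset_box] finite_box by linarith
  moreover have "int (card (box a b)) = a * b" using a_pos b_pos by (simp add: box_def)
  ultimately show ?thesis by linarith
qed

lemma full_row_count_bounds: "1 \<le> full_row_count" "full_row_count \<le> b"
  using T.full_col_count_bounds by (simp_all add: T_full)

lemma full_col_count_less_iff: "full_col_count < a \<longleftrightarrow> full_row_count < b"
  using dual[of "a - 1" "b - 1"] a_pos b_pos full_col_count_bounds full_row_count_bounds
  by (auto simp: full_col_count_def full_row_count_def)

lemma corner_hole: "holes \<noteq> {} \<Longrightarrow> full_col_count < a"
  using full_col_count_le by (force simp: mem_holes)

lemma no_holes: "holes = {} \<longleftrightarrow> full_col_count = a"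
proof -
  have "(a - 1, b - 1) \<in> holes" if "full_col_count < a"
    using that a_pos b_pos by (simp add: mem_holes full_col_count_def)
  then show ?thesis using corner_hole full_col_count_bounds by fastforce
qed

lemma holes_subset:
  "holes \<subseteq> {full_col_count..<a} \<times> {full_row_count..<b}"
proof
  fix p assume p: "p \<in> holes"
  obtain x y where xy: "p = (x, y)" by (cases p)
  have h: "0 \<le> x" "x < a" "0 \<le> y" "y < b" "r y \<le> x" using p by (auto simp: xy mem_holes)
  have "full_row_count \<le> c x" using T.full_col_count_le[of x] h by (simp add: T_full)
  moreover have "c x \<le> y" using dual[of x y] h by auto
  ultimately show "p \<in> {full_col_count..<a} \<times> {full_row_count..<b}"
    using h full_col_count_le[of y] by (simp add: xy)
qed

lemma single_hole:
  assumes "card holes = 1"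
  shows "full_col_count = a - 1" "full_row_count = b - 1"
proof -
  have ne: "holes \<noteq> {}" using assms by auto
  have lt: "full_col_count < a" "full_row_count < b" using corner_hole[OF ne] full_col_count_less_iff by auto
  obtain z where z: "holes = {z}" using assms by (auto simp: card_1_singleton_iff)
  have "(a - 1, b - 1) \<in> holes" using lt a_pos b_pos by (simp add: mem_holes full_col_count_def)
  then have z': "z = (a - 1, b - 1)" using z by simp
  have "a - 2 < full_col_count"
  proof (rule ccontr)
    assume "\<not> a - 2 < full_col_count"
    then have "(a - 2, b - 1) \<in> holes" using full_col_count_bounds a_pos b_pos by (simp add: mem_holes full_col_count_def)
    then show False using z z' by simp
  qed
  then show "full_col_count = a - 1" using lt by simp
  have "b - 2 < full_row_count"
  proof (rule ccontr)
    assume n: "\<not> b - 2 < full_row_count"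
    then have "\<not> a - 1 < r (b - 2)"
      using dual[of "a - 1" "b - 2"] full_row_count_bounds a_pos by (simp add: full_row_count_def)
    then have "(a - 1, b - 2) \<in> holes" using n full_row_count_bounds a_pos b_pos by (simp add: mem_holes)
    then show False using z z' by simp
  qed
  then show "full_row_count = b - 1" using lt by simp
qed

lemma two_holes:
  assumes "2 \<le> card holes"
  shows "2 \<le> a - full_col_count \<or> 2 \<le> b - full_row_count"
proof (rule ccontr)
  assume "\<not> ?thesis"
  then have "holes \<subseteq> {(a - 1, b - 1)}" using holes_subset by fastforce
  then have "card holes \<le> card {(a - 1, b - 1)}" by (intro card_mono) auto
  then show False using assms by simp
qed

lemma holes_two_rows:
  assumes "b = 2" "full_col_count < a"
  shows "int (card holes) = a - full_col_count"
proof -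
  have r1: "r 1 = full_col_count" using assms(1) unfolding full_col_count_def by simp
  have "holes = {full_col_count..<a} \<times> {1}"
  proof (intro equalityI subsetI)
    fix p assume p: "p \<in> holes"
    obtain x y where xy: "p = (x, y)" by (cases p)
    have h: "0 \<le> x" "x < a" "0 \<le> y" "y < b" "r y \<le> x" using p by (auto simp: xy mem_holes)
    have "y \<noteq> 0" using h(2,5) r_0 by auto
    then have "y = 1" using h assms(1) by simp
    then show "p \<in> {full_col_count..<a} \<times> {1}" using h r1 by (simp add: xy)
  next
    fix p assume "p \<in> {full_col_count..<a} \<times> {1::int}"
    then obtain x where x: "p = (x, 1)" "full_col_count \<le> x" "x < a" by auto
    moreover have "1 < b" using assms(1) by simp
    ultimately show "p \<in> holes" using r1 full_col_count_bounds by (simp add: mem_holes)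
  qed
  then show ?thesis using assms(2) by simp
qed

text \<open>Without empty cells every cell of the box belongs to the core.\<close>

lemma loops_full: "holes = {} \<Longrightarrow> loops a b diagram = {id}"
proof -
  assume "holes = {}"
  then have f: "full_col_count = a" by (simp add: no_holes)
  then have "full_row_count = b" using full_col_count_less_iff full_row_count_bounds by auto
  then have none: "diagram - core_cells = {}" using f diagram_subset_box by (auto simp: core_cells_def box_def)
  have "\<pi> = id" if "\<pi> \<in> loops a b diagram" for \<pi> using loops_noncore[OF that] unfolding none by simp
  then show ?thesis using G.id_mem by auto
qed

end

context young
begin

lemma card_transpose: "card T.diagram = card diagram" "card T.holes = card holes"
proof -
  show *: "card T.diagram = card diagram" unfolding diagram_transpose[symmetric] by (simp add: card_image)
  show "card T.holes = card holes" using card_holes T.card_holes * by (simp add: mult.commute)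
qed

text \<open>The box has eight cells and both sides are at least 2, so it measures 4 by 2 or 2 by 4;
  its two empty cells lie in the one incomplete line along the longer side.\<close>

lemma two_by_four:
  assumes "card diagram = 6" "card holes = 2"
  shows "a = 4 \<and> b = 2 \<and> full_col_count = 2 \<or> b = 4 \<and> a = 2 \<and> full_row_count = 2"
proof -
  have ab: "a * b = 8" using card_holes assms by simp
  have "holes \<noteq> {}" using assms(2) by auto
  then have lt: "full_col_count < a" "full_row_count < b" using corner_hole full_col_count_less_iff by auto
  then have ge: "2 \<le> a" "2 \<le> b" using full_col_count_bounds full_row_count_bounds by auto
  have "a dvd 8" using ab by (metis dvd_triv_left)
  then have "a \<le> 8" by (rule zdvd_imp_le) simp
  then have "a \<in> {2, 3, 4, 5, 6, 7, 8}" using ge(1) by auto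
  moreover have "a \<noteq> 3"
  proof
    assume "a = 3"
    then have "3 * b = 8" using ab by simp
    then show False by presburger
  qed
  ultimately have "a = 4 \<and> b = 2 \<or> a = 2 \<and> b = 4" using ab ge(2) by auto
  moreover have "a - full_col_count = 2" if "b = 2" using holes_two_rows[OF that lt(1)] assms by simp
  moreover have "b - full_row_count = 2" if "a = 2"
  proof -
    have "T.full_col_count < b" using lt(2) T_full(1) by linarith
    then have "int (card T.holes) = b - T.full_col_count" by (rule T.holes_two_rows[OF that])
    then show ?thesis using card_transpose(2) assms(2) T_full(1) by linarith
  qed
  ultimately show ?thesis by auto
qed

lemma four_by_two_cards:
  assumes "a = 4" "b = 2" "full_col_count = 2"
  shows "card diagram = 6 \<and> card holes = 2"
proof -
  have "int (card holes) = 2" using holes_two_rows[OF assms(2)] assms(1,3) by linarith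
  moreover from this have "int (card diagram) = 6" using card_holes unfolding assms(1,2) by linarith
  ultimately show ?thesis by linarith
qed

end

section \<open>The core and the push permutations of a configuration\<close>

context compact_young
begin

lemma holes_cards: "card (dom C) = card diagram" "card (empty_cells C) = card holes"
proof -
  show c: "card (dom C) = card diagram" using bij_betw_same_card[OF place_bij] by simp
  note bd = occupies_bounds[OF dom spanned_cells[OF s t]]
  have "bounding_box (dom C) = (\<lambda>p. p + v) ` box a b"
  proof (intro Set.set_eqI)
    fix p :: cell
    show "p \<in> bounding_box (dom C) \<longleftrightarrow> p \<in> (\<lambda>p. p + v) ` box a b"
      unfolding mem_translate_image bounding_box_def columns_def rows_def bd
      by (cases p; cases v) (auto simp: box_def)
  qed
  then have bb: "card (bounding_box (dom C)) = card (box a b)" "finite (bounding_box (dom C))"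
    "dom C \<subseteq> bounding_box (dom C)"
    using spanned_cells[OF s t] unfolding dom spanned_def by (auto simp: card_image inj_on_def box_def)
  have fin: "finite (dom C)" unfolding dom using finite_cells by simp
  have "card (empty_cells C) = card (box a b) - card diagram"
    unfolding empty_cells_def using bb fin c by (simp add: card_Diff_subset)
  also have "\<dots> = card holes"
    unfolding holes_def using finite_diagram diagram_subset_box by (simp add: card_Diff_subset)
  finally show "card (empty_cells C) = card holes" .
qed

text \<open>A column is full iff its rank is below the length of the shortest row, which occurs at
  row rank \<open>b - 1\<close>. Such columns form the interval of that length.\<close>

lemma full_columns_dom:
  "full_columns (dom C) = (\<lambda>x. x + fst v) ` {s full_col_count..<s full_col_count + full_col_count}"
proof (intro Set.set_eqI)
  fix x
  note bd = occupies_bounds[OF dom spanned_cells[OF s t]]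
  have mem: "(x, y) \<in> dom C \<longleftrightarrow> (x - fst v, y - snd v) \<in> cells s t" for y
    unfolding dom mem_translate_image by (cases v) simp
  have full: "(\<forall>y. 0 \<le> y \<and> y < b \<longrightarrow> (z, y) \<in> cells s t) \<longleftrightarrow>
      s full_col_count \<le> z \<and> z < s full_col_count + full_col_count" (is "?L \<longleftrightarrow> ?R") for z
  proof -
    have rk: "rank a s z < full_col_count \<longleftrightarrow> ?R" by (rule rank_less_iff[OF s full_col_count_bounds])
    have "?L \<longleftrightarrow> 0 \<le> z \<and> z < a \<and> (\<forall>y. 0 \<le> y \<and> y < b \<longrightarrow> rank a s z < r (rank b t y))"
      using b_pos by (auto simp: cells_def)
    also have "\<dots> \<longleftrightarrow> 0 \<le> z \<and> z < a \<and> rank a s z < full_col_count"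
    proof -
      obtain y where y: "0 \<le> y" "y < b" "rank b t y = b - 1" using rank_surj[OF t, of "b - 1"] b_pos by auto
      have "full_col_count \<le> r (rank b t y)" if "0 \<le> y" "y < b" for y
        using full_col_count_le rank_nonneg rank_less[OF t that] by blast
      moreover have "r (rank b t y) = full_col_count" using y(3) by (simp add: full_col_count_def)
      ultimately show ?thesis using y(1,2) by fastforce
    qed
    finally show ?thesis unfolding rk using offsets_bounds[OF s full_col_count_bounds] by auto
  qed
  have "x \<in> full_columns (dom C) \<longleftrightarrow> fst v \<le> x \<and> x \<le> fst v + a - 1 \<and>
      (\<forall>y. snd v \<le> y \<and> y \<le> snd v + b - 1 \<longrightarrow> (x - fst v, y - snd v) \<in> cells s t)"
    unfolding full_columns_def columns_def rows_def bd mem_Collect_eq Ball_def mem atLeastAtMost_iff by simp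
  also have "(\<forall>y. snd v \<le> y \<and> y \<le> snd v + b - 1 \<longrightarrow> (x - fst v, y - snd v) \<in> cells s t) \<longleftrightarrow>
      (\<forall>y. 0 \<le> y \<and> y < b \<longrightarrow> (x - fst v, y) \<in> cells s t)"
  proof (rule iffI; intro allI impI)
    fix y assume "\<forall>y. snd v \<le> y \<and> y \<le> snd v + b - 1 \<longrightarrow> (x - fst v, y - snd v) \<in> cells s t" "0 \<le> y \<and> y < b"
    then show "(x - fst v, y) \<in> cells s t" by (auto dest: spec[of _ "y + snd v"])
  next
    fix y assume "\<forall>y. 0 \<le> y \<and> y < b \<longrightarrow> (x - fst v, y) \<in> cells s t" "snd v \<le> y \<and> y \<le> snd v + b - 1"
    then show "(x - fst v, y - snd v) \<in> cells s t" by simp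
  qed
  finally show "x \<in> full_columns (dom C) \<longleftrightarrow> x \<in> (\<lambda>x. x + fst v) ` {s full_col_count..<s full_col_count + full_col_count}"
    unfolding full using offsets_bounds[OF s full_col_count_bounds] by (auto simp: image_iff intro: bexI[of _ "x - fst v"])
qed

lemma card_full_columns: "int (card (full_columns (dom C))) = full_col_count"
  unfolding full_columns_dom using full_col_count_bounds by (simp add: card_image inj_on_def)

text \<open>Turns statements on full columns into statements on full rows.\<close>

lemma swapped: "compact_young b a c r t s (map transposed ds) (prod.swap v) (swap_axes C)"
proof
  have "shape b a (map transposed ds) T.diagram = prod.swap ` shape a b ds diagram"
    unfolding shape_def diagram_transpose[symmetric] track_transposed by (simp add: image_image)
  then show "shape b a (map transposed ds) T.diagram = T.cells t s"
    by (simp add: from_diagram cells_transpose[OF s t])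
  have "dom (swap_axes C) = prod.swap ` dom C" by (auto simp: swap_axes_def dom_def)
  then show "dom (swap_axes C) = (\<lambda>p. p + prod.swap v) ` T.cells t s"
    by (simp add: dom cells_transpose[OF s t, symmetric] image_image prod.swap_def)
qed (use s t in auto)

lemma core_dom: "core (dom C) = (\<lambda>p. p + v) ` core_cells"
proof -
  note bd = occupies_bounds[OF dom spanned_cells[OF s t]]
  interpret S: compact_young b a c r t s "map transposed ds" "prod.swap v" "swap_axes C" by (rule swapped)
  have fc: "int (card (full_columns (dom C))) = full_col_count" by (rule card_full_columns)
  have "full_columns (dom (swap_axes C)) = full_rows (dom C)"
  proof -
    have d: "dom (swap_axes C) = prod.swap ` dom C" by (auto simp: swap_axes_def dom_def)
    show ?thesis
      unfolding full_columns_def full_rows_def d columns_def rows_def xmin_def xmax_def ymin_def ymax_def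
      by (simp add: image_image mem_swap_pair)
  qed
  then have fr: "int (card (full_rows (dom C))) = full_row_count" using S.card_full_columns by (simp add: T_full)
  have cols: "int (card (columns (dom C))) = a" and rows: "int (card (rows (dom C))) = b"
    unfolding columns_def rows_def bd using a_pos b_pos by auto
  let ?a' = "card (full_columns (dom C))" and ?b' = "card (full_rows (dom C))"
  let ?a'' = "card (columns (dom C)) - ?a'" and ?b'' = "card (rows (dom C)) - ?b'"
  have a'': "int ?a'' = a - full_col_count" and b'': "int ?b'' = b - full_row_count"
    using fc fr cols rows full_col_count_bounds full_row_count_bounds by linarith+
  \<comment> \<open>The condition in \<open>core\<close> says that both factors of
    \<open>core_cells\<close> are nonempty.\<close>
  have cond: "?a' > ?a'' \<and> ?b' > ?b'' \<longleftrightarrow> a - full_col_count < full_col_count \<and> b - full_row_count < full_row_count"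
    using a'' b'' fc fr by linarith
  have "core (dom C) = (if ?a' > ?a'' \<and> ?b' > ?b''
      then {xmin (dom C) + int ?a''..xmax (dom C) - int ?a''} \<times> {ymin (dom C) + int ?b''..ymax (dom C) - int ?b''} else {})"
    unfolding core_def Let_def ..
  also have "\<dots> = (\<lambda>p. p + v) ` core_cells"
  proof (intro Set.set_eqI)
    fix p
    show "p \<in> (if ?a' > ?a'' \<and> ?b' > ?b''
      then {xmin (dom C) + int ?a''..xmax (dom C) - int ?a''} \<times> {ymin (dom C) + int ?b''..ymax (dom C) - int ?b''} else {})
      \<longleftrightarrow> p \<in> (\<lambda>p. p + v) ` core_cells"
      unfolding cond a'' b'' bd mem_translate_image core_cells_def by (cases p; cases v) auto
  qed
  finally show ?thesis .
qed

lemma core_subset_diagram: "core_cells \<subseteq> diagram"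
  using core_subset_cells[OF offsets_zero offsets_zero] by (simp add: cells_zero)

lemma place_core: "p \<in> core_cells \<Longrightarrow> place p = p + v"
  using track_core[OF offsets_zero offsets_zero] by (simp add: place_def cells_zero)

lemma noncore_cells_eq: "noncore_cells C = place ` (diagram - core_cells)"
proof -
  have "place ` (diagram - core_cells) = place ` diagram - place ` core_cells"
    using place_bij core_subset_diagram by (intro inj_on_image_set_diff[of _ diagram]) (auto simp: bij_betw_def)
  also have "place ` core_cells = core (dom C)" unfolding core_dom using place_core by (rule image_cong[OF refl])
  finally show ?thesis using place_bij by (simp add: noncore_cells_def bij_betw_def)
qed

lemma push_perms_noncore:
  assumes "\<pi> \<in> push_perms C"
  shows "\<pi> permutes noncore_cells C" "evenperm \<pi>"
proof -
  obtain \<rho> where \<rho>: "\<rho> \<in> loops a b diagram" "\<pi> = map_permutation diagram place \<rho>"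
    using assms push_perms_eq by blast
  have inj: "inj_on place diagram" using place_bij by (simp add: bij_betw_def)
  have per: "\<rho> permutes diagram" using \<rho>(1) by (simp add: loops_def)
  show "evenperm \<pi>" using loops_even[OF \<rho>(1)] evenperm_map_permutation[OF inj per finite_diagram] \<rho>(2) by simp
  show "\<pi> permutes noncore_cells C"
  proof (rule permutes_superset)
    show "\<pi> permutes dom C" unfolding \<rho>(2) by (rule map_permutation_permutes[OF place_bij per])
    fix p assume p: "p \<in> dom C - noncore_cells C"
    then have "p \<in> place ` diagram" using bij_betw_imp_surj_on[OF place_bij] by blast
    then obtain q where q: "q \<in> diagram" "p = place q" by blast
    then have "q \<in> core_cells" using p noncore_cells_eq by blast
    then have "\<rho> q = q" using loops_noncore[OF \<rho>(1)] by (simp add: permutes_not_in)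
    then show "\<pi> p = p" using map_permutation_apply[OF inj q(1), of \<rho>] q(2) \<rho>(2) by simp
  qed
qed

lemma push_perms_alternating:
  assumes "loops a b diagram = {\<pi>. \<pi> permutes (diagram - core_cells) \<and> evenperm \<pi>}"
  shows "push_perms C = {\<pi>. \<pi> permutes noncore_cells C \<and> evenperm \<pi>}"
proof (intro equalityI subsetI)
  fix \<pi> assume "\<pi> \<in> push_perms C"
  then show "\<pi> \<in> {\<pi>. \<pi> permutes noncore_cells C \<and> evenperm \<pi>}" using push_perms_noncore by simp
next
  fix \<pi> assume "\<pi> \<in> {\<pi>. \<pi> permutes noncore_cells C \<and> evenperm \<pi>}"
  then have \<pi>: "\<pi> permutes noncore_cells C" "evenperm \<pi>" by auto
  have inj: "inj_on place diagram" using place_bij by (simp add: bij_betw_def)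
  have sub: "noncore_cells C \<subseteq> dom C" by (auto simp: noncore_cells_def)
  have perC: "\<pi> permutes dom C" using \<pi>(1) sub by (rule permutes_subset)
  have bij': "bij_betw (inv_into diagram place) (dom C) diagram" using bij_betw_inv_into[OF place_bij] .
  have fin: "finite (dom C)" using bij_betw_finite[OF place_bij] finite_diagram by simp
  define \<rho> where "\<rho> = map_permutation (dom C) (inv_into diagram place) \<pi>"
  have per: "\<rho> permutes diagram" unfolding \<rho>_def by (rule map_permutation_permutes[OF bij' perC])
  have "\<rho> permutes (diagram - core_cells)"
  proof (rule permutes_superset[OF per])
    fix q assume q: "q \<in> diagram - (diagram - core_cells)"
    have pq: "place q \<in> dom C" "inv_into diagram place (place q) = q"
      using q place_bij by (auto simp: bij_betw_def inv_into_f_f)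
    have "place q \<notin> noncore_cells C" using q inj unfolding noncore_cells_eq by (auto simp: inj_on_def)
    then have "\<pi> (place q) = place q" using \<pi>(1) by (simp add: permutes_not_in)
    then show "\<rho> q = q"
      using map_permutation_apply[OF bij_betw_imp_inj_on[OF bij'] pq(1), of \<pi>] pq(2) by (simp add: \<rho>_def)
  qed
  moreover have "evenperm \<rho>"
    unfolding \<rho>_def using evenperm_map_permutation[OF bij_betw_imp_inj_on[OF bij'] perC fin] \<pi>(2) by simp
  ultimately have "\<rho> \<in> loops a b diagram" using assms by simp
  moreover have "map_permutation diagram place \<rho> = \<pi>"
    unfolding \<rho>_def
    by (rule map_permutation_compose_inv[OF bij' perC]) (use place_bij in \<open>simp add: bij_betw_def f_inv_into_f\<close>)
  ultimately show "\<pi> \<in> push_perms C" unfolding push_perms_eq by (metis imageI)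
qed

text \<open>An odd permutation is corrected by first exchanging two equal labels. With distinct
  labels the rearranged configuration determines the permutation.\<close>

lemma relabelling:
  assumes alt: "push_perms C = {\<pi>. \<pi> permutes noncore_cells C \<and> evenperm \<pi>}"
    and \<pi>: "\<pi> permutes noncore_cells C"
  shows "p \<in> noncore_cells C \<Longrightarrow> q \<in> noncore_cells C \<Longrightarrow> p \<noteq> q \<Longrightarrow> C p = C q \<Longrightarrow> reachable C (rearrange \<pi> C)"
    and "\<not> (\<exists>p\<in>noncore_cells C. \<exists>q\<in>noncore_cells C. p \<noteq> q \<and> C p = C q) \<Longrightarrow>
      reachable C (rearrange \<pi> C) \<longleftrightarrow> evenperm \<pi>"
proof -
  have sub: "noncore_cells C \<subseteq> dom C" by (auto simp: noncore_cells_def)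
  have fin: "finite (noncore_cells C)"
    using sub bij_betw_finite[OF place_bij] finite_diagram by (auto intro: finite_subset)
  have reach: "reachable C (rearrange \<pi> C) \<longleftrightarrow> (\<exists>\<sigma>. \<sigma> permutes noncore_cells C \<and> evenperm \<sigma> \<and> rearrange \<sigma> C = rearrange \<pi> C)"
    unfolding reachable_rearrange_iff[OF permutes_subset[OF \<pi> sub]] alt by blast
  {
    assume pq: "p \<in> noncore_cells C" "q \<in> noncore_cells C" "p \<noteq> q" "C p = C q"
    show "reachable C (rearrange \<pi> C)"
    proof (cases "evenperm \<pi>")
      case False
      let ?\<sigma> = "\<pi> \<circ> transpose p q"
      have perm: "permutation \<pi>" using \<pi> fin permutation_permutes by blast
      have "?\<sigma> permutes noncore_cells C" using permutes_compose[OF permutes_swap_id[OF pq(1,2)] \<pi>] .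
      moreover have "evenperm ?\<sigma>"
        using False pq(3) evenperm_comp[OF perm permutation_swap_id] by (simp add: evenperm_swap)
      moreover have "rearrange ?\<sigma> C = rearrange \<pi> C"
      proof -
        have "inv' ?\<sigma> = transpose p q \<circ> inv' \<pi>" using permutes_bij[OF \<pi>] by (simp add: o_inv_distrib)
        moreover have "C \<circ> transpose p q = C" using pq(4) by (auto simp: fun_eq_iff transpose_def)
        ultimately show ?thesis unfolding rearrange_def by (metis comp_assoc)
      qed
      ultimately show ?thesis unfolding reach by blast
    qed (use reach \<pi> in blast)
  next
    assume distinct: "\<not> (\<exists>p\<in>noncore_cells C. \<exists>q\<in>noncore_cells C. p \<noteq> q \<and> C p = C q)"
    have "\<sigma> = \<pi>" if \<sigma>: "\<sigma> permutes noncore_cells C" "rearrange \<sigma> C = rearrange \<pi> C" for \<sigma>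
    proof -
      have "inv' \<sigma> p = inv' \<pi> p" for p
      proof (cases "p \<in> noncore_cells C")
        case True
        then have "inv' \<sigma> p \<in> noncore_cells C" "inv' \<pi> p \<in> noncore_cells C"
          using permutes_in_image[OF permutes_inv[OF \<sigma>(1)]] permutes_in_image[OF permutes_inv[OF \<pi>]] by auto
        moreover have "C (inv' \<sigma> p) = C (inv' \<pi> p)" using \<sigma>(2) unfolding rearrange_def by (metis comp_apply)
        ultimately show ?thesis using distinct by blast
      next
        case False
        then show ?thesis using permutes_inv[OF \<sigma>(1)] permutes_inv[OF \<pi>] by (simp add: permutes_not_in)
      qed
      then have "inv' \<sigma> = inv' \<pi>" by auto
      then show ?thesis using permutes_inv_inv[OF \<sigma>(1)] permutes_inv_inv[OF \<pi>] by metis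
    qed
    then show "reachable C (rearrange \<pi> C) \<longleftrightarrow> evenperm \<pi>" unfolding reach using \<pi> by blast
  }
qed

lemma push_perms_generic:
  assumes "card (empty_cells C) \<noteq> 0" "card (empty_cells C) \<noteq> 1"
    and "\<not> (card (dom C) = 6 \<and> card (empty_cells C) = 2)"
  shows "push_perms C = {\<pi>. \<pi> permutes noncore_cells C \<and> evenperm \<pi>}"
proof (rule push_perms_alternating, rule loops_alternating)
  have h: "2 \<le> card holes" using assms by (simp add: holes_cards)
  then have "holes \<noteq> {}" by auto
  then show lt: "full_col_count < a" "full_row_count < b" using corner_hole full_col_count_less_iff by auto
  show "2 \<le> a - full_col_count \<or> 2 \<le> b - full_row_count" by (rule two_holes[OF h])
  show "\<not> (a = 4 \<and> b = 2 \<and> full_col_count = 2)" using four_by_two_cards assms(3) unfolding holes_cards by metis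
  interpret S: compact_young b a c r t s "map transposed ds" "prod.swap v" "swap_axes C" by (rule swapped)
  show "\<not> (b = 4 \<and> a = 2 \<and> full_row_count = 2)"
    using T.four_by_two_cards assms(3) unfolding holes_cards T_full card_transpose by metis
qed

lemma push_perms_full:
  assumes "card (empty_cells C) = 0"
  shows "push_perms C = {id}"
proof -
  have "holes = {}" using assms finite_holes by (simp add: holes_cards)
  then show ?thesis
    unfolding push_perms_eq loops_full[OF \<open>holes = {}\<close>] using map_permutation_id' place_bij by (auto simp: bij_betw_def)
qed

end

section \<open>Configurations with a single empty cell\<close>

lemma cycle_of_list_eqI:
  assumes "distinct cs" "map f cs = rotate1 cs" "\<And>x. x \<notin> set cs \<Longrightarrow> f x = x"
  shows "cycle_of_list cs = f"
proof
  fix x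
  show "cycle_of_list cs x = f x"
  proof (cases "x \<in> set cs")
    case True
    have "map (cycle_of_list cs) cs = map f cs" using cyclic_rotation[OF assms(1), of 1] assms(2) by simp
    then show ?thesis using True by simp
  next
    case False
    then show ?thesis using assms(3) id_outside_supp by metis
  qed
qed

text \<open>Deleting \<open>z\<close> from a cyclic list makes its predecessor point to its
  successor.\<close>

lemma map_skip_rotate1:
  assumes "distinct (xs @ z # ys)" "map g (xs @ z # ys) = rotate1 (xs @ z # ys)"
  shows "map (\<lambda>p. if g p = z then g z else g p) (xs @ ys) = rotate1 (xs @ ys)"
proof -
  define k where "k = (\<lambda>q. if q = z then g z else q)"
  have k: "map k us = us" if "z \<notin> set us" for us using that by (auto simp: k_def intro: map_idI)
  have h: "map (\<lambda>p. if g p = z then g z else g p) us = map k (map g us)" for us by (simp add: k_def)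
  show ?thesis
  proof (cases xs)
    case Nil
    show ?thesis
    proof (cases ys)
      case (Cons y ys')
      then have "g z = y" "map g ys = ys' @ [z]" using assms(2) Nil by auto
      moreover have "z \<notin> set ys'" using assms(1) Nil Cons by auto
      ultimately show ?thesis using k[of ys'] unfolding h Nil Cons by (simp add: k_def)
    qed (simp add: Nil)
  next
    case (Cons x xs')
    then have "map g xs @ (g z # map g ys) = (xs' @ [z]) @ (ys @ [x])" using assms(2) by simp
    then have e: "map g xs = xs' @ [z]" "g z # map g ys = ys @ [x]"
      using Cons by (subst (asm) append_eq_append_conv, simp, blast)+
    have z: "z \<notin> set xs'" "z \<notin> set (ys @ [x])" using assms(1) Cons by auto
    then have "map k (map g ys) = map g ys" using e(2) by (intro k) (metis list.set_intros(2))
    then have "map k (map g (xs @ ys)) = xs' @ g z # map g ys" using e(1) k[OF z(1)] by (simp add: k_def)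
    then show ?thesis using e(2) Cons unfolding h by simp
  qed
qed

text \<open>The clockwise successor; the order of the cases assigns each corner to the side that
  starts there.\<close>

definition next_boundary_cell :: "cell set \<Rightarrow> cell \<Rightarrow> cell" where
  "next_boundary_cell S = (\<lambda>(x, y).
     if x = xmin S \<and> y < ymax S then (x, y + 1)
     else if y = ymax S \<and> x < xmax S then (x + 1, y)
     else if x = xmax S \<and> ymin S < y then (x, y - 1)
     else (x - 1, y))"

lemma map_shift_upto: "map (\<lambda>k. f (k + 1)) [i..j] = map f [i + 1..j + 1]" for i j :: int
proof (induction i j rule: upto.induct)
  case (1 i j)
  then show ?case by (subst (1 2) upto.simps) simp
qed

lemma map_next_boundary_cell:
  assumes "xmin S < xmax S" "ymin S < ymax S"
  shows "map (next_boundary_cell S) (clockwise_boundary S) = rotate1 (clockwise_boundary S)"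
proof -
  define x0 x1 y0 y1 where d: "x0 = xmin S" "x1 = xmax S" "y0 = ymin S" "y1 = ymax S"
  have lt: "x0 < x1" "y0 < y1" using assms by (simp_all add: d)
  let ?n = "next_boundary_cell S"
  have n: "?n (x, y) = (if x = x0 \<and> y < y1 then (x, y + 1) else if y = y1 \<and> x < x1 then (x + 1, y)
     else if x = x1 \<and> y0 < y then (x, y - 1) else (x - 1, y))" for x y
    by (simp add: next_boundary_cell_def d)
  have up: "[i..j - 1] = i # [i + 1..j - 1]" "[i + 1..j] = [i + 1..j - 1] @ [j]" if "i < j" for i j :: int
    using that upto_rec1[of i "j - 1"] upto_rec2[of "i + 1" j] by auto
  have asc: "map (\<lambda>k. f (k + 1)) [i..j - 1] = map f [i + 1..j - 1] @ [f j]" if "i < j" for i j :: int and f :: "int \<Rightarrow> cell"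
    using map_shift_upto[of f i "j - 1"] up(2)[OF that] by simp
  have desc: "map (\<lambda>k. f (k - 1)) (rev [i + 1..j]) = map f (rev [i + 1..j - 1]) @ [f i]" if "i < j" for i j :: int and f :: "int \<Rightarrow> cell"
  proof -
    have e: "map (\<lambda>k. f (k - 1)) [i + 1..j] = f i # map f [i + 1..j - 1]"
      using map_shift_upto[of "\<lambda>k. f (k - 1)" i "j - 1"] up(1)[OF that] by simp
    show ?thesis by (simp only: rev_map[symmetric] e rev.simps)
  qed
  have "map ?n (map (\<lambda>y. (x0, y)) [y0..y1 - 1]) = map (\<lambda>y. (x0, y + 1)) [y0..y1 - 1]"
    using lt by (auto simp: n)
  also have "\<dots> = map (\<lambda>y. (x0, y)) [y0 + 1..y1 - 1] @ [(x0, y1)]" by (rule asc[OF lt(2)])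
  finally have 1: "map ?n (map (\<lambda>y. (x0, y)) [y0..y1 - 1]) = \<dots>" .
  have "map ?n (map (\<lambda>x. (x, y1)) [x0..x1 - 1]) = map (\<lambda>x. (x + 1, y1)) [x0..x1 - 1]"
    using lt by (auto simp: n)
  also have "\<dots> = map (\<lambda>x. (x, y1)) [x0 + 1..x1 - 1] @ [(x1, y1)]" by (rule asc[OF lt(1)])
  finally have 2: "map ?n (map (\<lambda>x. (x, y1)) [x0..x1 - 1]) = \<dots>" .
  have "map ?n (map (\<lambda>y. (x1, y)) (rev [y0 + 1..y1])) = map (\<lambda>y. (x1, y - 1)) (rev [y0 + 1..y1])"
    using lt by (auto simp: n)
  also have "\<dots> = map (\<lambda>y. (x1, y)) (rev [y0 + 1..y1 - 1]) @ [(x1, y0)]" by (rule desc[OF lt(2)])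
  finally have 3: "map ?n (map (\<lambda>y. (x1, y)) (rev [y0 + 1..y1])) = \<dots>" .
  have "map ?n (map (\<lambda>x. (x, y0)) (rev [x0 + 1..x1])) = map (\<lambda>x. (x - 1, y0)) (rev [x0 + 1..x1])"
    using lt by (auto simp: n)
  also have "\<dots> = map (\<lambda>x. (x, y0)) (rev [x0 + 1..x1 - 1]) @ [(x0, y0)]" by (rule desc[OF lt(1)])
  finally have 4: "map ?n (map (\<lambda>x. (x, y0)) (rev [x0 + 1..x1])) = \<dots>" .
  show ?thesis
    unfolding clockwise_boundary_def d[symmetric] map_append 1 2 3 4
    unfolding up(1)[OF lt(1)] up(1)[OF lt(2)] up(2)[OF lt(1)] up(2)[OF lt(2)] by simp
qed

lemma distinct_clockwise_boundary:
  assumes "xmin S < xmax S" "ymin S < ymax S"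
  shows "distinct (clockwise_boundary S)"
  unfolding clockwise_boundary_def using assms by (auto simp: distinct_map inj_on_def)

lemma set_clockwise_boundary:
  assumes "xmin S < xmax S" "ymin S < ymax S"
  shows "(x, y) \<in> set (clockwise_boundary S) \<longleftrightarrow> xmin S \<le> x \<and> x \<le> xmax S \<and> ymin S \<le> y \<and> y \<le> ymax S \<and>
    (x = xmin S \<or> x = xmax S \<or> y = ymin S \<or> y = ymax S)"
  unfolding clockwise_boundary_def using assms by (auto simp: image_iff)

text \<open>\<open>K\<close> is \<open>carry_single\<close>, \<open>N\<close> is
  \<open>next_boundary_cell\<close>, both in box coordinates, and \<open>z\<close> is the empty
  corner selected by \<open>\<sigma>\<close> and \<open>\<tau>\<close>. On each side of the box one
  rotation step advances a boundary token by one cell, or by two across \<open>z\<close>.\<close>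

lemma rotation_skips_corner:
  fixes a b x y \<sigma> \<tau> :: int
  defines "K \<equiv> \<lambda>(x, y). let x' = (if y = b - 1 then x + \<sigma> else x) in
      (x', if \<sigma> \<le> x' \<and> x' < \<sigma> + (a - 1) then y else y + \<tau>)"
    and "N \<equiv> \<lambda>(x, y). if x = 0 \<and> y < b - 1 then (x, y + 1) else if y = b - 1 \<and> x < a - 1 then (x + 1, y)
       else if x = a - 1 \<and> 0 < y then (x, y - 1) else (x - 1, y)"
    and "z \<equiv> (if \<sigma> = 0 then a - 1 else 0, if \<tau> = 0 then b - 1 else 0)"
  assumes ab: "2 \<le> a" "2 \<le> b" and xy: "0 \<le> x" "x < a" "0 \<le> y" "y < b" "\<not> (x = a - 1 \<and> y = b - 1)"
    and \<sigma>: "\<sigma> = 0 \<or> \<sigma> = 1" and \<tau>: "\<tau> = 0 \<or> \<tau> = 1"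
    and bd: "K (x, y) = (k, l)" "k = 0 \<or> k = a - 1 \<or> l = 0 \<or> l = b - 1"
  shows "K (rect_rotation 0 (a - 1) (b - 1) (x, y)) = (if N (k, l) = z then N z else N (k, l))"
proof -
  consider (left) "x = 0" "y < b - 1" | (top) "y = b - 1" "x < a - 2" | (corner) "y = b - 1" "x = a - 2"
    | (right) "x = a - 1" "1 \<le> y" "y < b - 1" | (last) "y = 0" "x = a - 1" | (bottom) "y = 0" "0 < x" "x < a - 1"
    | (inner) "0 < x" "x < a - 1" "0 < y" "y < b - 1" using xy by (smt (verit))
  then show ?thesis
  proof cases
    case left
    then have "rect_rotation 0 (a - 1) (b - 1) (x, y) = (0, y + 1)" using xy by (simp add: rect_rotation_def)
    then show ?thesis using left \<sigma> \<tau> ab xy bd(1) unfolding K_def N_def z_def by (elim disjE) auto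
  next
    case top
    then have "rect_rotation 0 (a - 1) (b - 1) (x, y) = (x + 1, b - 1)" using xy by (simp add: rect_rotation_def)
    then show ?thesis using top \<sigma> \<tau> ab xy bd(1) unfolding K_def N_def z_def by (elim disjE) auto
  next
    case corner
    then have "rect_rotation 0 (a - 1) (b - 1) (x, y) = (a - 1, b - 2)" using xy by (simp add: rect_rotation_def)
    then show ?thesis using corner \<sigma> \<tau> ab xy bd(1) unfolding K_def N_def z_def by (elim disjE) auto
  next
    case right
    then have "rect_rotation 0 (a - 1) (b - 1) (x, y) = (a - 1, y - 1)" using ab by (simp add: rect_rotation_def)
    then show ?thesis using right \<sigma> \<tau> ab xy bd(1) unfolding K_def N_def z_def by (elim disjE) auto
  next
    case bottom
    then have "rect_rotation 0 (a - 1) (b - 1) (x, y) = (x - 1, 0)" using ab xy by (simp add: rect_rotation_def)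
    then show ?thesis using bottom \<sigma> \<tau> ab xy bd(1) unfolding K_def N_def z_def by (elim disjE) auto
  next
    case last
    then have "rect_rotation 0 (a - 1) (b - 1) (x, y) = (a - 2, 0)" using ab xy by (simp add: rect_rotation_def)
    then show ?thesis using last \<sigma> \<tau> ab xy bd(1) unfolding K_def N_def z_def by (elim disjE) auto
  next
    case inner
    then have "K (x, y) = (x, y)" using \<sigma> \<tau> by (auto simp: K_def)
    then have False using inner bd by auto
    then show ?thesis ..
  qed
qed

locale one_hole = compact_young +
  assumes one_hole: "full_col_count = a - 1" "full_row_count = b - 1"
begin

sublocale single_row
  by unfold_locales (use one_hole in linarith)+

lemma a_ge_2: "2 \<le> a"
  using full_col_count_bounds one_hole by simp

lemma corner_move_0:
  assumes p: "p \<in> diagram"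
  shows "corner_move 0 p = rect_rotation 0 (a - 1) (b - 1) p"
proof -
  have l: "0 < a - full_col_count" using one_hole by simp
  have pull: "pull_back 0 (x, y) = (x, y)" "push_out 0 (x, y) = (x, y)" if "0 \<le> y" "y < b" for x y
    using r_bounds[OF that] by (simp_all add: pull_back_def push_out_def)
  obtain x y where xy: "p = (x, y)" by (cases p)
  have y: "0 \<le> y" "y < b" using p by (auto simp: xy diagram_def)
  obtain x' y' where xy': "rect_rotation 0 (a - 1) (b - 1) p = (x', y')" by fastforce
  have y': "0 \<le> y'" "y' < b" using xy' y b_ge_2 by (auto simp: xy rect_rotation_def split: if_splits)
  have "corner_move 0 p = pull_back 0 (rect_rotation 0 full_col_count (height 0) (push_out 0 p))"
    by (rule corner_move_eq[OF _ l p]) simp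
  also have "\<dots> = rect_rotation 0 (a - 1) (b - 1) p"
    unfolding height_0 one_hole using xy' pull y y' by (simp add: xy)
  finally show ?thesis .
qed

lemma mem_diagram: "(x, y) \<in> diagram \<longleftrightarrow> 0 \<le> x \<and> x < a \<and> 0 \<le> y \<and> y < b \<and> \<not> (x = a - 1 \<and> y = b - 1)"
  using r_single[of y] one_hole by (auto simp: diagram_def)

text \<open>The empty cell is a corner of the bounding box; the cycle skips it.\<close>

lemma carry_rotation:
  assumes s': "offsets a s'" and t': "offsets b t'"
  obtains z where "z \<in> {0, a - 1} \<times> {0, b - 1}" "cells s' t' = box a b - {z}"
    "\<And>p. p \<in> diagram \<Longrightarrow> carry s' t' p + u \<in> set (clockwise_boundary S) \<Longrightarrow>
      xmin S = fst u \<Longrightarrow> ymin S = snd u \<Longrightarrow> xmax S = fst u + a - 1 \<Longrightarrow> ymax S = snd u + b - 1 \<Longrightarrow>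
      carry s' t' (corner_move 0 p) + u = (if next_boundary_cell S (carry s' t' p + u) = z + u
        then next_boundary_cell S (z + u) else next_boundary_cell S (carry s' t' p + u))"
proof -
  define \<sigma> \<tau> where st: "\<sigma> = s' full_col_count" "\<tau> = t' (b - 1)"
  have \<sigma>: "\<sigma> = 0 \<or> \<sigma> = 1" using offsets_bounds[OF s' full_col_count_bounds] one_hole st by auto
  have \<tau>: "\<tau> = 0 \<or> \<tau> = 1" using unit_offset[OF t'] st by simp
  define z where "z = (if \<sigma> = 0 then a - 1 else 0, if \<tau> = 0 then b - 1 else 0)"
  have cs: "carry s' t' (x, y) = (let x' = (if y = b - 1 then x + \<sigma> else x) in
      (x', if \<sigma> \<le> x' \<and> x' < \<sigma> + (a - 1) then y else y + \<tau>))" if "(x, y) \<in> diagram" for x y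
    unfolding carry_single[OF s' t' that] st one_hole ..
  show thesis
  proof (rule that[of z])
    show z: "z \<in> {0, a - 1} \<times> {0, b - 1}" by (simp add: z_def)
    have sub: "cells s' t' \<subseteq> box a b" using spanned_cells[OF s' t'] by (simp add: spanned_def)
    have nz: "z \<notin> cells s' t'"
    proof
      assume "z \<in> cells s' t'"
      then obtain x y where xy: "(x, y) \<in> diagram" "z = carry s' t' (x, y)"
        using carry_image[OF s' t'] by (metis imageE surj_pair)
      have b: "0 \<le> x" "x < a" "0 \<le> y" "y < b" "\<not> (x = a - 1 \<and> y = b - 1)" using xy(1) by (auto simp: mem_diagram)
      then show False using xy(2) \<sigma> \<tau> a_ge_2 b_ge_2 unfolding cs[OF xy(1)] z_def Let_def
        by (elim disjE) (auto split: if_splits)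
    qed
    show "cells s' t' = box a b - {z}"
    proof (rule card_subset_eq)
      have zb: "z \<in> box a b" using z a_ge_2 b_ge_2 by (auto simp: box_def)
      have "diagram = box a b - {(a - 1, b - 1)}" by (auto simp: mem_diagram box_def)
      moreover have "(a - 1, b - 1) \<in> box a b" using a_pos b_pos by (simp add: box_def)
      ultimately have "card diagram = card (box a b) - 1" using finite_box by simp
      moreover have "inj_on (carry s' t') diagram"
      proof (rule inj_onI)
        fix p q assume pq: "p \<in> diagram" "q \<in> diagram" "carry s' t' p = carry s' t' q"
        obtain x y x' y' where xy: "p = (x, y)" "q = (x', y')" by (cases p; cases q) blast
        show "p = q" using pq \<sigma> \<tau> unfolding xy cs[OF pq(1)[unfolded xy]] cs[OF pq(2)[unfolded xy]] mem_diagram Let_def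
          by (elim disjE) (auto split: if_splits)
      qed
      then have "card (cells s' t') = card diagram" using carry_image[OF s' t'] card_image by metis
      ultimately show "card (cells s' t') = card (box a b - {z})" using zb finite_box by simp
    qed (use sub nz finite_box in auto)
    fix p assume p: "p \<in> diagram" and bd: "carry s' t' p + u \<in> set (clockwise_boundary S)"
      and S: "xmin S = fst u" "ymin S = snd u" "xmax S = fst u + a - 1" "ymax S = snd u + b - 1"
    define N where "N = (\<lambda>(x, y). if x = 0 \<and> y < b - 1 then (x, y + 1) else if y = b - 1 \<and> x < a - 1 then (x + 1, y)
       else if x = a - 1 \<and> 0 < y then (x, y - 1) else (x - 1, y))"
    have next_shift: "next_boundary_cell S ((x, y) + u) =
      (if x = 0 \<and> y < b - 1 then (x, y + 1) else if y = b - 1 \<and> x < a - 1 then (x + 1, y)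
       else if x = a - 1 \<and> 0 < y then (x, y - 1) else (x - 1, y)) + u" for x y
      by (cases u) (simp add: next_boundary_cell_def S)
    obtain x y where xy: "p = (x, y)" by (cases p)
    have b: "0 \<le> x" "x < a" "0 \<le> y" "y < b" "\<not> (x = a - 1 \<and> y = b - 1)" using p by (auto simp: xy mem_diagram)
    obtain x' y' where xy': "rect_rotation 0 (a - 1) (b - 1) (x, y) = (x', y')" by fastforce
    have mem': "(x', y') \<in> diagram"
      using xy' b a_ge_2 b_ge_2 unfolding mem_diagram by (auto simp: rect_rotation_def split: if_splits)
    obtain k l where kl: "carry s' t' p = (k, l)" by fastforce
    have kl_bd: "k = 0 \<or> k = a - 1 \<or> l = 0 \<or> l = b - 1"
      using bd a_ge_2 b_ge_2 unfolding kl by (cases u) (simp add: set_clockwise_boundary S)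
    have "carry s' t' (x', y') = (if N (k, l) = z then N z else N (k, l))"
      using rotation_skips_corner[OF a_ge_2 b_ge_2 b \<sigma> \<tau> _ kl_bd] kl
      unfolding xy cs[OF p[unfolded xy]] cs[OF mem'] xy' z_def N_def by simp
    moreover have "next_boundary_cell S (q + u) = N q + u" for q
      by (cases q) (simp only: next_shift N_def prod.case)
    ultimately show "carry s' t' (corner_move 0 p) + u = (if next_boundary_cell S (carry s' t' p + u) = z + u
        then next_boundary_cell S (z + u) else next_boundary_cell S (carry s' t' p + u))"
      unfolding corner_move_0[OF p] unfolding xy xy' unfolding xy[symmetric] kl by simp
  qed
qed

text \<open>The identification \<open>place\<close> differs from the reference movement
  \<open>carry\<close> by a loop that commutes with the rotation. The generator can thus be followed
  through \<open>carry\<close>, where it is the clockwise step skipping the empty corner.\<close>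

lemma noncore_cycle_generates:
  "\<exists>f. noncore_cycle C = f \<and> f permutes dom C \<and> push_perms C = range (\<lambda>n. f ^^ n)"
proof -
  have 1: "a - full_col_count = 1" using one_hole by simp
  obtain M where M: "M \<in> loops a b diagram" "\<forall>p\<in>diagram. M p = corner_move 0 p"
    "loops a b diagram = range (\<lambda>n. M ^^ n)" using loops_cyclic[OF 1] by blast
  have perM: "\<pi> permutes diagram" if "\<pi> \<in> loops a b diagram" for \<pi> using that by (simp add: loops_def)
  have inj: "inj_on place diagram" using place_bij by (simp add: bij_betw_def)
  define f where "f = map_permutation diagram place M"
  have f_pow: "map_permutation diagram place (M ^^ n) = f ^^ n" for n
  proof (induction n)
    case 0
    show ?case unfolding funpow.simps by (rule map_permutation_id'[OF inj])
  next
    case (Suc n)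
    have "map_permutation diagram place (M \<circ> M ^^ n) = f \<circ> f ^^ n"
      using map_permutation_compose'[OF inj perM[OF G.funpow_mem[OF M(1)]]] Suc by (simp add: f_def)
    then show ?case unfolding funpow.simps .
  qed
  have P: "push_perms C = range (\<lambda>n. f ^^ n)" unfolding push_perms_eq M(3) by (simp add: image_image f_pow)
  then have fP: "f \<in> push_perms C" using rangeI[of "\<lambda>n. f ^^ n" 1] by simp
  have f_noncore: "f permutes noncore_cells C" by (rule push_perms_noncore(1)[OF fP])
  obtain s' t' \<gamma> where st': "\<gamma> \<in> loops a b diagram" "offsets a s'" "offsets b t'" "cells s t = cells s' t'"
    "\<forall>p\<in>diagram. track a b ds diagram p = carry s' t' (\<gamma> p)"
  proof -
    have "\<exists>\<gamma>\<in>loops a b diagram. \<forall>p\<in>diagram. \<gamma> p = corner_move i p" if "0 \<le> i" "i < a - full_col_count" for i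
    proof -
      have "i = 0" using that 1 by simp
      then show ?thesis using M(1,2) by blast
    qed
    then have "\<exists>s' t'. \<exists>\<gamma>\<in>loops a b diagram. offsets a s' \<and> offsets b t' \<and>
        shape a b ds (cells (\<lambda>_. 0) (\<lambda>_. 0)) = cells s' t' \<and>
        (\<forall>p\<in>diagram. track a b ds (cells (\<lambda>_. 0) (\<lambda>_. 0)) (carry (\<lambda>_. 0) (\<lambda>_. 0) p) = carry s' t' (\<gamma> p))"
      by (intro track_carry[OF offsets_zero offsets_zero G.perm_group_axioms perM])
    then show thesis using that from_diagram unfolding cells_zero carry_id by metis
  qed
  obtain n where n: "\<gamma> = M ^^ n" using st'(1) M(3) by blast
  have dom': "dom C = (\<lambda>p. p + v) ` cells s' t'" using dom st'(4) by simp
  note bd = occupies_bounds[OF dom' spanned_cells[OF st'(2,3)]]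
  have lt: "xmin (dom C) < xmax (dom C)" "ymin (dom C) < ymax (dom C)" using bd a_ge_2 b_ge_2 by simp_all
  obtain z where z: "z \<in> {0, a - 1} \<times> {0, b - 1}" "cells s' t' = box a b - {z}"
    and next_eq: "\<And>p. p \<in> diagram \<Longrightarrow> carry s' t' p + v \<in> set (clockwise_boundary (dom C)) \<Longrightarrow>
      carry s' t' (corner_move 0 p) + v = (if next_boundary_cell (dom C) (carry s' t' p + v) = z + v
        then next_boundary_cell (dom C) (z + v) else next_boundary_cell (dom C) (carry s' t' p + v))"
    using carry_rotation[OF st'(2,3), of v "dom C"] bd by metis
  let ?L = "clockwise_boundary (dom C)"
  have memL: "p \<in> set ?L \<longleftrightarrow> p - v \<in> box a b \<and> (fst (p - v) = 0 \<or> fst (p - v) = a - 1 \<or> snd (p - v) = 0 \<or> snd (p - v) = b - 1)" for p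
    using set_clockwise_boundary[OF lt, of "fst p" "snd p"] bd by (auto simp: box_def mem_Times_iff)
  have mem_dom: "p \<in> dom C \<longleftrightarrow> p - v \<in> box a b \<and> p \<noteq> z + v" for p
    unfolding dom' z(2) mem_translate_image by (auto simp: algebra_simps)
  have core_eq: "core (dom C) = (\<lambda>p. p + v) ` ({1..<a - 1} \<times> {1..<b - 1})"
    unfolding core_dom core_cells_def one_hole by simp
  have mem_noncore: "p \<in> noncore_cells C \<longleftrightarrow> p \<in> set ?L \<and> p \<noteq> z + v" for p
    unfolding noncore_cells_def core_eq Diff_iff mem_dom memL mem_translate_image
    by (cases "p - v") (auto simp: box_def)
  have zL: "z + v \<in> set ?L" using z(1) a_ge_2 b_ge_2 unfolding memL by (auto simp: box_def)
  then obtain xs ys where L: "?L = xs @ (z + v) # ys" using split_list by metis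
  have dist: "distinct (xs @ (z + v) # ys)" using distinct_clockwise_boundary[OF lt] L by simp
  define cs where "cs = filter (\<lambda>p. p \<in> noncore_cells C) ?L"
  have cs: "cs = xs @ ys"
  proof -
    have "filter (\<lambda>p. p \<in> noncore_cells C) xs = xs" "filter (\<lambda>p. p \<in> noncore_cells C) ys = ys"
      using dist by (auto simp: filter_id_conv mem_noncore L)
    then show ?thesis by (simp add: cs_def L mem_noncore)
  qed
  let ?g = "next_boundary_cell (dom C)"
  have f_next: "f p = (if ?g p = z + v then ?g (z + v) else ?g p)" if p: "p \<in> set cs" for p
  proof -
    have pn: "p \<in> noncore_cells C" "p \<in> set ?L" using p by (auto simp: cs_def)
    then have "p \<in> dom C" by (simp add: noncore_cells_def)
    then have "p \<in> place ` diagram" using bij_betw_imp_surj_on[OF place_bij] by blast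
    then obtain q where q: "q \<in> diagram" "p = place q" by blast
    have q': "\<gamma> q \<in> diagram" "M q \<in> diagram" "M (\<gamma> q) \<in> diagram"
      using perM[OF st'(1)] perM[OF M(1)] q(1) by (simp_all add: permutes_in_image)
    have "f p = place (M q)" unfolding f_def q(2) by (rule map_permutation_apply[OF inj q(1)])
    also have "\<dots> = carry s' t' (\<gamma> (M q)) + v" unfolding place_def using st'(5) q'(2) by simp
    \<comment> \<open>All loops are powers of \<open>M\<close>, hence \<open>\<gamma>\<close>
      commutes with it.\<close>
    also have "\<gamma> (M q) = M (\<gamma> q)" unfolding n by (simp add: funpow_swap1)
    also have "\<dots> = corner_move 0 (\<gamma> q)" using M(2) q'(1) by simp
    finally have "f p = carry s' t' (corner_move 0 (\<gamma> q)) + v" .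
    moreover have "p = carry s' t' (\<gamma> q) + v" unfolding q(2) place_def using st'(5) q(1) by simp
    ultimately show ?thesis using next_eq[OF q'(1)] pn(2) by simp
  qed
  have "cycle_of_list cs = f"
  proof (rule cycle_of_list_eqI)
    show "distinct cs" using dist by (simp add: cs)
    have "map f cs = map (\<lambda>p. if ?g p = z + v then ?g (z + v) else ?g p) cs" using f_next by simp
    also have "\<dots> = rotate1 cs" unfolding cs
    proof (rule map_skip_rotate1[OF dist])
      show "map ?g (xs @ (z + v) # ys) = rotate1 (xs @ (z + v) # ys)"
        using map_next_boundary_cell[OF lt] unfolding L .
    qed
    finally show "map f cs = rotate1 cs" .
    fix x assume "x \<notin> set cs"
    then have "x \<notin> noncore_cells C" using mem_noncore by (auto simp: cs_def)
    then show "f x = x" using f_noncore by (simp add: permutes_not_in)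
  qed
  then have "noncore_cycle C = f" by (simp add: noncore_cycle_def cs_def)
  moreover have "f permutes dom C" using f_noncore by (rule permutes_subset) (auto simp: noncore_cells_def)
  ultimately show ?thesis using P by blast
qed

end

section \<open>The push group\<close>

lemma group_sym_group_on: "group (sym_group_on S)"
proof (rule groupI)
  fix \<pi> assume "\<pi> \<in> carrier (sym_group_on S)"
  then show "\<exists>\<rho>\<in>carrier (sym_group_on S). \<rho> \<otimes>\<^bsub>sym_group_on S\<^esub> \<pi> = \<one>\<^bsub>sym_group_on S\<^esub>"
    using permutes_inv permutes_inv_o(2) by (fastforce simp: sym_group_on_def)
qed (auto simp: sym_group_on_def permutes_compose permutes_id comp_assoc)

lemma inv_sym_group_on:
  assumes "\<pi> permutes S"
  shows "inv\<^bsub>sym_group_on S\<^esub> \<pi> = inv' \<pi>"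
  using assms permutes_inv permutes_inv_o(2)
  by (intro group.inv_equality[OF group_sym_group_on]) (auto simp: sym_group_on_def)

text \<open>Powers with natural exponents suffice because they are assumed to form a group and so
  contain the inverse of \<open>f\<close>.\<close>

lemma generate_sym_group_on:
  assumes f: "f permutes S" and group: "perm_group (range (\<lambda>n. f ^^ n))"
  shows "generate (sym_group_on S) {f} = range (\<lambda>n. f ^^ n)"
proof (intro equalityI subsetI)
  interpret P: perm_group "range (\<lambda>n. f ^^ n)" by (rule group)
  fix \<pi> assume "\<pi> \<in> generate (sym_group_on S) {f}"
  then show "\<pi> \<in> range (\<lambda>n. f ^^ n)"
  proof induction
    case one
    have "\<one>\<^bsub>sym_group_on S\<^esub> = id" by (simp add: sym_group_on_def)
    then show ?case using P.id_mem by (simp only:)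
  next
    case (incl h)
    then show ?case using rangeI[of "\<lambda>n. f ^^ n" 1] by simp
  next
    case (inv h)
    have "f \<in> range (\<lambda>n. f ^^ n)" using rangeI[of "\<lambda>n. f ^^ n" 1] by simp
    then show ?case using inv P.inv_mem inv_sym_group_on[OF f] by simp
  next
    case (eng h1 h2)
    have "h1 \<otimes>\<^bsub>sym_group_on S\<^esub> h2 = h1 \<circ> h2" by (simp add: sym_group_on_def)
    then show ?case using P.comp_mem[OF eng.IH] by (simp only:)
  qed
next
  fix \<pi> assume "\<pi> \<in> range (\<lambda>n. f ^^ n)"
  then obtain n where "\<pi> = f ^^ n" by blast
  moreover have "f ^^ n \<in> generate (sym_group_on S) {f}"
  proof (induction n)
    case 0
    show ?case using generate.one[of "sym_group_on S" "{f}"] by (simp add: sym_group_on_def id_def)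
  next
    case (Suc n)
    have "f \<otimes>\<^bsub>sym_group_on S\<^esub> f ^^ n = f ^^ Suc n" by (simp add: sym_group_on_def)
    then show ?case using generate.eng[OF generate.incl[of f "{f}" "sym_group_on S"] Suc] by (simp only: insertI1)
  qed
  ultimately show "\<pi> \<in> generate (sym_group_on S) {f}" by simp
qed

lemma perm_group_map_permutation:
  assumes G: "perm_group G" "\<And>\<pi>. \<pi> \<in> G \<Longrightarrow> \<pi> permutes S" and f: "inj_on f S"
  shows "perm_group (map_permutation S f ` G)"
proof
  interpret G: perm_group G by (rule G(1))
  have bij: "bij_betw f S (f ` S)" using f by (rule inj_on_imp_bij_betw)
  show "id \<in> map_permutation S f ` G" using G.id_mem map_permutation_id'[OF f] by (metis imageI)
  fix p assume "p \<in> map_permutation S f ` G"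
  then obtain p0 where p: "p0 \<in> G" "p = map_permutation S f p0" by blast
  show "bij p" unfolding p(2) using map_permutation_permutes[OF bij G(2)[OF p(1)]] by (rule permutes_bij)
  have "p \<circ> map_permutation S f (inv' p0) = map_permutation S f (p0 \<circ> inv' p0)"
    "map_permutation S f (inv' p0) \<circ> p = map_permutation S f (inv' p0 \<circ> p0)"
    unfolding p(2) using map_permutation_compose'[OF f] G(2)[OF p(1)] permutes_inv by metis+
  then have "inv' p = map_permutation S f (inv' p0)"
    using permutes_inv_o[OF G(2)[OF p(1)]] map_permutation_id'[OF f] by (intro inv_unique_comp) simp_all
  then show "inv' p \<in> map_permutation S f ` G" using G.inv_mem[OF p(1)] by simp
  fix q assume "q \<in> map_permutation S f ` G"
  then obtain q0 where q: "q0 \<in> G" "q = map_permutation S f q0" by blast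
  have "p \<circ> q = map_permutation S f (p0 \<circ> q0)" unfolding p(2) q(2) using map_permutation_compose'[OF f G(2)[OF q(1)]] by simp
  then show "p \<circ> q \<in> map_permutation S f ` G" using G.comp_mem[OF p(1) q(1)] by simp
qed

lemma iso_map_permutation:
  assumes G: "\<And>\<pi>. \<pi> \<in> G \<Longrightarrow> \<pi> permutes S" and f: "bij_betw f S T"
  shows "(sym_group_on T)\<lparr>carrier := map_permutation S f ` G\<rparr> \<cong> (sym_group_on S)\<lparr>carrier := G\<rparr>"
    (is "?A \<cong> ?B")
proof -
  let ?h = "map_permutation T (inv_into S f)"
  have f_inv: "bij_betw (inv_into S f) T S" using f by (rule bij_betw_inv_into)
  have cancel: "?h (map_permutation S f \<pi>) = \<pi>" if "\<pi> \<in> G" for \<pi>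
    using f by (intro map_permutation_compose_inv[OF f G[OF that]]) (auto simp: bij_betw_def)
  have perT: "map_permutation S f \<pi> permutes T" if "\<pi> \<in> G" for \<pi> using map_permutation_permutes[OF f G[OF that]] .
  have "?h \<in> hom ?A ?B"
  proof (rule homI)
    fix p q assume "p \<in> carrier ?A" "q \<in> carrier ?A"
    then have q: "q permutes T" using perT by auto
    show "?h (p \<otimes>\<^bsub>?A\<^esub> q) = ?h p \<otimes>\<^bsub>?B\<^esub> ?h q"
      using map_permutation_compose'[OF bij_betw_imp_inj_on[OF f_inv] q] by (simp add: sym_group_on_def)
  qed (use cancel in auto)
  moreover have "bij_betw ?h (carrier ?A) (carrier ?B)"
    by (rule bij_betw_imageI) (auto simp: inj_on_def cancel image_image)
  ultimately have "?h \<in> iso ?A ?B" by (rule isoI)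
  then show ?thesis by (auto simp: is_iso_def)
qed

context compact_young
begin

lemma push_perms_group: "perm_group (push_perms C)"
  unfolding push_perms_eq
  by (rule perm_group_map_permutation[OF G.perm_group_axioms])
    (use place_bij in \<open>auto simp: loops_def bij_betw_def\<close>)

lemma push_group_cyclic:
  assumes "card (empty_cells C) = 1"
  shows "push_perms C = generate (sym_group_on (dom C)) {noncore_cycle C}"
proof -
  have h: "card holes = 1" using assms by (simp add: holes_cards)
  interpret one_hole a b r c s t ds v C by unfold_locales (fact single_hole[OF h])+
  obtain f where f: "noncore_cycle C = f" "f permutes dom C" "push_perms C = range (\<lambda>n. f ^^ n)"
    using noncore_cycle_generates by blast
  show ?thesis using generate_sym_group_on[OF f(2)] push_perms_group unfolding f(1,3) by simp
qed

lemma push_group_A5: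
  assumes "card (dom C) = 6" "card (empty_cells C) = 2"
  shows "push_group C \<cong> alt_group 5"
proof -
  have per: "\<pi> permutes diagram" if "\<pi> \<in> loops a b diagram" for \<pi> using that by (simp add: loops_def)
  have 1: "push_group C \<cong> (sym_group_on diagram)\<lparr>carrier := loops a b diagram\<rparr>"
    unfolding push_group_def push_perms_eq by (rule iso_map_permutation[OF per place_bij])
  consider "a = 4" "b = 2" "full_col_count = 2" | "b = 4" "a = 2" "full_row_count = 2"
    using two_by_four assms by (auto simp only: holes_cards)
  then have "(sym_group_on diagram)\<lparr>carrier := loops a b diagram\<rparr> \<cong> alt_group 5"
  proof cases
    case 1
    then interpret four_two a b r c by unfold_locales
    show ?thesis by (rule loops_iso)
  next
    case 2
    \<comment> \<open>The 2 by 4 box is reduced to the 4 by 2 box by conjugation with the exchange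
      of coordinates.\<close>
    then interpret F: four_two b a c r by unfold_locales (use T_full in linarith)+
    have swap: "bij_betw prod.swap T.diagram diagram" by (rule swap_bij)
    have perT: "\<pi> permutes T.diagram" if "\<pi> \<in> loops b a T.diagram" for \<pi> using that by (simp add: loops_def)
    have conj: "map_permutation T.diagram prod.swap \<pi> = prod.swap \<circ> \<pi> \<circ> prod.swap" if "\<pi> permutes T.diagram" for \<pi>
    proof
      fix p
      show "map_permutation T.diagram prod.swap \<pi> p = (prod.swap \<circ> \<pi> \<circ> prod.swap) p"
      proof (cases "p \<in> diagram")
        case True
        then obtain q where q: "q \<in> T.diagram" "p = prod.swap q" using swap unfolding bij_betw_def by (metis imageE)
        then show ?thesis using map_permutation_apply[OF bij_betw_imp_inj_on[OF swap] q(1), of \<pi>] by simp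
      next
        case False
        then have "prod.swap p \<notin> T.diagram" unfolding diagram_transpose[symmetric] mem_swap_image by simp
        then show ?thesis
          using False that map_permutation_permutes[OF swap that] by (simp add: permutes_not_in)
      qed
    qed
    have "loops a b diagram = map_permutation T.diagram prod.swap ` loops b a T.diagram"
    proof (intro equalityI subsetI)
      fix \<pi> assume \<pi>: "\<pi> \<in> loops a b diagram"
      have "prod.swap ` T.diagram = diagram" using swap by (simp add: bij_betw_def)
      then have *: "prod.swap \<circ> \<pi> \<circ> prod.swap \<in> loops b a T.diagram" using loops_transposed[of \<pi> a b T.diagram] \<pi> by simp
      have "map_permutation T.diagram prod.swap (prod.swap \<circ> \<pi> \<circ> prod.swap) = \<pi>"
        unfolding conj[OF perT[OF *]] by (simp add: fun_eq_iff)
      then show "\<pi> \<in> map_permutation T.diagram prod.swap ` loops b a T.diagram" using * by (metis imageI)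
    next
      fix \<pi> assume "\<pi> \<in> map_permutation T.diagram prod.swap ` loops b a T.diagram"
      then obtain \<rho> where "\<rho> \<in> loops b a T.diagram" "\<pi> = prod.swap \<circ> \<rho> \<circ> prod.swap" using conj perT by auto
      then show "\<pi> \<in> loops a b diagram" using loops_transposed[of \<rho> b a diagram] unfolding diagram_transpose by simp
    qed
    then have "(sym_group_on diagram)\<lparr>carrier := loops a b diagram\<rparr> \<cong> (sym_group_on T.diagram)\<lparr>carrier := loops b a T.diagram\<rparr>"
      using iso_map_permutation[OF perT swap] by simp
    then show ?thesis using F.loops_iso iso_trans by blast
  qed
  then show ?thesis using 1 iso_trans by blast
qed

end

theorem theorem5:
  fixes C :: "'l config"
  assumes "compact_config C"
  shows "(card (empty_cells C) = 0 \<longrightarrow> carrier (push_group C) = {id}) \<and>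
    (card (empty_cells C) = 1 \<longrightarrow>
       carrier (push_group C) = generate (sym_group_on (dom C)) {noncore_cycle C}) \<and>
    (card (dom C) = 6 \<and> card (empty_cells C) = 2 \<longrightarrow>
       push_group C \<cong> alt_group 5) \<and>
    (card (empty_cells C) \<noteq> 0 \<and> card (empty_cells C) \<noteq> 1 \<and>
     \<not> (card (dom C) = 6 \<and> card (empty_cells C) = 2) \<longrightarrow>
       carrier (push_group C) = {\<pi>. \<pi> permutes noncore_cells C \<and> evenperm \<pi>} \<and>
       ((\<exists>p\<in>noncore_cells C. \<exists>q\<in>noncore_cells C. p \<noteq> q \<and> C p = C q) \<longrightarrow>
          (\<forall>\<pi>. \<pi> permutes noncore_cells C \<longrightarrow> reachable C (rearrange \<pi> C))) \<and>
       (\<not> (\<exists>p\<in>noncore_cells C. \<exists>q\<in>noncore_cells C. p \<noteq> q \<and> C p = C q) \<longrightarrow>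
          (\<forall>\<pi>. \<pi> permutes noncore_cells C \<longrightarrow>
             (reachable C (rearrange \<pi> C) \<longleftrightarrow> evenperm \<pi>))))"
proof -
  obtain a b r c s t ds v where "compact_young a b r c s t ds v C" using compact_config_cells[OF assms] by blast
  then interpret compact_young a b r c s t ds v C .
  have carrier: "carrier (push_group C) = push_perms C" by (simp add: push_group_def)
  show ?thesis
    unfolding carrier
  proof (intro conjI impI)
    assume "card (empty_cells C) = 0"
    then show "push_perms C = {id}" by (rule push_perms_full)
  next
    assume "card (empty_cells C) = 1"
    then show "push_perms C = generate (sym_group_on (dom C)) {noncore_cycle C}" by (rule push_group_cyclic)
  next
    assume "card (dom C) = 6 \<and> card (empty_cells C) = 2"
    then show "push_group C \<cong> alt_group 5" using push_group_A5 by blast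
  next
    assume "card (empty_cells C) \<noteq> 0 \<and> card (empty_cells C) \<noteq> 1 \<and> \<not> (card (dom C) = 6 \<and> card (empty_cells C) = 2)"
    then have alt: "push_perms C = {\<pi>. \<pi> permutes noncore_cells C \<and> evenperm \<pi>}" using push_perms_generic by blast
    show "push_perms C = {\<pi>. \<pi> permutes noncore_cells C \<and> evenperm \<pi>}" by (rule alt)
    show "\<forall>\<pi>. \<pi> permutes noncore_cells C \<longrightarrow> reachable C (rearrange \<pi> C)"
      if "\<exists>p\<in>noncore_cells C. \<exists>q\<in>noncore_cells C. p \<noteq> q \<and> C p = C q"
      using relabelling(1)[OF alt] that by blast
    show "\<forall>\<pi>. \<pi> permutes noncore_cells C \<longrightarrow> (reachable C (rearrange \<pi> C) \<longleftrightarrow> evenperm \<pi>)"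
      if "\<not> (\<exists>p\<in>noncore_cells C. \<exists>q\<in>noncore_cells C. p \<noteq> q \<and> C p = C q)"
      using relabelling(2)[OF alt _ that] by blast
  qed
qed

end
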